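(* Let $q\ge10^5$ be an integer, and let $\chi$ be a Dirichlet character modulo $q$ (primitive or imprimitive). Then $$|b(\chi)|\le0.2515\,q\log q.$$
   Context: $L(s,\chi)$ denotes the Dirichlet $L$-function of $\chi$ (analytic or meromorphic continuation of $\sum_{n\ge1}\chi(n)n^{-s}$). $b(\chi)$ denotes the constant term in the Laurent expansion of $\frac{L'}{L}(s,\chi)$ at $s=0$; that is, if $m(\chi)\ge0$ is the order of the zero of $L(s,\chi)$ at $s=0$, then $\frac{L'}{L}(s,\chi)=\frac{m(\chi)}s+b(\chi)+O(|s|)$ near $s=0$. *)

theory Defs
  imports "HOL-Complex_Analysis.Complex_Analysis"
begin

definition dirichlet_character :: "nat \<Rightarrow> (int \<Rightarrow> complex) \<Rightarrow> bool" where
  "dirichlet_character q chi \<longleftrightarrow>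
     q > 0 \<and>
     (\<forall>n. chi (n + int q) = chi n) \<and>
     (\<forall>m n. chi (m * n) = chi m * chi n) \<and>
     (\<forall>n. chi n \<noteq> 0 \<longleftrightarrow> coprime n (int q))"

(* The condition "nicely meromorphic" fixes the values at singularities: removable ones are
   removed and poles get the value 0 (as at s = 1 for principal characters). Hence there is
   at most one such continuation. *)
definition dirichlet_L :: "(int \<Rightarrow> complex) \<Rightarrow> complex \<Rightarrow> complex" where
  "dirichlet_L chi =
     (THE f. f nicely_meromorphic_on UNIV \<and>
             (\<forall>s. Re s > 1 \<longrightarrow>
                (\<lambda>n. chi (int (Suc n)) * of_nat (Suc n) powr (-s)) sums f s))"

lemma dirichlet_L_eqI:
  assumes f: "f nicely_meromorphic_on UNIV"
    and f_sums: "\<And>s. Re s > 1 \<Longrightarrow>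
                   (\<lambda>n. chi (int (Suc n)) * of_nat (Suc n) powr (-s)) sums f s"
  shows "dirichlet_L chi = f"
  unfolding dirichlet_L_def
proof (rule the_equality)
  show "f nicely_meromorphic_on UNIV \<and> (\<forall>s. Re s > 1 \<longrightarrow>
          (\<lambda>n. chi (int (Suc n)) * of_nat (Suc n) powr (-s)) sums f s)"
    using f f_sums by blast
next
  fix g
  assume g: "g nicely_meromorphic_on UNIV \<and> (\<forall>s. Re s > 1 \<longrightarrow>
               (\<lambda>n. chi (int (Suc n)) * of_nat (Suc n) powr (-s)) sums g s)"
  have eq: "g s = f s" if "Re s > 1" for s
    using g f_sums that sums_unique2 by blast
  have "open {s. Re s > 1}"
    by (simp add: open_halfspace_Re_gt)
  hence "eventually (\<lambda>s. s \<in> {s. Re s > 1}) (nhds 2)"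
    by (intro eventually_nhds_in_open) auto
  hence ev2: "eventually (\<lambda>s. g s - f s = 0) (at 2)"
    unfolding eventually_at_filter by eventually_elim (use eq in auto)
  have "(\<lambda>s. g s - f s) meromorphic_on UNIV"
    using f g by (intro meromorphic_intros) (auto simp: nicely_meromorphic_on_def)
  hence "(\<forall>\<^sub>\<approx>s\<in>UNIV. g s - f s = 0) \<or> (\<forall>\<^sub>\<approx>s\<in>UNIV. g s - f s \<noteq> 0)"
    by (rule meromorphic_imp_constant_or_avoid) auto
  moreover have "\<not> (\<forall>\<^sub>\<approx>s\<in>UNIV. g s - f s \<noteq> 0)"
  proof
    assume "\<forall>\<^sub>\<approx>s\<in>UNIV. g s - f s \<noteq> 0"
    hence "eventually (\<lambda>s. g s - f s \<noteq> 0) (at 2)"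
      by (auto simp: eventually_cosparse_open_eq)
    with ev2 have "eventually (\<lambda>_. False) (at (2 :: complex))"
      by eventually_elim auto
    thus False by simp
  qed
  ultimately have ev: "eventually (\<lambda>s. g s = f s) (at z)" for z
    by (auto simp: eventually_cosparse_open_eq)
  show "g = f"
  proof
    fix z
    have pole: "is_pole g z \<longleftrightarrow> is_pole f z"
      by (rule is_pole_cong) (use ev in auto)
    have lim: "g \<midarrow>z\<rightarrow> c \<longleftrightarrow> f \<midarrow>z\<rightarrow> c" for c
      by (rule tendsto_cong) (use ev in auto)
    have not_both: "\<not> (is_pole f z \<and> f \<midarrow>z\<rightarrow> c)" for c
      using not_tendsto_and_filterlim_at_infinity[of "at z" f c] by (auto simp: is_pole_def)
    have "is_pole f z \<and> f z = 0 \<or> f \<midarrow>z\<rightarrow> f z" "is_pole g z \<and> g z = 0 \<or> g \<midarrow>z\<rightarrow> g z"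
      using f g by (auto simp: nicely_meromorphic_on_def)
    thus "g z = f z"
      using pole lim not_both LIM_unique by metis
  qed
qed

definition b_const :: "(int \<Rightarrow> complex) \<Rightarrow> complex" where
  "b_const chi =
     fls_nth (laurent_expansion (\<lambda>s. deriv (dirichlet_L chi) s / dirichlet_L chi s) 0) 0"

end

theory Submission
  imports Defs "HOL-Number_Theory.Number_Theory" "HOL-Real_Asymp.Real_Asymp"
begin

text \<open>
  For primitive \<open>\<chi>\<close> modulo \<open>d > 1\<close>, the functional equation expresses \<open>b(\<chi>)\<close> as
  \<open>ln (2 \<pi> / d) + \<gamma> - L'/L(1, \<chi>\<^sup>*)\<close> with \<open>\<chi>\<^sup>*\<close> the conjugate of \<open>\<chi>\<close>; passing to an induced character
  multiplies \<open>L\<close> by Euler factors, which changes \<open>b\<close> by at most \<open>q / 2\<close> in total. So everything rests on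
  bounding \<open>L'/L(1, \<chi>)\<close>. If \<open>\<chi>\<close> takes a nonreal value, then \<open>\<chi>\<^sup>2\<close> is nonprincipal and the 3-4-1
  inequality gives a zero-free disc of radius \<open>\<asymp> 1 / ln q\<close> about 1, hence \<open>L'/L(1, \<chi>) = O(ln\<^sup>2 q)\<close>.
  If \<open>\<chi>\<close> is real, compare
  \<open>A = \<Sum> \<chi>(n) (1 / (exp (n / d) - 1) - 1 / (exp (3 n / d) - 1)) = \<Sum> r(n) (exp (- n / d) - exp (- 3 n / d))\<close>,
  where \<open>r(n) = \<Sum>\<^sub>k\<^sub>|\<^sub>n \<chi>(k)\<close> is nonnegative and at least 1 at squares, with \<open>(2 d / 3) L(1, \<chi>)\<close>:
  expanding \<open>\<chi>\<close> in additive characters and summing by parts twice, the two differ by at most \<open>(7 / 144) \<surd>d\<close>,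
  whereas the squares between \<open>d / 4\<close> and \<open>d\<close> make \<open>A\<close> exceed a larger multiple of \<open>\<surd>d\<close>. So \<open>L(1, \<chi>)\<close> is at least a constant over \<open>\<surd>d\<close>.
\<close>

section \<open>Dirichlet series with bounded partial sums\<close>

text \<open>In units of \<open>q * ln q / 10^4\<close> the budget is
  \<open>2515 = 2000 + 50 + 465\<close>: the logarithmic derivative at 1, then \<open>ln d\<close>
  with the Euler constant, then imprimitivity, where \<open>ln q \<ge> 11\<close> turns
  \<open>q / 2\<close> into \<open>465\<close>. Only the real case is tight: \<open>L'(1)\<close> is
  of size \<open>ln^2 q / 2\<close> and \<open>L(1)\<close> may be as small as the proven constant
  over \<open>sqrt q\<close>, so the quotient is of order \<open>sqrt q * ln^2 q\<close>. It stays
  below \<open>q * ln q / 5\<close> because \<open>ln q / sqrt q\<close> is small from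
  \<open>10^5\<close> on, and the lower bound for \<open>L(1)\<close> must be explicit for every
  conductor up to \<open>q\<close>. The functional equation comes from the partial fractions of
  \<open>1 / (exp z - 1)\<close>: they turn an exponential sum over \<open>f\<close> into a sum of
  rational kernels over \<open>g\<close>, and Mellin transforms of both sides give Gamma and
  cosecant factors. The argument asks only for periodicity, parity, vanishing period sums and a
  finite Fourier relation. It therefore covers both parities at once, and also a 4-periodic function
  that stands in for the trivial character, whose L-function has a pole at 1.\<close>

definition psum :: "(int \<Rightarrow> complex) \<Rightarrow> nat \<Rightarrow> complex" where
  "psum f n = (\<Sum>k<n. f (int (Suc k)))"

text \<open>Summed by parts, so that the series converges absolutely for \<open>Re s > 0\<close> as soon as the partial sums of \<open>f\<close> are bounded.\<close>
definition Lser :: "(int \<Rightarrow> complex) \<Rightarrow> complex \<Rightarrow> complex" where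
  "Lser f s = (\<Sum>n. psum f (Suc n) *
     (of_nat (Suc n) powr (-s) - of_nat (Suc (Suc n)) powr (-s)))"

lemma psum_0 [simp]: "psum f 0 = 0"
  and psum_Suc: "psum f (Suc n) = psum f n + f (int (Suc n))"
  by (simp_all add: psum_def)

lemma sum_by_parts:
  fixes g :: "nat \<Rightarrow> complex"
  shows "(\<Sum>n<N. psum f (Suc n) * (g n - g (Suc n))) =
         (\<Sum>n<N. f (int (Suc n)) * g n) - psum f N * g N"
  by (induction N) (auto simp: psum_Suc algebra_simps)

text \<open>The boundary term \<open>psum f N * g N\<close> dies because \<open>psum\<close> is
  bounded and \<open>g\<close> tends to 0. Stated for general weights \<open>g\<close>, since
  powers, exponentials and rational kernels are all summed this way.\<close>

lemma by_parts_sums: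
  fixes g :: "nat \<Rightarrow> complex"
  assumes bd: "\<And>n. norm (psum f n) \<le> B"
    and g: "g \<longlonglongrightarrow> 0" and sm: "summable (\<lambda>n. norm (g n - g (Suc n)))"
  shows "summable (\<lambda>n. norm (psum f (Suc n) * (g n - g (Suc n))))"
    and "(\<lambda>n. f (int (Suc n)) * g n) sums (\<Sum>n. psum f (Suc n) * (g n - g (Suc n)))"
proof -
  show 1: "summable (\<lambda>n. norm (psum f (Suc n) * (g n - g (Suc n))))"
    by (rule summable_comparison_test'[OF summable_mult[OF sm, of B], of 0])
       (auto simp: norm_mult intro!: mult_right_mono bd)
  from summable_sums[OF summable_norm_cancel[OF 1]]
  have 2: "(\<lambda>N. (\<Sum>n<N. f (int (Suc n)) * g n) - psum f N * g N) \<longlonglongrightarrow>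
        (\<Sum>n. psum f (Suc n) * (g n - g (Suc n)))"
    unfolding sums_def sum_by_parts .
  have "(\<lambda>N. psum f N * g N) \<longlonglongrightarrow> 0"
  proof (rule Lim_null_comparison)
    show "\<forall>\<^sub>F N in sequentially. norm (psum f N * g N) \<le> B * norm (g N)"
      by (intro always_eventually allI) (auto simp: norm_mult intro!: mult_right_mono bd)
    show "(\<lambda>N. B * norm (g N)) \<longlonglongrightarrow> 0"
      using tendsto_mult_right_zero[OF tendsto_norm_zero[OF g]] .
  qed
  from tendsto_add[OF 2 this]
  show "(\<lambda>n. f (int (Suc n)) * g n) sums (\<Sum>n. psum f (Suc n) * (g n - g (Suc n)))"
    by (simp add: sums_def)
qed

text \<open>The difference is the integral of \<open>s * u powr (-s-1)\<close> over
  \<open>{a..b}\<close>; taking norms inside costs the factor \<open>norm s / Re s\<close>. The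
  bound keeps its telescoping form because \<open>Lser_split\<close> sums it over a whole
  tail.\<close>

lemma powr_diff_bound1:
  fixes s :: complex
  assumes x: "Re s > 0" and ab: "0 < a" "a < b"
  shows "norm (of_real a powr (-s) - of_real b powr (-s)) \<le>
           norm s / Re s * (a powr (- Re s) - b powr (- Re s))"
proof -
  have "norm (of_real b powr (-s) - of_real a powr (-s)) \<le>
        (- norm s / Re s * b powr (- Re s)) - (- norm s / Re s * a powr (- Re s))"
  proof (rule differentiable_bound_general[OF ab(2)])
    fix u :: real assume u: "a < u" "u < b"
    have [simp]: "u > 0" using u(1) ab(1) by linarith
    show "((\<lambda>u. of_real u powr (-s)) has_vector_derivative (-s * of_real u powr (-s-1))) (at u)"
      using u ab by (intro has_vector_derivative_real_field) (auto intro!: derivative_eq_intros simp: complex_nonpos_Reals_iff)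
    show "((\<lambda>u. - norm s / Re s * u powr (- Re s)) has_vector_derivative (norm s * u powr (- Re s - 1))) (at u)"
      unfolding has_real_derivative_iff_has_vector_derivative[symmetric] using x
      by (auto intro!: derivative_eq_intros simp: field_simps powr_diff)
    show "norm (-s * of_real u powr (-s-1)) \<le> norm s * u powr (- Re s - 1)"
      using u ab by (simp add: norm_mult norm_powr_real_powr)
  next
    show "continuous_on {a..b} (\<lambda>u. complex_of_real u powr (-s))"
      using ab by (intro continuous_intros) (auto simp: complex_nonpos_Reals_iff)
    show "continuous_on {a..b} (\<lambda>u. - norm s / Re s * u powr - Re s)"
      using ab by (intro continuous_intros) auto
  qed
  also have "\<dots> = norm s / Re s * (a powr (- Re s) - b powr (- Re s))" by (simp add: algebra_simps)
  finally show ?thesis by (simp add: norm_minus_commute)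
qed

lemma powr_diff_bound2:
  assumes x: "x > 0" and a: "0 < (a::real)"
  shows "a powr (-x) - (a+1) powr (-x) \<le> x * a powr (-x-1)"
proof -
  have "\<exists>u>a. u < a+1 \<and> (a+1) powr (-x) - a powr (-x) = (a+1-a) * (-x * u powr (-x-1))"
    by (rule MVT2) (use a in \<open>auto intro!: derivative_eq_intros\<close>)
  then obtain u where u: "u > a" "u < a+1" "(a+1) powr (-x) - a powr (-x) = (-x * u powr (-x-1))" by auto
  have "u powr (-x-1) \<le> a powr (-x-1)" using u a x by (intro powr_mono2') auto
  hence "x * u powr (-x-1) \<le> x * a powr (-x-1)" using x by (intro mult_left_mono) auto
  thus ?thesis using u(3) by auto
qed

lemma powr_diff_bound:
  fixes s :: complex
  assumes x: "Re s > 0"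
  shows "norm (of_nat (Suc n) powr (-s) - of_nat (Suc (Suc n)) powr (-s)) \<le>
           norm s * real (Suc n) powr (- Re s - 1)"
proof -
  have "norm (of_nat (Suc n) powr (-s) - of_nat (Suc (Suc n)) powr (-s)) \<le> 
     norm s / Re s * (real (Suc n) powr (- Re s) - real (Suc (Suc n)) powr (- Re s))"
    using powr_diff_bound1[OF x, of "real (Suc n)" "real (Suc (Suc n))"] by simp
  also have "\<dots> \<le> norm s / Re s * (Re s * real (Suc n) powr (- Re s - 1))"
    using powr_diff_bound2[OF x, of "real (Suc n)"] x by (intro mult_left_mono) (auto simp: add_ac)
  finally show ?thesis using x by simp
qed

lemma summable_powr_Suc: "x > 0 \<Longrightarrow> summable (\<lambda>n. real (Suc n) powr (- x - 1))"
  using summable_real_powr_iff[of "-x-1"] by (subst summable_Suc_iff) auto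

lemma tendsto_powr_Suc:
  assumes "Re s > 0" shows "(\<lambda>n. of_nat (Suc n) powr (-s) :: complex) \<longlonglongrightarrow> 0"
proof -
  have "(\<lambda>n. norm (of_nat (Suc n) powr (-s) :: complex)) = (\<lambda>n. real (Suc n) powr (- Re s))"
    by (auto simp: norm_powr_real_powr simp flip: of_nat_Suc)
  moreover have "(\<lambda>n. real (Suc n) powr (- Re s)) \<longlonglongrightarrow> 0"
    using assms by real_asymp
  ultimately show ?thesis by (metis tendsto_norm_zero_iff)
qed

lemma Lser_sums:
  assumes bd: "\<And>n. norm (psum f n) \<le> B" and s: "Re s > 0"
  shows "(\<lambda>n. f (int (Suc n)) * of_nat (Suc n) powr (-s)) sums Lser f s"
    and "summable (\<lambda>n. norm (psum f (Suc n) * (of_nat (Suc n) powr (-s) - of_nat (Suc (Suc n)) powr (-s))))"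
proof -
  have *: "summable (\<lambda>n. norm (of_nat (Suc n) powr (-s) - of_nat (Suc (Suc n)) powr (-s) :: complex))"
    by (rule summable_comparison_test'[OF summable_mult[OF summable_powr_Suc[OF s], of "norm s"], of 0])
       (use powr_diff_bound[OF s] in auto)
  show "(\<lambda>n. f (int (Suc n)) * of_nat (Suc n) powr (-s)) sums Lser f s"
    "summable (\<lambda>n. norm (psum f (Suc n) * (of_nat (Suc n) powr (-s) - of_nat (Suc (Suc n)) powr (-s))))"
    using by_parts_sums[OF bd tendsto_powr_Suc[OF s] *] by (simp_all add: Lser_def)
qed

text \<open>Termwise differentiation under a locally uniform majorant. The derivative is exhibited
  as a summed-by-parts series because its estimate at 1 and its comparison with the von Mangoldt
  series both start from that series.\<close>

lemma Lser_has_derivative: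
  assumes bd: "\<And>n. norm (psum f n) \<le> B" and s: "Re s > 0"
  shows "\<exists>D. (Lser f has_field_derivative D) (at s) \<and> 
    (\<lambda>n. psum f (Suc n) * (of_real (ln (real (Suc (Suc n)))) * of_nat (Suc (Suc n)) powr (-s)
         - of_real (ln (real (Suc n))) * of_nat (Suc n) powr (-s))) sums D"
proof -
  let ?S = "{s. Re s > 0}"
  let ?f = "\<lambda>n s. psum f (Suc n) * (of_nat (Suc n) powr (-s) - of_nat (Suc (Suc n)) powr (-s))"
  let ?f' = "\<lambda>n s. psum f (Suc n) * (of_real (ln (real (Suc (Suc n)))) * of_nat (Suc (Suc n)) powr (-s)
         - of_real (ln (real (Suc n))) * of_nat (Suc n) powr (-s))"
  have B: "B \<ge> 0" using bd[of 0] by simp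
  have "\<exists>g g'. \<forall>x\<in>?S. ?f n x = ?f n x \<and> (\<lambda>n. ?f n x) sums g x \<and> (\<lambda>n. ?f' n x) sums g' x \<and> (g has_field_derivative g' x) (at x)" for n
  proof -
    have "\<exists>g g'. \<forall>x\<in>?S. (\<lambda>n. ?f n x) sums g x \<and> (\<lambda>n. ?f' n x) sums g' x \<and> (g has_field_derivative g' x) (at x)"
    proof (rule series_and_derivative_comparison_complex)
      show "open ?S" by (rule open_halfspace_Re_gt)
    next
      fix n and x :: complex assume "x \<in> ?S"
      have ln: "Ln (of_nat (Suc m)) = of_real (ln (real (Suc m)))" for m
        using Ln_of_real[of "real (Suc m)"] by simp
      have D: "((\<lambda>s. of_nat (Suc m) powr (-s)) has_field_derivative (- of_real (ln (real (Suc m))) * of_nat (Suc m) powr (-x))) (at x)" for m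
      proof -
        have "(\<lambda>s. of_nat (Suc m) powr (-s) :: complex) = (\<lambda>s. exp (- s * of_real (ln (real (Suc m)))))"
          by (simp add: powr_def ln fun_eq_iff del: of_nat_Suc)
        moreover have "of_nat (Suc m) powr (-x) = exp (- x * of_real (ln (real (Suc m))))"
          by (simp add: powr_def ln del: of_nat_Suc)
        ultimately show ?thesis by (auto intro!: derivative_eq_intros)
      qed
      show "(?f n has_field_derivative ?f' n x) (at x)"
        by (rule derivative_eq_intros D refl)+ (simp add: algebra_simps del: of_nat_Suc)
    next
      fix x :: complex assume "x \<in> ?S"
      hence x: "Re x > 0" by simp
      \<comment> \<open>On the ball of radius \<open>Re x / 2\<close> the real part stays above
        \<open>Re x / 2\<close> and the norm below \<open>norm x + Re x / 2\<close>, so one summable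
        majorant serves the whole ball.\<close>
      define h where "h = (\<lambda>n. B * ((norm x + Re x / 2) * real (Suc n) powr (- (Re x / 2) - 1)))"
      have h0: "h n \<ge> 0" for n using x B by (auto simp: h_def)
      have sh: "summable h" unfolding h_def
        by (intro summable_mult summable_powr_Suc) (use x in auto)
      have bnd: "norm (?f n y) \<le> h n" if y: "y \<in> ball x (Re x / 2) \<inter> ?S" for n y
      proof -
        have d: "norm (x - y) < Re x / 2" using y by (auto simp: dist_norm)
        have "\<bar>Re (x - y)\<bar> \<le> norm (x - y)" by (rule abs_Re_le_cmod)
        hence r: "Re y > Re x / 2" using d by auto
        have n: "norm y \<le> norm x + Re x / 2" using d norm_triangle_ineq2[of y x] by (simp add: norm_minus_commute)
        have "norm (?f n y) \<le> B * (norm y * real (Suc n) powr (- Re y - 1))"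
          unfolding norm_mult using powr_diff_bound[of y n] r x by (intro mult_mono bd) (auto simp del: of_nat_Suc simp: B)
        also have "\<dots> \<le> h n" unfolding h_def using n r x B
          by (intro mult_left_mono mult_mono powr_mono) auto
        finally show ?thesis .
      qed
      show "\<exists>d h. 0 < d \<and> summable h \<and> range h \<subseteq> \<real>\<^sub>\<ge>\<^sub>0 \<and> (\<forall>\<^sub>F n in sequentially. \<forall>y\<in>ball x d \<inter> ?S. cmod (?f n y) \<le> cmod (h n))"
        using x sh h0 bnd
        by (intro exI[of _ "Re x / 2"] exI[of _ "\<lambda>n. complex_of_real (h n)"])
           (auto simp: summable_of_real_iff abs_of_nonneg intro!: always_eventually)
    qed
    thus ?thesis by simp
  qed
  then obtain g g' where g: "\<And>x. x \<in> ?S \<Longrightarrow> (\<lambda>n. ?f n x) sums g x" "\<And>x. x \<in> ?S \<Longrightarrow> (\<lambda>n. ?f' n x) sums g' x"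
     "\<And>x. x \<in> ?S \<Longrightarrow> (g has_field_derivative g' x) (at x)"
    by blast
  have "(Lser f has_field_derivative g' s) (at s)"
  proof (rule DERIV_cong_ev[OF refl _ refl, THEN iffD1])
    show "(g has_field_derivative g' s) (at s)" using g s by auto
    have "\<forall>\<^sub>F x in nhds s. x \<in> ?S" using s by (intro eventually_nhds_in_open open_halfspace_Re_gt) auto
    thus "\<forall>\<^sub>F x in nhds s. g x = Lser f x"
      by eventually_elim (use g(1) in \<open>auto simp: Lser_def sums_iff\<close>)
  qed
  thus ?thesis using g(2) s by blast
qed

lemma Lser_holomorphic:
  assumes bd: "\<And>n. norm (psum f n) \<le> B" and S: "S \<subseteq> {s. Re s > 0}"
  shows "Lser f holomorphic_on S"
  unfolding holomorphic_on_def field_differentiable_def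
  using Lser_has_derivative[OF bd] S by (meson has_field_derivative_at_within mem_Collect_eq subsetD)

text \<open>Cutting at a point where \<open>psum f\<close> vanishes, in practice a full period,
  leaves no boundary term, and the remaining tail telescopes.\<close>

lemma Lser_split:
  assumes bd: "\<And>n. norm (psum f n) \<le> B" and s: "Re s > 0" and q: "psum f q = 0"
  shows "norm (Lser f s - (\<Sum>n<q. f (int (Suc n)) * of_nat (Suc n) powr (-s))) \<le> B * (norm s / Re s) * real (Suc q) powr (- Re s)"
proof -
  let ?g = "\<lambda>n. of_nat (Suc n) powr (-s) :: complex"
  let ?t = "\<lambda>n. psum f (Suc n) * (?g n - ?g (Suc n))"
  have B: "B \<ge> 0" using bd[of 0] by simp
  have sm: "summable (\<lambda>n. norm (?t n))" using Lser_sums(2)[OF bd s] .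
  have "Lser f s = (\<Sum>n. ?t (n + q)) + (\<Sum>n<q. ?t n)"
    unfolding Lser_def by (rule suminf_split_initial_segment) (rule summable_norm_cancel[OF sm])
  also have "(\<Sum>n<q. ?t n) = (\<Sum>n<q. f (int (Suc n)) * of_nat (Suc n) powr (-s))"
    unfolding sum_by_parts[of f ?g q] q by simp
  finally have "norm (Lser f s - (\<Sum>n<q. f (int (Suc n)) * of_nat (Suc n) powr (-s))) = norm (\<Sum>n. ?t (n + q))" by simp
  also have "\<dots> \<le> (\<Sum>n. norm (?t (n + q)))" using sm by (intro summable_norm) (subst summable_iff_shift)
  also have "\<dots> \<le> B * (norm s / Re s) * real (Suc q) powr (- Re s)"
  proof (rule suminf_le_const)
    show "summable (\<lambda>n. norm (?t (n + q)))" using sm by (subst summable_iff_shift)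
    fix N
    let ?h = "\<lambda>n. real (Suc (n + q)) powr (- Re s)"
    have "norm (?t (n + q)) \<le> B * (norm s / Re s * (?h n - ?h (Suc n)))" for n
      unfolding norm_mult using powr_diff_bound1[OF s, of "real (Suc (n+q))" "real (Suc (Suc (n+q)))"]
      by (intro mult_mono bd) (auto simp: B)
    hence "(\<Sum>n<N. norm (?t (n + q))) \<le> (\<Sum>n<N. B * (norm s / Re s * (?h n - ?h (Suc n))))"
      by (rule sum_mono)
    also have "\<dots> = B * (norm s / Re s) * (\<Sum>n<N. ?h n - ?h (Suc n))"
      by (simp add: sum_distrib_left mult_ac)
    also have "\<dots> = B * (norm s / Re s) * (?h 0 - ?h N)" using sum_lessThan_telescope'[of ?h N] by simp
    also have "\<dots> \<le> B * (norm s / Re s) * ?h 0" using B s by (intro mult_left_mono) auto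
    finally show "(\<Sum>n<N. norm (?t (n + q))) \<le> B * (norm s / Re s) * real (Suc q) powr (- Re s)" by simp
  qed
  finally show ?thesis .
qed

section \<open>Mellin transforms and partial fractions\<close>

text \<open>The substitution \<open>t = sqrt (v / (1 - v))\<close> turns the integral into half of
  \<open>Beta (a / 2) (1 - a / 2)\<close>, which the reflection formula of Gamma evaluates.\<close>

lemma Mellin_inverse_quadratic:
  fixes a :: real
  assumes a: "0 < a" "a < 2"
  shows "has_bochner_integral lborel (\<lambda>t. indicator {0<..} t *\<^sub>R (t powr (a - 1) / (t\<^sup>2 + 1)))
           (pi / (2 * sin (pi * a / 2)))"
proof -
  define f where "f = (\<lambda>t::real. t powr (a - 1) / (t\<^sup>2 + 1))"
  define g where "g = (\<lambda>v::real. sqrt (v / (1 - v)))"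
  define g' where "g' = (\<lambda>v::real. 1 / (2 * sqrt (v / (1 - v)) * (1 - v)\<^sup>2))"
  define h where "h = (\<lambda>v::real. 1 / 2 * (v powr (a / 2 - 1) * (1 - v) powr ((1 - a / 2) - 1)))"
  have fg: "f (g v) * g' v = h v" if v: "0 < v" "v < 1" for v
  proof -
    have g: "g v = (v / (1 - v)) powr (1/2)" using v by (simp add: g_def powr_half_sqrt)
    have "g v powr (a - 1) = (v / (1 - v)) powr ((a - 1) / 2)"
    proof -
      have "1 / 2 * (a - 1) = (a - 1) / 2" by simp
      thus ?thesis by (simp only: g powr_powr)
    qed
    also have "\<dots> = v powr ((a-1)/2) * (1 - v) powr (-((a-1)/2))"
    proof -
      have "(v / (1 - v)) powr c = v powr c * (1 - v) powr (-c)" for c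
        using v by (simp add: powr_divide powr_minus_divide)
      thus ?thesis .
    qed
    finally have 1: "g v powr (a - 1) = v powr ((a-1)/2) * (1 - v) powr (-((a-1)/2))" .
    have 2: "(g v)\<^sup>2 + 1 = (1 - v) powr (-1)" using v by (simp add: g_def field_simps powr_minus)
    have 3: "g' v = 1/2 * (v powr (-1/2) * (1 - v) powr (1/2) * (1 - v) powr (-2))"
      using v by (simp add: g'_def powr_minus real_sqrt_divide powr_half_sqrt field_simps powr_numeral)
    have "f (g v) * g' v = 1/2 * (v powr ((a-1)/2) * v powr (-1/2)) * ((1 - v) powr (-((a-1)/2)) * (1 - v) powr 1 * (1 - v) powr (1/2) * (1 - v) powr (-2))"
      unfolding f_def 1 2 3 using v by (simp add: powr_minus field_simps)
    also have "\<dots> = h v"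
    proof -
      have "(a-1)/2 + -1/2 = a / 2 - 1" "-((a-1)/2) + 1 + 1/2 + -2 = (1 - a / 2) - 1" by (simp_all add: field_simps)
      thus ?thesis by (simp only: h_def powr_add[symmetric] mult.assoc)
    qed
    finally show ?thesis .
  qed
  have e01: "einterval 0 1 = {0::real<..<1}" "einterval 0 \<infinity> = {0::real<..}"
    by (auto simp: einterval_def zero_ereal_def one_ereal_def)
  have si: "set_integrable lborel {0<..<1} h"
    unfolding h_def by (intro set_integrable_mult_right set_integrable_subset[OF integrable_Beta]) (use a in auto)
  have x01: "0 < x \<and> x < 1" if "0 < ereal x" "ereal x < 1" for x using that by auto
  have c1: "DERIV g x :> g' x" if "0 < ereal x" "ereal x < 1" for x
  proof -
    have x: "0 < x" "x < 1" "x / (1 - x) > 0" using x01[OF that] by auto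
    show ?thesis unfolding g_def g'_def using x
      by (auto intro!: derivative_eq_intros simp: field_simps power2_eq_square)
  qed
  have c2: "isCont f (g x)" if "0 < ereal x" "ereal x < 1" for x
  proof -
    have x: "0 < x" "x < 1" "x / (1 - x) > 0" using x01[OF that] by auto
    have "g x > 0" using x by (simp add: g_def)
    thus "isCont f (g x)" unfolding f_def
      by (intro continuous_intros) (auto simp: add_nonneg_eq_0_iff)
  qed
  have c3: "isCont g' x" if "0 < ereal x" "ereal x < 1" for x
  proof -
    have x: "0 < x" "x < 1" "x / (1 - x) > 0" using x01[OF that] by auto
    show "isCont g' x" unfolding g'_def using x by (intro continuous_intros) auto
  qed
  have c4: "0 \<le> f (g x)" for x unfolding f_def by simp
  have c5: "0 \<le> g' x" if "0 \<le> ereal x" "ereal x \<le> 1" for x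
    using that unfolding g'_def by (auto simp: zero_ereal_def one_ereal_def)
  have "(g \<longlongrightarrow> 0) (at_right 0)" unfolding g_def by real_asymp
  hence c6: "((ereal \<circ> g \<circ> real_of_ereal) \<longlongrightarrow> 0) (at_right 0)"
    unfolding zero_ereal_def at_right_ereal filterlim_filtermap o_def by (simp add: tendsto_ereal)
  have "filterlim g at_top (at_left 1)" unfolding g_def by real_asymp
  hence c7: "((ereal \<circ> g \<circ> real_of_ereal) \<longlongrightarrow> \<infinity>) (at_left 1)"
    unfolding one_ereal_def at_left_ereal filterlim_filtermap o_def by (simp add: tendsto_PInfty_eq_at_top)
  have c8: "set_integrable lborel (einterval 0 1) (\<lambda>x. f (g x) * g' x)"
    unfolding e01 by (rule set_integrable_cong[THEN iffD1, OF refl refl _ si]) (auto simp: fg)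
  have "(0::ereal) < 1" by simp
  \<comment> \<open>For a nonnegative integrand the substitution rule also returns integrability on
    the half-line, which the Bochner form of the claim requires.\<close>
  note sub = interval_integral_substitution_nonneg[OF this c1 c2 c3 c4 c5 c6 c7 c8]
  note A1 = sub(1) and A2 = sub(2)
  have "(LBINT x=0..1. f (g x) * g' x) = (LBINT x:{0<..<1}. f (g x) * g' x)"
    unfolding interval_lebesgue_integral_def e01 by simp
  also have "\<dots> = (LBINT x:{0<..<1}. h x)" by (rule set_lebesgue_integral_cong) (auto simp: fg)
  also have "\<dots> = 1/2 * (LBINT x:{0<..<1}. x powr (a / 2 - 1) * (1 - x) powr ((1 - a / 2) - 1))"
    unfolding h_def by (rule set_integral_mult_right)
  also have "(LBINT x:{0<..<1}. x powr (a / 2 - 1) * (1 - x) powr ((1 - a / 2) - 1)) =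
      integral {0<..<1} (\<lambda>x. x powr (a / 2 - 1) * (1 - x) powr ((1 - a / 2) - 1))"
    by (rule set_borel_integral_eq_integral(2)[OF set_integrable_subset[OF integrable_Beta]]) (use a in auto)
  also have "\<dots> = Beta (a/2) (1 - a/2)"
    using has_integral_Beta_real[of "a/2" "1 - a/2"] a
    by (intro integral_unique) (simp add: has_integral_Icc_iff_Ioo)
  also have "\<dots> = pi / sin (pi * a / 2)"
  proof -
    have "complex_of_real (Gamma x * Gamma (1 - x)) = of_real (pi / sin (pi * x))" for x
      using Gamma_reflection_complex[of "of_real x"]
      unfolding of_real_mult of_real_divide Gamma_complex_of_real[symmetric] sin_of_real[symmetric] of_real_diff of_real_1 .
    hence "Gamma x * Gamma (1 - x) = pi / sin (pi * x)" for x :: real using of_real_eq_iff by blast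
    from this[of "a / 2"] show ?thesis by (simp add: Beta_def)
  qed
  finally have "(LBINT x=0..1. f (g x) * g' x) = pi / (2 * sin (pi * a / 2))" by simp
  with A2 have "(LBINT x=0..\<infinity>. f x) = pi / (2 * sin (pi * a / 2))" by metis
  thus ?thesis using A1 unfolding interval_lebesgue_integral_def e01 f_def set_integrable_def set_lebesgue_integral_def
    by (simp add: has_bochner_integral_iff)
qed

lemma Mellin_scale:
  fixes f :: "real \<Rightarrow> real"
  assumes "has_bochner_integral lborel (\<lambda>t. indicator {0<..} t *\<^sub>R (t powr (a - 1) * f t)) c" and w: "w > 0"
  shows "has_bochner_integral lborel (\<lambda>t. indicator {0<..} t *\<^sub>R (t powr (a - 1) * f (w * t))) (w powr (-a) * c)"
proof -
  have "has_bochner_integral lborel (\<lambda>t. indicator {0<..} (0 + w * t) *\<^sub>R ((0 + w * t) powr (a - 1) * f (0 + w * t))) (c /\<^sub>R \<bar>w\<bar>)"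
    by (rule lborel_has_bochner_integral_real_affine_iff[THEN iffD1]) (use assms in auto)
  from has_bochner_integral_mult_right[OF this, of "w powr (1 - a)"]
  have 1: "has_bochner_integral lborel (\<lambda>t. w powr (1-a) * (indicator {0<..} (0 + w * t) *\<^sub>R ((0 + w * t) powr (a - 1) * f (0 + w * t)))) (w powr (1-a) * (c /\<^sub>R \<bar>w\<bar>))"
    by simp
  have e1: "w powr (1-a) * (indicator {0<..} (0 + w * t) *\<^sub>R ((0 + w * t) powr (a - 1) * f (0 + w * t))) =
     indicator {0<..} t *\<^sub>R (t powr (a - 1) * f (w * t))" for t
  proof (cases "t > 0")
    case True
    have "w powr (1 - a) * w powr (a - 1) = 1" using w by (simp flip: powr_add)
    with True w show ?thesis by (simp add: powr_mult)
  next
    case False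
    hence "\<not> w * t > 0" using w by (simp add: zero_less_mult_iff)
    thus ?thesis using False by simp
  qed
  have e2: "w powr (1-a) * (c /\<^sub>R \<bar>w\<bar>) = w powr (-a) * c"
    using w by (simp add: powr_diff powr_minus divide_simps)
  show ?thesis using 1 unfolding e1 e2 .
qed

lemma Mellin_exp:
  fixes s n :: real
  assumes s: "s > 0" and n: "n > 0"
  shows "has_bochner_integral lborel (\<lambda>t::real. indicator {0<..} t *\<^sub>R (t powr (s - 1) * exp (-(n * t)))) (n powr (-s) * Gamma s)"
proof (rule Mellin_scale[where f = "\<lambda>t. exp (-t)", OF _ n])
  have 1: "(\<lambda>t. complex_of_real t powr (complex_of_real s - 1) / of_real (exp t)) absolutely_integrable_on {0<..}"
    using absolutely_integrable_Gamma_integral'[of "of_real s"] s by simp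
  have eq: "Re (complex_of_real t powr (complex_of_real s - 1) / of_real (exp t)) = t powr (s - 1) * exp (-t)"
    if "t \<in> {0<..}" for t :: real
  proof -
    have "complex_of_real t powr (complex_of_real s - 1) = of_real (t powr (s - 1))"
      using that powr_of_real[of t "s - 1"] by simp
    thus ?thesis by (simp only: exp_minus divide_inverse of_real_inverse[symmetric] of_real_mult[symmetric] Re_complex_of_real)
  qed
  have R: "set_integrable lebesgue {0<..} (\<lambda>t. Re (complex_of_real t powr (complex_of_real s - 1) / of_real (exp t)))"
    using integrable_Re[OF 1[unfolded set_integrable_def]] by (simp add: set_integrable_def)
  have "set_integrable lebesgue {0<..} (\<lambda>t. t powr (s - 1) * exp (-t))"
    by (rule iffD1[OF set_integrable_cong[OF refl refl eq] R])
  hence 2: "set_integrable lborel {0<..} (\<lambda>t. t powr (s - 1) * exp (-t))"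
    unfolding set_integrable_def by (subst (asm) integrable_completion) auto
  have "((\<lambda>t. Re (complex_of_real t powr (complex_of_real s - 1) / of_real (exp t))) has_integral Re (Gamma (complex_of_real s))) {0<..}"
    using has_integral_linear[OF Gamma_integral_complex' bounded_linear_Re, of "of_real s"] s by (simp add: o_def)
  from has_integral_eq[OF eq this]
  have "((\<lambda>t. t powr (s - 1) * exp (-t)) has_integral Gamma s) {0<..}"
    by (simp add: Gamma_complex_of_real)
  hence "integral {0<..} (\<lambda>t. t powr (s - 1) * exp (-t)) = Gamma s"
    by (rule integral_unique)
  with set_borel_integral_eq_integral(2)[OF 2] 2
  show "has_bochner_integral lborel (\<lambda>t. indicator {0<..} t *\<^sub>R (t powr (s - 1) * exp (- t))) (Gamma s)"
    by (simp add: has_bochner_integral_iff set_integrable_def set_lebesgue_integral_def)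
qed

lemma Mellin_inverse_quadratic':
  fixes a w :: real
  assumes a: "0 < a" "a < 2" and w: "w > 0"
  shows "has_bochner_integral lborel (\<lambda>t. indicator {0<..} t *\<^sub>R (t powr (a - 1) / (t\<^sup>2 + w\<^sup>2)))
           (w powr (a - 2) * (pi / (2 * sin (pi * a / 2))))"
proof -
  define C where "C = pi / (2 * sin (pi * a / 2))"
  have w': "1 / w > 0" using w by simp
  have "has_bochner_integral lborel (\<lambda>t. indicator {0<..} t *\<^sub>R (t powr (a - 1) * (1 / (t\<^sup>2 + 1)))) C"
    using Mellin_inverse_quadratic[OF a] unfolding C_def by simp
  from Mellin_scale[where f = "\<lambda>t. 1 / (t\<^sup>2 + 1)", OF this w']
  have "has_bochner_integral lborel (\<lambda>t. indicator {0<..} t *\<^sub>R (t powr (a - 1) * (1 / ((1 / w * t)\<^sup>2 + 1)))) ((1/w) powr (-a) * C)" .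
  from has_bochner_integral_mult_right[OF this, of "1 / w\<^sup>2"]
  have 1: "has_bochner_integral lborel (\<lambda>t. 1 / w\<^sup>2 * (indicator {0<..} t *\<^sub>R (t powr (a - 1) * (1 / ((1 / w * t)\<^sup>2 + 1)))))
           (1 / w\<^sup>2 * ((1/w) powr (-a) * C))" by simp
  have "1 / w\<^sup>2 * (1 / ((1 / w * t)\<^sup>2 + 1)) = 1 / (t\<^sup>2 + w\<^sup>2)" for t
  proof -
    have "w\<^sup>2 * ((1 / w * t)\<^sup>2 + 1) = t\<^sup>2 + w\<^sup>2" using w by (simp add: field_simps)
    thus ?thesis by (metis divide_divide_eq_left mult.right_neutral times_divide_eq_right)
  qed
  note q = this
  have e1: "1 / w\<^sup>2 * (indicator {0<..} t *\<^sub>R (t powr (a - 1) * (1 / ((1 / w * t)\<^sup>2 + 1)))) =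
     indicator {0<..} t *\<^sub>R (t powr (a - 1) / (t\<^sup>2 + w\<^sup>2))" for t :: real
  proof -
    have "c * (i *\<^sub>R (P * Q)) = i *\<^sub>R (P * (c * Q))" for c i P Q :: real
      by (simp only: real_scaleR_def mult.left_commute)
    from this[of "1 / w\<^sup>2" "indicator {0<..} t" "t powr (a - 1)" "1 / ((1 / w * t)\<^sup>2 + 1)"]
    show ?thesis unfolding q by (simp only: times_divide_eq_right mult.right_neutral)
  qed
  have "(1/w) powr (-a) = w powr a" using w by (simp add: powr_divide powr_minus_divide)
  moreover have "w powr (a - 2) = w powr a / w\<^sup>2" using w by (simp add: powr_diff powr_numeral)
  ultimately have e2: "1 / w\<^sup>2 * ((1/w) powr (-a) * C) = w powr (a - 2) * C" by simp
  show ?thesis using 1 unfolding e1 e2 unfolding C_def .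
qed

text \<open>Logarithmic differentiation of the reflection formula gives
  \<open>Digamma (1 - z) - Digamma z = pi * cot (pi * z)\<close>. In the difference of the two limit
  formulas for \<open>Digamma\<close> the terms \<open>ln m\<close> cancel.\<close>

lemma cot_partial_fractions:
  fixes z :: complex
  assumes z: "z \<notin> \<int>"
  shows "(\<lambda>m. \<Sum>n<m. inverse (z + of_nat n) - inverse (1 - z + of_nat n)) \<longlonglongrightarrow> of_real pi * cot (of_real pi * z)"
proof -
  have z': "z \<noteq> 0" "1 - z \<noteq> 0" "z \<notin> \<int>\<^sub>\<le>\<^sub>0" "1 - z \<notin> \<int>\<^sub>\<le>\<^sub>0"
    using z by (auto dest: nonpos_Ints_Int Ints_diff[OF Ints_1, of "1 - z"])
  have "(\<lambda>m. (of_real (ln (real m)) - (\<Sum>n<m. inverse (1 - z + of_nat n))) - (of_real (ln (real m)) - (\<Sum>n<m. inverse (z + of_nat n))))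
    \<longlonglongrightarrow> Digamma (1 - z) - Digamma z"
    by (intro tendsto_diff Digamma_LIMSEQ z')
  hence 1: "(\<lambda>m. \<Sum>n<m. inverse (z + of_nat n) - inverse (1 - z + of_nat n)) \<longlonglongrightarrow> Digamma (1 - z) - Digamma z"
    by (simp add: sum_subtractf algebra_simps)
  have sin: "sin (of_real pi * z) \<noteq> 0"
    using z by (auto simp: sin_eq_0)
  have 2: "((\<lambda>z. Gamma z * Gamma (1 - z)) has_field_derivative
      (Gamma z * Digamma z * Gamma (1 - z) - Gamma z * (Gamma (1 - z) * Digamma (1 - z)))) (at z)"
    using z' by (auto intro!: derivative_eq_intros)
  have 3: "((\<lambda>z::complex. of_real pi / sin (of_real pi * z)) has_field_derivative
      (- of_real pi * (of_real pi * cos (of_real pi * z)) / (sin (of_real pi * z))\<^sup>2)) (at z)"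
    using sin by (auto intro!: derivative_eq_intros simp: power2_eq_square)
  have "Gamma z * Gamma (1 - z) * (Digamma z - Digamma (1 - z)) = 
     - of_real pi * (of_real pi * cos (of_real pi * z)) / (sin (of_real pi * z))\<^sup>2"
    using DERIV_unique[OF 2[unfolded Gamma_reflection_complex] 3] by (simp add: algebra_simps)
  hence h: "of_real pi / sin (of_real pi * z) * (Digamma z - Digamma (1 - z)) = 
     - of_real pi * (of_real pi * cos (of_real pi * z)) / (sin (of_real pi * z))\<^sup>2"
    unfolding Gamma_reflection_complex .
  have K: "X = - p * (C / S)" if "p / S * X = - p * (p * C) / S\<^sup>2" "S \<noteq> 0" "p \<noteq> 0" for X p C S :: complex
  proof -
    have "p * (X * S) = p * (- p * C)" using that by (simp add: field_simps power2_eq_square)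
    hence "X * S = - p * C" using that by (simp only: mult_cancel_left) simp
    thus ?thesis using that by (simp add: field_simps)
  qed
  have "complex_of_real pi \<noteq> 0" by simp
  from K[OF h sin this] have "Digamma z - Digamma (1 - z) = - of_real pi * cot (of_real pi * z)"
    by (simp only: cot_def)
  hence "Digamma (1 - z) - Digamma z = of_real pi * cot (of_real pi * z)"
    by (simp add: algebra_simps)
  with 1 show ?thesis by simp
qed

text \<open>With \<open>u = z / (2 * pi * \<i>)\<close> the right side is
  \<open>cot (pi * u) / (2 * \<i>)\<close>. Term \<open>k\<close> pairs the pole
  \<open>2 * pi * \<i> * k\<close> with the pole \<open>- 2 * pi * \<i> * (k + 1)\<close>, so every
  pole occurs once and the series converges.\<close>

lemma inverse_exp_minus_1_partial_fractions:
  fixes z :: complex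
  assumes z: "Re z > 0"
  shows "(\<lambda>m. \<Sum>k<m. 1 / (z - 2 * of_real pi * \<i> * of_nat k) + 1 / (z + 2 * of_real pi * \<i> * of_nat (Suc k)))
     \<longlonglongrightarrow> 1 / (exp z - 1) + 1 / 2"
proof -
  define u where "u = z / (2 * of_real pi * \<i>)"
  have zu: "z = 2 * of_real pi * \<i> * u" by (simp add: u_def)
  have "u \<notin> \<int>"
  proof
    assume "u \<in> \<int>"
    then obtain k where "u = of_int k" by (auto elim: Ints_cases)
    thus False using z by (simp add: zu)
  qed
  hence vi: "- u \<notin> \<int>" by simp
  have e: "exp z \<noteq> 1"
    using z by (metis norm_exp_eq_Re norm_one one_less_exp_iff order_less_irrefl)
  define E where "E = exp (\<i> * (of_real pi * u))"
  have E: "E \<noteq> 0" "E * E = exp z" by (simp_all add: E_def zu algebra_simps flip: exp_add)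
  have EE: "E * E \<noteq> 1" using E e by simp
  have "cot (of_real pi * u) = \<i> * (E + 1 / E) / (E - 1 / E)"
  proof -
    have "cos (of_real pi * u) = (E + 1 / E) / 2" "sin (of_real pi * u) = (E - 1 / E) / (2 * \<i>)"
      by (simp_all add: cos_exp_eq sin_exp_eq E_def exp_minus inverse_eq_divide)
    moreover have "(a / 2) / (b / (2 * \<i>)) = \<i> * a / b" for a b :: complex
      by (cases "b = 0") (simp_all add: field_simps)
    ultimately show ?thesis by (simp only: cot_def)
  qed
  also have "\<dots> = \<i> * (exp z + 1) / (exp z - 1)"
  proof -
    have "E + 1 / E = (exp z + 1) / E" "E - 1 / E = (exp z - 1) / E"
      using E(1) by (simp_all add: E(2)[symmetric] add_divide_distrib diff_divide_distrib)
    thus ?thesis using E(1) by simp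
  qed
  finally have ct: "cot (of_real pi * u) = \<i> * (exp z + 1) / (exp z - 1)" .
  have half: "X \<noteq> 1 \<Longrightarrow> p \<noteq> 0 \<Longrightarrow> p * (\<i> * (X + 1) / (X - 1)) / (2 * p * \<i>) = 1 / (X - 1) + 1 / 2" for X p :: complex
    by (simp add: field_simps)
  have c: "of_real pi * cot (of_real pi * u) / (2 * of_real pi * \<i>) = 1 / (exp z - 1) + 1 / 2"
    unfolding ct by (rule half[OF e]) simp
  have "(\<lambda>m. (\<Sum>n<m. inverse (- u + of_nat n) - inverse (1 - (- u) + of_nat n)) / (- (2 * of_real pi * \<i>))) \<longlonglongrightarrow> of_real pi * cot (of_real pi * (- u)) / (- (2 * of_real pi * \<i>))"
    by (intro tendsto_divide cot_partial_fractions[OF vi] tendsto_const) auto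
  also have "of_real pi * cot (of_real pi * (- u)) / (- (2 * of_real pi * \<i>)) = 1 / (exp z - 1) + 1 / 2"
    using c by (simp add: cot_def)
  also have "(\<lambda>m. (\<Sum>n<m. inverse (- u + of_nat n) - inverse (1 - (- u) + of_nat n)) / (- (2 * of_real pi * \<i>))) = 
     (\<lambda>m. \<Sum>k<m. 1 / (z - 2 * of_real pi * \<i> * of_nat k) + 1 / (z + 2 * of_real pi * \<i> * of_nat (Suc k)))"
  proof (intro ext, unfold sum_divide_distrib, intro sum.cong refl)
    fix k :: nat
    have "z - 2 * of_real pi * \<i> * of_nat k = (- (2 * of_real pi * \<i>)) * (- u + of_nat k)" by (simp add: zu algebra_simps)
    moreover have "z + 2 * of_real pi * \<i> * of_nat (Suc k) = 2 * of_real pi * \<i> * (1 - (- u) + of_nat k)" by (simp add: zu algebra_simps)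
    ultimately show "(inverse (- u + of_nat k) - inverse (1 - (- u) + of_nat k)) / (- (2 * of_real pi * \<i>)) =
      1 / (z - 2 * of_real pi * \<i> * of_nat k) + 1 / (z + 2 * of_real pi * \<i> * of_nat (Suc k))"
      by (simp only: divide_inverse inverse_mult_distrib inverse_minus_eq) (simp add: algebra_simps)
  qed
  finally show ?thesis .
qed

section \<open>Duality between exponential and rational kernels\<close>

definition wfreq :: "nat \<Rightarrow> real \<Rightarrow> real" where "wfreq q x = 2 * pi * x / real q"

definition ker :: "real \<Rightarrow> real \<Rightarrow> complex" where "ker t w = 1 / (of_real t - \<i> * of_real w)"

text \<open>The kernels at the frequencies of \<open>n\<close> and \<open>- n\<close>, joined by the
  parity sign: what a sum over all nonzero integers becomes when
  \<open>g (- n) = \<epsilon> * g n\<close>.\<close>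

definition pker :: "nat \<Rightarrow> complex \<Rightarrow> real \<Rightarrow> nat \<Rightarrow> complex" where
  "pker q \<epsilon> t n = ker t (wfreq q (real (Suc n))) + \<epsilon> * ker t (- wfreq q (real (Suc n)))"

text \<open>The situation of \<open>f = \<chi>\<close> primitive: \<open>g\<close> is the conjugate of \<open>\<chi>\<close>, \<open>\<epsilon>\<close> its parity and \<open>\<tau>\<close> the Gauss sum.\<close>
definition dual :: "nat \<Rightarrow> (int \<Rightarrow> complex) \<Rightarrow> (int \<Rightarrow> complex) \<Rightarrow> complex \<Rightarrow> complex \<Rightarrow> bool" where
  "dual q f g \<epsilon> \<tau> \<longleftrightarrow> q > 0 \<and> norm \<epsilon> = 1 \<and> (\<forall>n. g (n + int q) = g n) \<and> g 0 = 0 \<and> (\<forall>n. g (- n) = \<epsilon> * g n) \<and>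
     (\<forall>n. (\<Sum>a<q. g (int a) * exp (2 * of_real pi * \<i> * of_int (int a * n) / of_nat q)) = \<tau> * f n) \<and>
     psum g q = 0 \<and> (\<exists>B. \<forall>n. norm (psum f n) \<le> B) \<and> (\<exists>B. \<forall>n. norm (psum g n) \<le> B)"

lemma norm_ker: "norm (ker t w) = 1 / sqrt (t\<^sup>2 + w\<^sup>2)"
proof -
  have "of_real t - \<i> * of_real w = Complex t (- w)" by (simp add: complex_eq_iff)
  thus ?thesis by (simp add: ker_def norm_divide complex_norm)
qed

text \<open>A single kernel decays only like \<open>1 / w\<close>, but a difference quotient decays
  like \<open>1 / w^2\<close>. This makes the summed-by-parts series over the kernels absolutely
  convergent and integrable term by term.\<close>

lemma ker_diff:
  assumes "0 < \<bar>w\<bar>" "\<bar>w\<bar> \<le> \<bar>w'\<bar>"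
  shows "norm (ker t w - ker t w') \<le> \<bar>w' - w\<bar> / (t\<^sup>2 + w\<^sup>2)"
proof -
  have w: "w \<noteq> 0" "w' \<noteq> 0" using assms by auto
  have nz: "of_real t - \<i> * of_real x \<noteq> 0" if "x \<noteq> 0" for x
    using that by (auto simp: complex_eq_iff)
  have "ker t w - ker t w' = (\<i> * of_real (w - w')) * (ker t w * ker t w')"
    using nz[OF w(1)] nz[OF w(2)] by (simp add: ker_def field_simps)
  hence "norm (ker t w - ker t w') = \<bar>w' - w\<bar> * (1 / sqrt (t\<^sup>2 + w\<^sup>2) * (1 / sqrt (t\<^sup>2 + w'\<^sup>2)))"
    by (simp only: norm_mult norm_ker norm_of_real) (simp add: abs_minus_commute)
  also have "\<dots> \<le> \<bar>w' - w\<bar> * (1 / sqrt (t\<^sup>2 + w\<^sup>2) * (1 / sqrt (t\<^sup>2 + w\<^sup>2)))"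
  proof -
    have "w\<^sup>2 \<le> w'\<^sup>2" using assms by (simp add: abs_le_square_iff)
    hence "1 / sqrt (t\<^sup>2 + w'\<^sup>2) \<le> 1 / sqrt (t\<^sup>2 + w\<^sup>2)"
      using w by (intro divide_left_mono) (auto intro!: mult_pos_pos add_nonneg_pos)
    thus ?thesis by (intro mult_left_mono) auto
  qed
  also have "1 / sqrt (t\<^sup>2 + w\<^sup>2) * (1 / sqrt (t\<^sup>2 + w\<^sup>2)) = 1 / (t\<^sup>2 + w\<^sup>2)"
    by (simp add: add_nonneg_nonneg)
  finally show ?thesis by simp
qed

lemma wfreq_pos: "q > 0 \<Longrightarrow> x > 0 \<Longrightarrow> wfreq q x > 0" by (simp add: wfreq_def)

lemma ker_diff_Suc:
  assumes q: "q > 0" and s: "s = 1 \<or> s = -1"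
  shows "norm (ker t (s * wfreq q (real (Suc n))) - ker t (s * wfreq q (real (Suc (Suc n))))) \<le>
           wfreq q 1 / (t\<^sup>2 + (wfreq q (real (Suc n)))\<^sup>2)"
proof -
  have p: "0 < wfreq q (real (Suc n))" using q by (intro wfreq_pos) auto
  have m: "wfreq q (real (Suc (Suc n))) = wfreq q (real (Suc n)) + wfreq q 1"
    by (simp add: wfreq_def add_divide_distrib ring_distribs)
  have 1: "wfreq q 1 > 0" using q by (intro wfreq_pos) auto
  have "norm (ker t (s * wfreq q (real (Suc n))) - ker t (s * wfreq q (real (Suc (Suc n))))) \<le>
     \<bar>s * wfreq q (real (Suc (Suc n))) - s * wfreq q (real (Suc n))\<bar> / (t\<^sup>2 + (s * wfreq q (real (Suc n)))\<^sup>2)"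
    by (rule ker_diff) (use s p 1 m in \<open>auto simp: abs_mult\<close>)
  also have "\<dots> = wfreq q 1 / (t\<^sup>2 + (wfreq q (real (Suc n)))\<^sup>2)"
    unfolding m using s 1 by auto
  finally show ?thesis .
qed

lemma pker_diff:
  assumes q: "q > 0" and e: "norm \<epsilon> = 1"
  shows "norm (pker q \<epsilon> t n - pker q \<epsilon> t (Suc n)) \<le> 2 * wfreq q 1 / (t\<^sup>2 + (wfreq q (real (Suc n)))\<^sup>2)"
proof -
  have "pker q \<epsilon> t n - pker q \<epsilon> t (Suc n) = (ker t (1 * wfreq q (real (Suc n))) - ker t (1 * wfreq q (real (Suc (Suc n)))))
     + \<epsilon> * (ker t (-1 * wfreq q (real (Suc n))) - ker t (-1 * wfreq q (real (Suc (Suc n)))))"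
    by (simp add: pker_def algebra_simps)
  also have "norm \<dots> \<le> wfreq q 1 / (t\<^sup>2 + (wfreq q (real (Suc n)))\<^sup>2) + 1 * (wfreq q 1 / (t\<^sup>2 + (wfreq q (real (Suc n)))\<^sup>2))"
    by (rule order.trans[OF norm_triangle_ineq])
       (unfold norm_mult e, intro add_mono mult_left_mono ker_diff_Suc q, auto)
  finally show ?thesis by simp
qed

lemma summable_wfreq:
  assumes q: "q > 0"
  shows "summable (\<lambda>n. c / (t\<^sup>2 + (wfreq q (real (Suc n)))\<^sup>2))"
proof (rule summable_comparison_test'[of "\<lambda>n. \<bar>c\<bar> / (wfreq q 1)\<^sup>2 * (1 / (real (Suc n))\<^sup>2)" 0])
  show "summable (\<lambda>n. \<bar>c\<bar> / (wfreq q 1)\<^sup>2 * (1 / (real (Suc n))\<^sup>2))"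
    using sums_summable[OF inverse_squares_sums] by (intro summable_mult) (simp add: add_ac)
  fix n :: nat
  have e: "(wfreq q (real (Suc n)))\<^sup>2 = (wfreq q 1)\<^sup>2 * (real (Suc n))\<^sup>2"
    unfolding power_mult_distrib[symmetric] by (simp add: wfreq_def field_simps)
  have p: "(wfreq q 1)\<^sup>2 * (real (Suc n))\<^sup>2 > 0"
    using q wfreq_pos[OF q, of 1] by simp
  have "norm (c / (t\<^sup>2 + (wfreq q (real (Suc n)))\<^sup>2)) = \<bar>c\<bar> / (t\<^sup>2 + (wfreq q (real (Suc n)))\<^sup>2)" by (simp add: abs_of_nonneg)
  also have "\<dots> \<le> \<bar>c\<bar> / ((wfreq q 1)\<^sup>2 * (real (Suc n))\<^sup>2)"
    unfolding e using p by (intro divide_left_mono) (auto intro!: mult_pos_pos add_nonneg_pos)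
  finally show "norm (c / (t\<^sup>2 + (wfreq q (real (Suc n)))\<^sup>2)) \<le> \<bar>c\<bar> / (wfreq q 1)\<^sup>2 * (1 / (real (Suc n))\<^sup>2)" by simp
qed

lemma ker_tendsto_0:
  assumes q: "q > 0" and s: "s = 1 \<or> s = -1"
  shows "(\<lambda>n. ker t (s * wfreq q (real (Suc n)))) \<longlonglongrightarrow> 0"
proof (rule tendsto_norm_zero_cancel)
  have "(\<lambda>n. 1 / sqrt (t\<^sup>2 + (2 * pi * real (Suc n) / real q)\<^sup>2)) \<longlonglongrightarrow> 0"
    using q by real_asymp
  moreover have "norm (ker t (s * wfreq q (real (Suc n)))) = 1 / sqrt (t\<^sup>2 + (2 * pi * real (Suc n) / real q)\<^sup>2)" for n
    using s unfolding norm_ker wfreq_def by auto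
  ultimately show "(\<lambda>n. norm (ker t (s * wfreq q (real (Suc n))))) \<longlonglongrightarrow> 0" by presburger
qed

lemma ker_by_parts:
  assumes q: "q > 0" and s: "s = 1 \<or> s = -1" and bd: "\<And>n. norm (psum g n) \<le> B"
  shows "(\<lambda>n. g (int (Suc n)) * ker t (s * wfreq q (real (Suc n)))) sums
     (\<Sum>n. psum g (Suc n) * (ker t (s * wfreq q (real (Suc n))) - ker t (s * wfreq q (real (Suc (Suc n))))))"
    and "summable (\<lambda>n. norm (psum g (Suc n) * (ker t (s * wfreq q (real (Suc n))) - ker t (s * wfreq q (real (Suc (Suc n)))))))"
proof -
  have sm: "summable (\<lambda>n. norm (ker t (s * wfreq q (real (Suc n))) - ker t (s * wfreq q (real (Suc (Suc n))))))"
    by (rule summable_comparison_test'[OF summable_wfreq[OF q, of "wfreq q 1" t], of 0])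
       (use ker_diff_Suc[OF q s, of t] in auto)
  show "(\<lambda>n. g (int (Suc n)) * ker t (s * wfreq q (real (Suc n)))) sums
     (\<Sum>n. psum g (Suc n) * (ker t (s * wfreq q (real (Suc n))) - ker t (s * wfreq q (real (Suc (Suc n))))))"
    and "summable (\<lambda>n. norm (psum g (Suc n) * (ker t (s * wfreq q (real (Suc n))) - ker t (s * wfreq q (real (Suc (Suc n)))))))"
    using by_parts_sums[OF bd ker_tendsto_0[OF q s, of t] sm] by auto
qed

lemma exp_by_parts:
  assumes t: "t > 0" and bd: "\<And>n. norm (psum f n) \<le> B"
  shows "(\<lambda>n. f (int (Suc n)) * of_real (exp (- (real (Suc n) * t)))) sums
     (\<Sum>n. psum f (Suc n) * (of_real (exp (- (real (Suc n) * t))) - of_real (exp (- (real (Suc (Suc n)) * t)))))"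
    and "summable (\<lambda>n. norm (psum f (Suc n) * (of_real (exp (- (real (Suc n) * t))) - of_real (exp (- (real (Suc (Suc n)) * t))))))"
proof -
  have l: "(\<lambda>n. exp (- (real (Suc n) * t))) \<longlonglongrightarrow> 0" using t by real_asymp
  have "(\<lambda>n. exp (- (real (Suc n) * t)) - exp (- (real (Suc (Suc n)) * t))) sums (exp (- (real (Suc 0) * t)) - 0)"
    by (rule telescope_sums'[OF l])
  moreover have "norm (complex_of_real (exp (- (real (Suc n) * t))) - of_real (exp (- (real (Suc (Suc n)) * t)))) =
     exp (- (real (Suc n) * t)) - exp (- (real (Suc (Suc n)) * t))" for n
    unfolding of_real_diff[symmetric] norm_of_real using t by (simp add: algebra_simps)
  ultimately have sm: "summable (\<lambda>n. norm (complex_of_real (exp (- (real (Suc n) * t))) - of_real (exp (- (real (Suc (Suc n)) * t)))))"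
    by (simp only:) (rule sums_summable)
  have "(\<lambda>n. complex_of_real (exp (- (real (Suc n) * t)))) \<longlonglongrightarrow> of_real 0"
    by (intro tendsto_of_real l)
  hence l': "(\<lambda>n. complex_of_real (exp (- (real (Suc n) * t)))) \<longlonglongrightarrow> 0" by simp
  show "(\<lambda>n. f (int (Suc n)) * of_real (exp (- (real (Suc n) * t)))) sums
     (\<Sum>n. psum f (Suc n) * (of_real (exp (- (real (Suc n) * t))) - of_real (exp (- (real (Suc (Suc n)) * t)))))"
    "summable (\<lambda>n. norm (psum f (Suc n) * (of_real (exp (- (real (Suc n) * t))) - of_real (exp (- (real (Suc (Suc n)) * t))))))"
    using by_parts_sums[OF bd l' sm] by auto
qed

lemma periodic_mult:
  fixes g :: "int \<Rightarrow> 'a"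
  assumes "\<And>n. g (n + int q) = g n"
  shows "g (n + int k * int q) = g n"
proof (induction k)
  case (Suc k)
  have "n + int (Suc k) * int q = (n + int k * int q) + int q" by (simp add: algebra_simps)
  thus ?case using Suc assms by metis
qed simp

lemma sum_blocks: "(\<Sum>a<q. \<Sum>k<m. h (k * q + a)) = (\<Sum>n<m * q. h n)" for h :: "nat \<Rightarrow> 'a::comm_monoid_add"
proof -
  have "(\<Sum>a<q. \<Sum>k<m. h (k * q + a)) = (\<Sum>k<m. \<Sum>a<q. h (k * q + a))" by (rule sum.swap)
  moreover have "(\<Sum>a<q. h (k * q + a)) = sum h {k * q..<k * q + q}" for k
    using sum.shift_bounds_nat_ivl[of h 0 "k * q" q] by (simp add: lessThan_atLeast0 add.commute)
  ultimately show ?thesis by (simp add: sum.nat_group)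
qed

text \<open>A Poisson summation formula. Inserting the finite Fourier expansion of
  \<open>\<tau> * f n\<close> makes the left side a combination of geometric series, that is, of
  values \<open>1 / (exp (z a) - 1)\<close>. As functions of \<open>t\<close> these have their poles
  at the points \<open>\<i> * wfreq q n\<close> with \<open>n\<close> congruent to \<open>a\<close>,
  and the periodicity of \<open>g\<close> collects the partial fractions of all \<open>a\<close>
  into one sum over \<open>n\<close>.\<close>

lemma exp_ker_duality:
  assumes D: "dual q f g \<epsilon> \<tau>" and t: "t > 0"
  shows "\<tau> * (\<Sum>n. psum f (Suc n) * (of_real (exp (- (real (Suc n) * t))) - of_real (exp (- (real (Suc (Suc n)) * t))))) =
         (\<Sum>n. psum g (Suc n) * (pker q \<epsilon> t n - pker q \<epsilon> t (Suc n)))"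
proof -
  from D obtain Bf Bg where q: "q > 0" and e: "norm \<epsilon> = 1" and per: "\<And>n. g (n + int q) = g n" and g0: "g 0 = 0"
    and par: "\<And>n. g (- n) = \<epsilon> * g n"
    and four: "\<And>n. (\<Sum>a<q. g (int a) * exp (2 * of_real pi * \<i> * of_int (int a * n) / of_nat q)) = \<tau> * f n"
    and pg: "psum g q = 0" and Bf: "\<And>n. norm (psum f n) \<le> Bf" and Bg: "\<And>n. norm (psum g n) \<le> Bg"
    unfolding dual_def by blast
  define z where "z = (\<lambda>a. of_real t - \<i> * of_real (wfreq q (real a)))"
  have gs: "(\<Sum>a<q. g (int a)) = 0"
  proof -
    have "(\<Sum>a<Suc q. g (int a)) = g (int 0) + (\<Sum>a<q. g (int (Suc a)))" by (rule sum.lessThan_Suc_shift)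
    hence "(\<Sum>a<q. g (int a)) + g (int q) = g 0 + psum g q" by (simp add: psum_def)
    moreover have "g (int q) = g 0" using per[of 0] by simp
    ultimately show ?thesis using pg g0 by simp
  qed
  have Rez: "Re (z a) > 0" for a using t by (simp add: z_def)
  have nz: "exp (z a) \<noteq> 1" for a
    using Rez[of a] by (metis norm_exp_eq_Re norm_one one_less_exp_iff order_less_irrefl)
  let ?F = "(\<Sum>n. psum f (Suc n) * (of_real (exp (- (real (Suc n) * t))) - of_real (exp (- (real (Suc (Suc n)) * t)))))"
  have F1: "(\<lambda>n. \<tau> * (f (int (Suc n)) * of_real (exp (- (real (Suc n) * t))))) sums (\<tau> * ?F)"
    by (intro sums_mult exp_by_parts(1)[OF t Bf])
  have F2: "(\<lambda>n. \<tau> * (f (int (Suc n)) * of_real (exp (- (real (Suc n) * t))))) sums (\<Sum>a<q. g (int a) * (1 / (exp (z a) - 1)))"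
  proof -
    have eq: "\<tau> * (f (int (Suc n)) * of_real (exp (- (real (Suc n) * t)))) = (\<Sum>a<q. g (int a) * exp (- z a) ^ Suc n)" for n
    proof -
      have "\<tau> * (f (int (Suc n)) * of_real (exp (- (real (Suc n) * t)))) = (\<Sum>a<q. g (int a) * exp (2 * of_real pi * \<i> * of_int (int a * int (Suc n)) / of_nat q)) * exp (of_real (- (real (Suc n) * t)))"
        unfolding four[of "int (Suc n)"] exp_of_real[symmetric] by (simp only: mult.assoc)
      also have "\<dots> = (\<Sum>a<q. g (int a) * exp (- z a) ^ Suc n)"
        unfolding sum_distrib_right
      proof (intro sum.cong refl)
        fix a
        have "exp (- z a) ^ Suc n = exp (of_nat (Suc n) * (- z a))" by (rule exp_of_nat_mult[symmetric])
        also have "of_nat (Suc n) * (- z a) = 2 * of_real pi * \<i> * of_int (int a * int (Suc n)) / of_nat q + of_real (- (real (Suc n) * t))"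
          using q by (simp add: z_def wfreq_def field_simps)
        finally show "g (int a) * exp (2 * of_real pi * \<i> * of_int (int a * int (Suc n)) / of_nat q) * exp (of_real (- (real (Suc n) * t))) = g (int a) * exp (- z a) ^ Suc n"
          by (simp only: exp_add mult.assoc)
      qed
      finally show ?thesis .
    qed
    have "(\<lambda>n. exp (- z a) ^ Suc n) sums (1 / (exp (z a) - 1))" for a
    proof -
      have "norm (exp (- z a)) < 1" using Rez[of a] by simp
      from sums_mult[OF geometric_sums[OF this], of "exp (- z a)"]
      have "(\<lambda>n. exp (- z a) ^ Suc n) sums (exp (- z a) * (1 / (1 - exp (- z a))))" by simp
      also have "exp (- z a) * (1 / (1 - exp (- z a))) = 1 / (exp (z a) - 1)"
        using nz[of a] by (simp add: exp_minus field_simps)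
      finally show ?thesis .
    qed
    hence "(\<lambda>n. \<Sum>a<q. g (int a) * exp (- z a) ^ Suc n) sums (\<Sum>a<q. g (int a) * (1 / (exp (z a) - 1)))"
      by (intro sums_sum sums_mult)
    thus ?thesis unfolding eq .
  qed
  have F: "\<tau> * ?F = (\<Sum>a<q. g (int a) * (1 / (exp (z a) - 1)))" using F1 F2 by (rule sums_unique2)
  have "(\<lambda>m. \<Sum>a<q. g (int a) * (\<Sum>k<m. 1 / (z a - 2 * of_real pi * \<i> * of_nat k) + 1 / (z a + 2 * of_real pi * \<i> * of_nat (Suc k))))
     \<longlonglongrightarrow> (\<Sum>a<q. g (int a) * (1 / (exp (z a) - 1) + 1 / 2))"
    by (intro tendsto_sum tendsto_mult tendsto_const inverse_exp_minus_1_partial_fractions Rez)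
  \<comment> \<open>The constant \<open>1 / 2\<close> of the expansion disappears because the values
    of \<open>g\<close> over a period sum to 0.\<close>
  also have "(\<Sum>a<q. g (int a) * (1 / (exp (z a) - 1) + 1 / 2)) = \<tau> * ?F"
    unfolding F by (simp add: distrib_left sum.distrib gs flip: sum_divide_distrib)
  finally have L: "(\<lambda>m. \<Sum>a<q. g (int a) * (\<Sum>k<m. 1 / (z a - 2 * of_real pi * \<i> * of_nat k) + 1 / (z a + 2 * of_real pi * \<i> * of_nat (Suc k))))
     \<longlonglongrightarrow> \<tau> * ?F" .
  define S where "S = (\<lambda>s. \<Sum>n. psum g (Suc n) * (ker t (s * wfreq q (real (Suc n))) - ker t (s * wfreq q (real (Suc (Suc n))))))"
  have eqm: "(\<Sum>a<q. g (int a) * (\<Sum>k<m. 1 / (z a - 2 * of_real pi * \<i> * of_nat k) + 1 / (z a + 2 * of_real pi * \<i> * of_nat (Suc k)))) =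
     (\<Sum>n<m * q. g (int n) * ker t (1 * wfreq q (real n))) + \<epsilon> * (\<Sum>n<m * q. g (int (Suc n)) * ker t (-1 * wfreq q (real (Suc n))))" for m
  proof -
    have A: "g (int a) * (1 / (z a - 2 * of_real pi * \<i> * of_nat k)) = g (int (k * q + a)) * ker t (1 * wfreq q (real (k * q + a)))" for a k
    proof -
      have "g (int (k * q + a)) = g (int a)" using periodic_mult[of g q "int a" k, OF per] by (simp add: add.commute)
      moreover have "z a - 2 * of_real pi * \<i> * of_nat k = of_real t - \<i> * of_real (wfreq q (real (k * q + a)))"
        using q by (simp add: z_def wfreq_def field_simps)
      ultimately show ?thesis by (simp add: ker_def)
    qed
    \<comment> \<open>Negative frequencies: the residue \<open>q - Suc a\<close> is that of
      \<open>- Suc a\<close>, so parity supplies \<open>\<epsilon>\<close>, and the pole of index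
      \<open>Suc k\<close> belongs to the integer \<open>- (k * q + a + 1)\<close>.\<close>
    have B: "g (int (q - Suc a)) * (1 / (z (q - Suc a) + 2 * of_real pi * \<i> * of_nat (Suc k))) = \<epsilon> * (g (int (Suc (k * q + a))) * ker t (-1 * wfreq q (real (Suc (k * q + a)))))" 
      if a: "a < q" for a k
    proof -
      have "g (int (Suc (k * q + a))) = g (int (Suc a))"
        using periodic_mult[of g q "int (Suc a)" k, OF per] by (simp add: ac_simps)
      moreover have "g (int (q - Suc a)) = \<epsilon> * g (int (Suc a))"
        using par[of "int (Suc a)"] per[of "- int (Suc a)"] a by (simp add: of_nat_diff algebra_simps)
      moreover have "z (q - Suc a) + 2 * of_real pi * \<i> * of_nat (Suc k) = of_real t - \<i> * of_real (-1 * wfreq q (real (Suc (k * q + a))))"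
        using q a by (simp add: z_def wfreq_def field_simps of_nat_diff)
      ultimately show ?thesis by (simp add: ker_def)
    qed
    have "(\<Sum>a<q. g (int a) * (\<Sum>k<m. 1 / (z a - 2 * of_real pi * \<i> * of_nat k) + 1 / (z a + 2 * of_real pi * \<i> * of_nat (Suc k)))) =
       (\<Sum>a<q. \<Sum>k<m. g (int a) * (1 / (z a - 2 * of_real pi * \<i> * of_nat k))) + (\<Sum>a<q. \<Sum>k<m. g (int a) * (1 / (z a + 2 * of_real pi * \<i> * of_nat (Suc k))))"
      by (simp only: sum_distrib_left sum.distrib distrib_left)
    also have "(\<Sum>a<q. \<Sum>k<m. g (int a) * (1 / (z a + 2 * of_real pi * \<i> * of_nat (Suc k)))) =
       (\<Sum>a<q. \<Sum>k<m. g (int (q - Suc a)) * (1 / (z (q - Suc a) + 2 * of_real pi * \<i> * of_nat (Suc k))))"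
      by (rule sum.nat_diff_reindex[symmetric])
    also have "\<dots> = (\<Sum>a<q. \<Sum>k<m. \<epsilon> * (g (int (Suc (k * q + a))) * ker t (-1 * wfreq q (real (Suc (k * q + a))))))"
      by (intro sum.cong refl B) auto
    also have "\<dots> = \<epsilon> * (\<Sum>a<q. \<Sum>k<m. g (int (Suc (k * q + a))) * ker t (-1 * wfreq q (real (Suc (k * q + a)))))"
      by (simp only: sum_distrib_left)
    also have "(\<Sum>a<q. \<Sum>k<m. g (int (Suc (k * q + a))) * ker t (-1 * wfreq q (real (Suc (k * q + a))))) =
       (\<Sum>n<m * q. g (int (Suc n)) * ker t (-1 * wfreq q (real (Suc n))))"
      by (rule sum_blocks)
    also have "(\<Sum>a<q. \<Sum>k<m. g (int a) * (1 / (z a - 2 * of_real pi * \<i> * of_nat k))) = (\<Sum>a<q. \<Sum>k<m. g (int (k * q + a)) * ker t (1 * wfreq q (real (k * q + a))))"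
      by (simp only: A)
    also have "\<dots> = (\<Sum>n<m * q. g (int n) * ker t (1 * wfreq q (real n)))"
      by (rule sum_blocks)
    finally show ?thesis .
  qed
  \<comment> \<open>The regrouping is exact only over whole periods. Both series are already known
    to converge, so their limits may be read off along the lengths \<open>m * q\<close>.\<close>
  have sub: "filterlim (\<lambda>m. m * q) at_top sequentially"
    using q by (intro filterlim_subseq strict_monoI) auto
  have S1: "(\<lambda>N. \<Sum>n<N. g (int (Suc n)) * ker t (s * wfreq q (real (Suc n)))) \<longlonglongrightarrow> S s" if "s = 1 \<or> s = -1" for s
    using ker_by_parts(1)[OF q that Bg, of t] unfolding sums_def S_def .
  \<comment> \<open>The positive frequencies are indexed from 0 here; the extra term is harmless
    since \<open>g 0 = 0\<close>.\<close>
  have "(\<lambda>N. \<Sum>n<Suc N. g (int n) * ker t (1 * wfreq q (real n))) \<longlonglongrightarrow> S 1"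
    unfolding sum.lessThan_Suc_shift using S1[of 1] g0 by simp
  hence "(\<lambda>N. \<Sum>n<N. g (int n) * ker t (1 * wfreq q (real n))) \<longlonglongrightarrow> S 1"
    by (rule LIMSEQ_imp_Suc)
  from filterlim_compose[OF this sub] filterlim_compose[OF S1[of "-1"] sub]
  have "(\<lambda>m. (\<Sum>n<m * q. g (int n) * ker t (1 * wfreq q (real n))) + \<epsilon> * (\<Sum>n<m * q. g (int (Suc n)) * ker t (-1 * wfreq q (real (Suc n)))))
     \<longlonglongrightarrow> S 1 + \<epsilon> * S (-1)"
    by (intro tendsto_add tendsto_mult tendsto_const) auto
  with L have "\<tau> * ?F = S 1 + \<epsilon> * S (-1)" unfolding eqm by (rule LIMSEQ_unique)
  also have "\<dots> = (\<Sum>n. psum g (Suc n) * (ker t (1 * wfreq q (real (Suc n))) - ker t (1 * wfreq q (real (Suc (Suc n))))) + 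
      \<epsilon> * (psum g (Suc n) * (ker t (-1 * wfreq q (real (Suc n))) - ker t (-1 * wfreq q (real (Suc (Suc n)))))))"
    unfolding S_def using ker_by_parts(2)[OF q _ Bg, of 1 t] ker_by_parts(2)[OF q _ Bg, of "-1" t]
    by (subst suminf_mult[symmetric], force intro: summable_norm_cancel, subst suminf_add)
       (auto intro!: summable_mult intro: summable_norm_cancel)
  also have "\<dots> = (\<Sum>n. psum g (Suc n) * (pker q \<epsilon> t n - pker q \<epsilon> t (Suc n)))"
    by (rule arg_cong[where f = suminf]) (auto simp: pker_def algebra_simps)
  finally show ?thesis .
qed

section \<open>The functional equation on the real axis\<close>

text \<open>Each \<open>D n\<close> is nonnegative, so its L1 norm is its own integral
  \<open>c n\<close>; the \<open>c n\<close> telescope, which justifies integrating the series term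
  by term.\<close>

lemma exp_side_integral:
  fixes s :: real
  assumes s: "0 < s" and bd: "\<And>n. norm (psum f n) \<le> B"
  shows "(\<integral>t. of_real (indicator {0<..} t * t powr (s - 1)) * (\<Sum>n. psum f (Suc n) * (of_real (exp (- (real (Suc n) * t))) - of_real (exp (- (real (Suc (Suc n)) * t))))) \<partial>lborel)
    = of_real (Gamma s) * Lser f (of_real s)"
proof -
  define D where "D = (\<lambda>n t::real. indicator {0<..} t *\<^sub>R (t powr (s - 1) * exp (-(real (Suc n) * t))) - indicator {0<..} t *\<^sub>R (t powr (s - 1) * exp (-(real (Suc (Suc n)) * t))))"
  define c where "c = (\<lambda>n. real (Suc n) powr (-s) * Gamma s - real (Suc (Suc n)) powr (-s) * Gamma s)"
  have D: "has_bochner_integral lborel (D n) (c n)" for n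
    unfolding D_def c_def by (intro has_bochner_integral_diff Mellin_exp s) auto
  have D_alt: "D n t = indicator {0<..} t * t powr (s - 1) * (exp (-(real (Suc n) * t)) - exp (-(real (Suc (Suc n)) * t)))" for n t
    by (simp add: D_def algebra_simps)
  have D_nonneg: "D n t \<ge> 0" for n t
    unfolding D_alt by (cases "t > 0") (auto intro!: mult_nonneg_nonneg)
  have B: "B \<ge> 0" using bd[of 0] by simp
  have c_nonneg: "c n \<ge> 0" for n
    using has_bochner_integral_integral_eq[OF D[of n]] Bochner_Integration.integral_nonneg[of lborel "D n"] D_nonneg by simp
  let ?f = "\<lambda>n t. psum f (Suc n) * of_real (D n t)"
  have intD: "integrable lborel (D n)" for n using D has_bochner_integral_iff by blast
  have hb: "has_bochner_integral lborel (?f n) (psum f (Suc n) * of_real (c n))" for n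
    by (intro has_bochner_integral_mult_right has_bochner_integral_bounded_linear[OF bounded_linear_of_real D])
  have sc: "summable c"
  proof -
    have "(\<lambda>n. real (Suc n) powr (-s) * Gamma s) \<longlonglongrightarrow> 0" using s by real_asymp
    from telescope_sums'[OF this] show ?thesis unfolding c_def by (rule sums_summable)
  qed
  have S0: "(\<lambda>n. integral\<^sup>L lborel (?f n)) sums (\<integral>t. (\<Sum>n. ?f n t) \<partial>lborel)"
  proof (rule sums_integral)
    show "integrable lborel (?f n)" for n using hb has_bochner_integral_iff by blast
    show "AE t in lborel. summable (\<lambda>n. norm (?f n t))"
    proof (intro AE_I2)
      fix t :: real
      show "summable (\<lambda>n. norm (?f n t))"
      proof (cases "t > 0")
        case True
        have "summable (\<lambda>n. t powr (s - 1) * norm (psum f (Suc n) * (of_real (exp (- (real (Suc n) * t))) - of_real (exp (- (real (Suc (Suc n)) * t))))))"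
          by (intro summable_mult exp_by_parts(2)[OF True bd])
        also have "(\<lambda>n. t powr (s - 1) * norm (psum f (Suc n) * (of_real (exp (- (real (Suc n) * t))) - of_real (exp (- (real (Suc (Suc n)) * t)))))) = (\<lambda>n. norm (?f n t))"
          using True by (simp add: D_alt norm_mult fun_eq_iff abs_mult flip: of_real_diff)
        finally show ?thesis .
      qed (simp add: D_alt)
    qed
    have "(\<integral>t. norm (?f n t) \<partial>lborel) = norm (psum f (Suc n)) * c n" for n
    proof -
      have "(\<integral>t. norm (?f n t) \<partial>lborel) = (\<integral>t. norm (psum f (Suc n)) * D n t \<partial>lborel)"
        by (simp add: norm_mult D_nonneg)
      also have "\<dots> = norm (psum f (Suc n)) * c n"
        using has_bochner_integral_integral_eq[OF D[of n]] by simp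
      finally show ?thesis .
    qed
    thus "summable (\<lambda>n. \<integral>t. norm (?f n t) \<partial>lborel)"
      by (intro summable_comparison_test'[OF summable_mult[OF sc, of B], of 0])
         (auto simp: c_nonneg abs_mult intro!: mult_right_mono bd)
  qed
  have I0: "integral\<^sup>L lborel (?f n) = of_real (Gamma s) * (psum f (Suc n) * (of_nat (Suc n) powr (- of_real s) - of_nat (Suc (Suc n)) powr (- of_real s)))" for n
  proof -
    have p: "of_nat (Suc m) powr (- of_real s) = complex_of_real (real (Suc m) powr (- s))" for m
      using powr_of_real[of "real (Suc m)" "-s"] by simp
    have "integral\<^sup>L lborel (?f n) = psum f (Suc n) * of_real (c n)"
      using hb by (rule has_bochner_integral_integral_eq)
    thus ?thesis unfolding p c_def by (simp add: algebra_simps)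
  qed
  have sm: "summable (\<lambda>n. psum f (Suc n) * (of_nat (Suc n) powr (- of_real s) - of_nat (Suc (Suc n)) powr (- of_real s)))"
    by (rule summable_norm_cancel[OF Lser_sums(2)[OF bd]]) (use s in simp)
  have S1: "(\<lambda>n. of_real (Gamma s) * (psum f (Suc n) * (of_nat (Suc n) powr (- of_real s) - of_nat (Suc (Suc n)) powr (- of_real s)))) sums (of_real (Gamma s) * Lser f (of_real s))"
    unfolding Lser_def by (rule sums_mult[OF summable_sums[OF sm]])
  have R: "(\<integral>t. (\<Sum>n. ?f n t) \<partial>lborel) = of_real (Gamma s) * Lser f (of_real s)"
    by (rule sums_unique2[OF S0[unfolded I0] S1])
  have K: "(\<Sum>n. ?f n t) = of_real (indicator {0<..} t * t powr (s - 1)) * (\<Sum>n. psum f (Suc n) * (of_real (exp (- (real (Suc n) * t))) - of_real (exp (- (real (Suc (Suc n)) * t)))))" for t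
  proof (cases "t > 0")
    case True
    show ?thesis
      by (subst suminf_mult[symmetric]) (use summable_norm_cancel[OF exp_by_parts(2)[OF True bd]] in \<open>auto simp: D_alt algebra_simps\<close>)
  qed (simp add: D_alt)
  show ?thesis using R unfolding K .
qed

text \<open>The Mellin transform of \<open>pker q \<epsilon> t n\<close> in \<open>t\<close>, up to
  a power of the frequency. Since \<open>ker t w = (t + \<i> * w) / (t^2 + w^2)\<close>, even parity
  keeps the part with \<open>t\<close> and odd parity the part with \<open>w\<close>.\<close>

definition Hfac :: "complex \<Rightarrow> real \<Rightarrow> complex" where
  "Hfac \<epsilon> s = (1 + \<epsilon>) * of_real (pi / (2 * sin (pi * (s + 1) / 2))) + \<i> * (1 - \<epsilon>) * of_real (pi / (2 * sin (pi * s / 2)))"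

lemma pker_integral:
  fixes s :: real
  assumes s: "0 < s" "s < 1" and q: "q > 0"
  shows "has_bochner_integral lborel (\<lambda>t. of_real (indicator {0<..} t * t powr (s - 1)) * pker q \<epsilon> t n)
     (of_real (wfreq q (real (Suc n)) powr (s - 1)) * Hfac \<epsilon> s)"
proof -
  define w where "w = wfreq q (real (Suc n))"
  have w: "w > 0" unfolding w_def by (intro wfreq_pos q) auto
  have 1: "has_bochner_integral lborel (\<lambda>t. indicator {0<..} t *\<^sub>R (t powr ((s + 1) - 1) / (t\<^sup>2 + w\<^sup>2))) (w powr ((s + 1) - 2) * (pi / (2 * sin (pi * (s + 1) / 2))))"
    by (rule Mellin_inverse_quadratic') (use s w in auto)
  have 2: "has_bochner_integral lborel (\<lambda>t. indicator {0<..} t *\<^sub>R (t powr (s - 1) / (t\<^sup>2 + w\<^sup>2))) (w powr (s - 2) * (pi / (2 * sin (pi * s / 2))))"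
    by (rule Mellin_inverse_quadratic') (use s w in auto)
  have "has_bochner_integral lborel (\<lambda>t. (1 + \<epsilon>) * of_real (indicator {0<..} t *\<^sub>R (t powr ((s + 1) - 1) / (t\<^sup>2 + w\<^sup>2))) +
      (\<i> * (1 - \<epsilon>) * of_real w) * of_real (indicator {0<..} t *\<^sub>R (t powr (s - 1) / (t\<^sup>2 + w\<^sup>2))))
     ((1 + \<epsilon>) * of_real (w powr ((s + 1) - 2) * (pi / (2 * sin (pi * (s + 1) / 2)))) +
      (\<i> * (1 - \<epsilon>) * of_real w) * of_real (w powr (s - 2) * (pi / (2 * sin (pi * s / 2)))))"
    by (intro has_bochner_integral_add has_bochner_integral_mult_right has_bochner_integral_bounded_linear[OF bounded_linear_of_real] 1 2)
  also have "(\<lambda>t. (1 + \<epsilon>) * of_real (indicator {0<..} t *\<^sub>R (t powr ((s + 1) - 1) / (t\<^sup>2 + w\<^sup>2))) +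
      (\<i> * (1 - \<epsilon>) * of_real w) * of_real (indicator {0<..} t *\<^sub>R (t powr (s - 1) / (t\<^sup>2 + w\<^sup>2)))) =
     (\<lambda>t. of_real (indicator {0<..} t * t powr (s - 1)) * pker q \<epsilon> t n)"
  proof
    fix t :: real
    show "(1 + \<epsilon>) * of_real (indicator {0<..} t *\<^sub>R (t powr ((s + 1) - 1) / (t\<^sup>2 + w\<^sup>2))) +
      (\<i> * (1 - \<epsilon>) * of_real w) * of_real (indicator {0<..} t *\<^sub>R (t powr (s - 1) / (t\<^sup>2 + w\<^sup>2))) =
      of_real (indicator {0<..} t * t powr (s - 1)) * pker q \<epsilon> t n"
    proof (cases "t > 0")
      case True
      have p: "t powr ((s + 1) - 1) = t powr (s - 1) * t" using True powr_mult_base[of t "s - 1"] by (simp add: mult.commute)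
      have nz: "complex_of_real t - \<i> * of_real w \<noteq> 0" "complex_of_real t + \<i> * of_real w \<noteq> 0"
        using True by (auto simp: complex_eq_iff)
      have d: "complex_of_real (t\<^sup>2 + w\<^sup>2) = (of_real t - \<i> * of_real w) * (of_real t + \<i> * of_real w)"
        by (simp add: algebra_simps power2_eq_square)
      have k: "ker t w = (of_real t + \<i> * of_real w) / of_real (t\<^sup>2 + w\<^sup>2)" "ker t (-w) = (of_real t - \<i> * of_real w) / of_real (t\<^sup>2 + w\<^sup>2)"
        unfolding d ker_def using nz by simp_all
      show ?thesis using True unfolding pker_def w_def[symmetric] k p
        by (simp add: add_divide_distrib diff_divide_distrib algebra_simps)
    qed simp
  qed
  also have "((1 + \<epsilon>) * of_real (w powr ((s + 1) - 2) * (pi / (2 * sin (pi * (s + 1) / 2)))) +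
      (\<i> * (1 - \<epsilon>) * of_real w) * of_real (w powr (s - 2) * (pi / (2 * sin (pi * s / 2))))) = 
     of_real (w powr (s - 1)) * Hfac \<epsilon> s"
  proof -
    have a: "w powr ((s + 1) - 2) = w powr (s - 1)" by (simp add: algebra_simps)
    have "w * w powr (s - 2) = w powr (s - 1)" using w powr_mult_base[of w "s - 2"] by (simp add: algebra_simps)
    hence b: "complex_of_real w * of_real (w powr (s - 2)) = of_real (w powr (s - 1))" by (simp only: of_real_mult[symmetric])
    have "(\<i> * (1 - \<epsilon>) * of_real w) * of_real (w powr (s - 2) * (pi / (2 * sin (pi * s / 2)))) =
       (\<i> * (1 - \<epsilon>)) * (of_real w * of_real (w powr (s - 2))) * of_real (pi / (2 * sin (pi * s / 2)))"
      by (simp only: of_real_mult mult.assoc)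
    thus ?thesis unfolding a b Hfac_def by (simp only: of_real_mult distrib_left mult.assoc mult.left_commute)
  qed
  finally show ?thesis unfolding w_def .
qed

text \<open>By \<open>pker_diff\<close> the \<open>n\<close>-th integrand is dominated by a multiple
  of \<open>t powr (s - 1) / (t^2 + w^2)\<close>, whose integral is a constant times
  \<open>w powr (s - 2)\<close>. These are summable because \<open>s < 1\<close>.\<close>

lemma ker_side_integral:
  fixes s :: real
  assumes s: "0 < s" "s < 1" and q: "q > 0" and e: "norm \<epsilon> = 1" and bd: "\<And>n. norm (psum g n) \<le> B"
  shows "(\<integral>t. of_real (indicator {0<..} t * t powr (s - 1)) * (\<Sum>n. psum g (Suc n) * (pker q \<epsilon> t n - pker q \<epsilon> t (Suc n))) \<partial>lborel)
    = Hfac \<epsilon> s * of_real (wfreq q 1 powr (s - 1)) * Lser g (of_real (1 - s))"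
proof -
  define P where "P = (\<lambda>n t::real. of_real (indicator {0<..} t * t powr (s - 1)) * pker q \<epsilon> t n)"
  define w where "w = (\<lambda>n. wfreq q (real (Suc n)))"
  have w: "w n > 0" for n unfolding w_def by (intro wfreq_pos q) auto
  have w1: "wfreq q 1 > 0" by (intro wfreq_pos q) auto
  have wn: "w n = wfreq q 1 * real (Suc n)" for n by (simp add: w_def wfreq_def)
  define c where "c = (\<lambda>n. of_real (w n powr (s - 1)) * Hfac \<epsilon> s)"
  have P: "has_bochner_integral lborel (P n) (c n)" for n
    unfolding P_def c_def w_def by (intro pker_integral s q)
  let ?f = "\<lambda>n t. psum g (Suc n) * (P n t - P (Suc n) t)"
  have hb: "has_bochner_integral lborel (?f n) (psum g (Suc n) * (c n - c (Suc n)))" for n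
    by (intro has_bochner_integral_mult_right has_bochner_integral_diff P)
  have B: "B \<ge> 0" using bd[of 0] by simp
  have fbd: "norm (?f n t) \<le> (B * (2 * wfreq q 1)) * (indicator {0<..} t *\<^sub>R (t powr (s - 1) / (t\<^sup>2 + (w n)\<^sup>2)))" for n t
  proof (cases "t > 0")
    case True
    have "norm (?f n t) = norm (psum g (Suc n)) * (t powr (s - 1) * norm (pker q \<epsilon> t n - pker q \<epsilon> t (Suc n)))"
      using True by (simp add: P_def norm_mult flip: right_diff_distrib)
    also have "\<dots> \<le> B * (t powr (s - 1) * (2 * wfreq q 1 / (t\<^sup>2 + (w n)\<^sup>2)))"
      unfolding w_def by (intro mult_mono bd order.refl pker_diff q e B) auto
    also have "\<dots> = (B * (2 * wfreq q 1)) * (1 *\<^sub>R (t powr (s - 1) / (t\<^sup>2 + (w n)\<^sup>2)))"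
      by (simp only: scaleR_one times_divide_eq_right mult_ac)
    finally show ?thesis using True by simp
  qed (simp add: P_def)
  have M: "has_bochner_integral lborel (\<lambda>t. (B * (2 * wfreq q 1)) * (indicator {0<..} t *\<^sub>R (t powr (s - 1) / (t\<^sup>2 + (w n)\<^sup>2))))
     ((B * (2 * wfreq q 1)) * (w n powr (s - 2) * (pi / (2 * sin (pi * s / 2)))))" for n
    by (intro has_bochner_integral_mult_right Mellin_inverse_quadratic' w) (use s in auto)
  have int: "integrable lborel (?f n)" for n using hb has_bochner_integral_iff by blast
  have S0: "(\<lambda>n. integral\<^sup>L lborel (?f n)) sums (\<integral>t. (\<Sum>n. ?f n t) \<partial>lborel)"
  proof (rule sums_integral)
    show "integrable lborel (?f n)" for n by (rule int)
    show "AE t in lborel. summable (\<lambda>n. norm (?f n t))"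
    proof (intro AE_I2)
      fix t :: real
      have "summable (\<lambda>n. (B * (2 * wfreq q 1) * (indicator {0<..} t * t powr (s - 1))) / (t\<^sup>2 + (w n)\<^sup>2))"
        unfolding w_def by (rule summable_wfreq[OF q])
      thus "summable (\<lambda>n. norm (?f n t))"
        by (rule summable_comparison_test'[of _ 0]) (use fbd[of _ t] in simp)
    qed
    show "summable (\<lambda>n. \<integral>t. norm (?f n t) \<partial>lborel)"
    proof (rule summable_comparison_test'[of _ 0])
      have "summable (\<lambda>n. (B * (2 * wfreq q 1)) * (wfreq q 1 powr (s - 2) * (pi / (2 * sin (pi * s / 2)))) * (real (Suc n) powr (- (1 - s) - 1)))"
        by (intro summable_mult summable_powr_Suc) (use s in auto)
      also have "(\<lambda>n. (B * (2 * wfreq q 1)) * (wfreq q 1 powr (s - 2) * (pi / (2 * sin (pi * s / 2)))) * (real (Suc n) powr (- (1 - s) - 1))) =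
         (\<lambda>n. (B * (2 * wfreq q 1)) * (w n powr (s - 2) * (pi / (2 * sin (pi * s / 2)))))"
      proof
        fix n
        have "- (1 - s) - 1 = s - 2" by simp
        moreover have "w n powr (s - 2) = wfreq q 1 powr (s - 2) * real (Suc n) powr (s - 2)"
         unfolding wn using w1 by (simp add: powr_mult)
        ultimately show "(B * (2 * wfreq q 1)) * (wfreq q 1 powr (s - 2) * (pi / (2 * sin (pi * s / 2)))) * (real (Suc n) powr (- (1 - s) - 1)) = (B * (2 * wfreq q 1)) * (w n powr (s - 2) * (pi / (2 * sin (pi * s / 2))))"
          by (simp only: mult.assoc mult.left_commute mult.commute)
      qed
      finally show "summable (\<lambda>n. (B * (2 * wfreq q 1)) * (w n powr (s - 2) * (pi / (2 * sin (pi * s / 2)))))" .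
      fix n
      have "(\<integral>t. norm (?f n t) \<partial>lborel) \<le> (\<integral>t. (B * (2 * wfreq q 1)) * (indicator {0<..} t *\<^sub>R (t powr (s - 1) / (t\<^sup>2 + (w n)\<^sup>2))) \<partial>lborel)"
        by (intro integral_mono fbd integrable_norm int) (use M has_bochner_integral_iff in blast)
      also have "\<dots> = (B * (2 * wfreq q 1)) * (w n powr (s - 2) * (pi / (2 * sin (pi * s / 2))))"
        using M by (rule has_bochner_integral_integral_eq)
      finally show "norm (\<integral>t. norm (?f n t) \<partial>lborel) \<le> (B * (2 * wfreq q 1)) * (w n powr (s - 2) * (pi / (2 * sin (pi * s / 2))))"
        by (simp add: integral_nonneg)
    qed
  qed
  have I0: "integral\<^sup>L lborel (?f n) = (Hfac \<epsilon> s * of_real (wfreq q 1 powr (s - 1))) * (psum g (Suc n) * (of_nat (Suc n) powr (- of_real (1 - s)) - of_nat (Suc (Suc n)) powr (- of_real (1 - s))))" for n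
  proof -
    have p: "of_nat (Suc m) powr (- of_real (1 - s)) = complex_of_real (real (Suc m) powr (s - 1))" for m
      using powr_of_real[of "real (Suc m)" "s - 1"] by simp
    have cm: "c m = Hfac \<epsilon> s * of_real (wfreq q 1 powr (s - 1)) * of_real (real (Suc m) powr (s - 1))" for m
      unfolding c_def wn using w1 by (subst powr_mult) auto
    have "integral\<^sup>L lborel (?f n) = psum g (Suc n) * (c n - c (Suc n))"
      using hb by (rule has_bochner_integral_integral_eq)
    thus ?thesis unfolding p cm by (simp only: right_diff_distrib[symmetric] mult.left_commute)
  qed
  have sm: "summable (\<lambda>n. psum g (Suc n) * (of_nat (Suc n) powr (- of_real (1 - s)) - of_nat (Suc (Suc n)) powr (- of_real (1 - s))))"
    by (rule summable_norm_cancel[OF Lser_sums(2)[OF bd]]) (use s in simp)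
  have S1: "(\<lambda>n. (Hfac \<epsilon> s * of_real (wfreq q 1 powr (s - 1))) * (psum g (Suc n) * (of_nat (Suc n) powr (- of_real (1 - s)) - of_nat (Suc (Suc n)) powr (- of_real (1 - s))))) sums ((Hfac \<epsilon> s * of_real (wfreq q 1 powr (s - 1))) * Lser g (of_real (1 - s)))"
    unfolding Lser_def by (rule sums_mult[OF summable_sums[OF sm]])
  have R: "(\<integral>t. (\<Sum>n. ?f n t) \<partial>lborel) = (Hfac \<epsilon> s * of_real (wfreq q 1 powr (s - 1))) * Lser g (of_real (1 - s))"
    by (rule sums_unique2[OF S0[unfolded I0] S1])
  have K: "(\<Sum>n. ?f n t) = of_real (indicator {0<..} t * t powr (s - 1)) * (\<Sum>n. psum g (Suc n) * (pker q \<epsilon> t n - pker q \<epsilon> t (Suc n)))" for t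
  proof -
    have "summable (\<lambda>n. psum g (Suc n) * (pker q \<epsilon> t n - pker q \<epsilon> t (Suc n)))"
    proof (rule summable_comparison_test'[of _ 0])
      show "summable (\<lambda>n. (B * (2 * wfreq q 1)) / (t\<^sup>2 + (wfreq q (real (Suc n)))\<^sup>2))" by (rule summable_wfreq[OF q])
      show "norm (psum g (Suc n) * (pker q \<epsilon> t n - pker q \<epsilon> t (Suc n))) \<le> (B * (2 * wfreq q 1)) / (t\<^sup>2 + (wfreq q (real (Suc n)))\<^sup>2)" for n
        using mult_mono[OF bd[of "Suc n"] pker_diff[OF q e, of t n] B norm_ge_zero] unfolding norm_mult times_divide_eq_right .
    qed
    from suminf_mult[OF this, of "of_real (indicator {0<..} t * t powr (s - 1))"]
    show ?thesis unfolding P_def by (simp only: right_diff_distrib mult.left_commute)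
  qed
  show ?thesis using R unfolding K .
qed

text \<open>Both sides are Mellin transforms of the two sides of
  \<open>exp_ker_duality\<close>.\<close>

lemma FE_real:
  fixes s :: real
  assumes D: "dual q f g \<epsilon> \<tau>" and s: "0 < s" "s < 1"
  shows "\<tau> * (of_real (Gamma s) * Lser f (of_real s)) = Hfac \<epsilon> s * of_real (wfreq q 1 powr (s - 1)) * Lser g (of_real (1 - s))"
proof -
  from D obtain Bf Bg where q: "q > 0" and e: "norm \<epsilon> = 1" and Bf: "\<And>n. norm (psum f n) \<le> Bf" and Bg: "\<And>n. norm (psum g n) \<le> Bg"
    unfolding dual_def by blast
  have "\<tau> * (of_real (Gamma s) * Lser f (of_real s)) = 
    (\<integral>t. \<tau> * (of_real (indicator {0<..} t * t powr (s - 1)) * (\<Sum>n. psum f (Suc n) * (of_real (exp (- (real (Suc n) * t))) - of_real (exp (- (real (Suc (Suc n)) * t)))))) \<partial>lborel)"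
    unfolding exp_side_integral[OF s(1) Bf, symmetric] by (rule integral_mult_right_zero[symmetric])
  also have "\<dots> = (\<integral>t. of_real (indicator {0<..} t * t powr (s - 1)) * (\<Sum>n. psum g (Suc n) * (pker q \<epsilon> t n - pker q \<epsilon> t (Suc n))) \<partial>lborel)"
  proof (rule Bochner_Integration.integral_cong[OF refl])
    fix t :: real
    show "\<tau> * (of_real (indicator {0<..} t * t powr (s - 1)) * (\<Sum>n. psum f (Suc n) * (of_real (exp (- (real (Suc n) * t))) - of_real (exp (- (real (Suc (Suc n)) * t)))))) =
      of_real (indicator {0<..} t * t powr (s - 1)) * (\<Sum>n. psum g (Suc n) * (pker q \<epsilon> t n - pker q \<epsilon> t (Suc n)))"
    proof (cases "t > 0")
      case True
      show ?thesis unfolding exp_ker_duality[OF D True, symmetric] by (rule mult.left_commute)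
    qed simp
  qed
  also have "\<dots> = Hfac \<epsilon> s * of_real (wfreq q 1 powr (s - 1)) * Lser g (of_real (1 - s))"
    by (rule ker_side_integral[OF s q e Bg])
  finally show ?thesis .
qed

section \<open>Analytic continuation and the constant term at 0\<close>

text \<open>\<open>Hfac\<close> times the frequency power, divided by \<open>Gamma s\<close> by
  means of the reflection formula. In this form it is holomorphic on all of \<open>Re s < 1\<close>,
  so that it also defines the continuation to the left of the strip.\<close>

definition Xfac :: "nat \<Rightarrow> complex \<Rightarrow> complex \<Rightarrow> complex" where
  "Xfac q \<epsilon> s = Gamma (1 - s) * ((1 + \<epsilon>) * sin (of_real pi * s / 2) + \<i> * (1 - \<epsilon>) * cos (of_real pi * s / 2)) *
     exp ((s - 1) * of_real (ln (wfreq q 1)))"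

lemma Xfac_holomorphic: "Xfac q \<epsilon> holomorphic_on {s. Re s < 1}"
  unfolding Xfac_def by (intro holomorphic_intros) (auto simp: complex_nonpos_Reals_iff elim!: nonpos_Ints_cases simp: complex_eq_iff)

lemma Xfac_real:
  fixes s :: real
  assumes s: "0 < s" "s < 1" and q: "q > 0"
  shows "Xfac q \<epsilon> (of_real s) * of_real (Gamma s) = Hfac \<epsilon> s * of_real (wfreq q 1 powr (s - 1))"
proof -
  have w1: "wfreq q 1 > 0" by (intro wfreq_pos q) auto
  have p: "exp ((of_real s - 1) * of_real (ln (wfreq q 1))) = complex_of_real (wfreq q 1 powr (s - 1))"
    using w1 by (simp add: powr_def exp_of_real[symmetric])
  define S where "S = sin (pi * s / 2)"
  define C where "C = cos (pi * s / 2)"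
  have S: "S > 0" unfolding S_def using s by (intro sin_gt_zero) (auto simp: field_simps)
  have C: "C > 0" unfolding C_def using s by (intro cos_gt_zero) (auto simp: field_simps)
  have e: "pi * (s + 1) / 2 = pi * s / 2 + pi / 2" by (simp add: field_simps)
  have sC: "sin (pi * (s + 1) / 2) = C"
    unfolding e C_def by (simp only: sin_add sin_pi_half cos_pi_half mult_zero_right mult_1_right add_0_left)
  have c: "sin (of_real pi * of_real s / 2) = complex_of_real S" "cos (of_real pi * of_real s / 2) = complex_of_real C"
    unfolding S_def C_def sin_of_real[symmetric] cos_of_real[symmetric] by simp_all
  have G: "Gamma (of_real s) * Gamma (1 - of_real s) = complex_of_real (pi / (2 * S * C))"
  proof -
    have "sin (of_real pi * complex_of_real s) = of_real (sin (2 * (pi * s / 2)))"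
      unfolding sin_of_real[symmetric] by simp
    also have "\<dots> = complex_of_real (2 * S * C)" unfolding sin_double S_def C_def ..
    finally show ?thesis unfolding Gamma_reflection_complex by simp
  qed
  have "Xfac q \<epsilon> (of_real s) * of_real (Gamma s) = (Gamma (of_real s) * Gamma (1 - of_real s)) * ((1 + \<epsilon>) * of_real S + \<i> * (1 - \<epsilon>) * of_real C) * of_real (wfreq q 1 powr (s - 1))"
    unfolding Xfac_def p c Gamma_complex_of_real[symmetric] by (simp only: mult_ac)
  also have "(Gamma (of_real s) * Gamma (1 - of_real s)) * ((1 + \<epsilon>) * of_real S + \<i> * (1 - \<epsilon>) * of_real C) = Hfac \<epsilon> s"
    unfolding G Hfac_def sC S_def[symmetric] using S C by (simp add: field_simps)
  finally show ?thesis .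
qed

text \<open>Identity theorem: both sides are holomorphic in the strip and agree on the real segment
  \<open>{0<..<1}\<close>, which accumulates at \<open>1 / 2\<close>.\<close>

lemma functional_equation:
  assumes D: "dual q f g \<epsilon> \<tau>" and s: "0 < Re s" "Re s < 1"
  shows "\<tau> * Lser f s = Xfac q \<epsilon> s * Lser g (1 - s)"
proof -
  from D obtain Bf Bg where q: "q > 0" and Bf: "\<And>n. norm (psum f n) \<le> Bf" and Bg: "\<And>n. norm (psum g n) \<le> Bg"
    unfolding dual_def by blast
  let ?S = "{s. Re s > 0} \<inter> {s. Re s < 1}"
  have hol: "(\<lambda>s. \<tau> * Lser f s - Xfac q \<epsilon> s * Lser g (1 - s)) holomorphic_on ?S"
    by (intro holomorphic_intros Lser_holomorphic[OF Bf] holomorphic_on_subset[OF Xfac_holomorphic]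
          holomorphic_on_compose[unfolded o_def, of "\<lambda>s. 1 - s" _ "Lser g"] Lser_holomorphic[OF Bg]) auto
  have "\<tau> * Lser f s - Xfac q \<epsilon> s * Lser g (1 - s) = 0"
  proof (rule analytic_continuation[OF hol])
    show "open ?S" by (intro open_Int open_halfspace_Re_gt open_halfspace_Re_lt)
    show "connected ?S" by (intro convex_connected convex_Int convex_halfspace_Re_gt convex_halfspace_Re_lt)
    show "of_real ` {0<..<1} \<subseteq> ?S" "complex_of_real (1/2) \<in> ?S" "s \<in> ?S" using s by auto
    show "complex_of_real (1/2) islimpt of_real ` {0<..<1}"
      unfolding islimpt_sequential
    proof (intro exI conjI allI)
      fix n show "complex_of_real (1/2 + 1 / (real n + 3)) \<in> of_real ` {0<..<1} - {of_real (1/2)}"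
      proof -
        have "1/2 + 1 / (real n + 3) \<in> {0<..<1}" "1/2 + 1 / (real n + 3) \<noteq> 1/2" by (auto simp: field_simps)
        thus ?thesis by (auto simp del: of_real_add of_real_divide simp: of_real_eq_iff)
      qed
      have "(\<lambda>n. 1/2 + 1 / (real n + 3)) \<longlonglongrightarrow> 1/2" by real_asymp
      thus "(\<lambda>n. complex_of_real (1/2 + 1 / (real n + 3))) \<longlonglongrightarrow> complex_of_real (1/2)" by (rule tendsto_of_real)
    qed
    fix z :: complex assume "z \<in> of_real ` {0<..<1}"
    then obtain x where z: "z = of_real x" and x: "0 < x" "x < 1" by auto
    have "of_real (Gamma x) * (\<tau> * Lser f z) = of_real (Gamma x) * (Xfac q \<epsilon> z * Lser g (1 - z))"
      using FE_real[OF D x] Xfac_real[OF x q, of \<epsilon>] unfolding z by (simp add: mult_ac)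
    moreover have "Gamma x \<noteq> 0" using Gamma_real_pos[OF x(1)] by simp
    ultimately show "\<tau> * Lser f z - Xfac q \<epsilon> z * Lser g (1 - z) = 0" by simp
  qed
  thus ?thesis by simp
qed

text \<open>The entire continuation of \<open>Lser f\<close> when \<open>f\<close> and
  \<open>g\<close> are dual. The case distinction is phrased as membership in a set to match the
  gluing lemma for holomorphic functions on two open sets.\<close>

definition Lent :: "nat \<Rightarrow> (int \<Rightarrow> complex) \<Rightarrow> (int \<Rightarrow> complex) \<Rightarrow> complex \<Rightarrow> complex \<Rightarrow> complex \<Rightarrow> complex" where
  "Lent q f g \<epsilon> \<tau> s = (if s \<in> {s. Re s > 0} then Lser f s else Xfac q \<epsilon> s * Lser g (1 - s) / \<tau>)"

lemma Lent_left:
  assumes D: "dual q f g \<epsilon> \<tau>" and t: "\<tau> \<noteq> 0" and s: "Re s < 1"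
  shows "Lent q f g \<epsilon> \<tau> s = Xfac q \<epsilon> s * Lser g (1 - s) / \<tau>"
  using functional_equation[OF D, of s] t s by (auto simp: Lent_def field_simps)

lemma Lent_holomorphic:
  assumes D: "dual q f g \<epsilon> \<tau>" and t: "\<tau> \<noteq> 0"
  shows "Lent q f g \<epsilon> \<tau> holomorphic_on UNIV"
proof -
  from D obtain Bf Bg where q: "q > 0" and Bf: "\<And>n. norm (psum f n) \<le> Bf" and Bg: "\<And>n. norm (psum g n) \<le> Bg"
    unfolding dual_def by blast
  have "(\<lambda>s. if s \<in> {s. Re s > 0} then Lser f s else Xfac q \<epsilon> s * Lser g (1 - s) / \<tau>) holomorphic_on ({s. Re s > 0} \<union> {s. Re s < 1})"
  proof (rule holomorphic_on_If_Un)
    show "Lser f holomorphic_on {s. Re s > 0}" by (rule Lser_holomorphic[OF Bf]) auto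
    show "(\<lambda>s. Xfac q \<epsilon> s * Lser g (1 - s) / \<tau>) holomorphic_on {s. Re s < 1}"
      using t by (intro holomorphic_intros holomorphic_on_subset[OF Xfac_holomorphic]
          holomorphic_on_compose[unfolded o_def, of "\<lambda>s. 1 - s" _ "Lser g"] Lser_holomorphic[OF Bg]) auto
    show "open {s. Re s > 0}" "open {s. Re s < 1}" by (intro open_halfspace_Re_gt open_halfspace_Re_lt)+
    show "Lser f z = Xfac q \<epsilon> z * Lser g (1 - z) / \<tau>" if "z \<in> {s. Re s > 0}" "z \<in> {s. Re s < 1}" for z
      using functional_equation[OF D, of z] that t by (auto simp: field_simps)
  qed
  moreover have "{s. Re s > 0} \<union> {s. Re s < 1} = UNIV" by auto
  ultimately show ?thesis unfolding Lent_def[abs_def] by simp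
qed

text \<open>Here \<open>m\<close> is the order of vanishing of \<open>F\<close> at 0.\<close>
definition has_b :: "(complex \<Rightarrow> complex) \<Rightarrow> complex \<Rightarrow> bool" where
  "has_b F c \<longleftrightarrow> (\<forall>\<^sub>F s in at 0. F s \<noteq> 0 \<and> F field_differentiable (at s)) \<and>
     (\<exists>m. ((\<lambda>s. deriv F s / F s - m / s) \<longlongrightarrow> c) (at 0))"

lemma has_b_nonzero:
  assumes "F analytic_on {0}" and "F 0 \<noteq> 0"
  shows "has_b F (deriv F 0 / F 0)"
proof -
  from assms(1) obtain r where r: "r > 0" "F holomorphic_on ball 0 r"
    unfolding analytic_on_def by auto
  have cont: "continuous_on (ball 0 r) F" using r by (intro holomorphic_on_imp_continuous_on)
  have b: "\<forall>\<^sub>F s in at 0. s \<in> ball 0 r"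
    using r by (intro eventually_at_in_open') auto
  have "isCont F 0" using cont r by (simp add: continuous_on_eq_continuous_at)
  hence F: "(F \<longlongrightarrow> F 0) (at 0)" by (simp add: isCont_def)
  have "(deriv F) holomorphic_on ball 0 r" using r by (intro holomorphic_deriv) auto
  hence "isCont (deriv F) 0"
    using r holomorphic_on_imp_continuous_on by (force simp: continuous_on_eq_continuous_at)
  hence dF: "(deriv F \<longlongrightarrow> deriv F 0) (at 0)" by (simp add: isCont_def)
  have nz: "\<forall>\<^sub>F s in at 0. F s \<noteq> 0" using tendsto_imp_eventually_ne[OF F assms(2)] .
  have "\<forall>\<^sub>F s in at 0. F s \<noteq> 0 \<and> F field_differentiable (at s)"
    using b nz by eventually_elim (use r in \<open>auto intro: holomorphic_on_imp_differentiable_at\<close>)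
  moreover have "((\<lambda>s. deriv F s / F s - 0 / s) \<longlongrightarrow> deriv F 0 / F 0) (at 0)"
    using tendsto_divide[OF dF F assms(2)] by simp
  ultimately show ?thesis unfolding has_b_def by blast
qed

lemma has_b_id: "has_b (\<lambda>s. s) 0"
proof -
  have "((\<lambda>s::complex. deriv (\<lambda>s. s) s / s - 1 / s) \<longlongrightarrow> 0) (at 0)" by simp
  moreover have "\<forall>\<^sub>F s in at (0::complex). s \<noteq> 0 \<and> (\<lambda>s. s) field_differentiable (at s)"
    by (simp add: eventually_at_filter)
  ultimately show ?thesis unfolding has_b_def by blast
qed

text \<open>Logarithmic derivatives add, hence so do the polar coefficients and the constant terms.
  With this the constant term of the functional equation is assembled factor by factor.\<close>

lemma has_b_mult:
  assumes "has_b F a" "has_b G b" shows "has_b (\<lambda>s. F s * G s) (a + b)"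
proof -
  from assms obtain m k where
    m: "((\<lambda>s. deriv F s / F s - m / s) \<longlongrightarrow> a) (at 0)" "\<forall>\<^sub>F s in at 0. F s \<noteq> 0 \<and> F field_differentiable (at s)" and
    k: "((\<lambda>s. deriv G s / G s - k / s) \<longlongrightarrow> b) (at 0)" "\<forall>\<^sub>F s in at 0. G s \<noteq> 0 \<and> G field_differentiable (at s)"
    unfolding has_b_def by blast
  have "\<forall>\<^sub>F s in at 0. (deriv F s / F s - m / s) + (deriv G s / G s - k / s) = deriv (\<lambda>s. F s * G s) s / (F s * G s) - (m + k) / s"
    using m(2) k(2)
  proof eventually_elim
    case (elim s)
    have "deriv (\<lambda>s. F s * G s) s / (F s * G s) = deriv F s / F s + deriv G s / G s"
      using elim by (simp add: deriv_mult add_divide_distrib)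
    thus ?case by (simp add: add_divide_distrib)
  qed
  from tendsto_cong[OF this] tendsto_add[OF m(1) k(1)]
  have "((\<lambda>s. deriv (\<lambda>s. F s * G s) s / (F s * G s) - (m + k) / s) \<longlongrightarrow> a + b) (at 0)" by simp
  moreover have "\<forall>\<^sub>F s in at 0. F s * G s \<noteq> 0 \<and> (\<lambda>s. F s * G s) field_differentiable (at s)"
    using m(2) k(2) by eventually_elim (auto intro: field_differentiable_mult)
  ultimately show ?thesis unfolding has_b_def by blast
qed

lemma has_b_divide:
  assumes "has_b F a" "has_b G b" shows "has_b (\<lambda>s. F s / G s) (a - b)"
proof -
  from assms obtain m k where
    m: "((\<lambda>s. deriv F s / F s - m / s) \<longlongrightarrow> a) (at 0)" "\<forall>\<^sub>F s in at 0. F s \<noteq> 0 \<and> F field_differentiable (at s)" and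
    k: "((\<lambda>s. deriv G s / G s - k / s) \<longlongrightarrow> b) (at 0)" "\<forall>\<^sub>F s in at 0. G s \<noteq> 0 \<and> G field_differentiable (at s)"
    unfolding has_b_def by blast
  have "\<forall>\<^sub>F s in at 0. (deriv F s / F s - m / s) - (deriv G s / G s - k / s) = deriv (\<lambda>s. F s / G s) s / (F s / G s) - (m - k) / s"
    using m(2) k(2)
  proof eventually_elim
    case (elim s)
    have *: "(a * y - x * b) / y\<^sup>2 / (x / y) = a / x - b / y" if "x \<noteq> 0" "y \<noteq> 0" for a b x y :: complex
      using that by (simp add: field_simps power2_eq_square)
    have "deriv (\<lambda>s. F s / G s) s / (F s / G s) = deriv F s / F s - deriv G s / G s"
    proof -
      have "deriv (\<lambda>s. F s / G s) s = (deriv F s * G s - F s * deriv G s) / (G s)\<^sup>2"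
        using elim by (intro deriv_divide) auto
      thus ?thesis using *[of "F s" "G s" "deriv F s" "deriv G s"] elim by (simp only:) simp
    qed
    thus ?case by (simp add: diff_divide_distrib)
  qed
  from tendsto_cong[OF this] tendsto_diff[OF m(1) k(1)]
  have "((\<lambda>s. deriv (\<lambda>s. F s / G s) s / (F s / G s) - (m - k) / s) \<longlongrightarrow> a - b) (at 0)" by simp
  moreover have "\<forall>\<^sub>F s in at 0. F s / G s \<noteq> 0 \<and> (\<lambda>s. F s / G s) field_differentiable (at s)"
    using m(2) k(2) by eventually_elim (auto intro: field_differentiable_divide)
  ultimately show ?thesis unfolding has_b_def by blast
qed

lemma eventually_at_imp_nhds:
  assumes "\<forall>\<^sub>F s in at (a::complex). P s"
  shows "\<forall>\<^sub>F s in at a. \<forall>\<^sub>F z in nhds s. P z"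
proof -
  from assms obtain S where S: "open S" "a \<in> S" "\<And>z. z \<in> S \<Longrightarrow> z \<noteq> a \<Longrightarrow> P z"
    unfolding eventually_at_topological by auto
  have "\<forall>\<^sub>F s in at a. s \<in> S - {a}" using S by (intro eventually_at_in_open) auto
  thus ?thesis
  proof eventually_elim
    case (elim s)
    have "\<forall>\<^sub>F z in nhds s. z \<in> S - {a}" using S elim by (intro eventually_nhds_in_open) auto
    thus ?case by eventually_elim (use S in auto)
  qed
qed

lemma has_b_cong:
  assumes ev: "\<forall>\<^sub>F s in at 0. F s = G s" and F: "has_b F c"
  shows "has_b G c"
proof -
  from F obtain m where
    m: "((\<lambda>s. deriv F s / F s - m / s) \<longlongrightarrow> c) (at 0)" "\<forall>\<^sub>F s in at 0. F s \<noteq> 0 \<and> F field_differentiable (at s)"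
    unfolding has_b_def by blast
  have ev2: "\<forall>\<^sub>F s in at 0. deriv F s = deriv G s \<and> F s = G s \<and> (F field_differentiable (at s) \<longrightarrow> G field_differentiable (at s))"
    using eventually_at_imp_nhds[OF ev]
  proof eventually_elim
    case (elim s)
    have "F s = G s" using eventually_nhds_x_imp_x[OF elim] .
    moreover have "deriv F s = deriv G s" by (rule deriv_cong_ev[OF elim refl])
    moreover have "G field_differentiable (at s)" if "F field_differentiable (at s)"
      using that DERIV_cong_ev[OF refl elim refl] unfolding field_differentiable_def by blast
    ultimately show ?case by blast
  qed
  have "\<forall>\<^sub>F s in at 0. deriv F s / F s - m / s = deriv G s / G s - m / s"
    using ev2 by eventually_elim auto
  from tendsto_cong[OF this] m(1) have "((\<lambda>s. deriv G s / G s - m / s) \<longlongrightarrow> c) (at 0)" by simp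
  moreover have "\<forall>\<^sub>F s in at 0. G s \<noteq> 0 \<and> G field_differentiable (at s)" using ev2 m(2) by eventually_elim auto
  ultimately show ?thesis unfolding has_b_def by blast
qed

lemma has_b_nonzeroI:
  assumes "(F has_field_derivative D) (at 0)" "F analytic_on {0}" "F 0 \<noteq> 0" "c = D / F 0"
  shows "has_b F c"
  using has_b_nonzero[OF assms(2,3)] assms(1,4) DERIV_imp_deriv by blast

lemma has_b_const: "k \<noteq> 0 \<Longrightarrow> has_b (\<lambda>_. k) 0"
  by (rule has_b_nonzeroI[where D = 0]) auto

lemma has_b_exp: "has_b (\<lambda>s. exp (a * s)) a"
  by (rule has_b_nonzeroI[where D = a]) (auto intro!: derivative_eq_intros analytic_intros)

lemma has_b_cos: "has_b (\<lambda>s. cos (a * s)) 0"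
  by (rule has_b_nonzeroI[where D = 0]) (auto intro!: derivative_eq_intros analytic_intros)

lemma has_b_Gamma: "has_b (\<lambda>s. Gamma (1 - s)) euler_mascheroni"
  by (rule has_b_nonzeroI[where D = euler_mascheroni]) (auto intro!: derivative_eq_intros analytic_intros)

text \<open>The zero at 0 is split off through the reflection formula: \<open>sin (a * s)\<close> is
  \<open>a * s\<close> times an even function that does not vanish at 0, and an even function has
  derivative 0 there.\<close>

lemma has_b_sin:
  assumes a: "a \<noteq> 0" shows "has_b (\<lambda>s. sin (a * s)) 0"
proof -
  define b where "b = a / of_real pi"
  have "has_b (\<lambda>s. rGamma (1 + b * s) * rGamma (1 - b * s)) 0"
    by (rule has_b_nonzeroI[where D = 0]) (auto intro!: derivative_eq_intros analytic_intros)
  from has_b_mult[OF has_b_mult[OF has_b_const[OF a] has_b_id] this]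
  have "has_b (\<lambda>s. a * s * (rGamma (1 + b * s) * rGamma (1 - b * s))) 0" by simp
  moreover have "a * s * (rGamma (1 + b * s) * rGamma (1 - b * s)) = sin (a * s)" for s
  proof -
    have "rGamma (b * s) * rGamma (1 - b * s) = sin (of_real pi * (b * s)) / of_real pi"
      by (rule rGamma_reflection_complex)
    moreover have "rGamma (b * s) = b * s * rGamma (1 + b * s)" using rGamma_plus1[of "b * s"] by (simp add: add.commute)
    moreover have "of_real pi * (b * s) = a * s" by (simp add: b_def)
    ultimately have "b * s * rGamma (1 + b * s) * rGamma (1 - b * s) = sin (a * s) / of_real pi" by metis
    hence "of_real pi * (b * s * rGamma (1 + b * s) * rGamma (1 - b * s)) = sin (a * s)" by simp
    thus ?thesis using \<open>of_real pi * (b * s) = a * s\<close> by (metis mult.assoc)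
  qed
  ultimately show ?thesis by simp
qed

text \<open>The Euler factor that vanishes at 0. Taking out \<open>exp (- L / 2 * s)\<close> leaves
  an odd function, a multiple of a sine, so only the exponential contributes to the constant
  term.\<close>

lemma has_b_one_minus_power_1:
  assumes L: "L > 0" shows "has_b (\<lambda>s. 1 - exp (- of_real L * s)) (- of_real L / 2)"
proof -
  have "has_b (\<lambda>s. (-2 * \<i>) * sin ((\<i> * of_real L / 2) * s) * exp (- of_real L / 2 * s)) (0 + 0 + (- of_real L / 2))"
    by (intro has_b_mult has_b_const has_b_sin has_b_exp) (use L in auto)
  moreover have "(-2 * \<i>) * sin ((\<i> * of_real L / 2) * s) * exp (- of_real L / 2 * s) = 1 - exp (- of_real L * s)" for s
  proof -
    define E where "E = exp (of_real L / 2 * s)"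
    have E: "E \<noteq> 0" by (simp add: E_def)
    have "exp (\<i> * ((\<i> * of_real L / 2) * s)) = 1 / E" "exp (- (\<i> * ((\<i> * of_real L / 2) * s))) = E" "exp (- of_real L / 2 * s) = 1 / E"
      by (simp_all add: E_def exp_minus inverse_eq_divide mult.assoc[symmetric])
    hence "(-2 * \<i>) * sin ((\<i> * of_real L / 2) * s) * exp (- of_real L / 2 * s) = (-2 * \<i>) * ((1 / E - E) / (2 * \<i>)) * (1 / E)"
      by (simp only: sin_exp_eq)
    also have "\<dots> = 1 - (1 / E) * (1 / E)" using E by (simp add: field_simps)
    also have "(1 / E) * (1 / E) = exp (- of_real L * s)"
      unfolding \<open>exp (- of_real L / 2 * s) = 1 / E\<close>[symmetric] exp_add[symmetric] by (simp add: mult.commute)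
    finally show ?thesis .
  qed
  ultimately show ?thesis by simp
qed

lemma has_b_one_minus_power:
  assumes "c \<noteq> 1" shows "has_b (\<lambda>s. 1 - c * exp (- of_real L * s)) (c * of_real L / (1 - c))"
  by (rule has_b_nonzeroI[where D = "c * of_real L"]) (use assms in \<open>auto intro!: derivative_eq_intros analytic_intros\<close>)

text \<open>One contribution per factor of \<open>Xfac q \<epsilon> s * Lser g (1 - s)\<close>: the
  Euler constant from \<open>Gamma (1 - s)\<close>, 0 from the sine or cosine of the given parity,
  \<open>ln (wfreq q 1)\<close> from the exponential, and minus the logarithmic derivative of
  \<open>Lser g\<close> at 1.\<close>

lemma has_b_Lent:
  assumes D: "dual q f g \<epsilon> \<tau>" and t: "\<tau> \<noteq> 0" and e: "\<epsilon> = 1 \<or> \<epsilon> = -1"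
    and nz: "Lser g 1 \<noteq> 0" and d: "(Lser g has_field_derivative d) (at 1)"
  shows "has_b (Lent q f g \<epsilon> \<tau>) (of_real (ln (wfreq q 1)) + euler_mascheroni - d / Lser g 1)"
proof -
  from D obtain Bf Bg where q: "q > 0" and Bf: "\<And>n. norm (psum f n) \<le> Bf" and Bg: "\<And>n. norm (psum g n) \<le> Bg"
    unfolding dual_def by blast
  let ?w = "complex_of_real (ln (wfreq q 1))"
  have 1: "has_b (\<lambda>s. (1 + \<epsilon>) * sin (of_real pi / 2 * s) + \<i> * (1 - \<epsilon>) * cos (of_real pi / 2 * s)) 0"
    using e has_b_mult[OF has_b_const has_b_sin, of 2 "of_real pi / 2"] has_b_mult[OF has_b_const has_b_cos, of "2 * \<i>" "of_real pi / 2"]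
    by (auto simp: mult.assoc mult.left_commute)
  have 2: "has_b (\<lambda>s. Lser g (1 - s)) (- d / Lser g 1)"
  proof (rule has_b_nonzeroI[where D = "- d"])
    show "((\<lambda>s. Lser g (1 - s)) has_field_derivative - d) (at 0)"
    proof -
      have a: "((\<lambda>s. 1 - s) has_field_derivative (-1)) (at (0::complex))" by (auto intro!: derivative_eq_intros)
      have b: "(Lser g has_field_derivative d) (at (1 - 0))" using d by simp
      from DERIV_chain'[OF a b] show ?thesis by simp
    qed
    have "(\<lambda>s. Lser g (1 - s)) holomorphic_on ball 0 1"
      by (intro holomorphic_on_compose[unfolded o_def, of "\<lambda>s. 1 - s" _ "Lser g"] holomorphic_intros Lser_holomorphic[OF Bg])
         (auto dest!: complex_Re_le_cmod[THEN order.strict_trans1])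
    thus "(\<lambda>s. Lser g (1 - s)) analytic_on {0}"
      by (auto simp: analytic_on_def intro!: exI[of _ 1])
  qed (use nz in auto)
  have "has_b (\<lambda>s. Gamma (1 - s) * ((1 + \<epsilon>) * sin (of_real pi / 2 * s) + \<i> * (1 - \<epsilon>) * cos (of_real pi / 2 * s)) * (exp (?w * s) * exp (- ?w)) * Lser g (1 - s) / \<tau>)
     (euler_mascheroni + 0 + (?w + 0) + (- d / Lser g 1) - 0)"
    by (intro has_b_divide has_b_mult has_b_Gamma 1 2 has_b_exp has_b_const t) simp
  hence "has_b (Lent q f g \<epsilon> \<tau>) (euler_mascheroni + 0 + (?w + 0) + (- d / Lser g 1) - 0)"
  proof (rule has_b_cong[rotated])
    have "\<forall>\<^sub>F s in at 0. s \<in> {s::complex. Re s < 1}"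
      by (intro eventually_at_in_open' open_halfspace_Re_lt) auto
    thus "\<forall>\<^sub>F s in at 0. Gamma (1 - s) * ((1 + \<epsilon>) * sin (of_real pi / 2 * s) + \<i> * (1 - \<epsilon>) * cos (of_real pi / 2 * s)) * (exp (?w * s) * exp (- ?w)) * Lser g (1 - s) / \<tau> = Lent q f g \<epsilon> \<tau> s"
    proof eventually_elim
      case (elim s)
      have "exp (?w * s) * exp (- ?w) = exp ((s - 1) * ?w)" unfolding exp_add[symmetric] by (simp add: algebra_simps)
      thus ?case using Lent_left[OF D t, of s] elim by (simp add: Xfac_def)
    qed
  qed
  thus ?thesis by (simp add: algebra_simps)
qed

text \<open>A continuation without any normalisation at its singularities, so that it survives
  multiplication and division by Euler factors; \<open>remove_sings\<close> restores the normal form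
  of \<open>dirichlet_L\<close> only in \<open>b_const_eqI\<close>.\<close>

definition cont_L :: "(int \<Rightarrow> complex) \<Rightarrow> (complex \<Rightarrow> complex) \<Rightarrow> bool" where
  "cont_L chi F \<longleftrightarrow> F meromorphic_on UNIV \<and> F analytic_on {s. Re s > 1} \<and>
     (\<forall>s. Re s > 1 \<longrightarrow> (\<lambda>n. chi (int (Suc n)) * of_nat (Suc n) powr (-s)) sums F s)"

text \<open>After subtracting \<open>m / s\<close> the logarithmic derivative has a finite limit at
  0, so its Laurent series has no negative part and the limit is its coefficient of index 0. The
  subtracted term changes only the coefficient of index -1.\<close>

lemma b_const_eqI:
  assumes L: "cont_L chi F" and b: "has_b F c"
  shows "b_const chi = c"
proof -
  let ?G = "remove_sings F"
  have mero: "F meromorphic_on UNIV" and an: "F analytic_on {s. Re s > 1}"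
    and sums: "\<And>s. Re s > 1 \<Longrightarrow> (\<lambda>n. chi (int (Suc n)) * of_nat (Suc n) powr (-s)) sums F s"
    using L by (auto simp: cont_L_def)
  have Geq: "?G s = F s" if "Re s > 1" for s
    using that by (intro remove_sings_at_analytic analytic_on_subset[OF an]) auto
  have G: "dirichlet_L chi = ?G"
    by (rule dirichlet_L_eqI[OF remove_sings_nicely_meromorphic[OF mero]]) (use sums Geq in auto)
  have "\<forall>\<^sub>F s in at 0. ?G s = F s"
    by (rule eventually_remove_sings_eq_at) (rule meromorphic_on_isolated_singularity[OF meromorphic_on_subset[OF mero]], simp)
  hence "\<forall>\<^sub>F s in at 0. F s = ?G s" by eventually_elim simp
  from has_b_cong[OF this b] obtain m where
    m: "((\<lambda>s. deriv ?G s / ?G s - m / s) \<longlongrightarrow> c) (at 0)"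
    unfolding has_b_def by blast
  let ?f = "\<lambda>s. deriv ?G s / ?G s"
  have "?f meromorphic_on UNIV"
    by (intro meromorphic_intros remove_sings_meromorphic mero)
  hence "?f meromorphic_on {0}" by (rule meromorphic_on_subset) auto
  hence "(\<lambda>w. ?f (0 + w)) has_laurent_expansion laurent_expansion ?f 0"
    by (intro meromorphic_on_imp_has_laurent_expansion) auto
  hence 1: "?f has_laurent_expansion laurent_expansion ?f 0" by simp
  define H where "H = laurent_expansion ?f 0 - fls_const m * fls_X_inv"
  have "(\<lambda>s. ?f s - m * inverse s) has_laurent_expansion H"
    unfolding H_def by (intro laurent_expansion_intros 1)
  hence H: "(\<lambda>s. ?f s - m / s) has_laurent_expansion H" by (simp add: divide_inverse)
  have "fls_subdegree H \<ge> 0"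
  proof (rule ccontr)
    assume "\<not> fls_subdegree H \<ge> 0"
    hence "is_pole (\<lambda>s. ?f s - m / s) 0" by (intro has_laurent_expansion_imp_is_pole_0[OF H]) auto
    thus False using m unfolding is_pole_def by (metis at_neq_bot not_tendsto_and_filterlim_at_infinity)
  qed
  from has_laurent_expansion_imp_tendsto_0[OF H this] m
  have "fls_nth H 0 = c" using tendsto_unique[of "at 0"] by (metis at_neq_bot)
  moreover have "fls_nth H 0 = fls_nth (laurent_expansion ?f 0) 0" by (simp add: H_def fls_X_inv_def)
  ultimately show ?thesis unfolding b_const_def G by simp
qed

section \<open>Dirichlet characters and Gauss sums\<close>

lemma char_cong:
  assumes chi: "dirichlet_character q chi" and "[m = n] (mod int q)"
  shows "chi m = chi n"
proof -
  from assms obtain k where k: "m = n + int q * k"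
    by (metis cong_iff_lin cong_sym mult.commute)
  have per: "\<And>n. chi (n + int q) = chi n" using chi by (auto simp: dirichlet_character_def)
  have nat: "chi (x + int q * int j) = chi x" for x j
    using periodic_mult[of chi q x j, OF per] by (simp add: mult.commute)
  show ?thesis
  proof (cases "k \<ge> 0")
    case True thus ?thesis using nat[of n "nat k"] k by simp
  next
    case False thus ?thesis using nat[of m "nat (-k)"] k by simp
  qed
qed

lemma char_mult: "dirichlet_character q chi \<Longrightarrow> chi (m * n) = chi m * chi n"
  by (auto simp: dirichlet_character_def)

lemma char_pos: "dirichlet_character q chi \<Longrightarrow> q > 0"
  by (auto simp: dirichlet_character_def)

lemma char_nz_iff: "dirichlet_character q chi \<Longrightarrow> chi n \<noteq> 0 \<longleftrightarrow> coprime n (int q)"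
  by (auto simp: dirichlet_character_def)

lemma char_1: "dirichlet_character q chi \<Longrightarrow> chi 1 = 1"
  using char_mult[of q chi 1 1] char_nz_iff[of q chi 1] by simp

lemma char_power: "dirichlet_character q chi \<Longrightarrow> chi (n ^ k) = chi n ^ k"
  by (induction k) (auto simp: char_1 char_mult)

lemma char_totient:
  assumes chi: "dirichlet_character q chi" and n: "coprime n (int q)"
  shows "chi n ^ totient q = 1"
proof -
  define m where "m = nat (n mod int q)"
  have q: "q > 0" using char_pos[OF chi] .
  have m: "int m = n mod int q" using q by (simp add: m_def)
  have "coprime (int m) (int q)" using n q unfolding m by (simp add: coprime_mod_left_iff)
  hence "coprime m q" by simp
  hence "[m ^ totient q = 1] (mod q)" by (rule euler_theorem)
  hence c: "[int m ^ totient q = 1] (mod int q)"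
    by (metis cong_int_iff of_nat_1 of_nat_power)
  have "chi n = chi (int m)" unfolding m by (rule char_cong[OF chi]) (simp add: cong_def)
  hence "chi n ^ totient q = chi (int m ^ totient q)" by (simp add: char_power[OF chi])
  also have "\<dots> = chi 1" by (rule char_cong[OF chi c])
  finally show ?thesis by (simp add: char_1[OF chi])
qed

lemma char_norm:
  assumes chi: "dirichlet_character q chi"
  shows "coprime n (int q) \<Longrightarrow> norm (chi n) = 1" "norm (chi n) \<le> 1"
proof -
  show 1: "norm (chi n) = 1" if "coprime n (int q)"
  proof -
    have "norm (chi n) ^ totient q = 1" using char_totient[OF chi that] by (metis norm_power norm_one)
    thus ?thesis using char_pos[OF chi] power_eq_imp_eq_base[of "norm (chi n)" "totient q" 1] by simp
  qed
  show "norm (chi n) \<le> 1"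
    using 1 char_nz_iff[OF chi, of n] by (cases "coprime n (int q)") auto
qed

lemma char_cnj:
  assumes "dirichlet_character q chi" shows "dirichlet_character q (\<lambda>n. cnj (chi n))"
  using assms by (auto simp: dirichlet_character_def)

lemma char_square:
  assumes "dirichlet_character q chi" shows "dirichlet_character q (\<lambda>n. chi n ^ 2)"
  using assms by (auto simp: dirichlet_character_def power_mult_distrib)

lemma sum_residues_mult:
  fixes h :: "int \<Rightarrow> complex"
  assumes q: "q > 0" and per: "\<And>m n. [m = n] (mod int q) \<Longrightarrow> h m = h n" and c: "coprime c (int q)"
  shows "(\<Sum>a\<in>{0..<int q}. h (c * a)) = (\<Sum>a\<in>{0..<int q}. h a)"
proof -
  let ?f = "\<lambda>a. (c * a) mod int q"
  have inj: "inj_on ?f {0..<int q}"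
  proof (rule inj_onI)
    fix a b assume ab: "a \<in> {0..<int q}" "b \<in> {0..<int q}" "?f a = ?f b"
    hence "[c * a = c * b] (mod int q)" by (simp add: cong_def)
    hence "[a = b] (mod int q)" using c by (simp add: cong_mult_lcancel)
    hence "a mod int q = b mod int q" by (simp only: cong_def)
    thus "a = b" using ab(1,2) by (simp add: mod_pos_pos_trivial)
  qed
  have "?f ` {0..<int q} = {0..<int q}"
    using q by (intro endo_inj_surj inj) auto
  hence "bij_betw ?f {0..<int q} {0..<int q}" using inj by (simp add: bij_betw_def)
  from sum.reindex_bij_betw[OF this, of h]
  have "(\<Sum>a\<in>{0..<int q}. h (?f a)) = (\<Sum>a\<in>{0..<int q}. h a)" .
  moreover have "h (?f a) = h (c * a)" for a by (rule per) (simp add: cong_def)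
  ultimately show ?thesis by simp
qed

lemma sum_int_residues: "(\<Sum>a<q. h (int a)) = (\<Sum>a\<in>{0..<int q}. h a)"
  by (rule sum.reindex_bij_witness[of _ nat int]) auto

lemma psum_residues:
  assumes "\<And>n. f (n + int q) = f n" and "q > 0"
  shows "psum f q = (\<Sum>a\<in>{0..<int q}. f a)"
proof -
  have "(\<Sum>a<Suc q. f (int a)) = f (int 0) + (\<Sum>a<q. f (int (Suc a)))" by (rule sum.lessThan_Suc_shift)
  hence "(\<Sum>a<q. f (int a)) + f (int q) = f 0 + psum f q" by (simp add: psum_def)
  moreover have "f (int q) = f 0" using assms(1)[of 0] by simp
  ultimately show ?thesis by (simp add: sum_int_residues)
qed

lemma char_psum_0:
  assumes chi: "dirichlet_character q chi" and c: "coprime c (int q)" "chi c \<noteq> 1"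
  shows "psum chi q = 0"
proof -
  have "(\<Sum>a\<in>{0..<int q}. chi (c * a)) = (\<Sum>a\<in>{0..<int q}. chi a)"
    by (rule sum_residues_mult[OF char_pos[OF chi] char_cong[OF chi] c(1)])
  hence "chi c * (\<Sum>a\<in>{0..<int q}. chi a) = (\<Sum>a\<in>{0..<int q}. chi a)"
    by (simp add: char_mult[OF chi] sum_distrib_left)
  hence "(chi c - 1) * (\<Sum>a\<in>{0..<int q}. chi a) = 0" by (simp add: algebra_simps)
  hence "(\<Sum>a\<in>{0..<int q}. chi a) = 0" using c by simp
  moreover have "chi (n + int q) = chi n" for n using chi by (auto simp: dirichlet_character_def)
  ultimately show ?thesis using psum_residues char_pos[OF chi] by metis
qed

lemma psum_bounded:
  assumes per: "\<And>n. f (n + int q) = f n" and q: "q > 0" and z: "psum f q = 0" and b: "\<And>n. norm (f n) \<le> C"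
  shows "norm (psum f n) \<le> C * real q"
proof -
  have C: "C \<ge> 0" using b[of 0] norm_ge_zero order_trans by blast
  have shift: "psum f (m + q) = psum f m" for m
  proof (induction m)
    case (Suc m)
    have "f (int (Suc (m + q))) = f (int (Suc m))" using per[of "int (Suc m)"] by (simp add: add_ac)
    thus ?case using Suc by (simp add: psum_Suc)
  qed (use z in simp)
  have "psum f (m + k * q) = psum f m" for m k
  proof (induction k)
    case (Suc k)
    thus ?case using shift[of "m + k * q"] by (simp add: add_ac)
  qed simp
  from this[of "n mod q" "n div q"] have "psum f n = psum f (n mod q)" by simp
  also have "norm \<dots> \<le> (\<Sum>k<n mod q. C)" unfolding psum_def by (intro sum_norm_le b)
  also have "\<dots> \<le> C * real q" using q C by (simp add: mult.commute mult_left_mono less_imp_le)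
  finally show ?thesis .
qed

lemma char_psum_bounded:
  assumes chi: "dirichlet_character q chi" and c: "coprime c (int q)" "chi c \<noteq> 1"
  shows "norm (psum chi n) \<le> real q"
proof -
  have "\<And>n. chi (n + int q) = chi n" using chi by (auto simp: dirichlet_character_def)
  from psum_bounded[OF this char_pos[OF chi] char_psum_0[OF assms] char_norm(2)[OF chi], of n]
  show ?thesis by simp
qed

text \<open>Primitivity tested only on the maximal proper divisors \<open>q / p\<close> of the modulus, which suffices.\<close>
definition prim :: "nat \<Rightarrow> (int \<Rightarrow> complex) \<Rightarrow> bool" where
  "prim q chi \<longleftrightarrow> (\<forall>p. prime p \<and> p dvd q \<longrightarrow>
     (\<exists>c. coprime c (int q) \<and> [c = 1] (mod int (q div p)) \<and> chi c \<noteq> 1))"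

section \<open>Additive characters and Gauss sums\<close>

definition ez :: "nat \<Rightarrow> int \<Rightarrow> complex" where
  "ez q k = exp (2 * of_real pi * \<i> * of_int k / of_nat q)"

lemma ez_add: "ez q (a + b) = ez q a * ez q b"
  by (simp add: ez_def exp_add[symmetric] add_divide_distrib ring_distribs)

lemma ez_multiple: "q > 0 \<Longrightarrow> ez q (int q * k) = 1"
  by (simp add: ez_def exp_eq_1)

lemma ez_power: "ez q k ^ n = ez q (k * int n)"
proof (induction n)
  case (Suc n)
  have "ez q (k * int (Suc n)) = ez q (k + k * int n)" by (simp add: algebra_simps)
  thus ?case using Suc by (simp add: ez_add)
qed (simp add: ez_def)

lemma ez_cong:
  assumes "q > 0" "[a = b] (mod int q)" shows "ez q a = ez q b"
proof -
  from assms(2) obtain k where "a = b + int q * k"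
    by (metis cong_iff_lin cong_sym mult.commute)
  thus ?thesis using assms(1) by (simp add: ez_add ez_multiple)
qed

lemma ez_eq_1_iff: assumes "q > 0" shows "ez q k = 1 \<longleftrightarrow> int q dvd k"
proof
  assume "ez q k = 1"
  then obtain n where n: "2 * pi * of_int k / of_nat q = of_int (2 * n) * pi"
    by (auto simp: ez_def exp_eq_1)
  hence "real_of_int k = of_int n * of_nat q" using assms by (simp add: field_simps)
  hence "k = n * int q" by (metis of_int_eq_iff of_int_mult of_int_of_nat_eq)
  thus "int q dvd k" by simp
qed (use assms in \<open>auto simp: ez_multiple\<close>)

lemma ez_cnj: "cnj (ez q k) = ez q (- k)"
  by (simp add: ez_def exp_cnj)

lemma ez_orthogonality:
  assumes q: "q > 0"
  shows "(\<Sum>n\<in>{0..<int q}. ez q (k * n)) = (if int q dvd k then of_nat q else 0)"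
proof (cases "int q dvd k")
  case True
  hence "ez q (k * n) = 1" for n using q by (subst ez_eq_1_iff) auto
  thus ?thesis using True by simp
next
  case False
  have "(\<Sum>n\<in>{0..<int q}. ez q (k * n)) = (\<Sum>n<q. ez q (k * int n))" by (rule sum_int_residues[symmetric])
  also have "\<dots> = (\<Sum>n<q. ez q k ^ n)"
    by (simp only: ez_power)
  also have "\<dots> = (ez q k ^ q - 1) / (ez q k - 1)"
    using False q by (intro geometric_sum) (simp add: ez_eq_1_iff)
  also have "ez q k ^ q = 1" using ez_multiple[OF q, of k] by (simp add: ez_power mult.commute)
  finally show ?thesis using False by simp
qed

text \<open>Built from the conjugate character, so that it is proportional to \<open>chi n\<close>
  itself: this is the Fourier relation that \<open>dual\<close> demands.\<close>

definition gauss :: "nat \<Rightarrow> (int \<Rightarrow> complex) \<Rightarrow> int \<Rightarrow> complex" where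
  "gauss q chi n = (\<Sum>a\<in>{0..<int q}. cnj (chi a) * ez q (a * n))"

lemma gauss_reindex:
  assumes chi: "dirichlet_character q chi" and c: "coprime c (int q)"
  shows "gauss q chi n = cnj (chi c) * (\<Sum>a\<in>{0..<int q}. cnj (chi a) * ez q (c * a * n))"
proof -
  have q: "q > 0" using char_pos[OF chi] .
  have "gauss q chi n = (\<Sum>a\<in>{0..<int q}. cnj (chi (c * a)) * ez q (c * a * n))"
    unfolding gauss_def
  proof (rule sum_residues_mult[OF q _ c, of "\<lambda>a. cnj (chi a) * ez q (a * n)", symmetric])
    fix m k assume mk: "[m = k] (mod int q)"
    show "cnj (chi m) * ez q (m * n) = cnj (chi k) * ez q (k * n)"
      using char_cong[OF chi mk] ez_cong[OF q cong_scalar_right[OF mk, of n]] by simp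
  qed
  thus ?thesis by (simp add: char_mult[OF chi] sum_distrib_left mult.assoc)
qed

text \<open>If \<open>n\<close> is coprime to \<open>q\<close>, reindex the residues. Otherwise some
  prime \<open>p\<close> divides both. Primitivity at \<open>q div p\<close> supplies
  \<open>c\<close> with \<open>chi c \<noteq> 1\<close> for which replacing \<open>a\<close> by
  \<open>c * a\<close> leaves \<open>ez q (a * n)\<close> unchanged; the sum then equals
  \<open>cnj (chi c)\<close> times itself and vanishes, like \<open>chi n\<close>.\<close>

lemma gauss_separable:
  assumes chi: "dirichlet_character q chi" and pr: "prim q chi"
  shows "gauss q chi n = gauss q chi 1 * chi n"
proof (cases "coprime n (int q)")
  case True
  have "gauss q chi 1 = cnj (chi n) * gauss q chi n"
    using gauss_reindex[OF chi True, of 1] by (simp add: gauss_def mult.commute[of n])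
  hence "gauss q chi 1 * chi n = (chi n * cnj (chi n)) * gauss q chi n" by (simp add: mult_ac)
  also have "chi n * cnj (chi n) = 1" using char_norm(1)[OF chi True] by (simp add: complex_norm_square[symmetric])
  finally show ?thesis by simp
next
  case False
  have q: "q > 0" using char_pos[OF chi] .
  from False have "gcd n (int q) \<noteq> 1" by (simp add: coprime_iff_gcd_eq_1)
  hence "nat (gcd n (int q)) \<noteq> 1" by (metis gcd_ge_0_int int_nat_eq of_nat_1)
  then obtain p where p: "prime p" "p dvd nat (gcd n (int q))" using prime_factor_nat by blast
  have pn: "int p dvd n" "int p dvd int q" using p(2)
    by (metis dvd_trans gcd_dvd1 gcd_dvd2 gcd_ge_0_int int_dvd_int_iff int_nat_eq)+
  hence pq: "p dvd q" by simp
  from pr p(1) pq obtain c where c: "coprime c (int q)" "[c = 1] (mod int (q div p))" "chi c \<noteq> 1"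
    unfolding prim_def by blast
  have qpd: "int q = int (q div p) * int p" using pq by (metis dvd_div_mult_self of_nat_mult)
  have "ez q (c * a * n) = ez q (a * n)" for a
  proof (rule ez_cong[OF q])
    have "int (q div p) dvd c - 1" using c(2) by (simp add: cong_iff_dvd_diff)
    hence "int q dvd (c - 1) * n" unfolding qpd using pn(1) by (rule mult_dvd_mono)
    hence "int q dvd ((c - 1) * n) * a" by (rule dvd_mult2)
    thus "[c * a * n = a * n] (mod int q)" by (simp add: cong_iff_dvd_diff algebra_simps)
  qed
  hence "gauss q chi n = cnj (chi c) * gauss q chi n"
    using gauss_reindex[OF chi c(1), of n] by (simp add: gauss_def)
  moreover have "cnj (chi c) \<noteq> 1" using c(3) by (metis complex_cnj_cnj complex_cnj_one)
  ultimately have "gauss q chi n = 0" by simp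
  moreover have "chi n = 0" using char_nz_iff[OF chi] False by blast
  ultimately show ?thesis by simp
qed

text \<open>The mean square of the Gauss sums over a period, computed twice: orthogonality gives
  \<open>q * E\<close>, separability gives the squared norm of \<open>gauss q chi 1\<close> times
  \<open>E\<close>, and \<open>E > 0\<close>.\<close>

lemma gauss_norm:
  assumes chi: "dirichlet_character q chi" and pr: "prim q chi"
  shows "norm (gauss q chi 1) = sqrt (real q)"
proof -
  have q: "q > 0" using char_pos[OF chi] .
  let ?R = "{0..<int q}"
  define E where "E = (\<Sum>a\<in>?R. chi a * cnj (chi a))"
  have "(\<Sum>n\<in>?R. gauss q chi n * cnj (gauss q chi n)) =
     (\<Sum>n\<in>?R. \<Sum>a\<in>?R. \<Sum>b\<in>?R. cnj (chi a) * chi b * ez q ((a - b) * n))"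
  proof (intro sum.cong refl)
    fix n
    have "gauss q chi n * cnj (gauss q chi n) = (\<Sum>a\<in>?R. \<Sum>b\<in>?R. (cnj (chi a) * ez q (a * n)) * (chi b * ez q (- (b * n))))"
      by (simp only: gauss_def cnj_sum sum_product complex_cnj_mult complex_cnj_cnj ez_cnj)
    also have "\<dots> = (\<Sum>a\<in>?R. \<Sum>b\<in>?R. cnj (chi a) * chi b * ez q ((a - b) * n))"
    proof (intro sum.cong refl)
      fix a b
      have "ez q ((a - b) * n) = ez q (a * n) * ez q (- (b * n))"
        using ez_add[of q "a * n" "- (b * n)"] by (simp add: algebra_simps)
      thus "(cnj (chi a) * ez q (a * n)) * (chi b * ez q (- (b * n))) = cnj (chi a) * chi b * ez q ((a - b) * n)"
        by (simp only: mult_ac)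
    qed
    finally show "gauss q chi n * cnj (gauss q chi n) = (\<Sum>a\<in>?R. \<Sum>b\<in>?R. cnj (chi a) * chi b * ez q ((a - b) * n))" .
  qed
  also have "\<dots> = (\<Sum>a\<in>?R. \<Sum>n\<in>?R. \<Sum>b\<in>?R. cnj (chi a) * chi b * ez q ((a - b) * n))" by (rule sum.swap)
  also have "\<dots> = (\<Sum>a\<in>?R. \<Sum>b\<in>?R. \<Sum>n\<in>?R. cnj (chi a) * chi b * ez q ((a - b) * n))"
    by (intro sum.cong refl sum.swap)
  also have "\<dots> = (\<Sum>a\<in>?R. \<Sum>b\<in>?R. if b = a then cnj (chi a) * chi b * of_nat q else 0)"
  proof (intro sum.cong refl)
    fix a b assume ab: "a \<in> ?R" "b \<in> ?R"
    have "int q dvd a - b \<longleftrightarrow> b = a"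
      using ab by (auto simp flip: cong_iff_dvd_diff dest: cong_less_imp_eq_int)
    thus "(\<Sum>n\<in>?R. cnj (chi a) * chi b * ez q ((a - b) * n)) = (if b = a then cnj (chi a) * chi b * of_nat q else 0)"
      unfolding sum_distrib_left[symmetric] ez_orthogonality[OF q] by auto
  qed
  also have "\<dots> = of_nat q * E"
    unfolding E_def by (simp add: sum_distrib_left mult_ac)
  finally have 1: "(\<Sum>n\<in>?R. gauss q chi n * cnj (gauss q chi n)) = of_nat q * E" .
  have "(\<Sum>n\<in>?R. gauss q chi n * cnj (gauss q chi n)) = gauss q chi 1 * cnj (gauss q chi 1) * E"
    unfolding E_def sum_distrib_left
  proof (intro sum.cong refl)
    fix n
    show "gauss q chi n * cnj (gauss q chi n) = gauss q chi 1 * cnj (gauss q chi 1) * (chi n * cnj (chi n))"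
      unfolding gauss_separable[OF chi pr, of n] complex_cnj_mult by (simp only: mult_ac)
  qed
  with 1 have "gauss q chi 1 * cnj (gauss q chi 1) * E = of_nat q * E" by simp
  moreover have "E \<noteq> 0"
  proof -
    have E: "E = of_real (\<Sum>a\<in>?R. norm (chi a) ^ 2)"
      unfolding E_def of_real_sum by (simp only: complex_norm_square)
    have "(\<Sum>a\<in>?R. norm (chi a) ^ 2) > 0"
    proof (rule sum_pos2[of _ "1 mod int q"])
      have "chi (1 mod int q) = chi 1" by (rule char_cong[OF chi]) (simp add: cong_def)
      thus "0 < norm (chi (1 mod int q)) ^ 2" by (simp add: char_1[OF chi])
    qed (use q in auto)
    thus ?thesis unfolding E by (metis of_real_eq_0_iff order_less_irrefl)
  qed
  ultimately have "gauss q chi 1 * cnj (gauss q chi 1) = of_nat q" by simp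
  hence "complex_of_real (norm (gauss q chi 1) ^ 2) = of_real (real q)" by (simp only: complex_norm_square of_real_of_nat_eq)
  hence "norm (gauss q chi 1) ^ 2 = real q" by (metis of_real_eq_iff)
  thus ?thesis by (metis norm_ge_zero real_sqrt_unique)
qed

lemma char_minus_1:
  assumes chi: "dirichlet_character q chi"
  shows "chi (-1) = 1 \<or> chi (-1) = -1"
proof -
  have "chi (-1) * chi (-1) = chi ((-1) * (-1))" by (simp only: char_mult[OF chi])
  hence "(chi (-1))\<^sup>2 = 1" using char_1[OF chi] by (simp add: power2_eq_square)
  thus ?thesis by (simp add: power2_eq_1_iff)
qed

lemma char_dual:
  assumes chi: "dirichlet_character q chi" and pr: "prim q chi" and c: "coprime c (int q)" "chi c \<noteq> 1"
  shows "dual q chi (\<lambda>n. cnj (chi n)) (chi (-1)) (gauss q chi 1)"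
proof -
  have q: "q > 0" using char_pos[OF chi] .
  have c': "cnj (chi c) \<noteq> 1" using c(2) by (metis complex_cnj_cnj complex_cnj_one)
  have "q \<noteq> 1"
  proof
    assume "q = 1"
    hence "chi c = chi 1" by (intro char_cong[OF chi]) auto
    thus False using c(2) char_1[OF chi] by simp
  qed
  hence "\<not> coprime 0 (int q)" using q by simp
  hence "chi 0 = 0" using char_nz_iff[OF chi] by blast
  moreover have "cnj (chi (- n)) = chi (-1) * cnj (chi n)" for n
    using char_mult[OF chi, of "-1" n] char_minus_1[OF chi] by auto
  moreover have "(\<Sum>a<q. cnj (chi (int a)) * exp (2 * of_real pi * \<i> * of_int (int a * n) / of_nat q)) = gauss q chi 1 * chi n" for n
  proof -
    have "(\<Sum>a<q. cnj (chi (int a)) * exp (2 * of_real pi * \<i> * of_int (int a * n) / of_nat q)) = gauss q chi n"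
      using sum_int_residues[of "\<lambda>a. cnj (chi a) * ez q (a * n)" q] by (simp only: gauss_def ez_def)
    thus ?thesis by (simp only: gauss_separable[OF chi pr, of n])
  qed
  moreover have "psum (\<lambda>n. cnj (chi n)) q = 0" by (rule char_psum_0[OF char_cnj[OF chi] c(1) c'])
  moreover have "norm (psum chi n) \<le> real q" for n by (rule char_psum_bounded[OF chi c])
  moreover have "norm (psum (\<lambda>n. cnj (chi n)) n) \<le> real q" for n by (rule char_psum_bounded[OF char_cnj[OF chi] c(1) c'])
  moreover have "norm (chi (-1)) = 1" using char_minus_1[OF chi] by auto
  moreover have "chi (n + int q) = chi n" for n using chi by (auto simp: dirichlet_character_def)
  ultimately show ?thesis unfolding dual_def using q by auto
qed

section \<open>Reduction to primitive characters\<close>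

lemma coprime_cong:
  fixes a b m :: int
  assumes "[a = b] (mod m)" shows "coprime a m \<longleftrightarrow> coprime b m"
  using assms by (metis cong_gcd_eq coprime_iff_gcd_eq_1)

text \<open>Triviality on the classes that are 1 modulo \<open>d = q div p\<close> means that
  \<open>chi\<close> factors through \<open>d\<close>. If \<open>p\<close> still divides
  \<open>d\<close>, then coprimality to \<open>q\<close> and to \<open>d\<close> coincide and
  \<open>chi\<close> itself has period \<open>d\<close>. If not, \<open>chi'\<close> is read off at
  a representative whose component modulo \<open>p\<close> is trivial, and the two characters differ
  exactly at multiples of \<open>p\<close>.\<close>

lemma char_lower_modulus:
  assumes chi: "dirichlet_character q chi" and p: "prime p" "p dvd q"
    and triv: "\<And>c. coprime c (int q) \<Longrightarrow> [c = 1] (mod int (q div p)) \<Longrightarrow> chi c = 1"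
  obtains chi' where "dirichlet_character (q div p) chi'"
    and "\<And>n. chi n = (if int p dvd n then 0 else chi' n)"
proof -
  define d where "d = q div p"
  have q: "q > 0" using char_pos[OF chi] .
  have qd: "q = d * p" using p(2) by (simp add: d_def)
  hence qd': "int q = int d * int p" by simp
  have d: "d > 0" using q qd by (cases d) auto
  have pp: "prime (int p)" using p(1) by simp
  have p0: "chi n = 0" if "int p dvd n" for n
  proof -
    have "\<not> coprime n (int q)"
      using that pp unfolding qd' by (meson coprime_common_divisor dvd_triv_right not_prime_unit)
    thus ?thesis using char_nz_iff[OF chi] by blast
  qed
  have inv: "\<exists>m. [n * m = 1] (mod int q) \<and> coprime m (int q)" if cop: "coprime n (int q)" for n
  proof -
    obtain m where m: "[n * m = 1] (mod int q)" using cong_solve_coprime_int[OF cop] by blast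
    hence "coprime (n * m) (int q)" using coprime_cong[OF m] by simp
    thus ?thesis using m by auto
  qed
  show ?thesis
  proof (cases "p dvd d")
    case True
    have cop: "coprime n (int q) \<longleftrightarrow> coprime n (int d)" for n
    proof
      assume a: "coprime n (int d)"
      hence "coprime n (int p)" using True by (meson coprime_divisors dvd_refl int_dvd_int_iff)
      thus "coprime n (int q)" using a unfolding qd' by simp
    qed (auto simp: qd')
    have per: "chi (n + int d) = chi n" for n
    proof (cases "coprime n (int d)")
      case True
      have "[n + int d = n] (mod int d)" by (simp add: cong_iff_dvd_diff)
      hence nd: "coprime (n + int d) (int q)" using True coprime_cong cop by blast
      obtain m where m: "[n * m = 1] (mod int q)" "coprime m (int q)" using inv[of n] True cop by auto
      have "int d dvd int q" by (simp add: qd')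
      with m(1) have "[n * m = 1] (mod int d)" by (rule cong_dvd_modulus)
      hence "[n * m + int d * m = 1 + int d * m] (mod int d)" by (intro cong_add) auto
      moreover have "[1 + int d * m = 1] (mod int d)" by (simp add: cong_iff_dvd_diff)
      ultimately have "[(n + int d) * m = 1] (mod int d)" unfolding distrib_right by (rule cong_trans)
      hence "chi ((n + int d) * m) = 1" by (intro triv) (use nd m in \<open>auto simp: d_def\<close>)
      hence "chi n = chi n * chi ((n + int d) * m)" by simp
      also have "\<dots> = chi (n + int d) * chi (n * m)" by (simp add: char_mult[OF chi] mult_ac)
      also have "chi (n * m) = chi 1" by (rule char_cong[OF chi m(1)])
      finally show ?thesis by (simp add: char_1[OF chi])
    next
      case False
      have "[n + int d = n] (mod int d)" by (simp add: cong_iff_dvd_diff)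
      hence "\<not> coprime (n + int d) (int q)" using False coprime_cong cop by blast
      thus ?thesis using False cop char_nz_iff[OF chi] by metis
    qed
    have "dirichlet_character d chi"
      unfolding dirichlet_character_def using d per char_mult[OF chi] char_nz_iff[OF chi] cop by auto
    thus ?thesis using that[of chi] p0 by (auto simp: d_def)
  next
    case False
    hence "coprime (int p) (int d)" using p(1) by (simp add: prime_imp_coprime)
    then obtain x where x: "[int p * x = 1] (mod int d)" using cong_solve_coprime_int by blast
    define e where "e = int p * x"
    \<comment> \<open>An explicit Chinese remainder: \<open>e\<close> is 1 modulo \<open>d\<close>
      and 0 modulo \<open>p\<close>, so \<open>u n\<close> is \<open>n\<close> modulo
      \<open>d\<close> and 1 modulo \<open>p\<close>. Being a polynomial in \<open>n\<close>, it is
      multiplicative modulo \<open>q\<close> by an algebraic identity.\<close>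
    define u where "u = (\<lambda>n. n * e + 1 - e)"
    have de: "int d dvd e - 1" using x by (simp add: e_def cong_iff_dvd_diff)
    have ud: "[u n = n] (mod int d)" for n
    proof -
      have "u n - n = (e - 1) * (n - 1)" by (simp add: u_def algebra_simps)
      thus ?thesis using de by (simp add: cong_iff_dvd_diff)
    qed
    have up: "[u n = 1] (mod int p)" for n
    proof -
      have "u n - 1 = int p * (x * (n - 1))" by (simp add: u_def e_def algebra_simps)
      thus ?thesis by (simp add: cong_iff_dvd_diff)
    qed
    have cu: "coprime (u n) (int q) \<longleftrightarrow> coprime n (int d)" for n
      unfolding qd' using coprime_cong[OF ud[of n]] coprime_cong[OF up[of n]] by simp
    have um: "[u (m * n) = u m * u n] (mod int q)" for m n
    proof -
      have "u (m * n) - u m * u n = (int p * x) * ((e - 1) * (m + n - m * n - 1))"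
        unfolding u_def e_def[symmetric] by (simp add: algebra_simps)
      moreover have "int q dvd (int p * x) * ((e - 1) * (m + n - m * n - 1))"
        unfolding qd' mult.commute[of "int d"] using de by (intro mult_dvd_mono dvd_triv_left) (auto intro: dvd_mult2)
      ultimately show ?thesis by (simp add: cong_iff_dvd_diff)
    qed
    have uper: "[u (n + int d) = u n] (mod int q)" for n
      by (simp add: cong_iff_dvd_diff u_def e_def qd' algebra_simps)
    have "dirichlet_character d (\<lambda>n. chi (u n))"
      unfolding dirichlet_character_def
      using d char_cong[OF chi uper] char_cong[OF chi um] char_mult[OF chi] char_nz_iff[OF chi] cu by auto
    moreover have "chi n = (if int p dvd n then 0 else chi (u n))" for n
    proof (cases "int p dvd n")
      case False
      have cq: "coprime n (int q) \<longleftrightarrow> coprime n (int d)"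
        using False pp unfolding qd' by (auto simp: coprime_commute[of n] intro: prime_imp_coprime)
      show ?thesis
      proof (cases "coprime n (int d)")
        case True
        obtain v where v: "[u n * v = 1] (mod int q)" "coprime v (int q)" using inv[of "u n"] cu True by blast
        have "[n * v = u n * v] (mod int d)" using ud[of n] by (intro cong_scalar_right) (rule cong_sym)
        moreover have "[u n * v = 1] (mod int d)" using v(1) by (rule cong_dvd_modulus) (simp add: qd')
        ultimately have "[n * v = 1] (mod int d)" by (rule cong_trans)
        hence "chi (n * v) = 1" by (intro triv) (use v True cq in \<open>auto simp: d_def\<close>)
        hence "chi (u n) = chi (u n) * chi (n * v)" by simp
        also have "\<dots> = chi n * chi (u n * v)" by (simp add: char_mult[OF chi] mult_ac)
        also have "chi (u n * v) = chi 1" by (rule char_cong[OF chi v(1)])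
        finally show ?thesis using False by (simp add: char_1[OF chi])
      next
        case False
        thus ?thesis using cq cu char_nz_iff[OF chi] by metis
      qed
    qed (use p0 in auto)
    ultimately show ?thesis using that[of "\<lambda>n. chi (u n)"] by (simp add: d_def)
  qed
qed

text \<open>The second series lives on multiples of \<open>p\<close> and is the first one reindexed.
  The coefficients are arbitrary, since the same step removes a prime from a character, builds
  partial Euler products and relates \<open>f4\<close> to zeta.\<close>

lemma step_sums:
  fixes a :: "int \<Rightarrow> complex"
  assumes A: "(\<lambda>n. a (int (Suc n)) * of_nat (Suc n) powr (-s)) sums A" and p: "p > 0"
  shows "(\<lambda>n. (a (int (Suc n)) - (if p dvd Suc n then c * a (int (Suc n div p)) else 0)) * of_nat (Suc n) powr (-s))
     sums ((1 - c * of_nat p powr (-s)) * A)"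
proof -
  let ?h = "\<lambda>n. (if p dvd Suc n then c * a (int (Suc n div p)) else 0) * of_nat (Suc n) powr (-s)"
  \<comment> \<open>Index \<open>n\<close> stands for the integer \<open>Suc n\<close>, so the
    multiple \<open>p * Suc n\<close> sits at index \<open>p * Suc n - 1\<close>.\<close>
  define g where "g = (\<lambda>n. p * Suc n - 1)"
  have Sg: "Suc (g n) = p * Suc n" for n using p by (simp add: g_def)
  have "strict_mono g"
    by (rule strict_monoI_Suc) (use p in \<open>simp add: g_def\<close>)
  moreover have "?h n = 0" if "n \<notin> range g" for n
  proof (rule ccontr)
    assume "?h n \<noteq> 0"
    hence "p dvd Suc n" by (auto split: if_splits)
    then obtain k where k: "Suc n = p * k" by auto
    then obtain j where "k = Suc j" by (cases k) auto
    hence "n = g j" using k Sg[of j] by simp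
    thus False using that by simp
  qed
  ultimately have "(\<lambda>n. ?h (g n)) sums (c * of_nat p powr (-s) * A) \<longleftrightarrow> ?h sums (c * of_nat p powr (-s) * A)"
    by (rule sums_mono_reindex)
  moreover have "(\<lambda>n. ?h (g n)) sums (c * of_nat p powr (-s) * A)"
  proof -
    have "?h (g n) = c * of_nat p powr (-s) * (a (int (Suc n)) * of_nat (Suc n) powr (-s))" for n
    proof -
      have "of_nat (p * Suc n) powr (-s) = (of_nat p powr (-s) * of_nat (Suc n) powr (-s) :: complex)"
        unfolding of_nat_mult using powr_times_real[of "of_nat p" "of_nat (Suc n)" "-s"] by simp
      thus ?thesis unfolding Sg using p by (simp del: of_nat_Suc of_nat_mult mult_Suc_right)
    qed
    thus ?thesis using sums_mult[OF A, of "c * of_nat p powr (-s)"] by simp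
  qed
  ultimately have "?h sums (c * of_nat p powr (-s) * A)" by simp
  from sums_diff[OF A this] show ?thesis by (simp add: algebra_simps)
qed

lemma euler_factor_exp:
  fixes s :: complex
  assumes "p > 0" shows "of_nat p powr (-s) = exp (- of_real (ln (real p)) * s)"
  using assms Ln_of_real[of "real p"] by (simp add: powr_def mult.commute)

text \<open>With \<open>S = \<Sum>j<k. j * z ^ j\<close> one has \<open>S * (z - 1) = k\<close>, and
  \<open>norm S\<close> is at most \<open>k^2 / 2\<close>. This bounds how close an Euler factor can
  come to 0 at \<open>s = 0\<close>.\<close>

lemma norm_root_of_unity_quotient:
  fixes z :: complex
  assumes z: "z ^ k = 1" "z \<noteq> 1" "k > 0"
  shows "norm (1 / (1 - z)) \<le> real k / 2"
proof -
  have nz: "norm z = 1" 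
    using power_eq_imp_eq_base[of "norm z" k 1] z norm_power[of z k] by simp
  define S where "S = (\<Sum>j<k. of_nat j * z ^ j)"
  have "(\<Sum>j<k. of_nat j * z ^ j) * (z - 1) = of_nat k * z ^ k - z * (\<Sum>j<k. z ^ j)" for k
    by (induction k) (simp_all add: algebra_simps)
  from this[of k] have "S * (z - 1) = of_nat k"
    using z by (simp add: S_def geometric_sum)
  hence "1 / (1 - z) = - S / of_nat k" using z by (simp add: field_simps)
  hence n1: "norm (1 / (1 - z)) = norm S / real k" by (simp add: norm_divide)
  have "norm S \<le> (\<Sum>j<k. real j)"
    unfolding S_def by (intro order.trans[OF norm_sum] sum_mono) (simp add: norm_mult norm_power nz)
  hence "norm S / real k \<le> (\<Sum>j<k. real j) / real k" by (rule divide_right_mono) simp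
  also have "(\<Sum>j<k. real j) / real k \<le> (real k * real k / 2) / real k"
  proof (rule divide_right_mono)
    show "(\<Sum>j<k. real j) \<le> real k * real k / 2" by (induction k) (auto simp: field_simps)
  qed simp
  also have "\<dots> = real k / 2" using z by simp
  finally show ?thesis using n1 by simp
qed

text \<open>With \<open>d = q div p\<close>, the Euler factor costs at most
  \<open>d * ln p / 2\<close>, while the allowance grows from \<open>d / 2\<close> to
  \<open>d * p / 2\<close>. The inequality \<open>ln p + 1 \<le> p\<close> closes the step, which
  explains the shape \<open>q / 2\<close> of the bound.\<close>

lemma b_step:
  assumes chi: "dirichlet_character q chi" and p: "prime p" "p dvd q"
    and triv: "\<And>c. coprime c (int q) \<Longrightarrow> [c = 1] (mod int (q div p)) \<Longrightarrow> chi c = 1"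
    and IH: "\<And>chi'. dirichlet_character (q div p) chi' \<Longrightarrow> \<exists>F c. cont_L chi' F \<and> has_b F c \<and> norm c \<le> P + real (q div p) / 2"
  shows "\<exists>F c. cont_L chi F \<and> has_b F c \<and> norm c \<le> P + real q / 2"
proof -
  define d where "d = q div p"
  from char_lower_modulus[OF chi p triv] obtain chi' where
    chi': "dirichlet_character d chi'" and eq: "\<And>n. chi n = (if int p dvd n then 0 else chi' n)"
    unfolding d_def by blast
  from IH[of chi'] chi' obtain F c where F: "cont_L chi' F" "has_b F c" "norm c \<le> P + real d / 2"
    unfolding d_def by blast
  have p1: "p > 1" using p(1) prime_gt_1_nat by blast
  have d: "d > 0" using char_pos[OF chi'] .
  define L where "L = ln (real p)"
  have L: "L > 0" "L \<le> real p - 1" using p1 ln_le_minus_one[of "real p"] by (auto simp: L_def)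
  define z where "z = chi' (int p)"
  have e: "of_nat p powr (-s) = exp (- of_real L * s)" for s :: complex
    using euler_factor_exp[of p s] p1 by (simp add: L_def)
  \<comment> \<open>Three possibilities for \<open>z = chi' p\<close>: the value 1, where the factor
    vanishes at 0; another root of unity, of order dividing \<open>totient d\<close>; or 0, when
    \<open>p\<close> divides \<open>d\<close>.\<close>
  obtain l where l: "has_b (\<lambda>s. 1 - z * exp (- of_real L * s)) l" "norm l \<le> real d * L / 2"
  proof (cases "z = 1")
    case True
    show ?thesis
    proof (rule that)
      show "has_b (\<lambda>s. 1 - z * exp (- of_real L * s)) (- of_real L / 2)"
        using has_b_one_minus_power_1[OF L(1)] True by simp
      have "1 * L \<le> real d * L" using d L by (intro mult_right_mono) auto
      thus "norm (- complex_of_real L / 2) \<le> real d * L / 2" using L by (simp add: norm_divide)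
    qed
  next
    case False
    show ?thesis
    proof (rule that)
      show "has_b (\<lambda>s. 1 - z * exp (- of_real L * s)) (z * of_real L / (1 - z))"
        by (rule has_b_one_minus_power[OF False])
      have "norm (1 / (1 - z)) \<le> real d / 2"
      proof (cases "coprime (int p) (int d)")
        case True
        have "norm (1 / (1 - z)) \<le> real (totient d) / 2"
          by (rule norm_root_of_unity_quotient) (use char_totient[OF chi' True] False d in \<open>auto simp: z_def\<close>)
        thus ?thesis using totient_le[of d] by simp
      next
        case False
        hence z0: "z = 0" using char_nz_iff[OF chi', of "int p"] unfolding z_def by blast
        have "d \<noteq> 1" using False by auto
        hence "d \<ge> 2" using d by simp
        thus ?thesis using z0 by simp
      qed
      moreover have "norm z \<le> 1" unfolding z_def by (rule char_norm(2)[OF chi'])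
      ultimately have "norm z * L * norm (1 / (1 - z)) \<le> 1 * L * (real d / 2)"
        using L by (intro mult_mono) auto
      thus "norm (z * of_real L / (1 - z)) \<le> real d * L / 2"
        using L by (simp add: norm_divide norm_mult mult.commute)
    qed
  qed
  define G where "G = (\<lambda>s. (1 - z * exp (- of_real L * s)) * F s)"
  have "cont_L chi G"
    unfolding cont_L_def
  proof (intro conjI allI impI)
    have M1: "(\<lambda>s. 1 - z * exp (- of_real L * s)) meromorphic_on UNIV"
      by (intro analytic_on_imp_meromorphic_on analytic_intros)
    have M2: "F meromorphic_on UNIV" using F(1) by (simp add: cont_L_def)
    show "G meromorphic_on UNIV" unfolding G_def by (rule meromorphic_on_mult[OF M1 M2])
    show "G analytic_on {s. Re s > 1}" unfolding G_def using F(1) by (intro analytic_intros) (auto simp: cont_L_def)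
    fix s :: complex assume s: "Re s > 1"
    have "(\<lambda>n. chi' (int (Suc n)) * of_nat (Suc n) powr (-s)) sums F s" using F(1) s by (auto simp: cont_L_def)
    from step_sums[OF this, of p z] p1
    have "(\<lambda>n. (chi' (int (Suc n)) - (if p dvd Suc n then z * chi' (int (Suc n div p)) else 0)) * of_nat (Suc n) powr (-s))
       sums ((1 - z * of_nat p powr (-s)) * F s)" by simp
    moreover have "chi' (int (Suc n)) - (if p dvd Suc n then z * chi' (int (Suc n div p)) else 0) = chi (int (Suc n))" for n
    proof (cases "p dvd Suc n")
      case True
      hence "chi' (int (Suc n)) = z * chi' (int (Suc n div p))"
        unfolding z_def char_mult[OF chi', symmetric] by (metis dvd_mult_div_cancel of_nat_mult)
      thus ?thesis using True unfolding eq int_dvd_int_iff by simp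
    qed (unfold eq int_dvd_int_iff, simp)
    ultimately show "(\<lambda>n. chi (int (Suc n)) * of_nat (Suc n) powr (-s)) sums G s"
      unfolding G_def e by simp
  qed
  moreover have "has_b G (l + c)" unfolding G_def by (rule has_b_mult[OF l(1) F(2)])
  moreover have "norm (l + c) \<le> P + real q / 2"
  proof -
    have "norm (l + c) \<le> real d * L / 2 + (P + real d / 2)"
      by (rule order.trans[OF norm_triangle_ineq add_mono[OF l(2) F(3)]])
    also have "\<dots> = P + real d * (L + 1) / 2" by (simp add: field_simps)
    also have "\<dots> \<le> P + real d * real p / 2"
      using L by (intro add_left_mono divide_right_mono mult_left_mono) auto
    also have "real d * real p = real q" using p(2) unfolding d_def by (metis dvd_div_mult_self of_nat_mult)
    finally show ?thesis .
  qed
  ultimately show ?thesis by blast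
qed

text \<open>Descent by one prime at a time until the character is primitive. The constant
  \<open>P\<close> is uniform over all moduli up to \<open>Q\<close>, so it covers whichever
  conductor the descent ends at.\<close>

lemma b_induction:
  assumes base: "\<And>d chi. d \<le> Q \<Longrightarrow> dirichlet_character d chi \<Longrightarrow> prim d chi \<Longrightarrow> \<exists>F c. cont_L chi F \<and> has_b F c \<and> norm c \<le> P"
  shows "q \<le> Q \<Longrightarrow> dirichlet_character q chi \<Longrightarrow> \<exists>F c. cont_L chi F \<and> has_b F c \<and> norm c \<le> P + real q / 2"
proof (induction q arbitrary: chi rule: less_induct)
  case (less q)
  show ?case
  proof (cases "prim q chi")
    case True
    from base[OF less.prems True] obtain F c where "cont_L chi F" "has_b F c" "norm c \<le> P" by blast
    thus ?thesis by (intro exI[of _ F] exI[of _ c]) simp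
  next
    case False
    then obtain p where p: "prime p" "p dvd q"
      "\<And>c. coprime c (int q) \<Longrightarrow> [c = 1] (mod int (q div p)) \<Longrightarrow> chi c = 1"
      unfolding prim_def by blast
    have "q > 0" using char_pos[OF less.prems(2)] .
    hence lt: "q div p < q" using p(1) prime_gt_1_nat by simp
    show ?thesis
    proof (rule b_step[OF less.prems(2) p])
      fix chi' assume "dirichlet_character (q div p) chi'"
      thus "\<exists>F c. cont_L chi' F \<and> has_b F c \<and> norm c \<le> P + real (q div p) / 2"
        using less.IH[OF lt, of chi'] lt less.prems(1) by simp
    qed
  qed
qed

section \<open>The derivative at 1, and the zeta function\<close>

lemma ln_over_antimono:
  fixes x y :: real
  assumes "3 \<le> x" "x \<le> y" shows "ln y / y \<le> ln x / x"
proof -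
  have "exp 1 \<le> x" using exp_le assms by linarith
  thus ?thesis using assms by (intro ln_x_over_x_mono)
qed

text \<open>Comparison with the integral of \<open>ln x / x\<close>. The induction starts at 3
  because the integrand decreases only from \<open>exp 1\<close> on; the constant 1 absorbs the
  initial terms.\<close>

lemma sum_ln_over_le:
  assumes "q \<ge> 3"
  shows "(\<Sum>n<q. ln (real (Suc n)) / real (Suc n)) \<le> (ln (real q))\<^sup>2 / 2 + 1"
  using assms
proof (induction q rule: nat_induct_at_least)
  case base
  have "ln (2::real) \<le> 1" using ln_le_minus_one[of "2::real"] by simp
  moreover have "ln (3::real) \<le> 2" using ln_le_minus_one[of "3::real"] by simp
  moreover have "ln (1/3::real) \<le> 1/3 - 1" by (rule ln_le_minus_one) simp
  hence "ln (3::real) \<ge> 2/3" by (simp add: ln_div)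
  hence "(ln (3::real))\<^sup>2 \<ge> (2/3)\<^sup>2" by (intro power_mono) auto
  ultimately show ?case by (simp add: eval_nat_numeral power2_eq_square)
next
  case (Suc q)
  have "\<exists>z>real q. z < real (Suc q) \<and> (ln (real (Suc q)))\<^sup>2 / 2 - (ln (real q))\<^sup>2 / 2 = (real (Suc q) - real q) * (ln z / z)"
    by (rule MVT2) (use Suc.hyps in \<open>auto intro!: derivative_eq_intros simp: field_simps\<close>)
  then obtain z where z: "z > real q" "z < real (Suc q)" "(ln (real (Suc q)))\<^sup>2 / 2 - (ln (real q))\<^sup>2 / 2 = ln z / z"
    by auto
  have "ln (real (Suc q)) / real (Suc q) \<le> ln z / z" using z Suc.hyps by (intro ln_over_antimono) auto
  thus ?case using Suc.IH z(3) by simp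
qed

text \<open>The series is cut after \<open>q\<close> terms, where \<open>psum\<close> vanishes. The
  head is bounded trivially; in the tail \<open>ln n / n\<close> decreases, so its differences
  telescope to the single value at \<open>Suc q\<close>.\<close>

lemma Lser_deriv_bound:
  assumes bd: "\<And>n. norm (psum f n) \<le> B" and q: "psum f q = 0" "q \<ge> 3" and C: "\<And>n. norm (f n) \<le> C"
    and D: "(Lser f has_field_derivative D) (at 1)"
  shows "norm D \<le> C * ((ln (real q))\<^sup>2 / 2 + 1) + B * (ln (real (Suc q)) / real (Suc q))"
proof -
  define h where "h = (\<lambda>n. ln (real (Suc n)) / real (Suc n))"
  have B: "B \<ge> 0" using bd[of 0] by simp
  have C0: "C \<ge> 0" using C[of 0] norm_ge_zero order_trans by blast
  from Lser_has_derivative[OF bd, of 1] obtain D' where D': "(Lser f has_field_derivative D') (at 1)"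
    and S: "(\<lambda>n. psum f (Suc n) * (of_real (ln (real (Suc (Suc n)))) * of_nat (Suc (Suc n)) powr (-1)
         - of_real (ln (real (Suc n))) * of_nat (Suc n) powr (-1))) sums D'"
    by auto
  have DD: "D' = D" using D D' DERIV_unique by blast
  have H: "of_real (ln (real (Suc m))) * of_nat (Suc m) powr (-1) = complex_of_real (h m)" for m
    by (simp add: h_def powr_minus divide_inverse del: of_nat_Suc)
  have S: "(\<lambda>n. psum f (Suc n) * (of_real (h (Suc n)) - of_real (h n))) sums D"
    using S unfolding H DD .
  let ?t = "\<lambda>n. psum f (Suc n) * (of_real (h n) - of_real (h (Suc n)))"
  have "(\<lambda>n. - (psum f (Suc n) * (of_real (h (Suc n)) - of_real (h n)))) sums (- D)"
    using S by (rule sums_minus)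
  hence S2: "?t sums (- D)" by (simp add: algebra_simps)
  from sums_split_initial_segment[OF S2, of q]
  have tail: "(\<lambda>n. ?t (n + q)) sums (- D - (\<Sum>n<q. ?t n))" .
  have hn: "h n \<ge> 0" for n by (simp add: h_def)
  have e: "(\<Sum>n<q. ?t n) = (\<Sum>n<q. f (int (Suc n)) * of_real (h n))"
    using sum_by_parts[of f "\<lambda>n. of_real (h n)" q] q(1) by simp
  have "norm (\<Sum>n<q. ?t n) \<le> (\<Sum>n<q. C * h n)"
    unfolding e
  proof (rule sum_norm_le)
    fix n
    have "norm (f (int (Suc n)) * complex_of_real (h n)) = norm (f (int (Suc n))) * h n"
      by (simp only: norm_mult norm_of_real abs_of_nonneg[OF hn])
    also have "\<dots> \<le> C * h n" by (intro mult_right_mono C hn)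
    finally show "norm (f (int (Suc n)) * complex_of_real (h n)) \<le> C * h n" .
  qed
  also have "\<dots> \<le> C * ((ln (real q))\<^sup>2 / 2 + 1)"
    unfolding sum_distrib_left[symmetric] h_def using C0 q(2) by (intro mult_left_mono sum_ln_over_le) auto
  finally have 1: "norm (\<Sum>n<q. ?t n) \<le> C * ((ln (real q))\<^sup>2 / 2 + 1)" .
  have "norm (- D - (\<Sum>n<q. ?t n)) \<le> B * h q"
  proof (rule tendsto_upperbound)
    show "(\<lambda>N. norm (\<Sum>n<N. ?t (n + q))) \<longlonglongrightarrow> norm (- D - (\<Sum>n<q. ?t n))"
      using tail unfolding sums_def by (rule tendsto_norm)
    show "\<forall>\<^sub>F N in sequentially. norm (\<Sum>n<N. ?t (n + q)) \<le> B * h q"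
    proof (intro always_eventually allI)
      fix N
      have "norm (\<Sum>n<N. ?t (n + q)) \<le> (\<Sum>n<N. B * (h (n + q) - h (Suc n + q)))"
      proof (rule sum_norm_le)
        fix n
        have "h (Suc n + q) \<le> h (n + q)" unfolding h_def using q(2) by (intro ln_over_antimono) auto
        thus "norm (?t (n + q)) \<le> B * (h (n + q) - h (Suc n + q))"
          unfolding norm_mult of_real_diff[symmetric] norm_of_real by (intro mult_mono bd B) auto
      qed
      also have "\<dots> = B * (h (0 + q) - h (N + q))"
        unfolding sum_distrib_left[symmetric] using sum_lessThan_telescope'[of "\<lambda>n. h (n + q)" N] by simp
      also have "h (N + q) \<ge> 0" by (simp add: h_def)
      hence "B * (h (0 + q) - h (N + q)) \<le> B * h q" using B by (intro mult_left_mono) auto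
      finally show "norm (\<Sum>n<N. ?t (n + q)) \<le> B * h q" .
    qed
  qed auto
  with 1 have "norm (- D) \<le> C * ((ln (real q))\<^sup>2 / 2 + 1) + B * h q"
    using norm_triangle_ineq[of "- D - (\<Sum>n<q. ?t n)" "\<Sum>n<q. ?t n"] by simp
  thus ?thesis by (simp add: h_def)
qed

text \<open>The coefficients of \<open>(1 - 2 powr (-s)) * (1 - 2 * 2 powr (-s))\<close> times zeta.
  The second factor cancels the pole at 1, the first makes \<open>f4 0 = 0\<close>, and the result
  is its own finite Fourier transform modulo 4 up to the factor 2. Thus zeta falls under
  \<open>dual\<close>.\<close>

definition f4 :: "int \<Rightarrow> complex" where
  "f4 n = (if odd n then 1 else if n mod 4 = 2 then -2 else 0)"

lemma f4_mod: "f4 n = f4 (n mod 4)"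
proof -
  have "even (n mod 4) = even n" by presburger
  thus ?thesis by (simp add: f4_def)
qed

lemma ez4: "ez 4 (int k) = \<i> ^ k"
proof -
  have "ez 4 1 = exp (\<i> * of_real (pi / 2))" by (simp add: ez_def mult.commute)
  also have "\<dots> = \<i>" by (simp only: cis_conv_exp[symmetric] cis_pi_half)
  finally show ?thesis using ez_power[of 4 1 k] by simp
qed

lemma f4_values: "f4 0 = 0" "f4 1 = 1" "f4 2 = -2" "f4 3 = 1" "f4 4 = 0"
  by (simp_all add: f4_def)

lemma lessThan_4: "{..<4::nat} = {0, 1, 2, 3}"
  by auto

lemma psum_f4: "psum f4 4 = 0"
  unfolding psum_def lessThan_4 by (simp add: f4_values)

lemma f4_periodic: "f4 (n + int 4) = f4 n"
  using f4_mod[of n] f4_mod[of "n + 4"] by simp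

lemma psum_f4_bounded: "norm (psum f4 n) \<le> 8"
  using psum_bounded[OF f4_periodic _ psum_f4, of 2 n] by (simp add: f4_def)

lemma f4_dual: "dual 4 f4 f4 1 2"
proof -
  have "(\<Sum>a<4. f4 (int a) * exp (2 * of_real pi * \<i> * of_int (int a * n) / of_nat 4)) = 2 * f4 n" for n
  proof -
    define r where "r = nat (n mod 4)"
    have r: "int r = n mod 4" "r < 4" by (auto simp: r_def)
    have "(\<Sum>a<4. f4 (int a) * exp (2 * of_real pi * \<i> * of_int (int a * n) / of_nat 4)) = (\<Sum>a<4. f4 (int a) * ez 4 (int (a * r)))"
    proof (intro sum.cong refl)
      fix a
      have "[int a * n = int a * int r] (mod int 4)" unfolding r(1) by (intro cong_scalar_left) (simp add: cong_def)
      from ez_cong[OF _ this] show "f4 (int a) * exp (2 * of_real pi * \<i> * of_int (int a * n) / of_nat 4) = f4 (int a) * ez 4 (int (a * r))"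
        by (simp add: ez_def)
    qed
    also have "\<dots> = (\<Sum>a<4. f4 (int a) * \<i> ^ (a * r))" by (simp only: ez4)
    also have "\<dots> = 2 * f4 (int r)"
    proof -
      have "r \<in> {0, 1, 2, 3}" using r(2) by auto
      moreover have "\<i> ^ 3 = - \<i>" "\<i> ^ 4 = 1" "\<i> ^ 6 = -1" "\<i> ^ 9 = \<i>"
        using power_mult[of "\<i>" 2 3] power_mult[of "\<i>" 2 4] power_add[of "\<i>" 8 1]
        by (simp_all add: power3_eq_cube power4_eq_xxxx)
      ultimately show ?thesis unfolding lessThan_4 by (auto simp: f4_values)
    qed
    also have "f4 (int r) = f4 n" unfolding r(1) by (rule f4_mod[symmetric])
    finally show ?thesis .
  qed
  moreover have "f4 (- n) = f4 n" for n
  proof -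
    have "(- n) mod 4 = 2 \<longleftrightarrow> n mod 4 = 2" by presburger
    thus ?thesis by (simp add: f4_def)
  qed
  ultimately show ?thesis
    unfolding dual_def using f4_periodic psum_f4 psum_f4_bounded by (auto simp: f4_def)
qed

text \<open>Grouped in fours, every block is nonnegative by convexity of \<open>1 / x\<close>, and
  the first is \<open>1 - 2 / 2 + 1 / 3\<close>.\<close>

lemma Lser_f4_1: "Re (Lser f4 1) \<ge> 1/3"
proof -
  have "(\<lambda>n. f4 (int (Suc n)) * of_nat (Suc n) powr (-1)) sums Lser f4 1"
    by (rule Lser_sums(1)[OF psum_f4_bounded]) simp
  hence "(\<lambda>n. Re (f4 (int (Suc n)) * of_nat (Suc n) powr (-1))) sums Re (Lser f4 1)" by (rule sums_Re)
  moreover have "Re (f4 (int (Suc n)) * of_nat (Suc n) powr (-1)) = Re (f4 (int (Suc n))) / real (Suc n)" for n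
  proof -
    have "(of_nat (Suc n) :: complex) powr (-1) = of_real (1 / real (Suc n))"
      by (simp add: powr_minus divide_inverse del: of_nat_Suc)
    thus ?thesis by (simp del: of_nat_Suc)
  qed
  ultimately have S: "(\<lambda>n. Re (f4 (int (Suc n))) / real (Suc n)) sums Re (Lser f4 1)" by simp
  define T where "T = (\<lambda>N. \<Sum>n<N. Re (f4 (int (Suc n))) / real (Suc n))"
  have T: "T (4 * Suc m) \<ge> 1/3" for m
  proof (induction m)
    case (Suc m)
    define k where "k = 4 * Suc m"
    have "k mod 4 = 0" by (simp add: k_def)
    hence v: "f4 (int (Suc k)) = 1" "f4 (int (Suc (Suc k))) = -2" "f4 (int (Suc (Suc (Suc k)))) = 1" "f4 (int (Suc (Suc (Suc (Suc k))))) = 0"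
      unfolding k_def by (auto simp: f4_def; presburger)+
    have "T (4 * Suc (Suc m)) = T k + (1 / (real k + 1) - 2 / (real k + 2) + 1 / (real k + 3))"
    proof -
      have "4 * Suc (Suc m) = Suc (Suc (Suc (Suc k)))" by (simp add: k_def)
      moreover have TS: "T (Suc N) = T N + Re (f4 (int (Suc N))) / real (Suc N)" for N
        by (simp add: T_def)
      ultimately show ?thesis by (simp only: TS v) (simp add: add_ac)
    qed
    moreover have "1 / (real k + 1) - 2 / (real k + 2) + 1 / (real k + 3) \<ge> 0"
    proof -
      have "1 / (real k + 1) - 2 / (real k + 2) + 1 / (real k + 3) = 2 / ((real k + 1) * (real k + 2) * (real k + 3))"
        by (simp add: divide_simps) (simp add: algebra_simps)
      thus ?thesis by simp
    qed
    ultimately show ?case using Suc by (simp add: k_def)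
  next
    case 0
    show ?case unfolding T_def mult_1_right lessThan_4 by (simp add: lessThan_4 f4_values)
  qed
  show ?thesis
  proof (rule tendsto_lowerbound)
    have "T \<longlonglongrightarrow> Re (Lser f4 1)" using S unfolding sums_def T_def .
    moreover have "filterlim (\<lambda>m. 4 * Suc m) at_top sequentially"
      by (intro filterlim_subseq strict_monoI) auto
    ultimately show "(\<lambda>m. T (4 * Suc m)) \<longlonglongrightarrow> Re (Lser f4 1)" by (rule filterlim_compose)
    show "\<forall>\<^sub>F m in sequentially. 1/3 \<le> T (4 * Suc m)" using T by (intro always_eventually) auto
  qed simp
qed

lemma abs_ln_le:
  assumes "1 / (1 + y) \<le> x" "x \<le> 1 + y" "y \<ge> 0" shows "\<bar>ln x\<bar> \<le> (y::real)"
proof -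
  have x: "x > 0" using assms by (meson less_le_trans zero_less_divide_1_iff add_pos_nonneg zero_less_one)
  have "ln x \<le> x - 1" using x by (rule ln_le_minus_one)
  moreover have "ln (1 / x) \<le> 1 / x - 1" using x by (intro ln_le_minus_one) auto
  moreover have "1 / x \<le> 1 + y" using assms x by (simp add: field_simps)
  ultimately show ?thesis using assms x by (simp add: ln_div)
qed

text \<open>Zeta is the entire function \<open>Lent 4 f4 f4 1 2\<close> divided by the two factors
  at 2, and its constant term is assembled accordingly. The bound 100 is generous: the target for
  large \<open>Q\<close> exceeds 20000.\<close>

lemma zeta_b:
  assumes chi: "dirichlet_character 1 chi"
  shows "\<exists>F c. cont_L chi F \<and> has_b F c \<and> norm c \<le> 100"
proof -
  have chi1: "chi n = 1" for n
    using char_cong[OF chi, of n 1] char_1[OF chi] by simp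
  define L where "L = ln (2::real)"
  have L: "L > 0" "L \<le> 1" using ln_le_minus_one[of "2::real"] by (auto simp: L_def)
  have e: "of_nat 2 powr (-s) = exp (- of_real L * s)" for s :: complex
    using euler_factor_exp[of 2 s] by (simp add: L_def)
  define E1 where "E1 = (\<lambda>s::complex. 1 - exp (- of_real L * s))"
  define E2 where "E2 = (\<lambda>s::complex. 1 - 2 * exp (- of_real L * s))"
  define G where "G = Lent 4 f4 f4 1 2"
  define F where "F = (\<lambda>s. G s / (E2 s * E1 s))"
  have G: "G holomorphic_on UNIV" unfolding G_def by (rule Lent_holomorphic[OF f4_dual]) simp
  hence Ga: "G analytic_on UNIV" by (simp add: analytic_on_open)
  have Ea: "E1 analytic_on UNIV" "E2 analytic_on UNIV" unfolding E1_def E2_def by (auto intro!: analytic_intros)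
  have nz: "E1 s \<noteq> 0" "E2 s \<noteq> 0" if "Re s > 1" for s
  proof -
    have "norm (exp (- of_real L * s)) = exp (- L * Re s)" by simp
    also have "\<dots> < exp (- L)" using L that by simp
    also have "\<dots> = 1/2" by (simp add: L_def exp_minus)
    finally have "norm (exp (- of_real L * s)) < 1/2" .
    moreover have "norm (exp (- of_real L * s)) = 1" if "E1 s = 0" 
    proof -
      have "exp (- of_real L * s) = 1" using that by (simp add: E1_def)
      thus ?thesis by simp
    qed
    moreover have "norm (exp (- of_real L * s)) = 1/2" if "E2 s = 0"
    proof -
      have E: "exp (- of_real L * s) = 1/2" using that by (simp add: E2_def eq_divide_eq mult.commute)
      show ?thesis unfolding E by simp
    qed
    ultimately show "E1 s \<noteq> 0" "E2 s \<noteq> 0" by force+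
  qed
  have "cont_L chi F"
    unfolding cont_L_def
  proof (intro conjI allI impI)
    show "F meromorphic_on UNIV" unfolding F_def
      by (intro meromorphic_on_divide meromorphic_on_mult analytic_on_imp_meromorphic_on Ga Ea)
    show "F analytic_on {s. Re s > 1}" unfolding F_def
      by (intro analytic_intros analytic_on_subset[OF Ga] analytic_on_subset[OF Ea(1)] analytic_on_subset[OF Ea(2)]) (use nz in auto)
    fix s :: complex assume s: "Re s > 1"
    have "summable (\<lambda>n. of_nat (Suc n) powr (-s) :: complex)"
    proof (rule summable_norm_cancel)
      have "summable (\<lambda>n. real (Suc n) powr (- (Re s - 1) - 1))" using s by (intro summable_powr_Suc) auto
      moreover have "norm (of_nat (Suc n) powr (-s) :: complex) = real (Suc n) powr (- (Re s - 1) - 1)" for n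
        using norm_powr_real_powr[of "of_nat (Suc n)" "-s"] by simp
      ultimately show "summable (\<lambda>n. norm (of_nat (Suc n) powr (-s) :: complex))" by simp
    qed
    then obtain Z where Z: "(\<lambda>n. of_nat (Suc n) powr (-s) :: complex) sums Z" by (auto simp: summable_def)
    define h where "h = (\<lambda>n::int. if even n then 0 else (1::complex))"
    have "(\<lambda>n. (1 - (if 2 dvd Suc n then 1 * 1 else 0)) * of_nat (Suc n) powr (-s)) sums ((1 - 1 * of_nat 2 powr (-s)) * Z)"
      using step_sums[of "\<lambda>_. 1" s Z 2 1] Z by simp
    moreover have "1 - (if 2 dvd Suc n then 1 * 1 else 0) = h (int (Suc n))" for n
      by (simp add: h_def)
    ultimately have "(\<lambda>n. h (int (Suc n)) * of_nat (Suc n) powr (-s)) sums (E1 s * Z)" by (simp only: e E1_def mult_1)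
    from step_sums[OF this, of 2 2]
    have "(\<lambda>n. (h (int (Suc n)) - (if 2 dvd Suc n then 2 * h (int (Suc n div 2)) else 0)) * of_nat (Suc n) powr (-s)) sums (E2 s * (E1 s * Z))"
      by (simp only: e E2_def zero_less_numeral simp_thms)
    moreover have "h (int (Suc n)) - (if 2 dvd Suc n then 2 * h (int (Suc n div 2)) else 0) = f4 (int (Suc n))" for n
    proof -
      have "(int m mod 4 = 2) = odd (m div 2)" if "even m" for m :: nat using that by presburger
      thus ?thesis unfolding h_def f4_def by (auto simp del: of_nat_Suc)
    qed
    ultimately have "(\<lambda>n. f4 (int (Suc n)) * of_nat (Suc n) powr (-s)) sums (E2 s * (E1 s * Z))" by simp
    moreover have "(\<lambda>n. f4 (int (Suc n)) * of_nat (Suc n) powr (-s)) sums Lser f4 s"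
      by (rule Lser_sums(1)[OF psum_f4_bounded]) (use s in simp)
    ultimately have "E2 s * (E1 s * Z) = Lser f4 s" by (rule sums_unique2)
    hence "Z = F s" unfolding F_def G_def Lent_def using nz[OF s] s by (simp add: field_simps)
    thus "(\<lambda>n. chi (int (Suc n)) * of_nat (Suc n) powr (-s)) sums F s" using Z by (simp add: chi1)
  qed
  moreover obtain d where d: "(Lser f4 has_field_derivative d) (at 1)"
    using Lser_has_derivative[OF psum_f4_bounded, of 1] by auto
  have l1: "norm (Lser f4 1) \<ge> 1/3" using Lser_f4_1 complex_Re_le_cmod order_trans by blast
  hence "Lser f4 1 \<noteq> 0" by auto
  hence "has_b G (of_real (ln (wfreq 4 1)) + euler_mascheroni - d / Lser f4 1)"
    unfolding G_def by (intro has_b_Lent[OF f4_dual _ _ _ d]) auto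
  moreover have "has_b E1 (- of_real L / 2)" unfolding E1_def by (rule has_b_one_minus_power_1[OF L(1)])
  moreover have "has_b E2 (2 * of_real L / (1 - 2))" unfolding E2_def by (rule has_b_one_minus_power) simp
  ultimately have "cont_L chi F \<and> has_b F ((of_real (ln (wfreq 4 1)) + euler_mascheroni - d / Lser f4 1) - (2 * of_real L / (1 - 2) + (- of_real L / 2)))"
    unfolding F_def by (intro conjI has_b_divide has_b_mult) auto
  moreover have "norm ((of_real (ln (wfreq 4 1)) + euler_mascheroni - d / Lser f4 1) - (2 * of_real L / (1 - 2) + (- of_real L / 2))) \<le> 100"
  proof -
    have w: "\<bar>ln (wfreq 4 1)\<bar> \<le> 1" by (rule abs_ln_le) (use pi_gt3 pi_less_4 in \<open>auto simp: wfreq_def\<close>)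
    have g: "\<bar>euler_mascheroni :: real\<bar> \<le> 1" using euler_mascheroni_less_13_over_22 euler_mascheroni_pos by simp
    have "norm d \<le> 2 * ((ln (real 4))\<^sup>2 / 2 + 1) + 8 * (ln (real (Suc 4)) / real (Suc 4))"
      by (rule Lser_deriv_bound[OF psum_f4_bounded psum_f4 _ _ d]) (auto simp: f4_def)
    also have "\<dots> \<le> 2 * (3\<^sup>2 / 2 + 1) + 8 * (4 / 5)"
    proof -
      have "ln (4::real) \<le> 3" "ln (5::real) \<le> 4" using ln_le_minus_one[of "4::real"] ln_le_minus_one[of "5::real"] by auto
      moreover have "(ln (4::real))\<^sup>2 \<le> 3\<^sup>2" using \<open>ln 4 \<le> 3\<close> by (intro power_mono) auto
      ultimately show ?thesis by simp
    qed
    finally have d: "norm d \<le> 18" by simp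
    have "norm d / norm (Lser f4 1) \<le> 18 / (1/3)" using d l1 by (intro frac_le) auto
    hence "norm (d / Lser f4 1) \<le> 54" by (simp add: norm_divide)
    moreover have "norm (complex_of_real (ln (wfreq 4 1))) \<le> 1" using w by simp
    moreover have "norm (euler_mascheroni :: complex) \<le> 1" using g by (metis norm_of_real of_real_euler_mascheroni)
    moreover have "norm (2 * complex_of_real L / (1 - 2)) \<le> 2" "norm (- complex_of_real L / 2) \<le> 1" using L by (auto simp: norm_divide norm_mult)
    ultimately show ?thesis
      by (smt (verit) norm_triangle_ineq norm_triangle_ineq4)
  qed
  ultimately show ?thesis by blast
qed

section \<open>Zeros and logarithmic derivatives\<close>

text \<open>The map \<open>w = h / (2 * A - h)\<close> fixes 0 and sends the disc into the open unit
  disc because \<open>Re h < A\<close>; Schwarz's lemma then bounds \<open>w\<close>, hence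
  \<open>h\<close>. The strict inequality is what places \<open>w\<close> in the open disc; the weak
  form follows by letting \<open>A'\<close> decrease to \<open>A\<close>.\<close>

lemma Borel_Caratheodory_strict:
  assumes hol: "h holomorphic_on ball 0 R" and R: "R > 0" and h0: "h 0 = 0"
    and A: "\<And>z. z \<in> ball 0 R \<Longrightarrow> Re (h z) < A"
  shows "norm (deriv h 0) \<le> 2 * A / R" and "\<And>z. z \<in> ball 0 R \<Longrightarrow> norm (h z) \<le> 2 * A * norm z / (R - norm z)"
proof -
  have A0: "A > 0" using A[of 0] R h0 by simp
  define w where "w = (\<lambda>z. h (of_real R * z) / (2 * of_real A - h (of_real R * z)))"
  have inb: "of_real R * z \<in> ball 0 R" if "norm z < 1" for z :: complex
    using that R by (simp add: norm_mult)
  have nz: "2 * of_real A - h (of_real R * z) \<noteq> 0" if "norm z < 1" for z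
  proof
    assume "2 * of_real A - h (of_real R * z) = 0"
    hence "Re (h (of_real R * z)) = 2 * A" by (simp add: complex_eq_iff)
    thus False using A[OF inb[OF that]] A0 by simp
  qed
  have hR: "(\<lambda>z. h (of_real R * z)) holomorphic_on ball 0 1"
    by (rule holomorphic_on_compose_gen[unfolded o_def, OF _ hol]) (use inb in \<open>auto intro!: holomorphic_intros\<close>)
  have wh: "w holomorphic_on ball 0 1"
    unfolding w_def by (intro holomorphic_intros hR) (use nz in auto)
  have w0: "w 0 = 0" by (simp add: w_def h0)
  have w1: "norm (w z) < 1" if "norm z < 1" for z
  proof -
    define v where "v = h (of_real R * z)"
    have v: "Re v < A" unfolding v_def by (rule A[OF inb[OF that]])
    have "(norm v)\<^sup>2 < (norm (2 * of_real A - v))\<^sup>2"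
    proof -
      have "(norm (2 * of_real A - v))\<^sup>2 - (norm v)\<^sup>2 = 4 * A * (A - Re v)"
        unfolding cmod_power2 by (simp add: power2_eq_square algebra_simps)
      also have "\<dots> > 0" using v A0 by simp
      finally show ?thesis by simp
    qed
    hence "norm v < norm (2 * of_real A - v)" by (rule power2_less_imp_less) simp
    thus ?thesis unfolding w_def v_def[symmetric] norm_divide using nz[OF that]
      by (simp add: v_def divide_less_eq)
  qed
  note SL = Schwarz_Lemma[OF wh w0 w1]
  have dh: "(h has_field_derivative deriv h 0) (at 0)"
    using hol R by (intro holomorphic_derivI[of h "ball 0 R"]) auto
  have "((\<lambda>z. h (of_real R * z)) has_field_derivative deriv h 0 * of_real R) (at 0)"
  proof -
    have "((\<lambda>z. of_real R * z) has_field_derivative of_real R) (at 0)" by (auto intro!: derivative_eq_intros)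
    moreover have "(h has_field_derivative deriv h 0) (at (of_real R * 0))" using dh by simp
    ultimately show ?thesis by (rule DERIV_chain')
  qed
  hence "(w has_field_derivative (deriv h 0 * of_real R * (2 * of_real A - h (of_real R * 0)) - h (of_real R * 0) * (0 - deriv h 0 * of_real R)) / ((2 * of_real A - h (of_real R * 0)) * (2 * of_real A - h (of_real R * 0)))) (at 0)"
    unfolding w_def by (intro DERIV_divide DERIV_diff) (use nz[of 0] in auto)
  hence "(w has_field_derivative (deriv h 0 * of_real R / (2 * of_real A))) (at 0)"
    using A0 by (simp add: h0 mult.commute)
  hence dw: "deriv w 0 = deriv h 0 * of_real R / (2 * of_real A)" by (rule DERIV_imp_deriv)
  have "norm (deriv w 0) \<le> 1" using SL(2)[of 0] by simp
  thus "norm (deriv h 0) \<le> 2 * A / R" unfolding dw using A0 R by (simp add: norm_divide norm_mult field_simps)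
  fix z :: complex assume z: "z \<in> ball 0 R"
  define y where "y = z / of_real R"
  have y: "norm y = norm z / R" "of_real R * y = z" using R by (simp_all add: y_def norm_divide)
  have y1: "norm y < 1" using z R by (simp add: y)
  have wy: "norm (w y) \<le> norm y" by (rule SL(1)[OF _ y1]) auto
  have "w y * (2 * of_real A - h z) = h z" using nz[OF y1] by (simp add: w_def y)
  hence "h z * (1 + w y) = 2 * of_real A * w y" by (simp add: algebra_simps)
  hence eq: "norm (h z) * norm (1 + w y) = 2 * A * norm (w y)" using A0 by (metis abs_of_pos mult_numeral_1 norm_mult norm_numeral norm_of_real)
  have "1 - norm y \<le> norm (1 + w y)"
    using norm_triangle_ineq2[of 1 "- w y"] wy by simp
  hence "norm (h z) * (1 - norm y) \<le> norm (h z) * norm (1 + w y)" by (intro mult_left_mono) auto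
  also have "\<dots> \<le> 2 * A * norm y" unfolding eq using wy A0 by (intro mult_left_mono) auto
  finally have F0: "norm (h z) * (1 - norm y) \<le> 2 * A * norm y" .
  have F1: "norm (h z) * (1 - norm y) * R \<le> 2 * A * norm y * R" using R F0 by (intro mult_right_mono) auto
  have F2: "norm y * R = norm z" using R by (simp add: y)
  have F4: "2 * A * norm y * R = 2 * A * norm z" using F2 by (simp only: mult.assoc)
  have F3: "norm (h z) * (1 - norm y) * R = norm (h z) * (R - norm y * R)" by (simp add: algebra_simps)
  have "norm (h z) * (R - norm z) \<le> 2 * A * norm z" using F1 F4 F3[unfolded F2] by linarith
  thus "norm (h z) \<le> 2 * A * norm z / (R - norm z)" using z by (simp add: field_simps)
qed

lemma Borel_Caratheodory:
  assumes hol: "h holomorphic_on ball 0 R" and R: "R > 0" and h0: "h 0 = 0"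
    and A: "\<And>z. z \<in> ball 0 R \<Longrightarrow> Re (h z) \<le> A"
  shows "norm (deriv h 0) \<le> 2 * A / R" and "\<And>z. z \<in> ball 0 R \<Longrightarrow> norm (h z) \<le> 2 * A * norm z / (R - norm z)"
proof -
  have lt: "Re (h z) < A'" if "A' > A" "z \<in> ball 0 R" for A' z
    using A[OF that(2)] that(1) by linarith
  have S1: "norm (deriv h 0) \<le> 2 * A' * (1 / R)" if "A' > A" for A'
    using Borel_Caratheodory_strict(1)[OF hol R h0 lt[OF that]] by simp
  have S2: "norm (h z) \<le> 2 * A' * (norm z / (R - norm z))" if "A' > A" "z \<in> ball 0 R" for A' z
    using Borel_Caratheodory_strict(2)[OF hol R h0 lt[OF that(1)] that(2)] by simp
  have lim: "((\<lambda>A'. 2 * A' * c) \<longlongrightarrow> 2 * A * c) (at_right A)" for c by (intro tendsto_intros)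
  have ev: "\<forall>\<^sub>F A' in at_right A. A' > A" by (rule eventually_at_right_less)
  have "norm (deriv h 0) \<le> 2 * A * (1 / R)"
    by (rule tendsto_lowerbound[OF lim]) (rule eventually_mono[OF ev S1], simp_all)
  thus "norm (deriv h 0) \<le> 2 * A / R" by simp
  fix z :: complex assume z: "z \<in> ball 0 R"
  have "norm (h z) \<le> 2 * A * (norm z / (R - norm z))"
    by (rule tendsto_lowerbound[OF lim]) (rule eventually_mono[OF ev S2[OF _ z]], simp_all)
  thus "norm (h z) \<le> 2 * A * norm z / (R - norm z)" by simp
qed

text \<open>Borel-Caratheodory applied to a holomorphic logarithm of \<open>g\<close>, shifted to
  vanish at the centre. The second part is a Harnack-type inequality that carries a lower bound for
  \<open>norm g\<close> from the centre to nearby points.\<close>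

lemma zero_free_bounds:
  assumes hol: "g holomorphic_on ball c R" and R: "R > 0" and nz: "\<And>z. z \<in> ball c R \<Longrightarrow> g z \<noteq> 0"
    and M: "\<And>z. z \<in> ball c R \<Longrightarrow> norm (g z) \<le> M"
  shows "norm (deriv g c / g c) \<le> 2 * ln (M / norm (g c)) / R"
    and "\<And>z. z \<in> ball c R \<Longrightarrow> ln (norm (g c)) - 2 * ln (M / norm (g c)) * norm (z - c) / (R - norm (z - c)) \<le> ln (norm (g z))"
proof -
  obtain l where l: "l holomorphic_on ball c R" "\<And>z. z \<in> ball c R \<Longrightarrow> g z = exp (l z)"
    using contractible_imp_holomorphic_log[OF hol convex_imp_contractible[OF convex_ball] nz] by metis
  have c: "c \<in> ball c R" using R by simp
  define h where "h = (\<lambda>z. l (c + z) - l c)"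
  have inb: "z \<in> ball 0 R \<Longrightarrow> c + z \<in> ball c R" for z by (simp add: dist_norm)
  have hh: "h holomorphic_on ball 0 R" unfolding h_def
    by (intro holomorphic_intros holomorphic_on_compose_gen[unfolded o_def, OF _ l(1)]) (use inb in auto)
  have Reh: "Re (h z) = ln (norm (g (c + z))) - ln (norm (g c))" if "z \<in> ball 0 R" for z
    using l(2)[OF c] l(2)[OF inb[OF that]] by (simp add: h_def)
  have Rh: "Re (h z) \<le> ln (M / norm (g c))" if "z \<in> ball 0 R" for z
  proof -
    have g: "norm (g (c + z)) > 0" "norm (g c) > 0" using nz inb that c by auto
    have le: "norm (g (c + z)) \<le> M" using M inb that by auto
    have M0: "M > 0" using g(1) le by linarith
    have "ln (norm (g (c + z))) \<le> ln M" using ln_le_cancel_iff[OF g(1) M0] le by blast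
    moreover have "ln (M / norm (g c)) = ln M - ln (norm (g c))" using M0 g(2) by (simp add: ln_div)
    ultimately
    show ?thesis unfolding Reh[OF that] by simp
  qed
  have h00: "h 0 = 0" by (simp add: h_def)
  note BC = Borel_Caratheodory[OF hh R h00 Rh]
  have dl: "(l has_field_derivative deriv l c) (at c)"
    using l(1) R by (intro holomorphic_derivI[of l "ball c R"]) auto
  have "((\<lambda>z. l (c + z)) has_field_derivative deriv l c * 1) (at 0)"
    by (rule DERIV_chain'[of "\<lambda>z. c + z" 1]) (use dl in \<open>auto intro!: derivative_eq_intros\<close>)
  hence "(h has_field_derivative deriv l c) (at 0)"
    unfolding h_def by (auto intro!: derivative_eq_intros)
  hence d1: "deriv h 0 = deriv l c" by (rule DERIV_imp_deriv)
  have d: "((\<lambda>z. exp (l z)) has_field_derivative exp (l c) * deriv l c) (at c)"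
    using dl by (auto intro!: derivative_eq_intros)
  have ev: "\<forall>\<^sub>F z in nhds c. exp (l z) = g z"
  proof -
    have "\<forall>\<^sub>F z in nhds c. z \<in> ball c R" using c by (intro eventually_nhds_in_open) auto
    thus ?thesis by eventually_elim (simp add: l(2))
  qed
  have "(g has_field_derivative exp (l c) * deriv l c) (at c)"
    by (rule iffD1[OF DERIV_cong_ev[OF refl ev refl] d])
  hence "deriv g c / g c = deriv l c" using l(2)[OF c] by (simp add: DERIV_imp_deriv)
  thus "norm (deriv g c / g c) \<le> 2 * ln (M / norm (g c)) / R" using BC(1) by (simp add: d1)
  fix z assume z: "z \<in> ball c R"
  hence z': "z - c \<in> ball 0 R" by (simp add: dist_norm norm_minus_commute)
  have "norm (h (z - c)) \<le> 2 * ln (M / norm (g c)) * norm (z - c) / (R - norm (z - c))"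
    by (rule BC(2)) (use z' in auto)
  moreover have "- norm (h (z - c)) \<le> Re (h (z - c))" using abs_Re_le_cmod[of "h (z - c)"] by linarith
  ultimately show "ln (norm (g c)) - 2 * ln (M / norm (g c)) * norm (z - c) / (R - norm (z - c)) \<le> ln (norm (g z))"
    using Reh[OF z'] by simp
qed

lemma remove_zero:
  assumes hol: "f holomorphic_on ball c R1" and R: "0 < R" "R < R1"
    and M: "\<And>z. norm (z - c) \<le> R \<Longrightarrow> norm (f z) \<le> M"
    and fc: "f c \<noteq> 0" and rho: "f \<rho> = 0" "norm (\<rho> - c) < R"
  obtains g where "g holomorphic_on ball c R1" "\<And>z. norm (z - c) \<le> R \<Longrightarrow> norm (g z) \<le> M"
    "norm (g c) = norm (f c) * R / norm (c - \<rho>)" "\<And>z. norm (z - c) < R \<Longrightarrow> g z = 0 \<Longrightarrow> f z = 0"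
    "deriv f c / f c = deriv g c / g c + 1 / (c - \<rho>) - cnj (c - \<rho>) / of_real (R\<^sup>2)"
proof -
  define q where "q = (\<lambda>z. if z = \<rho> then deriv f \<rho> else (f z - f \<rho>) / (z - \<rho>))"
  have q: "q holomorphic_on ball c R1" unfolding q_def by (rule pole_lemma_open[OF hol]) simp
  have fq: "f z = (z - \<rho>) * q z" for z using rho by (simp add: q_def)
  define a where "a = \<rho> - c"
  have ne: "c \<noteq> \<rho>" using fc rho by auto
  have a: "a \<noteq> 0" "norm a < R" using ne rho by (auto simp: a_def)
  define e where "e = (\<lambda>z. (of_real (R\<^sup>2) - cnj a * (z - c)) / of_real R)"
  define g where "g = (\<lambda>z. q z * e z)"
  have eh: "e holomorphic_on UNIV" unfolding e_def by (intro holomorphic_intros) (use R in auto)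
  have gh: "g holomorphic_on ball c R1" unfolding g_def by (intro holomorphic_intros q holomorphic_on_subset[OF eh]) auto
  have ez: "e z \<noteq> 0" if "norm (z - c) < R" for z
  proof
    assume "e z = 0"
    hence "complex_of_real (R\<^sup>2) = cnj a * (z - c)" using R by (simp add: e_def)
    hence "norm (complex_of_real (R\<^sup>2)) = norm a * norm (z - c)" by (simp only: norm_mult complex_mod_cnj)
    hence "R * R = norm a * norm (z - c)" by (simp only: norm_of_real) (simp add: power2_eq_square)
    moreover have "norm a * norm (z - c) < R * R" using that a by (intro mult_strict_mono') auto
    ultimately show False by simp
  qed
  have sph: "norm (g z) \<le> M" if "norm (z - c) = R" for z
  proof -
    define w where "w = z - c"
    have w1: "norm w = R" using that by (simp add: w_def)
    have w: "norm w = R" "w * cnj w = of_real (R\<^sup>2)" using w1 complex_norm_square[of w] by metis+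
    have "of_real (R\<^sup>2) - cnj a * w = w * cnj (w - a)" unfolding w(2)[symmetric] by (simp add: algebra_simps)
    hence "norm (e z) = norm (z - \<rho>)"
      unfolding e_def w_def[symmetric] norm_divide using R w(1) by (simp add: norm_mult del: complex_cnj_diff) (simp add: w_def a_def)
    hence "norm (g z) = norm (f z)" by (simp add: g_def fq norm_mult)
    thus ?thesis using M[of z] that by simp
  qed
  have "norm (g z) \<le> M" if "norm (z - c) \<le> R" for z
  proof (rule maximum_modulus_frontier[of g "cball c R" M z])
    show "g holomorphic_on interior (cball c R)"
      by (rule holomorphic_on_subset[OF gh]) (use R in auto)
    show "continuous_on (closure (cball c R)) g"
      using R by (intro holomorphic_on_imp_continuous_on holomorphic_on_subset[OF gh]) auto
    show "norm (g w) \<le> M" if "w \<in> frontier (cball c R)" for w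
      using that R by (intro sph) (auto simp: frontier_cball dist_norm norm_minus_commute)
    show "z \<in> cball c R" using that by (simp add: dist_norm norm_minus_commute)
  qed auto
  moreover have "norm (g c) = norm (f c) * R / norm (c - \<rho>)"
    using ne R by (simp add: g_def fq[of c] e_def norm_mult norm_divide power2_eq_square)
  moreover have "f z = 0" if "norm (z - c) < R" "g z = 0" for z
    using ez[OF that(1)] that(2) by (simp add: g_def fq)
  moreover have "deriv f c / f c = deriv g c / g c + 1 / (c - \<rho>) - cnj (c - \<rho>) / of_real (R\<^sup>2)"
  proof -
    have "R1 > 0" using R by simp
    hence dq: "(q has_field_derivative deriv q c) (at c)"
      using q by (intro holomorphic_derivI[of q "ball c R1"]) auto
    have "((\<lambda>z. (z - \<rho>) * q z) has_field_derivative (q c + (c - \<rho>) * deriv q c)) (at c)"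
      by (rule derivative_eq_intros dq refl | simp)+
    hence 1: "deriv f c = q c + (c - \<rho>) * deriv q c" using fq DERIV_imp_deriv by (metis (no_types, lifting) ext)
    have "(e has_field_derivative (- cnj a / of_real R)) (at c)"
      unfolding e_def using R by (auto intro!: derivative_eq_intros)
    hence "(g has_field_derivative (deriv q c * e c + (- cnj a / of_real R) * q c)) (at c)"
      unfolding g_def by (intro DERIV_mult dq)
    hence 2: "deriv g c = deriv q c * e c + (- cnj a / of_real R) * q c" by (rule DERIV_imp_deriv)
    have ec: "e c = of_real R" using R by (simp add: e_def power2_eq_square)
    have qc: "q c \<noteq> 0" using fc by (simp add: fq)
    have gc: "g c = q c * of_real R" by (simp add: g_def ec)
    have "deriv g c / g c = deriv q c / q c - cnj a / of_real (R\<^sup>2)"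
      unfolding 2 gc ec using qc R by (simp add: field_simps power2_eq_square)
    moreover have "deriv f c / f c = deriv q c / q c + 1 / (c - \<rho>)"
      unfolding 1 fq[of c] using qc ne by (simp add: field_simps)
    moreover have "cnj (c - \<rho>) = - cnj a" by (simp add: a_def)
    ultimately show ?thesis by simp
  qed
  ultimately show ?thesis using that[of g] gh by blast
qed

text \<open>Zeros within \<open>\<theta> * R\<close> are divided out one at a time. Each lies to the
  left of \<open>c\<close>, so its contribution to the real part of the logarithmic derivative is
  nonnegative and may be dropped. Each removal multiplies the value at the centre by at least
  \<open>1 / \<theta>\<close> under the fixed bound \<open>M\<close>, so the process ends; this
  takes the place of a count of the zeros. What remains is free of zeros in radius
  \<open>\<theta> * R\<close>.\<close>

lemma minus_logderiv_le:
  assumes "f holomorphic_on ball c R1" and R: "0 < R" "R < R1" and th: "0 < \<theta>" "\<theta> < 1"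
    and "\<And>z. norm (z - c) \<le> R \<Longrightarrow> norm (f z) \<le> M"
    and "f c \<noteq> 0" and "\<And>z. norm (z - c) < R \<Longrightarrow> f z = 0 \<Longrightarrow> Re z \<le> Re c"
  shows "- Re (deriv f c / f c) \<le> 2 * ln (M / norm (f c)) / (\<theta> * R)"
proof -
  have main: "M * \<theta> ^ n < norm (f c) \<Longrightarrow> - Re (deriv f c / f c) \<le> 2 * ln (M / norm (f c)) / (\<theta> * R)"
    if "f holomorphic_on ball c R1" "\<And>z. norm (z - c) \<le> R \<Longrightarrow> norm (f z) \<le> M" "f c \<noteq> 0"
       "\<And>z. norm (z - c) < R \<Longrightarrow> f z = 0 \<Longrightarrow> Re z \<le> Re c" for n f
    using that
  proof (induction n arbitrary: f)
    case 0
    have "norm (f c) \<le> M" using R by (intro "0.prems") auto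
    thus ?case using "0.prems"(1) by simp
  next
    case (Suc n)
    show ?case
    proof (cases "\<exists>\<rho>. f \<rho> = 0 \<and> norm (\<rho> - c) < \<theta> * R")
      case False
      have le: "\<theta> * R \<le> R" using th R by simp
      have tR: "\<theta> * R > 0" using th R by simp
      have "norm (deriv f c / f c) \<le> 2 * ln (M / norm (f c)) / (\<theta> * R)"
      proof (rule zero_free_bounds(1)[OF _ tR])
        show "f holomorphic_on ball c (\<theta> * R)" by (rule holomorphic_on_subset[OF Suc.prems(2) subset_ball]) (use le R in linarith)
        fix z assume "z \<in> ball c (\<theta> * R)"
        hence z: "norm (z - c) < \<theta> * R" by (simp add: dist_norm norm_minus_commute)
        show "f z \<noteq> 0" using False z by auto
        show "norm (f z) \<le> M" using Suc.prems(3)[of z] z le by simp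
      qed
      thus ?thesis using abs_Re_le_cmod[of "deriv f c / f c"] by linarith
    next
      case True
      then obtain \<rho> where rho: "f \<rho> = 0" "norm (\<rho> - c) < \<theta> * R" by blast
      have le: "\<theta> * R \<le> R" using th R by simp
      have rho': "norm (\<rho> - c) < R" using rho le by simp
      obtain g where g: "g holomorphic_on ball c R1" "\<And>z. norm (z - c) \<le> R \<Longrightarrow> norm (g z) \<le> M"
        "norm (g c) = norm (f c) * R / norm (c - \<rho>)" "\<And>z. norm (z - c) < R \<Longrightarrow> g z = 0 \<Longrightarrow> f z = 0"
        "deriv f c / f c = deriv g c / g c + 1 / (c - \<rho>) - cnj (c - \<rho>) / of_real (R\<^sup>2)"
        using remove_zero[OF Suc.prems(2) R Suc.prems(3,4) rho(1) rho'] by blast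
      have ne: "c \<noteq> \<rho>" using rho Suc.prems(4) by auto
      define d where "d = norm (c - \<rho>)"
      have d: "d > 0" "d < \<theta> * R" "d < R" using ne rho rho' by (auto simp: d_def norm_minus_commute)
      have fc: "norm (f c) > 0" using Suc.prems(4) by simp
      have gc: "norm (g c) \<ge> norm (f c) / \<theta>"
        unfolding g(3) d_def[symmetric] using d fc th R by (simp add: field_simps)
      have "M * \<theta> ^ n < norm (f c) / \<theta>" using Suc.prems(1) th by (simp add: field_simps)
      hence 1: "M * \<theta> ^ n < norm (g c)" using gc by simp
      have gc0: "norm (g c) > 0" using gc fc th by (meson divide_pos_pos less_le_trans)
      have Mf: "norm (f c) \<le> M" using Suc.prems(3)[of c] R by simp
      have M0: "M > 0" using Mf fc by linarith
      have "norm (f c) \<le> norm (f c) / \<theta>" using th fc by (simp add: field_simps)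
      hence gf: "norm (f c) \<le> norm (g c)" using gc by simp
      have "- Re (deriv g c / g c) \<le> 2 * ln (M / norm (g c)) / (\<theta> * R)"
      proof (rule Suc.IH[OF 1 g(1,2)])
        show "g c \<noteq> 0" using gc0 by auto
        show "Re z \<le> Re c" if "norm (z - c) < R" "g z = 0" for z
          using Suc.prems(5)[OF that(1)] g(4)[OF that] by blast
      qed
      also have "\<dots> \<le> 2 * ln (M / norm (f c)) / (\<theta> * R)"
      proof -
        have "ln (M / norm (g c)) \<le> ln (M / norm (f c))"
          using gf fc gc0 Mf by (subst ln_le_cancel_iff) (auto intro!: divide_left_mono divide_pos_pos mult_pos_pos M0 less_imp_le[OF M0])
        thus ?thesis using th R by (intro divide_right_mono mult_left_mono) auto
      qed
      finally have "- Re (deriv g c / g c) \<le> 2 * ln (M / norm (f c)) / (\<theta> * R)" .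
      moreover have "Re (1 / (c - \<rho>) - cnj (c - \<rho>) / of_real (R\<^sup>2)) \<ge> 0"
      proof -
        have "Re (1 / (c - \<rho>)) = Re (c - \<rho>) / d\<^sup>2"
          unfolding d_def by (simp add: Re_divide cmod_power2)
        moreover have "Re (cnj (c - \<rho>) / of_real (R\<^sup>2)) = Re (c - \<rho>) / R\<^sup>2"
          by (simp only: Re_divide_of_real complex_cnj cnj.sel)
        moreover have "Re (c - \<rho>) / R\<^sup>2 \<le> Re (c - \<rho>) / d\<^sup>2"
          using d Suc.prems(5)[OF rho' rho(1)] by (intro divide_left_mono power_mono mult_pos_pos) auto
        ultimately show ?thesis by (simp only: minus_complex.sel)
      qed
      ultimately show ?thesis unfolding g(5) by simp
    qed
  qed
  have "(\<lambda>n. M * \<theta> ^ n) \<longlonglongrightarrow> 0" using th by (intro tendsto_mult_right_zero LIMSEQ_realpow_zero) auto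
  hence "\<forall>\<^sub>F n in sequentially. M * \<theta> ^ n < norm (f c)"
    using assms(7) by (intro order_tendstoD) auto
  then obtain n where "M * \<theta> ^ n < norm (f c)" by (auto simp: eventually_sequentially)
  thus ?thesis using main[OF assms(1,6,7,8)] by blast
qed

text \<open>Remove the prescribed zero first and keep its term; \<open>minus_logderiv_le\<close>
  treats the quotient, whose value at the centre has only become larger.\<close>

lemma minus_logderiv_zero_le:
  assumes hol: "f holomorphic_on ball c R1" and R: "0 < R" "R < R1" and th: "0 < \<theta>" "\<theta> < 1"
    and M: "\<And>z. norm (z - c) \<le> R \<Longrightarrow> norm (f z) \<le> M"
    and fc: "f c \<noteq> 0" and z: "\<And>z. norm (z - c) < R \<Longrightarrow> f z = 0 \<Longrightarrow> Re z \<le> Re c"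
    and rho: "f \<rho> = 0" "norm (\<rho> - c) < R"
  shows "- Re (deriv f c / f c) \<le> 2 * ln (M / norm (f c)) / (\<theta> * R) - Re (c - \<rho>) * (1 / (norm (c - \<rho>))\<^sup>2 - 1 / R\<^sup>2)"
proof -
  obtain g where g: "g holomorphic_on ball c R1" "\<And>z. norm (z - c) \<le> R \<Longrightarrow> norm (g z) \<le> M"
    "norm (g c) = norm (f c) * R / norm (c - \<rho>)" "\<And>z. norm (z - c) < R \<Longrightarrow> g z = 0 \<Longrightarrow> f z = 0"
    "deriv f c / f c = deriv g c / g c + 1 / (c - \<rho>) - cnj (c - \<rho>) / of_real (R\<^sup>2)"
    using remove_zero[OF hol R M fc rho] by blast
  define d where "d = norm (c - \<rho>)"
  have "c \<noteq> \<rho>" using rho fc by auto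
  hence d: "d > 0" "d < R" using rho by (auto simp: d_def norm_minus_commute)
  have f0: "norm (f c) > 0" using fc by simp
  have gf: "norm (f c) \<le> norm (g c)" unfolding g(3) d_def[symmetric] using d f0 by (simp add: field_simps)
  have gc0: "norm (g c) > 0" by (rule less_le_trans[OF f0 gf])
  have Mf: "norm (f c) \<le> M" using M[of c] R by simp
  have M0: "M > 0" using Mf f0 by linarith
  have "- Re (deriv g c / g c) \<le> 2 * ln (M / norm (g c)) / (\<theta> * R)"
    by (rule minus_logderiv_le[OF g(1) R th g(2)]) (use gc0 g(4) z in auto)
  also have "\<dots> \<le> 2 * ln (M / norm (f c)) / (\<theta> * R)"
  proof -
    have "ln (M / norm (g c)) \<le> ln (M / norm (f c))"
      using gf f0 gc0 Mf by (subst ln_le_cancel_iff) (auto intro!: divide_left_mono divide_pos_pos mult_pos_pos M0 less_imp_le[OF M0])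
    thus ?thesis using th R by (intro divide_right_mono mult_left_mono) auto
  qed
  finally have 1: "- Re (deriv g c / g c) \<le> 2 * ln (M / norm (f c)) / (\<theta> * R)" .
  have "Re (1 / (c - \<rho>)) = Re (c - \<rho>) / d\<^sup>2"
    unfolding d_def by (simp add: Re_divide cmod_power2)
  moreover have "Re (cnj (c - \<rho>) / of_real (R\<^sup>2)) = Re (c - \<rho>) / R\<^sup>2"
    by (simp only: Re_divide_of_real complex_cnj cnj.sel)
  ultimately have "Re (deriv f c / f c) = Re (deriv g c / g c) + Re (c - \<rho>) * (1 / d\<^sup>2 - 1 / R\<^sup>2)"
    unfolding g(5) by (simp only: minus_complex.sel plus_complex.sel) (simp add: right_diff_distrib)
  thus ?thesis using 1 by (simp add: d_def)
qed

section \<open>Divisor sums and Euler products\<close>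

text \<open>Regrouping of a double series along the bijection between pairs \<open>(d, m)\<close>
  and pairs of \<open>n = d * m\<close> with a divisor \<open>d\<close>. It serves both Dirichlet
  convolutions and Lambert series.\<close>

lemma divisor_sum_has_sum:
  fixes f :: "nat \<times> nat \<Rightarrow> 'a::banach"
  assumes "(f has_sum S) ({0<..} \<times> {0<..})"
  shows "((\<lambda>n. \<Sum>d | d dvd n. f (d, n div d)) has_sum S) {0<..}"
proof -
  have "((\<lambda>(n, d). f (d, n div d)) has_sum S) (SIGMA n:{0<..}. {d. d dvd n})"
    by (rule has_sum_reindex_bij_witness[of _ "\<lambda>(d, m). (d * m, d)" "\<lambda>(n, d). (d, n div d)", THEN iffD2, OF _ _ _ _ _ _ assms])
       (auto elim!: dvdE)
  from has_sum_SigmaD[OF this, of "\<lambda>n. \<Sum>d | d dvd n. f (d, n div d)"]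
  show ?thesis by (auto intro!: has_sum_finiteI)
qed

lemma dirichlet_convolution_sums:
  fixes a b :: "nat \<Rightarrow> complex"
  assumes a: "summable (\<lambda>n. norm (a n))" and b: "summable (\<lambda>n. norm (b n))" and a0: "a 0 = 0" and b0: "b 0 = 0"
  shows "(\<lambda>n. \<Sum>d | d dvd n. a d * b (n div d)) sums ((\<Sum>n. a n) * (\<Sum>n. b n))"
proof -
  define A where "A = (\<Sum>n. a n)"
  define B where "B = (\<Sum>n. b n)"
  have hb: "(b has_sum B) UNIV"
    by (rule norm_summable_imp_has_sum[OF b]) (simp add: B_def summable_norm_cancel[OF b] summable_sums)
  have ha: "(a has_sum A) UNIV"
    by (rule norm_summable_imp_has_sum[OF a]) (simp add: A_def summable_norm_cancel[OF a] summable_sums)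
  have aa: "(\<lambda>x. norm (a x)) summable_on UNIV" and bb: "(\<lambda>x. norm (b x)) summable_on UNIV"
    using a b by (auto intro!: norm_summable_imp_summable_on)
  have "(\<lambda>p. norm (a (fst p) * b (snd p))) summable_on (UNIV \<times> UNIV)"
    unfolding Infinite_Sum.abs_summable_on_Sigma_iff
  proof (intro conjI ballI)
    fix x show "(\<lambda>y. norm (a (fst (x, y)) * b (snd (x, y)))) summable_on UNIV"
      using bb by (simp add: norm_mult summable_on_cmult_right)
    have "(\<lambda>x. norm (a x) * (\<Sum>\<^sub>\<infinity>y. norm (b y))) summable_on UNIV"
      using aa by (intro summable_on_cmult_left)
    moreover have "norm (\<Sum>\<^sub>\<infinity>y. norm (a (fst (x, y)) * b (snd (x, y)))) = norm (a x) * (\<Sum>\<^sub>\<infinity>y. norm (b y))" for x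
    proof -
      have "(\<Sum>\<^sub>\<infinity>y. norm (a x) * norm (b y)) = norm (a x) * (\<Sum>\<^sub>\<infinity>y. norm (b y))"
        by (rule infsum_cmult_right) (use bb in auto)
      thus ?thesis by (simp add: norm_mult infsum_nonneg abs_mult)
    qed
    ultimately show "(\<lambda>x. norm (\<Sum>\<^sub>\<infinity>y. norm (a (fst (x, y)) * b (snd (x, y))))) summable_on UNIV" by simp
  qed
  hence "(\<lambda>p. a (fst p) * b (snd p)) summable_on (UNIV \<times> UNIV)" by (rule Infinite_Sum.abs_summable_summable)
  hence "((\<lambda>p. a (fst p) * b (snd p)) has_sum (A * B)) (UNIV \<times> UNIV)"
    using has_sum_cmult_right[OF hb] has_sum_cmult_left[OF ha]
    by (intro has_sum_SigmaI[where g = "\<lambda>x. a x * B"]) auto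
  hence "((\<lambda>p. a (fst p) * b (snd p)) has_sum (A * B)) ({0<..} \<times> {0<..})"
  proof (rule has_sum_cong_neutral[THEN iffD1, rotated -1])
    fix p :: "nat \<times> nat" assume "p \<in> UNIV \<times> UNIV - {0<..} \<times> {0<..}"
    thus "a (fst p) * b (snd p) = 0" using a0 b0 by (cases p) auto
  qed auto
  from divisor_sum_has_sum[OF this]
  have "((\<lambda>n. \<Sum>d | d dvd n. a d * b (n div d)) has_sum (A * B)) {0<..}" by simp
  \<comment> \<open>At \<open>n = 0\<close> the set of divisors is infinite, so the sum over it is 0
    by convention and the index 0 can be added.\<close>
  hence "((\<lambda>n. \<Sum>d | d dvd n. a d * b (n div d)) has_sum (A * B)) UNIV"
    by (rule has_sum_cong_neutral[THEN iffD1, rotated -1]) auto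
  thus ?thesis unfolding A_def B_def by (rule has_sum_imp_sums)
qed

section \<open>Zeta at real points and truncated Euler products\<close>

lemma powr_diff_lower:
  assumes x: "x > 0" and a: "0 < (a::real)"
  shows "x * (a+1) powr (-x-1) \<le> a powr (-x) - (a+1) powr (-x)"
proof -
  have "\<exists>u>a. u < a+1 \<and> (a+1) powr (-x) - a powr (-x) = (a+1-a) * (-x * u powr (-x-1))"
    by (rule MVT2) (use a in \<open>auto intro!: derivative_eq_intros\<close>)
  then obtain u where u: "u > a" "u < a+1" "(a+1) powr (-x) - a powr (-x) = (-x * u powr (-x-1))" by auto
  have "(a+1) powr (-x-1) \<le> u powr (-x-1)" using u a x by (intro powr_mono2') auto
  hence "x * (a+1) powr (-x-1) \<le> x * u powr (-x-1)" using x by (intro mult_left_mono) auto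
  thus ?thesis using u(3) by auto
qed

definition zet :: "real \<Rightarrow> real" where "zet x = (\<Sum>n. real (Suc n) powr (-x))"

lemma zet_summable: "x > 1 \<Longrightarrow> summable (\<lambda>n. real (Suc n) powr (-x))"
  using summable_powr_Suc[of "x - 1"] by simp

lemma zet_bounds:
  assumes "x > 1"
  shows "1 / (x - 1) \<le> zet x" "zet x \<le> 1 + 1 / (x - 1)"
proof -
  define y where "y = x - 1"
  have y: "y > 0" using assms by (simp add: y_def)
  let ?h = "\<lambda>n. real (Suc n) powr (-y)"
  have h0: "?h \<longlonglongrightarrow> 0" using y by real_asymp
  from telescope_sums'[OF h0] have tel: "(\<lambda>n. ?h n - ?h (Suc n)) sums 1" by simp
  hence tel': "(\<lambda>n. (?h n - ?h (Suc n)) / y) sums (1 / y)" by (rule sums_divide)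
  have s: "(\<lambda>n. real (Suc n) powr (-x)) sums zet x"
    unfolding zet_def by (rule summable_sums[OF zet_summable[OF assms]])
  have e: "- y - 1 = - x" by (simp add: y_def)
  show "1 / (x - 1) \<le> zet x" unfolding y_def[symmetric]
  proof (rule sums_le[OF _ tel' s])
    fix n show "(?h n - ?h (Suc n)) / y \<le> real (Suc n) powr (-x)"
      using powr_diff_bound2[OF y, of "real (Suc n)"] y unfolding e by (simp add: field_simps)
  qed
  have s': "(\<lambda>n. real (Suc (Suc n)) powr (-x)) sums (zet x - 1)"
    using sums_split_initial_segment[OF s, of 1] by simp
  have "zet x - 1 \<le> 1 / y"
  proof (rule sums_le[OF _ s' tel'])
    fix n show "real (Suc (Suc n)) powr (-x) \<le> (?h n - ?h (Suc n)) / y"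
      using powr_diff_lower[OF y, of "real (Suc n)"] y unfolding e by (simp add: field_simps)
  qed
  thus "zet x \<le> 1 + 1 / (x - 1)" by (simp add: y_def)
qed

text \<open>Induction over the primes with \<open>step_sums\<close>. A prime of \<open>P\<close>
  differs from the new prime \<open>p\<close>, so it divides \<open>p * m\<close> exactly when it
  divides \<open>m\<close>; the sieve by \<open>P\<close> is thus compatible with division by
  \<open>p\<close>.\<close>

lemma euler_product_partial:
  fixes psi :: "int \<Rightarrow> complex"
  assumes mult: "\<And>m n. psi (m * n) = psi m * psi n"
    and S: "(\<lambda>n. psi (int (Suc n)) * of_nat (Suc n) powr (-s)) sums S"
    and P: "finite P" "\<And>p. p \<in> P \<Longrightarrow> prime p"
  shows "(\<lambda>n. (if \<exists>p\<in>P. p dvd Suc n then 0 else psi (int (Suc n))) * of_nat (Suc n) powr (-s))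
     sums ((\<Prod>p\<in>P. 1 - psi (int p) * of_nat p powr (-s)) * S)"
  using P
proof (induction P rule: finite_induct)
  case empty
  show ?case using S by simp
next
  case (insert p P)
  define a where "a = (\<lambda>n::int. if \<exists>q\<in>P. int q dvd n then 0 else psi n)"
  have pp: "prime p" "\<And>q. q \<in> P \<Longrightarrow> prime q" using insert.prems by auto
  have a_nat: "a (int m) = (if \<exists>q\<in>P. q dvd m then 0 else psi (int m))" for m
    by (simp add: a_def)
  have "(\<lambda>n. a (int (Suc n)) * of_nat (Suc n) powr (-s)) sums ((\<Prod>p\<in>P. 1 - psi (int p) * of_nat p powr (-s)) * S)"
    unfolding a_nat using insert.IH pp by blast
  from step_sums[OF this, of p "psi (int p)"] prime_gt_0_nat[OF pp(1)]
  have "(\<lambda>n. (a (int (Suc n)) - (if p dvd Suc n then psi (int p) * a (int (Suc n div p)) else 0)) * of_nat (Suc n) powr (-s))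
     sums ((1 - psi (int p) * of_nat p powr (-s)) * ((\<Prod>p\<in>P. 1 - psi (int p) * of_nat p powr (-s)) * S))" by simp
  moreover have "a (int (Suc n)) - (if p dvd Suc n then psi (int p) * a (int (Suc n div p)) else 0) =
     (if \<exists>q\<in>insert p P. q dvd Suc n then 0 else psi (int (Suc n)))" for n
  proof (cases "p dvd Suc n")
    case True
    then obtain m where m: "Suc n = p * m" by auto
    have md: "Suc n div p = m" using m prime_gt_0_nat[OF pp(1)] by simp
    have "q dvd p * m \<longleftrightarrow> q dvd m" if "q \<in> P" for q
    proof -
      have "q \<noteq> p" using that insert.hyps by auto
      hence "\<not> q dvd p" using pp that by (metis primes_dvd_imp_eq)
      thus ?thesis using pp(2)[OF that] by (auto simp: prime_dvd_mult_iff)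
    qed
    hence "a (int (Suc n)) = psi (int p) * a (int m)"
      unfolding a_nat m by (auto simp: mult)
    thus ?thesis using True md by auto
  next
    case False
    thus ?thesis unfolding a_nat by auto
  qed
  ultimately show ?case using insert.hyps by (simp add: mult.assoc)
qed

text \<open>Sieving by the primes up to \<open>N\<close> leaves 1 plus a tail, so the finite product
  times \<open>S\<close> has norm at least 1 minus that tail. Each factor has norm at most
  \<open>1 + p powr (-x) \<le> 1 / (1 - p powr (-x))\<close>, and the product of these majorants is
  at most \<open>zet x\<close>. Then \<open>N\<close> tends to infinity.\<close>

lemma euler_lower_bound:
  fixes psi :: "int \<Rightarrow> complex"
  assumes mult: "\<And>m n. psi (m * n) = psi m * psi n" and p1: "psi 1 = 1" and bd: "\<And>n. norm (psi n) \<le> 1"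
    and s: "Re s > 1"
    and S: "(\<lambda>n. psi (int (Suc n)) * of_nat (Suc n) powr (-s)) sums S"
  shows "norm S * zet (Re s) \<ge> 1"
proof -
  define x where "x = Re s"
  have x: "x > 1" using s by (simp add: x_def)
  define P where "P = (\<lambda>N::nat. {p. prime p \<and> p \<le> N})"
  have P: "finite (P N)" "\<And>p. p \<in> P N \<Longrightarrow> prime p" for N by (auto simp: P_def)
  define E where "E = (\<lambda>N. \<Sum>n. real (Suc (n + N)) powr (-x))"
  have nrm: "norm (of_nat (Suc n) powr (-s) :: complex) = real (Suc n) powr (-x)" for n
    using norm_powr_real_powr[of "of_nat (Suc n)" "-s"] by (simp add: x_def)
  have np: "norm (of_nat p powr (-s) :: complex) = real p powr (-x)" if "p > 0" for p
    using nrm[of "p - 1"] that by simp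
  have Zs: "(\<lambda>n. real (Suc n) powr (-x)) sums zet x"
    unfolding zet_def by (rule summable_sums[OF zet_summable[OF x]])
  have key: "1 - E N \<le> norm S * zet x" if N: "N \<ge> 1" for N
  proof -
    let ?a = "\<lambda>n. (if \<exists>p\<in>P N. p dvd Suc n then 0 else psi (int (Suc n))) * of_nat (Suc n) powr (-s)"
    let ?Q = "\<Prod>p\<in>P N. 1 - psi (int p) * of_nat p powr (-s)"
    have A: "?a sums (?Q * S)" by (rule euler_product_partial[OF mult S P])
    have zero: "?a n = 0" if "0 < n" "n < N" for n
    proof -
      have "Suc n \<noteq> 1" using that by simp
      then obtain p where "prime p" "p dvd Suc n" using prime_factor_nat by blast
      moreover have "p \<le> Suc n" using \<open>p dvd Suc n\<close> by (rule dvd_imp_le) simp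
      ultimately have "\<exists>p\<in>P N. p dvd Suc n" using that by (auto simp: P_def)
      thus ?thesis by simp
    qed
    have "(\<Sum>n<N. ?a n) = (\<Sum>n\<in>{0}. ?a n)"
      by (rule sum.mono_neutral_right) (use N zero in auto)
    also have "\<dots> = 1"
    proof -
      have "\<not> (\<exists>p\<in>P N. p dvd 1)" by (auto simp: P_def)
      thus ?thesis using p1 by simp
    qed
    finally have A1: "(\<lambda>n. ?a (n + N)) sums (?Q * S - 1)"
      using sums_split_initial_segment[OF A, of N] by simp
    have B1: "(\<lambda>n. real (Suc (n + N)) powr (-x)) sums E N"
      unfolding E_def by (rule summable_sums) (use zet_summable[OF x] in \<open>subst summable_iff_shift[of "\<lambda>n. real (Suc n) powr (-x)"]\<close>)
    have C1: "norm (?a n) \<le> real (Suc n) powr (-x)" for n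
      unfolding norm_mult nrm using bd by (intro mult_left_le_one_le) auto
    have "norm (?Q * S - 1) \<le> E N"
      by (rule norm_sums_le[OF A1 B1 C1])
    hence 1: "1 - E N \<le> norm ?Q * norm S"
      using norm_triangle_ineq2[of 1 "1 - ?Q * S"] by (simp add: norm_minus_commute norm_mult)
    have "norm ?Q \<le> zet x"
    proof -
      define y where "y = (\<lambda>p::nat. real p powr (-x))"
      have y: "0 < y p" "y p < 1" if "p \<in> P N" for p
      proof -
        have "p \<ge> 2" using P(2)[OF that] by (rule prime_ge_2_nat)
        thus "0 < y p" "y p < 1" using x by (auto simp: y_def powr_less_one)
      qed
      have c: "of_nat p powr (- complex_of_real x) = of_real (y p)" for p
        using powr_of_real[of "real p" "-x"] by (simp add: y_def)
      \<comment> \<open>The same sieve for the constant function 1: its first term alone shows that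
        the product of the \<open>1 - y p\<close> times \<open>zet x\<close> is at least 1.\<close>
      have "(\<lambda>n. (\<lambda>_. 1) (int (Suc n)) * of_nat (Suc n) powr (- complex_of_real x)) sums of_real (zet x)"
        using sums_of_real[OF Zs, where 'a = complex] powr_of_real[of "real (Suc n)" "-x" for n] by simp
      from euler_product_partial[where psi = "\<lambda>_. 1", OF _ this P(1)[of N] P(2)[of _ N]]
      have "(\<lambda>n. (if \<exists>p\<in>P N. p dvd Suc n then 0 else 1) * of_nat (Suc n) powr (- complex_of_real x)) sums ((\<Prod>p\<in>P N. 1 - of_real (y p)) * of_real (zet x))"
        by (simp only: c mult_1 simp_thms)
      note sums_c = this
      have pr: "(\<Prod>p\<in>P N. 1 - complex_of_real (y p)) * of_real (zet x) = of_real ((\<Prod>p\<in>P N. 1 - y p) * zet x)"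
        by (simp only: of_real_mult of_real_prod of_real_diff of_real_1)
      have R: "(\<lambda>n. Re ((if \<exists>p\<in>P N. p dvd Suc n then 0 else 1) * of_nat (Suc n) powr (- complex_of_real x))) sums ((\<Prod>p\<in>P N. 1 - y p) * zet x)"
        using sums_Re[OF sums_c] unfolding pr Re_complex_of_real .
      have Re_eq: "Re ((if \<exists>p\<in>P N. p dvd Suc n then 0 else 1) * of_nat (Suc n) powr (- complex_of_real x)) = (if \<exists>p\<in>P N. p dvd Suc n then 0 else y (Suc n))" for n
        unfolding c by simp
      have H1: "(\<lambda>n. if n = 0 then 1 else 0 :: real) sums 1" using sums_single[of 0 "\<lambda>_. 1::real"] by simp
      have H2: "(if n = 0 then 1 else 0) \<le> (if \<exists>p\<in>P N. p dvd Suc n then 0 else y (Suc n))" for n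
      proof -
        have "\<not> (\<exists>p\<in>P N. p dvd 1)" by (auto simp: P_def)
        thus ?thesis by (auto simp: y_def)
      qed
      have "1 \<le> (\<Prod>p\<in>P N. 1 - y p) * zet x"
        by (rule sums_le[OF H2 H1 R[unfolded Re_eq]])
      moreover have pos: "(\<Prod>p\<in>P N. 1 - y p) > 0" by (intro prod_pos) (use y in auto)
      ultimately have Z: "1 / (\<Prod>p\<in>P N. 1 - y p) \<le> zet x" by (simp add: field_simps)
      have "norm ?Q = (\<Prod>p\<in>P N. norm (1 - psi (int p) * of_nat p powr (-s)))" by (rule prod_norm[symmetric])
      also have "\<dots> \<le> (\<Prod>p\<in>P N. 1 / (1 - y p))"
      proof (intro prod_mono conjI norm_ge_zero)
        fix p assume p: "p \<in> P N"
        have p0: "p > 0" using P(2)[OF p] by (rule prime_gt_0_nat)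
        have "norm (1 - psi (int p) * of_nat p powr (-s)) \<le> norm (1::complex) + norm (psi (int p) * of_nat p powr (-s))" by (rule norm_triangle_ineq4)
        also have "norm (psi (int p) * of_nat p powr (-s)) \<le> 1 * y p"
          unfolding norm_mult np[OF p0] y_def using bd by (intro mult_right_mono) auto
        also have "norm (1::complex) + 1 * y p \<le> 1 / (1 - y p)"
          using y[OF p] by (simp add: field_simps)
        finally show "norm (1 - psi (int p) * of_nat p powr (-s)) \<le> 1 / (1 - y p)" by simp
      qed
      also have "\<dots> = 1 / (\<Prod>p\<in>P N. 1 - y p)" by (simp add: prod_dividef)
      finally show ?thesis using Z by simp
    qed
    hence "norm ?Q * norm S \<le> zet x * norm S" by (intro mult_right_mono) auto
    thus ?thesis using 1 by (simp add: mult.commute)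
  qed
  have "E \<longlonglongrightarrow> 0"
    unfolding E_def using suminf_exist_split2[OF zet_summable[OF x]] by simp
  hence "(\<lambda>N. 1 - E N) \<longlonglongrightarrow> 1 - 0" by (intro tendsto_intros)
  hence "1 - 0 \<le> norm S * zet x"
    by (rule tendsto_upperbound) (use key in \<open>auto simp: eventually_sequentially intro!: exI[of _ 1]\<close>)
  thus ?thesis by (simp add: x_def)
qed

section \<open>The von Mangoldt function and the 3-4-1 inequality\<close>

text \<open>The threshold \<open>10^5\<close> enters mainly here: \<open>ln Q / Q\<close> and
  \<open>ln Q / sqrt Q\<close> decrease, so their values at \<open>10^5\<close> decide, and
  \<open>exp 11 \<le> 10^5 \<le> exp 12\<close> is reduced to powers of rational numbers.\<close>

lemma ln_facts:
  fixes Q :: real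
  assumes Q: "Q \<ge> 10 ^ 5"
  shows "ln Q \<ge> 11" "ln Q \<le> Q * (12 / 10 ^ 5)" "(ln Q)\<^sup>2 \<le> Q * (144 / 10 ^ 5)"
proof -
  \<comment> \<open>\<open>273 / 256 = 1 + 1/16 + (1/16)^2\<close> is the quadratic upper bound for
    the exponential, and \<open>176 = 11 * 16\<close>.\<close>
  have e1: "exp (1/16) \<le> (273/256::real)" using exp_bound[of "1/16::real"] by (simp add: power2_eq_square)
  have "exp (11::real) = exp (1/16) ^ 176" by (simp add: exp_of_nat_mult[symmetric])
  also have "\<dots> \<le> (273/256) ^ 176" using e1 by (intro power_mono) auto
  also have "\<dots> \<le> 10 ^ 5" by (simp add: power_divide)
  finally have "exp 11 \<le> Q" using Q by simp
  hence "ln (exp 11) \<le> ln Q" by (intro ln_mono) auto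
  thus "ln Q \<ge> 11" by simp
  have e2: "(101/100::real) \<le> exp (1/100)" using exp_ge_add_one_self[of "1/100::real"] by simp
  have "(27/10::real) \<le> (101/100) ^ 100" by (simp add: power_divide)
  also have "\<dots> \<le> exp (1/100) ^ 100" using e2 by (intro power_mono) auto
  also have "\<dots> = exp (1::real)" by (simp add: exp_of_nat_mult[symmetric])
  finally have e3: "(27/10::real) \<le> exp 1" .
  have "(10::real) ^ 5 \<le> (27/10) ^ 12" by (simp add: power_divide)
  also have "\<dots> \<le> exp 1 ^ 12" using e3 by (intro power_mono) auto
  also have "\<dots> = exp (12::real)" by (simp add: exp_of_nat_mult[symmetric])
  finally have "ln (10 ^ 5 :: real) \<le> ln (exp 12)" by (intro ln_mono) auto
  hence l5: "ln (10 ^ 5 :: real) \<le> 12" by simp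
  have "ln Q / Q \<le> ln (10 ^ 5) / 10 ^ 5" by (rule ln_over_antimono) (use Q in auto)
  also have "\<dots> \<le> 12 / 10 ^ 5" using l5 by (intro divide_right_mono) auto
  finally show "ln Q \<le> Q * (12 / 10 ^ 5)" using Q by (simp add: divide_le_eq mult.commute)
  have sQ: "sqrt Q \<ge> sqrt (10 ^ 5)" using Q by simp
  have s5: "sqrt (10 ^ 5) \<ge> (3::real)" by (rule real_le_rsqrt) simp
  have "ln (sqrt Q) / sqrt Q \<le> ln (sqrt (10 ^ 5)) / sqrt (10 ^ 5)"
    by (rule ln_over_antimono[OF s5 sQ])
  also have "\<dots> = ln (10 ^ 5) / 2 / sqrt (10 ^ 5)" by (subst ln_sqrt) auto
  also have "\<dots> \<le> 6 / sqrt (10 ^ 5)" using l5 by (intro divide_right_mono) auto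
  finally have "ln Q / 2 / sqrt Q \<le> 6 / sqrt (10 ^ 5)" using Q by (subst (asm) ln_sqrt) auto
  hence "ln Q \<le> 12 / sqrt (10 ^ 5) * sqrt Q" using Q by (simp add: divide_le_eq)
  hence "(ln Q)\<^sup>2 \<le> (12 / sqrt (10 ^ 5) * sqrt Q)\<^sup>2" using \<open>ln Q \<ge> 11\<close> by (intro power_mono) auto
  also have "\<dots> = 144 / 10 ^ 5 * Q" using Q by (simp add: power_mult_distrib power_divide)
  finally show "(ln Q)\<^sup>2 \<le> Q * (144 / 10 ^ 5)" by simp
qed

section \<open>The von Mangoldt series at real points\<close>

lemma ln_powr_antimono:
  fixes u v x :: real
  assumes "3 \<le> u" "u \<le> v" "x > 1"
  shows "ln v * v powr (-x) \<le> ln u * u powr (-x)"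
proof -
  have *: "ln w * w powr (-x) = (ln w / w) * w powr (- (x - 1))" if "w > 0" for w
  proof -
    have "w powr (- (x - 1)) = w powr (-x) * w powr 1" unfolding powr_add[symmetric] by simp
    thus ?thesis using that by simp
  qed
  have "(ln v / v) * v powr (- (x - 1)) \<le> (ln u / u) * u powr (- (x - 1))"
    using assms by (intro mult_mono ln_over_antimono powr_mono2') auto
  thus ?thesis using assms by (simp add: *)
qed

text \<open>Comparison with an integral: \<open>- G\<close> is an antiderivative of
  \<open>ln u * u powr (-x)\<close>, used from 3 on, where the integrand decreases.
  \<open>G 3 \<le> 1 / y^2\<close> because \<open>(1 + v) * exp (- v) \<le> 1\<close>; the first
  three terms account for the 2.\<close>

lemma sum_ln_powr:
  assumes x: "x > 1"
  shows "summable (\<lambda>n. ln (real (Suc n)) * real (Suc n) powr (-x))"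
    and "(\<Sum>n. ln (real (Suc n)) * real (Suc n) powr (-x)) \<le> 1 / (x - 1)\<^sup>2 + 2"
proof -
  define y where "y = x - 1"
  have y: "y > 0" using x by (simp add: y_def)
  let ?f = "\<lambda>n. ln (real (Suc n)) * real (Suc n) powr (-x)"
  define G where "G = (\<lambda>u::real. u powr (-y) * (ln u / y + 1 / y\<^sup>2))"
  have step: "?f (n + 3) \<le> G (real (n + 3)) - G (real (Suc n + 3))" for n
  proof -
    have "\<exists>u>real (n + 3). u < real (Suc n + 3) \<and> G (real (Suc n + 3)) - G (real (n + 3)) = (real (Suc n + 3) - real (n + 3)) * (- (ln u * u powr (-x)))"
    proof (rule MVT2)
      fix u assume u: "real (n + 3) \<le> u" "u \<le> real (Suc n + 3)"
      hence u0: "u > 0" by simp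
      have p: "u powr (-x) = u powr (-y) / u" using u0 by (simp add: y_def powr_diff powr_minus field_simps)
      have "(G has_real_derivative ((- y * u powr (-y - 1)) * (ln u / y + 1 / y\<^sup>2) + u powr (-y) * (1 / u / y))) (at u)"
        unfolding G_def using u0 y by (auto intro!: derivative_eq_intros)
      also have "u powr (-y - 1) = u powr (-y) / u" using u0 by (simp add: powr_diff)
      also have "(- y * (u powr (-y) / u)) * (ln u / y + 1 / y\<^sup>2) + u powr (-y) * (1 / u / y) = - (ln u * u powr (-x))"
        unfolding p using u0 y by (simp add: field_simps power2_eq_square)
      finally show "(G has_real_derivative - (ln u * u powr (-x))) (at u)" .
    qed simp
    then obtain u where u: "u > real (n + 3)" "u < real (Suc n + 3)" "G (real (Suc n + 3)) - G (real (n + 3)) = - (ln u * u powr (-x))" by auto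
    have "ln (real (Suc (n + 3))) * real (Suc (n + 3)) powr (-x) \<le> ln u * u powr (-x)"
      using u by (intro ln_powr_antimono x) auto
    thus ?thesis using u(3) by simp
  qed
  have G0: "(\<lambda>n. G (real (n + 3))) \<longlonglongrightarrow> 0" unfolding G_def using y by real_asymp
  from telescope_sums'[OF this] have T: "(\<lambda>n. G (real (n + 3)) - G (real (Suc n + 3))) sums G 3" by simp
  have f0: "?f n \<ge> 0" for n by simp
  have sf3: "summable (\<lambda>n. ?f (n + 3))"
    by (rule summable_comparison_test'[OF sums_summable[OF T], of 0]) (use step f0 in \<open>auto simp del: of_nat_Suc of_nat_add\<close>)
  thus sm: "summable ?f" by (subst (asm) summable_iff_shift)
  have "(\<Sum>n. ?f n) = (\<Sum>n. ?f (n + 3)) + (\<Sum>n<3. ?f n)" by (rule suminf_split_initial_segment[OF sm])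
  also have "(\<Sum>n. ?f (n + 3)) \<le> G 3"
    using suminf_le[OF step sf3 sums_summable[OF T]] T by (simp add: sums_iff)
  also have "G 3 \<le> 1 / y\<^sup>2"
  proof -
    have "1 + y * ln 3 \<le> exp (y * ln 3)" by (rule exp_ge_add_one_self)
    hence "exp (- (y * ln 3)) * (1 + y * ln 3) \<le> 1" by (simp add: exp_minus field_simps)
    moreover have "G 3 = exp (- (y * ln 3)) * (1 + y * ln 3) / y\<^sup>2"
      unfolding G_def powr_def using y by (simp add: field_simps power2_eq_square)
    ultimately show ?thesis using y by (simp add: divide_right_mono)
  qed
  also have "(\<Sum>n<3. ?f n) \<le> 2"
  proof -
    have "ln (2::real) * 2 powr (-x) \<le> 1 * 1" using ln_le_minus_one[of "2::real"] x by (intro mult_mono) (use powr_mono[of "-x" 0 "2::real"] in auto)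
    moreover have "ln (3::real) * 3 powr (-x) \<le> 2 * (1/3)"
    proof (intro mult_mono)
      show "ln 3 \<le> (2::real)" using ln_le_minus_one[of "3::real"] by simp
      have "3 powr (-x) \<le> 3 powr (-1::real)" using x by (intro powr_mono) auto
      thus "3 powr (-x) \<le> 1/3" by (simp add: powr_minus)
    qed auto
    ultimately show ?thesis by (simp add: eval_nat_numeral)
  qed
  finally show "(\<Sum>n. ?f n) \<le> 1 / (x - 1)\<^sup>2 + 2" by (simp add: y_def)
qed

text \<open>The Dirichlet series of \<open>- L' / L\<close>. Real arguments suffice because the
  3-4-1 inequality is evaluated at a single point just to the right of 1.\<close>

definition Vser :: "(int \<Rightarrow> complex) \<Rightarrow> real \<Rightarrow> complex" where
  "Vser psi x = (\<Sum>n. mangoldt n * psi (int n) * of_real (real n powr (-x)))"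

lemma Vser_summable:
  assumes bd: "\<And>n. norm (psi n) \<le> 1" and x: "x > 1"
  shows "summable (\<lambda>n. norm (mangoldt n * psi (int n) * of_real (real n powr (-x)) :: complex))"
proof -
  have "summable (\<lambda>n. ln (real n) * real n powr (-x))"
    using sum_ln_powr(1)[OF x] by (subst (asm) summable_Suc_iff)
  thus ?thesis
  proof (rule summable_comparison_test'[of _ 0])
    fix n :: nat
    have "norm (mangoldt n * psi (int n) * of_real (real n powr (-x)) :: complex) \<le> (mangoldt n * 1) * real n powr (-x)"
      unfolding norm_mult norm_of_real using bd by (intro mult_mono) (auto simp: mangoldt_nonneg)
    also have "\<dots> \<le> ln (real n) * real n powr (-x)"
      using mangoldt_le[of n] by (cases "n = 0") (auto intro!: mult_right_mono)
    finally show "norm (norm (mangoldt n * psi (int n) * of_real (real n powr (-x)) :: complex)) \<le> ln (real n) * real n powr (-x)" by simp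
  qed
qed

text \<open>The divisor identity that sums \<open>mangoldt\<close> to \<open>ln n\<close>, twisted
  by a completely multiplicative function and read as a product of absolutely convergent Dirichlet
  series.\<close>

lemma Vser_mult:
  assumes mult: "\<And>m n. psi (m * n) = psi m * psi n" and bd: "\<And>n. norm (psi n) \<le> 1" and x: "x > 1"
    and S: "(\<lambda>n. psi (int (Suc n)) * of_nat (Suc n) powr (- of_real x)) sums S"
  shows "(\<lambda>n. of_real (ln (real (Suc n))) * psi (int (Suc n)) * of_nat (Suc n) powr (- of_real x)) sums (Vser psi x * S)"
proof -
  let ?b = "\<lambda>n. psi (int n) * complex_of_real (real n powr (-x))"
  let ?a = "\<lambda>n. mangoldt n * psi (int n) * complex_of_real (real n powr (-x))"
  have c: "of_nat (Suc n) powr (- of_real x) = complex_of_real (real (Suc n) powr (-x))" for n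
    using powr_of_real[of "real (Suc n)" "-x"] by simp
  have "summable (\<lambda>n. norm (?b (Suc n)))"
    by (rule summable_comparison_test'[OF zet_summable[OF x], of 0])
       (use bd in \<open>auto simp: norm_mult intro!: mult_left_le_one_le\<close>)
  hence sb: "summable (\<lambda>n. norm (?b n))" by (subst (asm) summable_Suc_iff)
  have "?b sums (S + ?b 0)" using S unfolding c by (subst (asm) sums_Suc_iff) simp
  hence Sb: "(\<Sum>n. ?b n) = S" by (simp add: sums_iff)
  have "(\<lambda>n. \<Sum>d | d dvd n. ?a d * ?b (n div d)) sums ((\<Sum>n. ?a n) * (\<Sum>n. ?b n))"
    by (rule dirichlet_convolution_sums[OF Vser_summable[OF bd x] sb]) auto
  moreover have "(\<Sum>d | d dvd n. ?a d * ?b (n div d)) = of_real (ln (real n)) * psi (int n) * complex_of_real (real n powr (-x))" if "n > 0" for n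
  proof -
    have "(\<Sum>d | d dvd n. ?a d * ?b (n div d)) = (\<Sum>d | d dvd n. mangoldt d * (psi (int n) * complex_of_real (real n powr (-x))))"
    proof (intro sum.cong refl)
      fix d assume "d \<in> {d. d dvd n}"
      then obtain m where m: "n = d * m" by auto
      have d: "d > 0" "m > 0" using that m by auto
      have "real n powr (-x) = real d powr (-x) * real m powr (-x)" using d by (simp add: m powr_mult)
      moreover have "psi (int n) = psi (int d) * psi (int m)" by (simp add: m mult)
      moreover have "n div d = m" using m d by simp
      ultimately show "?a d * ?b (n div d) = mangoldt d * (psi (int n) * complex_of_real (real n powr (-x)))"
        by (simp only: of_real_mult mult_ac)
    qed
    also have "\<dots> = of_real (ln (real n)) * (psi (int n) * complex_of_real (real n powr (-x)))"
      unfolding sum_distrib_right[symmetric] using mangoldt_sum[of n, where 'a = complex] that by simp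
    finally show ?thesis by (simp only: mult.assoc)
  qed
  moreover have "(\<Sum>d | d dvd (0::nat). ?a d * ?b (0 div d)) = 0" by simp
  ultimately have "(\<lambda>n. \<Sum>d | d dvd Suc n. ?a d * ?b (Suc n div d)) sums ((\<Sum>n. ?a n) * (\<Sum>n. ?b n))"
    by (subst sums_Suc_iff) simp
  thus ?thesis using \<open>\<And>n. n > 0 \<Longrightarrow> (\<Sum>d | d dvd n. ?a d * ?b (n div d)) = _\<close> unfolding Sb Vser_def c by (simp del: of_nat_Suc)
qed

text \<open>Undoing the summation by parts in the derivative and convolving with the von Mangoldt
  function lead to the same series with coefficients \<open>chi n * ln n\<close>.\<close>

lemma Lser_logderiv:
  assumes mult: "\<And>m n. chi (m * n) = chi m * chi n" and bd: "\<And>n. norm (chi n) \<le> 1"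
    and B: "\<And>n. norm (psum chi n) \<le> B" and x: "x > 1"
  shows "deriv (Lser chi) (of_real x) = - (Vser chi x * Lser chi (of_real x))"
proof -
  have S: "(\<lambda>n. chi (int (Suc n)) * of_nat (Suc n) powr (- of_real x)) sums Lser chi (of_real x)"
    by (rule Lser_sums(1)[OF B]) (use x in simp)
  note T = Vser_mult[OF mult bd x S]
  define g where "g = (\<lambda>n. complex_of_real (ln (real (Suc n))) * of_nat (Suc n) powr (- of_real x))"
  from Lser_has_derivative[OF B, of "of_real x"] x obtain D where D: "(Lser chi has_field_derivative D) (at (of_real x))"
    "(\<lambda>n. psum chi (Suc n) * (g (Suc n) - g n)) sums D"
    by (auto simp: g_def)
  have "(\<lambda>n. - (psum chi (Suc n) * (g (Suc n) - g n))) sums (- D)" using D(2) by (rule sums_minus)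
  hence "(\<lambda>n. psum chi (Suc n) * (g n - g (Suc n))) sums (- D)" by (simp add: algebra_simps)
  hence L1: "(\<lambda>N. (\<Sum>n<N. chi (int (Suc n)) * g n) - psum chi N * g N) \<longlonglongrightarrow> - D"
    unfolding sums_def sum_by_parts .
  have gn: "norm (g n) = ln (real (Suc n)) * real (Suc n) powr (-x)" for n
    using powr_of_real[of "real (Suc n)" "-x"] by (simp add: g_def norm_mult del: of_nat_Suc)
  have "(\<lambda>N. psum chi N * g N) \<longlonglongrightarrow> 0"
  proof (rule Lim_null_comparison)
    show "\<forall>\<^sub>F N in sequentially. norm (psum chi N * g N) \<le> B * norm (g N)"
      by (intro always_eventually allI) (auto simp: norm_mult intro!: mult_right_mono B)
    show "(\<lambda>N. B * norm (g N)) \<longlonglongrightarrow> 0"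
      unfolding gn by (rule tendsto_mult_right_zero[OF summable_LIMSEQ_zero[OF sum_ln_powr(1)[OF x]]])
  qed
  from tendsto_add[OF L1 this] have "(\<lambda>n. chi (int (Suc n)) * g n) sums (- D)" by (simp add: sums_def)
  moreover have "(\<lambda>n. chi (int (Suc n)) * g n) sums (Vser chi x * Lser chi (of_real x))"
    using T by (simp add: g_def mult_ac del: of_nat_Suc)
  ultimately have "- D = Vser chi x * Lser chi (of_real x)" by (rule sums_unique2)
  thus ?thesis using DERIV_imp_deriv[OF D(1)] by (metis minus_minus)
qed

text \<open>The product of this series with \<open>zet x\<close> is the sum of
  \<open>ln n * n powr (-x)\<close>. Dividing its upper bound by the lower bound
  \<open>1 / (x - 1)\<close> for \<open>zet x\<close> gives the claim without any expansion of zeta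
  at its pole.\<close>

lemma Vser_1_le:
  assumes x: "x > 1"
  shows "Re (Vser (\<lambda>_. 1) x) \<le> 1 / (x - 1) + 2 * (x - 1)"
proof -
  have "(\<lambda>n. of_real (real (Suc n) powr (-x))) sums complex_of_real (zet x)"
    unfolding zet_def by (intro sums_of_real summable_sums zet_summable x)
  moreover have c: "of_nat (Suc n) powr (- of_real x) = complex_of_real (real (Suc n) powr (-x))" for n
    using powr_of_real[of "real (Suc n)" "-x"] by simp
  ultimately have S: "(\<lambda>n. (\<lambda>_. 1) (int (Suc n)) * of_nat (Suc n) powr (- of_real x)) sums complex_of_real (zet x)" by (simp only: mult_1)
  have "(\<lambda>n. of_real (ln (real (Suc n))) * 1 * of_nat (Suc n) powr (- of_real x)) sums (Vser (\<lambda>_. 1) x * of_real (zet x))"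
    using Vser_mult[where psi = "\<lambda>_. 1", OF _ _ x S] by simp
  hence "(\<lambda>n. Re (of_real (ln (real (Suc n))) * 1 * of_nat (Suc n) powr (- of_real x))) sums Re (Vser (\<lambda>_. 1) x * of_real (zet x))"
    by (rule sums_Re)
  hence "(\<lambda>n. ln (real (Suc n)) * real (Suc n) powr (-x)) sums (Re (Vser (\<lambda>_. 1) x) * zet x)"
    unfolding c by simp
  hence c1: "Re (Vser (\<lambda>_. 1) x) * zet x \<le> 1 / (x - 1)\<^sup>2 + 2" using sum_ln_powr(2)[OF x] by (simp add: sums_iff)
  have z: "zet x \<ge> 1 / (x - 1)" by (rule zet_bounds(1)[OF x])
  have c3: "Re (Vser (\<lambda>_. 1) x) * (1 / (x - 1)) \<le> 1 / (x - 1)\<^sup>2 + 2"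
  proof (cases "Re (Vser (\<lambda>_. 1) x) \<ge> 0")
    case True
    hence "Re (Vser (\<lambda>_. 1) x) * (1 / (x - 1)) \<le> Re (Vser (\<lambda>_. 1) x) * zet x" using z by (intro mult_left_mono) auto
    thus ?thesis using c1 by linarith
  next
    case False
    hence "Re (Vser (\<lambda>_. 1) x) * (1 / (x - 1)) \<le> 0" using x by (intro mult_nonpos_nonneg) auto
    thus ?thesis by (smt (verit) zero_le_divide_1_iff zero_le_power2)
  qed
  define \<delta> where "\<delta> = x - 1"
  have d: "\<delta> > 0" using x by (simp add: \<delta>_def)
  have "Re (Vser (\<lambda>_. 1) x) * (1 / \<delta>) \<le> 1 / \<delta>\<^sup>2 + 2" using c3 by (simp only: \<delta>_def)
  hence "Re (Vser (\<lambda>_. 1) x) * (1 / \<delta>) * \<delta> \<le> (1 / \<delta>\<^sup>2 + 2) * \<delta>" using d by (intro mult_right_mono) auto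
  moreover have "(1 / \<delta>\<^sup>2 + 2) * \<delta> = 1 / \<delta> + 2 * \<delta>" using d by (simp add: distrib_right power2_eq_square)
  ultimately show ?thesis using d by (simp add: \<delta>_def)
qed

text \<open>On the unit circle \<open>3 + 4 * Re z + Re (z^2) = 2 * (1 + Re z)^2\<close>. The
  constant function 1 takes the place of the principal character, so integers not coprime to the
  modulus contribute nonnegative terms as well.\<close>

lemma three_four_one:
  assumes chi: "dirichlet_character q chi" and x: "x > 1"
  shows "3 * Re (Vser (\<lambda>_. 1) x) + 4 * Re (Vser chi x) + Re (Vser (\<lambda>n. chi n ^ 2) x) \<ge> 0"
proof -
  define t :: "(int \<Rightarrow> complex) \<Rightarrow> nat \<Rightarrow> complex" where
    "t = (\<lambda>psi n. mangoldt n * psi (int n) * complex_of_real (real n powr (-x)))"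
  have R: "(\<lambda>n. Re (t psi n)) sums Re (Vser psi x)" if b: "\<And>n. norm (psi n) \<le> 1" for psi :: "int \<Rightarrow> complex"
    unfolding Vser_def t_def by (rule sums_Re[OF summable_sums[OF summable_norm_cancel[OF Vser_summable[OF b x]]]])
  have R1: "(\<lambda>n. Re (t (\<lambda>_. 1) n)) sums Re (Vser (\<lambda>_. 1) x)" by (rule R) simp
  note R2 = R[OF char_norm(2)[OF chi]]
  note R3 = R[OF char_norm(2)[OF char_square[OF chi]]]
  have S: "(\<lambda>n. 3 * Re (t (\<lambda>_. 1) n) + 4 * Re (t chi n) + Re (t (\<lambda>n. chi n ^ 2) n)) sums
    (3 * Re (Vser (\<lambda>_. 1) x) + 4 * Re (Vser chi x) + Re (Vser (\<lambda>n. chi n ^ 2) x))"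
    by (rule sums_add[OF sums_add[OF sums_mult[OF R1] sums_mult[OF R2]] R3])
  have nn: "0 \<le> 3 * Re (t (\<lambda>_. 1) n) + 4 * Re (t chi n) + Re (t (\<lambda>n. chi n ^ 2) n)" for n
  proof -
    define z where "z = chi (int n)"
    define r :: real where "r = mangoldt n * real n powr (-x)"
    have r: "r \<ge> 0" unfolding r_def by (intro mult_nonneg_nonneg mangoldt_nonneg) auto
    have eq: "Re (mangoldt n * w * complex_of_real (real n powr (-x))) = r * Re w" for w
    proof -
      have "mangoldt n * w * complex_of_real (real n powr (-x)) = complex_of_real r * w"
        by (simp add: r_def mult_ac)
      hence "Re (mangoldt n * w * complex_of_real (real n powr (-x))) = Re (complex_of_real r * w)" by (rule arg_cong)
      also have "\<dots> = r * Re w" by simp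
      finally show ?thesis .
    qed
    have "3 + 4 * Re z + Re (z\<^sup>2) \<ge> 0"
    proof (cases "z = 0")
      case False
      hence "norm z = 1" using char_norm(1)[OF chi] char_nz_iff[OF chi] unfolding z_def by blast
      hence "(Re z)\<^sup>2 + (Im z)\<^sup>2 = 1" by (simp add: cmod_power2[symmetric])
      hence "3 + 4 * Re z + Re (z\<^sup>2) = 2 * (1 + Re z)\<^sup>2"
        by (simp add: power2_eq_square algebra_simps)
      thus ?thesis by simp
    qed simp
    hence "r * (3 + 4 * Re z + Re (z\<^sup>2)) \<ge> 0" using r by (rule mult_nonneg_nonneg[rotated])
    moreover have "Re (t (\<lambda>_. 1) n) = r * 1" "Re (t chi n) = r * Re z" "Re (t (\<lambda>n. chi n ^ 2) n) = r * Re (z\<^sup>2)"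
      unfolding t_def eq z_def by simp_all
    ultimately show ?thesis by (simp add: algebra_simps)
  qed
  show ?thesis by (rule sums_le[OF nn sums_zero S])
qed

section \<open>Nonreal characters\<close>

lemma sum_powr_quarter: "(\<Sum>n<d. real (Suc n) powr (-1/4)) \<le> 4 / 3 * real d powr (3/4)"
proof (induction d)
  case (Suc d)
  have "real (Suc d) powr (-1/4) \<le> 4 / 3 * (real (Suc d) powr (3/4) - real d powr (3/4))"
  proof (cases "d = 0")
    case False
    have "\<exists>z>real d. z < real (Suc d) \<and> real (Suc d) powr (3/4) - real d powr (3/4) = (real (Suc d) - real d) * (3/4 * z powr (3/4 - 1))"
      by (rule MVT2) (use False in \<open>auto intro!: derivative_eq_intros\<close>)
    then obtain z where z: "z > real d" "z < real (Suc d)" "real (Suc d) powr (3/4) - real d powr (3/4) = 3/4 * z powr (3/4 - 1)" by auto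
    have "real (Suc d) powr (-1/4) \<le> z powr (-1/4)" using z False by (intro powr_mono2') auto
    thus ?thesis using z(3) by simp
  qed auto
  thus ?case using Suc by (simp add: algebra_simps)
qed simp

lemma sum_inverse_le: "d > 0 \<Longrightarrow> (\<Sum>n<d. 1 / real (Suc n)) \<le> 1 + ln (real d)"
proof (induction d rule: nat_induct_non_zero)
  case (Suc d)
  have "ln (real d / real (Suc d)) \<le> real d / real (Suc d) - 1" using Suc.hyps by (intro ln_le_minus_one) auto
  also have "real d / real (Suc d) - 1 = - (1 / real (Suc d))" by (simp add: field_simps)
  also have "ln (real d / real (Suc d)) = ln (real d) - ln (real (Suc d))" using Suc.hyps by (simp add: ln_div del: of_nat_Suc)
  finally show ?case using Suc.IH by simp
qed simp

lemma Lser_bound_trivial: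
  assumes bd: "\<And>n. norm (psum f n) \<le> real d" and f: "\<And>n. norm (f n) \<le> 1" and s: "Re s > 0" and d: "psum f d = 0"
  shows "norm (Lser f s) \<le> (\<Sum>n<d. real (Suc n) powr (- Re s)) + real d * (norm s / Re s) * real (Suc d) powr (- Re s)"
proof -
  let ?S = "\<Sum>n<d. f (int (Suc n)) * of_nat (Suc n) powr (-s)"
  have "norm ?S \<le> (\<Sum>n<d. real (Suc n) powr (- Re s))"
  proof (rule sum_norm_le)
    fix n
    have "norm (of_nat (Suc n) powr (-s) :: complex) = real (Suc n) powr (- Re s)"
      using norm_powr_real_powr[of "of_nat (Suc n)" "-s"] by simp
    thus "norm (f (int (Suc n)) * of_nat (Suc n) powr (-s)) \<le> real (Suc n) powr (- Re s)"
      unfolding norm_mult using f by (simp add: mult_left_le_one_le)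
  qed
  moreover have "norm (Lser f s) \<le> norm ?S + norm (Lser f s - ?S)"
    using norm_triangle_ineq[of ?S "Lser f s - ?S"] by simp
  ultimately show ?thesis using Lser_split[OF bd s d] by linarith
qed

text \<open>The left edge \<open>Re s = 1/4\<close> is the worst case: the head costs
  \<open>4/3\<close> and the tail \<open>norm s / Re s \<le> 8\<close> times
  \<open>d powr (3/4)\<close>. The bound is used on a disc of fixed radius, where only its logarithm
  counts.\<close>

lemma Lser_bound_far:
  assumes bd: "\<And>n. norm (psum f n) \<le> real d" and f: "\<And>n. norm (f n) \<le> 1" and d: "psum f d = 0" "d > 0" "real d \<le> Q"
    and s: "Re s \<ge> 1/4" "norm s \<le> 2"
  shows "norm (Lser f s) \<le> 10 * Q powr (3/4)"
proof -
  have "(\<Sum>n<d. real (Suc n) powr (- Re s)) \<le> (\<Sum>n<d. real (Suc n) powr (-1/4))"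
    using s by (intro sum_mono powr_mono) auto
  also have "\<dots> \<le> 4/3 * real d powr (3/4)" by (rule sum_powr_quarter)
  finally have 1: "(\<Sum>n<d. real (Suc n) powr (- Re s)) \<le> 4/3 * real d powr (3/4)" .
  have "norm s / Re s \<le> 2 / (1/4)" using s by (intro frac_le) auto
  moreover have "real (Suc d) powr (- Re s) \<le> real (Suc d) powr (-1/4)" using s by (intro powr_mono) auto
  moreover have "real (Suc d) powr (-1/4) \<le> real d powr (-1/4)" using d by (intro powr_mono2') auto
  ultimately have "real d * (norm s / Re s) * real (Suc d) powr (- Re s) \<le> real d * 8 * real d powr (-1/4)"
    using s by (intro mult_mono) auto
  also have "real d * real d powr (-1/4) = real d powr (3/4)"
    using d powr_mult_base[of "real d" "-1/4"] by simp
  hence "real d * 8 * real d powr (-1/4) = 8 * real d powr (3/4)" by simp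
  finally have 2: "real d * (norm s / Re s) * real (Suc d) powr (- Re s) \<le> 8 * real d powr (3/4)" .
  have "norm (Lser f s) \<le> 4/3 * real d powr (3/4) + 8 * real d powr (3/4)"
    using Lser_bound_trivial[OF bd f _ d(1), of s] 1 2 s by linarith
  also have "\<dots> \<le> 10 * real d powr (3/4)" by simp
  also have "\<dots> \<le> 10 * Q powr (3/4)" using d by (intro mult_left_mono powr_mono2) auto
  finally show ?thesis .
qed

text \<open>Within a small multiple of \<open>1 / ln Q\<close> of 1, \<open>n powr (- Re s)\<close>
  agrees with \<open>1 / n\<close> up to about one percent for all \<open>n \<le> 2 * Q\<close>, so
  the head is essentially a harmonic sum. The radius is \<open>11/10\<close> of the zero-free radius
  \<open>3 / (1000 * ln Q)\<close>, to leave room for a shifted centre.\<close>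

lemma Lser_bound_near:
  assumes bd: "\<And>n. norm (psum f n) \<le> real d" and f: "\<And>n. norm (f n) \<le> 1" and d: "psum f d = 0" "d > 0" "real d \<le> Q"
    and Q: "ln Q \<ge> 11" "Q \<ge> 10 ^ 5" and s: "norm (s - 1) \<le> 33 / (10000 * ln Q)"
  shows "norm (Lser f s) \<le> 13 / 10 * ln Q"
proof -
  define e where "e = 33 / (10000 * ln Q)"
  have "e \<le> 33 / (10000 * 11)" unfolding e_def using Q by (intro divide_left_mono) auto
  hence e: "0 < e" "e \<le> 3 / 10000" using Q by (auto simp: e_def)
  have "\<bar>Re (s - 1)\<bar> \<le> e" using abs_Re_le_cmod[of "s - 1"] s by (simp add: e_def)
  hence x: "Re s \<ge> 1 - e" by simp
  have "norm s \<le> 1 + e" using norm_triangle_ineq2[of s 1] s by (simp add: e_def)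
  hence ns: "norm s / Re s \<le> (1 + e) / (1 - e)" using x e by (intro frac_le) auto
  have "(1 + e) / (1 - e) \<le> 101/100" using e by (simp add: divide_le_eq)
  hence ns: "norm s / Re s \<le> 101/100" using ns by linarith
  have pw: "real m powr (- Re s) \<le> 101/100 / real m" if m: "1 \<le> m" "real m \<le> 2 * Q" for m
  proof -
    have "real m powr (- Re s) \<le> real m powr (-1 + e)" using m x by (intro powr_mono) auto
    also have "-1 + e = e - 1" by simp
    also have "real m powr (e - 1) = real m powr e / real m" using m by (simp only: powr_diff) simp
    also have "real m powr e \<le> 101/100"
    proof -
      have "ln (real m) \<le> ln (2 * Q)" using m by (intro ln_mono) auto
      also have "\<dots> \<le> 1 + ln Q" using Q ln_le_minus_one[of "2::real"] by (simp add: ln_mult)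
      also have "\<dots> \<le> 2 * ln Q" using Q by simp
      finally have "e * ln (real m) \<le> e * (2 * ln Q)" using e by (intro mult_left_mono) auto
      also have "e * (2 * ln Q) = 66/10000" using Q by (simp add: e_def)
      finally have "exp (e * ln (real m)) \<le> exp (66/10000)" by simp
      also have "\<dots> \<le> 1 + 66/10000 + (66/10000)\<^sup>2" by (rule exp_bound) auto
      also have "\<dots> \<le> 101/100" by (simp add: power2_eq_square)
      finally show ?thesis using m by (simp add: powr_def)
    qed
    hence "real m powr e / real m \<le> 101/100 / real m" using m by (intro divide_right_mono) auto
    finally show ?thesis .
  qed
  have "(\<Sum>n<d. real (Suc n) powr (- Re s)) \<le> (\<Sum>n<d. 101/100 * (1 / real (Suc n)))"
  proof (rule sum_mono)
    fix n assume "n \<in> {..<d}"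
    thus "real (Suc n) powr (- Re s) \<le> 101/100 * (1 / real (Suc n))" using pw[of "Suc n"] d Q by simp
  qed
  also have "\<dots> = 101/100 * (\<Sum>n<d. 1 / real (Suc n))" by (simp only: sum_distrib_left)
  also have "\<dots> \<le> 101/100 * (1 + ln (real d))" using sum_inverse_le[OF d(2)] by simp
  also have "\<dots> \<le> 101/100 * (1 + ln Q)" using d by (intro mult_left_mono add_left_mono ln_mono) auto
  finally have 1: "(\<Sum>n<d. real (Suc n) powr (- Re s)) \<le> 101/100 * (1 + ln Q)" .
  have "real (Suc d) powr (- Re s) \<le> 101/100 / real (Suc d)" using pw[of "Suc d"] d Q by simp
  hence "real d * (norm s / Re s) * real (Suc d) powr (- Re s) \<le> real d * (101/100) * (101/100 / real (Suc d))"
    using ns x e by (intro mult_mono) auto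
  also have "\<dots> = (101/100)\<^sup>2 * (real d / real (Suc d))" by (simp add: power2_eq_square)
  also have "\<dots> \<le> (101/100)\<^sup>2 * 1" by (intro mult_left_mono) auto
  finally have 2: "real d * (norm s / Re s) * real (Suc d) powr (- Re s) \<le> (101/100)\<^sup>2 * 1" .
  have "norm (Lser f s) \<le> 101/100 * (1 + ln Q) + (101/100)\<^sup>2 * 1"
    using Lser_bound_trivial[OF bd f _ d(1), of s] 1 2 x e by linarith
  also have "\<dots> \<le> 13 / 10 * ln Q" using Q by (simp add: power2_eq_square field_simps)
  finally show ?thesis .
qed

lemma Lser_lower_bound:
  assumes chi: "dirichlet_character d chi" and c: "coprime c (int d)" "chi c \<noteq> 1" and s: "Re s > 1"
  shows "norm (Lser chi s) * (1 + 1 / (Re s - 1)) \<ge> 1"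
proof -
  have S: "(\<lambda>n. chi (int (Suc n)) * of_nat (Suc n) powr (-s)) sums Lser chi s"
    by (rule Lser_sums(1)[OF char_psum_bounded[OF chi c]]) (use s in simp)
  have "1 \<le> norm (Lser chi s) * zet (Re s)"
    by (rule euler_lower_bound[OF char_mult[OF chi] char_1[OF chi] char_norm(2)[OF chi] s S])
  also have "\<dots> \<le> norm (Lser chi s) * (1 + 1 / (Re s - 1))"
    using zet_bounds(2)[OF s] by (intro mult_left_mono) auto
  finally show ?thesis .
qed

text \<open>The disc of radius \<open>3/4\<close> about \<open>\<sigma>\<close> stays in
  \<open>Re s \<ge> 1/4\<close>. There the upper bound divided by the value at
  \<open>\<sigma>\<close> is at most
  \<open>10 * Q powr (3/4) * (1 + 50 * ln Q) \<le> Q powr (7/4)\<close>. With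
  \<open>\<theta> = 99/100\<close> this gives
  \<open>2 * (7/4) / (99/100 * 3/4) < 4.714\<close>.\<close>

lemma minus_logderiv_L_le:
  assumes chi: "dirichlet_character d chi" and c: "coprime c (int d)" "chi c \<noteq> 1" and d: "real d \<le> Q"
    and Q: "Q \<ge> 10 ^ 5"
  defines "\<sigma> \<equiv> complex_of_real (1 + 1 / (50 * ln Q))"
  shows "- Re (deriv (Lser chi) \<sigma> / Lser chi \<sigma>) \<le> 4714 / 1000 * ln Q"
    and "\<And>\<rho>. Lser chi \<rho> = 0 \<Longrightarrow> norm (\<rho> - \<sigma>) < 3/4 \<Longrightarrow>
       - Re (deriv (Lser chi) \<sigma> / Lser chi \<sigma>) \<le> 4714 / 1000 * ln Q - Re (\<sigma> - \<rho>) * (1 / (norm (\<sigma> - \<rho>))\<^sup>2 - 1 / (3/4)\<^sup>2)"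
proof -
  note lnQ = ln_facts[OF Q]
  define \<delta> where "\<delta> = 1 / (50 * ln Q)"
  have "1 / (50 * ln Q) \<le> 1 / (50 * 11)" using lnQ by (intro divide_left_mono) auto
  hence \<delta>: "0 < \<delta>" "\<delta> \<le> 1/550" using lnQ by (auto simp: \<delta>_def)
  have \<sigma>: "\<sigma> = complex_of_real (1 + \<delta>)" by (simp add: \<sigma>_def \<delta>_def)
  have Re\<sigma>: "Re \<sigma> = 1 + \<delta>" by (simp add: \<sigma>)
  define M where "M = 10 * Q powr (3/4)"
  have nb: "norm (Lser chi \<sigma>) * (1 + 50 * ln Q) \<ge> 1"
    using Lser_lower_bound[OF chi c, of \<sigma>] \<delta> by (simp add: Re\<sigma>) (simp add: \<delta>_def)
  have hol: "Lser chi holomorphic_on ball \<sigma> (9/10)"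
  proof (rule Lser_holomorphic[OF char_psum_bounded[OF chi c]], safe)
    fix z assume "z \<in> ball \<sigma> (9/10)"
    hence "\<bar>Re (z - \<sigma>)\<bar> < 9/10" using abs_Re_le_cmod[of "z - \<sigma>"] by (simp add: dist_norm norm_minus_commute)
    thus "0 < Re z" using \<delta> abs_ge_minus_self[of "Re (z - \<sigma>)"] unfolding minus_complex.sel Re\<sigma> by linarith
  qed
  have bM: "norm (Lser chi z) \<le> M" if "norm (z - \<sigma>) \<le> 3/4" for z
    unfolding M_def
  proof (rule Lser_bound_far[OF char_psum_bounded[OF chi c] char_norm(2)[OF chi] char_psum_0[OF chi c] char_pos[OF chi] d])
    have "\<bar>Re (z - \<sigma>)\<bar> \<le> 3/4" using abs_Re_le_cmod[of "z - \<sigma>"] that by simp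
    thus "1/4 \<le> Re z" using \<delta> abs_ge_minus_self[of "Re (z - \<sigma>)"] unfolding minus_complex.sel Re\<sigma> by linarith
    have "norm z \<le> norm \<sigma> + 3/4" using norm_triangle_ineq2[of z \<sigma>] that by simp
    also have "norm \<sigma> = 1 + \<delta>" unfolding \<sigma> norm_of_real using \<delta> by simp
    finally show "norm z \<le> 2" using \<delta> by simp
  qed
  have nz: "Lser chi \<sigma> \<noteq> 0" using nb by auto
  have zeros: "Re z \<le> Re \<sigma>" if "Lser chi z = 0" for z
  proof (rule ccontr)
    assume "\<not> Re z \<le> Re \<sigma>"
    hence "Re z > 1" using \<delta> by (simp add: Re\<sigma>)
    from Lser_lower_bound[OF chi c this] that show False by simp
  qed
  have log: "2 * ln (M / norm (Lser chi \<sigma>)) / (99/100 * (3/4)) \<le> 4714 / 1000 * ln Q"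
  proof -
    have "M / norm (Lser chi \<sigma>) \<le> M * (1 + 50 * ln Q)"
    proof -
      have "1 / norm (Lser chi \<sigma>) \<le> 1 + 50 * ln Q" using nb nz by (simp add: divide_le_eq mult.commute)
      hence "M * (1 / norm (Lser chi \<sigma>)) \<le> M * (1 + 50 * ln Q)" by (intro mult_left_mono) (auto simp: M_def)
      thus ?thesis by simp
    qed
    also have "\<dots> = Q powr (3/4) * (10 + 500 * ln Q)" by (simp add: M_def algebra_simps)
    also have "\<dots> \<le> Q powr (3/4) * Q" using lnQ(2) Q by (intro mult_left_mono) auto
    finally have "ln (M / norm (Lser chi \<sigma>)) \<le> ln (Q powr (3/4) * Q)"
      using nz Q by (intro ln_mono) (auto simp: M_def)
    also have "\<dots> = 7/4 * ln Q" using Q by (simp add: ln_mult ln_powr)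
    finally show ?thesis using lnQ(1) by simp
  qed
  have "- Re (deriv (Lser chi) \<sigma> / Lser chi \<sigma>) \<le> 2 * ln (M / norm (Lser chi \<sigma>)) / (99/100 * (3/4))"
    by (rule minus_logderiv_le[OF hol _ _ _ _ bM nz]) (use zeros in auto)
  thus "- Re (deriv (Lser chi) \<sigma> / Lser chi \<sigma>) \<le> 4714 / 1000 * ln Q" using log by linarith
  fix \<rho> assume rho: "Lser chi \<rho> = 0" "norm (\<rho> - \<sigma>) < 3/4"
  have "- Re (deriv (Lser chi) \<sigma> / Lser chi \<sigma>) \<le> 2 * ln (M / norm (Lser chi \<sigma>)) / (99/100 * (3/4)) - Re (\<sigma> - \<rho>) * (1 / (norm (\<sigma> - \<rho>))\<^sup>2 - 1 / (3/4)\<^sup>2)"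
    by (rule minus_logderiv_zero_le[OF hol _ _ _ _ bM nz _ rho]) (use zeros in auto)
  thus "- Re (deriv (Lser chi) \<sigma> / Lser chi \<sigma>) \<le> 4714 / 1000 * ln Q - Re (\<sigma> - \<rho>) * (1 / (norm (\<sigma> - \<rho>))\<^sup>2 - 1 / (3/4)\<^sup>2)"
    using log by linarith
qed

text \<open>A zero in this disc contributes at least \<open>1 / (115/100 * \<delta>)\<close>, where
  \<open>\<delta> = 1 / (50 * ln Q)\<close> and \<open>15/100 * \<delta>\<close> is the radius of
  the disc. In units of \<open>ln Q\<close> the 3-4-1 inequality then compares
  \<open>3 * 50 + 5 * 4.714 = 173.57\<close> with \<open>4 * 50 / 1.15 > 173.91\<close>; the
  leftover terms of order \<open>\<delta>\<close> fit into the gap. Since \<open>chi^2\<close> is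
  nonprincipal, its term carries no pole.\<close>

lemma zero_free_disc:
  assumes chi: "dirichlet_character d chi" and c: "coprime c (int d)" "chi c ^ 2 \<noteq> 1" and d: "real d \<le> Q"
    and Q: "Q \<ge> 10 ^ 5" and rho: "norm (\<rho> - 1) < 3 / (1000 * ln Q)"
  shows "Lser chi \<rho> \<noteq> 0"
proof
  assume z: "Lser chi \<rho> = 0"
  note lnQ = ln_facts[OF Q]
  have c1: "chi c \<noteq> 1" using c(2) by auto
  define \<delta> where "\<delta> = 1 / (50 * ln Q)"
  have "1 / (50 * ln Q) \<le> 1 / (50 * 11)" using lnQ by (intro divide_left_mono) auto
  hence \<delta>: "0 < \<delta>" "\<delta> \<le> 1/550" using lnQ by (auto simp: \<delta>_def)
  define x where "x = 1 + \<delta>"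
  have x: "x > 1" using \<delta> by (simp add: x_def)
  have V: "Re (Vser chi x) = - Re (deriv (Lser chi) (of_real x) / Lser chi (of_real x))"
    if "dirichlet_character d chi" "chi c \<noteq> 1" for chi
  proof -
    have "norm (Lser chi (of_real x)) * (1 + 1 / (x - 1)) \<ge> 1"
      using Lser_lower_bound[OF that(1) c(1) that(2), of "of_real x"] x by simp
    hence "Lser chi (of_real x) \<noteq> 0" by auto
    thus ?thesis
      using Lser_logderiv[OF char_mult[OF that(1)] char_norm(2)[OF that(1)] char_psum_bounded[OF that(1) c(1) that(2)] x]
      by simp
  qed
  have V2: "Re (Vser (\<lambda>n. chi n ^ 2) x) \<le> 4714 / 1000 * ln Q"
    using V[OF char_square[OF chi] c(2)] minus_logderiv_L_le(1)[OF char_square[OF chi] c d Q] by (simp add: x_def \<delta>_def)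
  define w where "w = complex_of_real x - \<rho>"
  define v where "v = w - of_real \<delta>"
  have v: "norm v < 15/100 * \<delta>"
    using rho by (simp add: v_def w_def x_def \<delta>_def norm_minus_commute)
  have wv: "w = of_real \<delta> + v" by (simp add: v_def)
  have rv: "\<bar>Re v\<bar> < 15/100 * \<delta>" using abs_Re_le_cmod[of v] v by linarith
  have Rew: "Re w = \<delta> + Re v" by (simp add: wv)
  have nw: "(norm w)\<^sup>2 = \<delta>\<^sup>2 + 2 * \<delta> * Re v + (norm v)\<^sup>2"
    unfolding cmod_power2 wv by (simp add: power2_eq_square algebra_simps)
  have nv: "(norm v)\<^sup>2 \<le> (15/100 * \<delta>)\<^sup>2" using v by (intro power_mono) auto
  have w0: "norm w > 0" using Rew rv \<delta> by auto
  \<comment> \<open>The left side is \<open>Re (1 / w)\<close>; over the disc of radius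
    \<open>15/100 * \<delta>\<close> about \<open>\<delta>\<close> it is smallest at the far real
    point \<open>115/100 * \<delta>\<close>.\<close>
  have q: "Re w / (norm w)\<^sup>2 \<ge> 1 / (115/100 * \<delta>)"
  proof -
    have "Re w * (115/100 * \<delta>) - (norm w)\<^sup>2 = 15/100 * \<delta>\<^sup>2 - (norm v)\<^sup>2 - 85/100 * \<delta> * Re v"
      unfolding nw Rew by (simp add: power2_eq_square algebra_simps)
    moreover have "85/100 * \<delta> * Re v \<le> 85/100 * \<delta> * (15/100 * \<delta>)" using rv \<delta> by (intro mult_left_mono) auto
    ultimately have "(norm w)\<^sup>2 \<le> Re w * (115/100 * \<delta>)" using nv by (simp add: power2_eq_square)
    thus ?thesis using w0 \<delta> by (simp add: divide_simps)
  qed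
  have "norm (\<rho> - of_real x) < 3/4"
  proof -
    have "norm w \<le> \<delta> + norm v" unfolding wv using norm_triangle_ineq[of "of_real \<delta>" v] \<delta> by simp
    thus ?thesis using v \<delta> by (simp add: w_def norm_minus_commute)
  qed
  hence "Re (Vser chi x) \<le> 4714 / 1000 * ln Q - Re w * (1 / (norm w)\<^sup>2 - 1 / (3/4)\<^sup>2)"
    using V[OF chi c1] minus_logderiv_L_le(2)[OF chi c(1) c1 d Q z] by (simp add: x_def \<delta>_def w_def)
  also have "Re w * (1 / (norm w)\<^sup>2 - 1 / (3/4)\<^sup>2) = Re w / (norm w)\<^sup>2 - 16/9 * Re w"
    by (simp add: right_diff_distrib power2_eq_square)
  finally have V1': "Re (Vser chi x) \<le> 4714 / 1000 * ln Q - (Re w / (norm w)\<^sup>2 - 16/9 * Re w)" .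
  have V1: "Re (Vser chi x) \<le> 4714 / 1000 * ln Q - 1 / (115/100 * \<delta>) + 16/9 * (115/100 * \<delta>)"
  proof -
    have "Re w \<le> 115/100 * \<delta>" using Rew rv by linarith
    thus ?thesis using q V1' by linarith
  qed
  have V0: "Re (Vser (\<lambda>_. 1) x) \<le> 1 / \<delta> + 2 * \<delta>" using Vser_1_le[OF x] by (simp add: x_def)
  have "1 / \<delta> = 50 * ln Q" "1 / (115/100 * \<delta>) = 100/115 * (50 * ln Q)" by (simp_all add: \<delta>_def)
  with three_four_one[OF chi x] V0 V1 V2 \<delta> lnQ(1) show False by simp
qed

text \<open>Two zero-free discs of the same radius \<open>r\<close>. The one centred at
  \<open>1 + r / 10\<close> carries the Euler product lower bound from the right of 1 over to the
  point 1, at the price of a factor \<open>11/9\<close> on the logarithm; the one centred at 1 then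
  bounds the logarithmic derivative. Altogether
  \<open>2 * 11/9 * 128/100 * 1000/3 < 1050\<close>.\<close>

lemma complex_logderiv_bound:
  assumes chi: "dirichlet_character d chi" and c: "coprime c (int d)" "chi c ^ 2 \<noteq> 1" and d: "real d \<le> Q"
    and Q: "Q \<ge> 10 ^ 5"
  shows "Lser chi 1 \<noteq> 0" and "norm (deriv (Lser chi) 1 / Lser chi 1) \<le> 1050 * (ln Q)\<^sup>2"
proof -
  note lnQ = ln_facts[OF Q]
  have c1: "chi c \<noteq> 1" using c(2) by auto
  define r where "r = 3 / (1000 * ln Q)"
  have "r \<le> 3 / (1000 * 11)" unfolding r_def using lnQ by (intro divide_left_mono) auto
  hence r: "r > 0" "r \<le> 3/11000" using lnQ by (auto simp: r_def)
  define t where "t = r / 10"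
  define M where "M = 13/10 * ln Q"
  have nz: "Lser chi z \<noteq> 0" if "norm (z - 1) < r \<or> Re z > 1" for z
  proof (cases "Re z > 1")
    case True
    from Lser_lower_bound[OF chi c(1) c1 this] show ?thesis by auto
  next
    case False
    thus ?thesis using zero_free_disc[OF chi c d Q, of z] that by (auto simp: r_def)
  qed
  have hol: "Lser chi holomorphic_on ball (complex_of_real (1 + u)) r" if "u \<ge> 0" for u
  proof (rule Lser_holomorphic[OF char_psum_bounded[OF chi c(1) c1]], safe)
    fix z assume "z \<in> ball (complex_of_real (1 + u)) r"
    hence "\<bar>Re (z - of_real (1 + u))\<bar> < r" using abs_Re_le_cmod[of "z - of_real (1 + u)"] by (simp add: dist_norm norm_minus_commute)
    thus "0 < Re z" using that r abs_ge_minus_self[of "Re (z - of_real (1 + u))"] unfolding minus_complex.sel Re_complex_of_real by linarith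
  qed
  have bM: "norm (Lser chi z) \<le> M" if "norm (z - 1) \<le> 11/10 * r" for z
    unfolding M_def
  proof (rule Lser_bound_near[OF char_psum_bounded[OF chi c(1) c1] char_norm(2)[OF chi] char_psum_0[OF chi c(1) c1] char_pos[OF chi] d lnQ(1) Q])
    show "norm (z - 1) \<le> 33 / (10000 * ln Q)" using that by (simp add: r_def)
  qed
  define c0 where "c0 = complex_of_real (1 + t)"
  have t: "t > 0" "t < r" using r by (auto simp: t_def)
  have near: "norm (z - 1) \<le> 11/10 * r" if "z \<in> ball c0 r" for z
  proof -
    have "norm (z - 1) \<le> norm (z - c0) + norm (c0 - 1)" using norm_triangle_ineq[of "z - c0" "c0 - 1"] by simp
    moreover have "norm (c0 - 1) = t" using t by (simp add: c0_def)
    ultimately show ?thesis using that by (simp add: dist_norm norm_minus_commute t_def)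
  qed
  \<comment> \<open>A point of the shifted disc with \<open>Re z \<le> 1\<close> is nearer to 1 than
    to \<open>c0\<close>, hence lies in the zero-free disc about 1.\<close>
  have nz0: "Lser chi z \<noteq> 0" if z: "z \<in> ball c0 r" for z
  proof (cases "Re z > 1")
    case False
    have "norm (z - 1) < r"
    proof (rule power2_less_imp_less)
      have "norm (z - c0) < r" using z by (simp add: dist_norm norm_minus_commute)
      hence "(norm (z - c0))\<^sup>2 < r\<^sup>2" by (intro power_strict_mono) auto
      moreover have "(norm (z - c0))\<^sup>2 = (norm (z - 1))\<^sup>2 - 2 * t * (Re z - 1) + t\<^sup>2"
        unfolding cmod_power2 c0_def by (simp add: power2_eq_square algebra_simps)
      moreover have "t * (Re z - 1) \<le> 0" using False t by (intro mult_nonneg_nonpos) auto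
      ultimately show "(norm (z - 1))\<^sup>2 < r\<^sup>2" using zero_le_power2[of t] mult.assoc[of 2 t "Re z - 1"] by linarith
    qed (use r in simp)
    thus ?thesis using nz by blast
  qed (use nz in blast)
  define A where "A = ln (M / norm (Lser chi c0))"
  have zb: "ln (norm (Lser chi c0)) - 2 * A * norm (1 - c0) / (r - norm (1 - c0)) \<le> ln (norm (Lser chi 1))"
    unfolding A_def
  proof (rule zero_free_bounds(2))
    show "Lser chi holomorphic_on ball c0 r" unfolding c0_def using t by (intro hol) simp
    show "1 \<in> ball c0 r" using t by (simp add: c0_def dist_norm)
  qed (use r nz0 bM near in auto)
  have "norm (1 - c0) = t" using t by (simp add: c0_def)
  moreover have "t / (r - t) = 1/9" using r by (simp add: t_def)
  ultimately have "2 * A * norm (1 - c0) / (r - norm (1 - c0)) = 2/9 * A"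
    using times_divide_eq_right[of "2 * A" t "r - t"] by simp
  with zb have low: "ln (norm (Lser chi c0)) - 2/9 * A \<le> ln (norm (Lser chi 1))" by simp
  show n1: "Lser chi 1 \<noteq> 0" using nz[of 1] r by simp
  have nc0: "Lser chi c0 \<noteq> 0" using nz0[of c0] r by simp
  have M0: "M > 0" using lnQ by (simp add: M_def)
  have b1: "norm (deriv (Lser chi) 1 / Lser chi 1) \<le> 2 * ln (M / norm (Lser chi 1)) / r"
  proof (rule zero_free_bounds(1))
    show "Lser chi holomorphic_on ball 1 r" using hol[of 0] by simp
    show "Lser chi z \<noteq> 0" if "z \<in> ball 1 r" for z using that nz by (auto simp: dist_norm norm_minus_commute)
    show "norm (Lser chi z) \<le> M" if "z \<in> ball 1 r" for z using that r by (intro bM) (auto simp: dist_norm norm_minus_commute)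
  qed (use r in auto)
  have "ln (M / norm (Lser chi 1)) = ln M - ln (norm (Lser chi 1))" using M0 n1 by (simp add: ln_div)
  moreover have "A = ln M - ln (norm (Lser chi c0))" using M0 nc0 by (simp add: A_def ln_div)
  ultimately have l1: "ln (M / norm (Lser chi 1)) \<le> 11/9 * A" using low by linarith
  have "A \<le> 128/100 * ln Q"
  proof -
    have "1 \<le> norm (Lser chi c0) * (1 + 1 / t)"
      using Lser_lower_bound[OF chi c(1) c1, of c0] t by (simp add: c0_def)
    hence "1 / norm (Lser chi c0) \<le> 1 + 1 / t" using nc0 by (simp add: divide_le_eq mult.commute)
    hence "M * (1 / norm (Lser chi c0)) \<le> M * (1 + 1 / t)" using M0 by (intro mult_left_mono) auto
    also have "1 / t = 10000/3 * ln Q" by (simp add: t_def r_def)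
    also have "M * (1 + 10000/3 * ln Q) = 13/10 * ln Q + 13000/3 * (ln Q)\<^sup>2"
      by (simp add: M_def power2_eq_square algebra_simps)
    \<comment> \<open>\<open>13000/3 * 144 / 10^5\<close> is about 6.24. The factor 8 costs
      \<open>ln 8 \<le> 3\<close>, which is below \<open>28/100 * 11\<close>.\<close>
    also have "\<dots> \<le> 8 * Q" using lnQ Q by simp
    finally have "M / norm (Lser chi c0) \<le> 8 * Q" by simp
    hence "A \<le> ln (8 * Q)" unfolding A_def using M0 nc0 by (intro ln_mono) auto
    also have "\<dots> = 3 * ln 2 + ln Q" using Q ln_realpow[of 2 3] by (simp add: ln_mult)
    also have "\<dots> \<le> 3 + ln Q" using ln_le_minus_one[of "2::real"] by simp
    finally show ?thesis using lnQ(1) by simp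
  qed
  hence "2 * ln (M / norm (Lser chi 1)) / r \<le> 2 * (11/9 * (128/100 * ln Q)) / r"
    using l1 r by (intro divide_right_mono) auto
  also have "\<dots> = 2 * 11/9 * 128/100 * 1000/3 * (ln Q)\<^sup>2" by (simp add: r_def power2_eq_square)
  also have "\<dots> \<le> 1050 * (ln Q)\<^sup>2" by (intro mult_right_mono) auto
  finally show "norm (deriv (Lser chi) 1 / Lser chi 1) \<le> 1050 * (ln Q)\<^sup>2" using b1 by linarith
qed

section \<open>Concavity of the Bose function\<close>

text \<open>The sign of the derivative in \<open>lazarevic\<close> reduces to this difference, with
  \<open>E\<close> the exponential; the factorisation shows that it is nonnegative, with a zero of
  order four at \<open>E = 1\<close>.\<close>

lemma lazarevic_poly:
  fixes E :: real
  shows "2 * (E * (E\<^sup>2 + 4 * E + 1)) ^ 3 - 27 * (E * (E + 1)) ^ 4 = E ^ 3 * (E - 1) ^ 4 * (2 * (E + 1)\<^sup>2 + E)"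
  by (simp add: eval_nat_numeral algebra_simps)

text \<open>Lazarevic's inequality \<open>x ^ 3 * cosh x \<le> sinh x ^ 3\<close> at \<open>x = u / 2\<close>; it expresses the concavity of \<open>bose\<close> below.\<close>
lemma lazarevic:
  fixes u :: real
  assumes u: "u > 0"
  shows "u ^ 3 * (exp u * (exp u + 1)) \<le> 2 * (exp u - 1) ^ 3"
proof -
  \<comment> \<open>In terms of cube roots the claim reads \<open>f u \<ge> 0\<close>, and
    \<open>f 0 = 0\<close>. The derivative turns out to be \<open>c * P / B - 1\<close> with
    \<open>c = B powr (-1/3)\<close>, and its sign is that of \<open>P ^ 3 - B ^ 4\<close>.\<close>
  define f where "f = (\<lambda>x::real. (exp x - 1) * (exp x * (exp x + 1) / 2) powr (-1/3) - x)"
  have "f 0 \<le> f u"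
  proof (rule DERIV_nonneg_imp_nondecreasing[of 0 u f])
    fix x assume "0 \<le> x" "x \<le> u"
    define E where "E = exp x"
    define B where "B = E * (E + 1) / 2"
    define c where "c = B powr (-1/3)"
    define P where "P = E * (E\<^sup>2 + 4 * E + 1) / 6"
    have E: "E > 0" by (simp add: E_def)
    have B: "B > 0" using E by (simp add: B_def)
    have c: "c > 0" using B by (simp add: c_def)
    have c3: "c ^ 3 * B = 1"
    proof -
      have "c ^ 3 = B powr (-1)" using B by (simp add: c_def powr_power)
      thus ?thesis using B by (simp add: powr_minus)
    qed
    have P: "P > 0" using E by (auto simp: P_def intro!: mult_pos_pos add_pos_pos)
    have "(f has_real_derivative E * c + (E - 1) * (-1/3 * (c / B) * ((2 * E\<^sup>2 + E) / 2)) - 1) (at x)"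
    proof -
      have "B powr (-1/3 - 1) = c / B" using B powr_diff[of B "-1/3" 1] by (simp add: c_def)
      moreover have "(f has_real_derivative E * B powr (-1/3) + (E - 1) * (-1/3 * B powr (-1/3 - 1) * ((2 * E\<^sup>2 + E) / 2)) - 1) (at x)"
      proof -
        have B': "((\<lambda>x. exp x * (exp x + 1) / 2) has_real_derivative ((2 * E\<^sup>2 + E) / 2)) (at x)"
          unfolding E_def by (auto intro!: derivative_eq_intros simp: power2_eq_square algebra_simps)
        have P': "((\<lambda>x. (exp x * (exp x + 1) / 2) powr (-1/3)) has_real_derivative
            (-1/3 * B powr (-1/3 - 1) * ((2 * E\<^sup>2 + E) / 2))) (at x)"
          using DERIV_fun_powr[OF B', of "-1/3"] B by (simp add: B_def E_def)
        have "((\<lambda>x. exp x - 1) has_real_derivative E) (at x)"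
          unfolding E_def by (auto intro!: derivative_eq_intros)
        from DERIV_diff[OF DERIV_mult[OF this P'] DERIV_ident]
        have "(f has_real_derivative (E * (exp x * (exp x + 1) / 2) powr (-1/3) + (-1/3 * B powr (-1/3 - 1) * ((2 * E\<^sup>2 + E) / 2)) * (exp x - 1) - 1)) (at x)"
          unfolding f_def .
        thus ?thesis by (simp add: B_def E_def mult.commute)
      qed
      ultimately show ?thesis unfolding c_def by simp
    qed
    moreover have "E * c + (E - 1) * (-1/3 * (c / B) * ((2 * E\<^sup>2 + E) / 2)) - 1 = c * P / B - 1"
    proof -
      have "E * B - (E - 1) * ((2 * E\<^sup>2 + E) / 2) / 3 = P"
        unfolding B_def P_def by (simp add: field_simps power2_eq_square)
      hence "c * P / B = c * (E * B - (E - 1) * ((2 * E\<^sup>2 + E) / 2) / 3) / B" by simp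
      also have "\<dots> = E * c + (E - 1) * (-1/3 * (c / B) * ((2 * E\<^sup>2 + E) / 2))"
        using B by (simp add: field_simps)
      finally show ?thesis by simp
    qed
    moreover have "c * P / B - 1 \<ge> 0"
    proof (rule ccontr)
      assume "\<not> c * P / B - 1 \<ge> 0"
      hence "c * P < B" using B by (simp add: divide_simps)
      hence "(c * P) ^ 3 < B ^ 3" using c P by (intro power_strict_mono) auto
      hence "(c * P) ^ 3 * B < B ^ 3 * B" using B by (rule mult_strict_right_mono)
      moreover have "(c * P) ^ 3 * B = (c ^ 3 * B) * P ^ 3" by (simp add: power_mult_distrib)
      moreover have "B ^ 3 * B = B ^ 4" by (simp add: power_numeral_reduce)
      ultimately have "P ^ 3 < B ^ 4" using c3 by (simp only: mult_1)
      moreover have "P ^ 3 - B ^ 4 = (2 * (E * (E\<^sup>2 + 4 * E + 1)) ^ 3 - 27 * (E * (E + 1)) ^ 4) / 432"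
        by (simp add: P_def B_def power_divide)
      moreover have "E ^ 3 * (E - 1) ^ 4 * (2 * (E + 1)\<^sup>2 + E) \<ge> 0" using E by (intro mult_nonneg_nonneg) auto
      ultimately show False unfolding lazarevic_poly by linarith
    qed
    ultimately show "\<exists>y. (f has_real_derivative y) (at x) \<and> 0 \<le> y" by auto
  qed (use u in simp)
  hence le: "u \<le> (exp u - 1) * (exp u * (exp u + 1) / 2) powr (-1/3)" by (simp add: f_def)
  define B where "B = exp u * (exp u + 1) / 2"
  have B: "B > 0" by (simp add: B_def add_pos_pos)
  have "u ^ 3 \<le> ((exp u - 1) * B powr (-1/3)) ^ 3" using le u unfolding B_def by (intro power_mono) auto
  also have "\<dots> = (exp u - 1) ^ 3 / B"
  proof -
    have "(B powr (-1/3)) ^ 3 = B powr (-1)" using B by (simp add: powr_power)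
    thus ?thesis using B by (simp add: power_mult_distrib powr_minus field_simps)
  qed
  finally have "u ^ 3 * B \<le> (exp u - 1) ^ 3" using B by (simp add: pos_le_divide_eq)
  thus ?thesis by (simp add: B_def)
qed

text \<open>The geometric series kernel with its pole at 0 removed. The value at 0 is the limit, so
  that second differences may start at index 0.\<close>

definition bose :: "real \<Rightarrow> real" where "bose u = (if u = 0 then -1/2 else 1 / (exp u - 1) - 1 / u)"
definition bose' :: "real \<Rightarrow> real" where "bose' u = 1 / u\<^sup>2 - exp u / (exp u - 1)\<^sup>2"

lemma bose_deriv:
  assumes "u > 0"
  shows "(bose has_real_derivative bose' u) (at u)"
proof -
  have "((\<lambda>u. 1 / (exp u - 1) - 1 / u) has_real_derivative bose' u) (at u)"
    unfolding bose'_def using assms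
    by (auto intro!: derivative_eq_intros simp: power2_eq_square)
  moreover have "eventually (\<lambda>x. bose x = 1 / (exp x - 1) - 1 / x) (nhds u)"
    using eventually_nhds_in_open[of "{0<..}" u] assms by (auto elim!: eventually_mono simp: bose_def)
  ultimately show ?thesis by (subst DERIV_cong_ev[OF refl _ refl]) auto
qed

lemma bose'_antimono:
  assumes "0 < x" "x \<le> y"
  shows "bose' y \<le> bose' x"
proof (rule DERIV_nonpos_imp_nonincreasing[OF assms(2)])
  fix u assume u: "x \<le> u" "u \<le> y"
  hence u0: "u > 0" using assms by simp
  define E where "E = exp u"
  have E: "E > 1" using u0 by (simp add: E_def)
  have "(bose' has_real_derivative - 2 / u ^ 3 + E * (E + 1) / (E - 1) ^ 3) (at u)"
  proof -
    have "(bose' has_real_derivative - (2 * u) / (u\<^sup>2)\<^sup>2 - (E * (E - 1)\<^sup>2 - E * (2 * (E - 1) * E)) / ((E - 1)\<^sup>2)\<^sup>2) (at u)"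
      unfolding bose'_def E_def using u0
      by (auto intro!: derivative_eq_intros simp: power2_eq_square)
    moreover have "- (2 * u) / (u\<^sup>2)\<^sup>2 = - 2 / u ^ 3" using u0 by (simp add: field_simps power_numeral_reduce)
    moreover have "(E * (E - 1)\<^sup>2 - E * (2 * (E - 1) * E)) / ((E - 1)\<^sup>2)\<^sup>2 = - (E * (E + 1) / (E - 1) ^ 3)"
    proof -
      define D where "D = E - 1"
      have D: "D > 0" "E = D + 1" using E by (auto simp: D_def)
      show ?thesis unfolding D_def[symmetric] unfolding D(2) using D(1) by (simp add: field_simps power_numeral_reduce)
    qed
    ultimately show ?thesis by simp
  qed
  moreover have "- 2 / u ^ 3 + E * (E + 1) / (E - 1) ^ 3 \<le> 0"
  proof -
    have "u ^ 3 * (E * (E + 1)) \<le> 2 * (E - 1) ^ 3" using lazarevic[OF u0] by (simp add: E_def)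
    hence "E * (E + 1) / (E - 1) ^ 3 \<le> 2 / u ^ 3"
      using E u0 by (subst frac_le_eq, simp, simp) (intro divide_nonpos_pos, simp_all add: algebra_simps)
    thus ?thesis by simp
  qed
  ultimately show "\<exists>z. (bose' has_real_derivative z) (at u) \<and> z \<le> 0" by blast
qed

text \<open>A decreasing function lies between its limits at infinity and at 0. The limit
  \<open>1/12\<close> is the linear coefficient in
  \<open>1 / (exp u - 1) = 1 / u - 1/2 + u / 12 - ...\<close>.\<close>

lemma bose'_bounds:
  assumes u: "u > 0"
  shows "0 \<le> bose' u" "bose' u \<le> 1 / 12"
proof -
  have "(bose' \<longlongrightarrow> 0) at_top" unfolding bose'_def by real_asymp
  thus "0 \<le> bose' u"
  proof (rule tendsto_upperbound)
    show "eventually (\<lambda>i. bose' i \<le> bose' u) at_top"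
      using eventually_ge_at_top[of u] by eventually_elim (rule bose'_antimono[OF u])
  qed simp
  have "(bose' \<longlongrightarrow> 1 / 12) (at_right 0)" unfolding bose'_def by real_asymp
  thus "bose' u \<le> 1 / 12"
    by (rule tendsto_lowerbound)
       (use eventually_at_right_real[OF u] bose'_antimono in \<open>auto elim!: eventually_mono\<close>)
qed

lemma bose_tendsto: "(bose \<longlongrightarrow> 0) at_top" "(bose \<longlongrightarrow> -1/2) (at_right 0)"
proof -
  have "((\<lambda>u::real. 1 / (exp u - 1) - 1 / u) \<longlongrightarrow> 0) at_top" by real_asymp
  thus "(bose \<longlongrightarrow> 0) at_top"
    by (rule Lim_transform_eventually) (use eventually_gt_at_top[of 0] in \<open>auto elim!: eventually_mono simp: bose_def\<close>)
  have "((\<lambda>u::real. 1 / (exp u - 1) - 1 / u) \<longlongrightarrow> -1/2) (at_right 0)" by real_asymp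
  thus "(bose \<longlongrightarrow> -1/2) (at_right 0)"
    by (rule Lim_transform_eventually) (auto simp: eventually_at_filter bose_def)
qed

lemma bose_mvt:
  assumes "0 \<le> a" "a < b"
  obtains x where "a < x" "x < b" "bose b - bose a = (b - a) * bose' x"
proof -
  have tend: "bose \<midarrow>x\<rightarrow> bose x" if "x > 0" for x
    using bose_deriv[OF that] DERIV_isCont isCont_def by blast
  have "continuous_on {a..b} bose"
  proof (rule continuous_on_IccI)
    show "(bose \<longlongrightarrow> bose a) (at_right a)"
      using bose_tendsto(2) tend[of a] assms by (cases "a = 0") (auto simp: bose_def[of 0] intro: filterlim_mono at_le)
    show "(bose \<longlongrightarrow> bose b) (at_left b)"
      using tend[of b] assms by (auto intro: filterlim_mono at_le)
  qed (use assms tend in auto)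
  from MVT[OF assms(2) this] obtain l z where z: "a < z" "z < b" "DERIV bose z :> l" "bose b - bose a = (b - a) * l"
    using bose_deriv assms real_differentiable_def by (metis order_le_less_trans)
  have "l = bose' z" using DERIV_unique[OF z(3) bose_deriv] z(1) assms by simp
  thus ?thesis using that z by blast
qed

lemma bose_mono: "0 \<le> a \<Longrightarrow> a \<le> b \<Longrightarrow> bose a \<le> bose b"
proof -
  assume a: "0 \<le> a" "a \<le> b"
  show ?thesis
  proof (cases "a = b")
    case False
    then obtain x where "a < x" "x < b" "bose b - bose a = (b - a) * bose' x" using bose_mvt[of a b] a by auto
    moreover from this have "(b - a) * bose' x \<ge> 0" using a bose'_bounds(1)[of x] by simp
    ultimately show ?thesis by simp
  qed simp
qed

lemma bose_le: "0 \<le> y \<Longrightarrow> bose y + 1 / 2 \<le> y / 12"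
proof -
  assume y: "0 \<le> y"
  show ?thesis
  proof (cases "y = 0")
    case False
    then obtain x where x: "0 < x" "bose y - bose 0 = (y - 0) * bose' x" using bose_mvt[of 0 y] y by auto
    have "y * bose' x \<le> y * (1 / 12)" using y bose'_bounds(2)[OF x(1)] by (intro mult_left_mono) auto
    thus ?thesis using x(2) by (simp add: bose_def[of 0])
  qed (simp add: bose_def)
qed

lemma bose_second_difference:
  assumes y: "y > 0"
  shows "bose (real (Suc (Suc n)) * y) - 2 * bose (real (Suc n) * y) + bose (real n * y) \<le> 0"
proof -
  obtain x1 where x1: "real n * y < x1" "x1 < real (Suc n) * y" "bose (real (Suc n) * y) - bose (real n * y) = (real (Suc n) * y - real n * y) * bose' x1"
    by (rule bose_mvt[of "real n * y" "real (Suc n) * y"]) (use y in auto)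
  obtain x2 where x2: "real (Suc n) * y < x2" "bose (real (Suc (Suc n)) * y) - bose (real (Suc n) * y) = (real (Suc (Suc n)) * y - real (Suc n) * y) * bose' x2"
    by (rule bose_mvt[of "real (Suc n) * y" "real (Suc (Suc n)) * y"]) (use y in auto)
  have "0 \<le> real n * y" using y by simp
  hence "bose' x2 \<le> bose' x1" using x1 x2 by (intro bose'_antimono) auto
  hence "y * bose' x2 \<le> y * bose' x1" using y by simp
  moreover have "real (Suc n) * y - real n * y = y" "real (Suc (Suc n)) * y - real (Suc n) * y = y" by (simp_all add: algebra_simps)
  ultimately show ?thesis using x1(3) x2(2) by simp
qed

text \<open>By concavity all second differences have the same sign, so their absolute values
  telescope to at most the first increment \<open>bose y - bose 0\<close>.\<close>

lemma bose_variation: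
  assumes y: "y > 0"
  shows "(\<Sum>n<N. \<bar>bose (real (Suc (Suc n)) * y) - 2 * bose (real (Suc n) * y) + bose (real n * y)\<bar>) \<le> y / 12"
proof -
  have "(\<Sum>n<N. bose (real (Suc (Suc n)) * y) - 2 * bose (real (Suc n) * y) + bose (real n * y)) =
     (bose (real (Suc N) * y) - bose (real N * y)) - (bose y - bose 0)"
    by (induction N) auto
  moreover have "bose (real N * y) \<le> bose (real (Suc N) * y)" using y by (intro bose_mono) auto
  moreover have "bose y - bose 0 \<le> y / 12" using bose_le[of y] y by (simp add: bose_def[of 0])
  moreover have "\<bar>bose (real (Suc (Suc n)) * y) - 2 * bose (real (Suc n) * y) + bose (real n * y)\<bar> =
     - (bose (real (Suc (Suc n)) * y) - 2 * bose (real (Suc n) * y) + bose (real n * y))" for n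
    using bose_second_difference[OF y, of n] by linarith
  ultimately show ?thesis by (simp only: sum_negf)
qed

text \<open>Each factor \<open>1 - z\<close> trades a sum against powers of \<open>z\<close> for one
  over differences of \<open>h\<close>. The gain \<open>1 / norm (1 - z) ^ 2\<close> is what
  \<open>sum_inverse_ez\<close> can sum over the roots of unity.\<close>

lemma twice_by_parts:
  fixes z :: complex and h :: "nat \<Rightarrow> complex"
  assumes h0: "h 0 = 0" and z: "norm z = 1"
  shows "norm ((1 - z)\<^sup>2 * (\<Sum>n<N. z ^ Suc n * h (Suc n))) \<le>
     norm (h 1) + (\<Sum>n<N. norm (h (Suc (Suc n)) - 2 * h (Suc n) + h n)) + norm (h (Suc N) - h N) + 2 * norm (h N)"
proof -
  have eq: "(1 - z)\<^sup>2 * (\<Sum>n<N. z ^ Suc n * h (Suc n)) =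
     z * h 1 + (\<Sum>n<N. z ^ Suc (Suc n) * (h (Suc (Suc n)) - 2 * h (Suc n) + h n))
       - z ^ Suc N * ((h (Suc N) - h N) + (1 - z) * h N)"
    by (induction N) (simp_all add: h0 algebra_simps power2_eq_square)
  have nz: "norm (z ^ k) = 1" for k by (simp add: norm_power z)
  have "norm (\<Sum>n<N. z ^ Suc (Suc n) * (h (Suc (Suc n)) - 2 * h (Suc n) + h n)) \<le> (\<Sum>n<N. norm (h (Suc (Suc n)) - 2 * h (Suc n) + h n))"
    by (rule sum_norm_le) (simp add: norm_mult norm_power z)
  moreover have "norm (z * h 1) = norm (h 1)" by (simp add: norm_mult z)
  moreover have "norm (z ^ Suc N * ((h (Suc N) - h N) + (1 - z) * h N)) \<le> norm (h (Suc N) - h N) + 2 * norm (h N)"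
  proof -
    have "norm (1 - z) \<le> 2" using norm_triangle_ineq4[of 1 z] z by simp
    hence "norm ((1 - z) * h N) \<le> 2 * norm (h N)" unfolding norm_mult by (rule mult_right_mono) simp
    thus ?thesis using norm_triangle_ineq[of "h (Suc N) - h N" "(1 - z) * h N"] by (simp only: norm_mult nz)
  qed
  ultimately show ?thesis unfolding eq
    using norm_triangle_ineq4[of "z * h 1 + (\<Sum>n<N. z ^ Suc (Suc n) * (h (Suc (Suc n)) - 2 * h (Suc n) + h n))" "z ^ Suc N * ((h (Suc N) - h N) + (1 - z) * h N)"]
      norm_triangle_ineq[of "z * h 1" "\<Sum>n<N. z ^ Suc (Suc n) * (h (Suc (Suc n)) - 2 * h (Suc n) + h n)"] by linarith
qed

text \<open>Parseval's identity for \<open>\<Sum>n<d. n * z ^ n = d / (z - 1)\<close>, valid at the \<open>d\<close>-th roots of unity \<open>z \<noteq> 1\<close>.\<close>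
lemma sum_inverse_ez:
  assumes d: "d > 0"
  shows "(\<Sum>a\<in>{1..<int d}. 1 / (norm (1 - ez d a))\<^sup>2) \<le> (real d)\<^sup>2 / 12"
proof -
  define W where "W = (\<lambda>a. \<Sum>n\<in>{0..<int d}. of_int n * ez d (a * n))"
  have W0: "W 0 = of_real (real d * (real d - 1) / 2)"
  proof -
    have "(\<Sum>n<d. real n) = real d * (real d - 1) / 2" by (induction d) (auto simp: field_simps)
    moreover have "W 0 = of_real (\<Sum>n<d. real n)"
      unfolding W_def of_real_sum using sum_int_residues[of "\<lambda>n. of_int n :: complex" d] by (simp add: ez_def)
    ultimately show ?thesis by (simp only:)
  qed
  have W: "(norm (W a))\<^sup>2 = (real d)\<^sup>2 * (1 / (norm (1 - ez d a))\<^sup>2)" if a: "a \<in> {1..<int d}" for a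
  proof -
    define z where "z = ez d a"
    have "\<not> int d dvd a" using a zdvd_not_zless by auto
    hence z1: "z \<noteq> 1" using ez_eq_1_iff[OF d] by (simp add: z_def)
    have zd: "z ^ d = 1" unfolding z_def ez_power using ez_multiple[OF d, of a] by (simp add: mult.commute)
    have Wz: "W a = (\<Sum>n<d. of_nat n * z ^ n)"
      unfolding W_def z_def ez_power by (subst sum_int_residues[symmetric]) simp
    have "(z - 1) * (\<Sum>n<N. of_nat n * z ^ n) = of_nat N * z ^ N - z * (\<Sum>n<N. z ^ n)" for N
      by (induction N) (simp_all add: algebra_simps)
    moreover have "(\<Sum>n<d. z ^ n) = 0" using zd z1 by (simp add: geometric_sum)
    ultimately have "(z - 1) * W a = of_nat d" using zd by (simp add: Wz)
    hence "norm (z - 1) * norm (W a) = real d" by (metis norm_mult norm_of_nat)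
    hence "norm (W a) = real d / norm (1 - z)" using z1 by (simp add: field_simps norm_minus_commute)
    thus ?thesis by (simp add: z_def power_divide)
  qed
  have "(\<Sum>a\<in>{0..<int d}. W a * cnj (W a)) = (\<Sum>n\<in>{0..<int d}. \<Sum>m\<in>{0..<int d}. of_int n * of_int m * (\<Sum>a\<in>{0..<int d}. ez d ((n - m) * a)))"
  proof -
    have "W a * cnj (W a) = (\<Sum>n\<in>{0..<int d}. \<Sum>m\<in>{0..<int d}. of_int n * of_int m * ez d ((n - m) * a))" for a
    proof -
      have "W a * cnj (W a) = (\<Sum>n\<in>{0..<int d}. \<Sum>m\<in>{0..<int d}. (of_int n * ez d (a * n)) * (of_int m * ez d (- (a * m))))"
        unfolding W_def cnj_sum sum_product by (simp add: ez_cnj)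
      moreover have "(of_int n * ez d (a * n)) * (of_int m * ez d (- (a * m))) = of_int n * of_int m * ez d ((n - m) * a)" for n m
      proof -
        have "ez d ((n - m) * a) = ez d (a * n + - (a * m))" by (simp add: algebra_simps)
        thus ?thesis by (simp only: ez_add) (simp add: mult_ac)
      qed
      ultimately show ?thesis by simp
    qed
    hence "(\<Sum>a\<in>{0..<int d}. W a * cnj (W a)) = (\<Sum>a\<in>{0..<int d}. \<Sum>n\<in>{0..<int d}. \<Sum>m\<in>{0..<int d}. of_int n * of_int m * ez d ((n - m) * a))"
      by simp
    also have "\<dots> = (\<Sum>n\<in>{0..<int d}. \<Sum>a\<in>{0..<int d}. \<Sum>m\<in>{0..<int d}. of_int n * of_int m * ez d ((n - m) * a))"
      by (rule sum.swap)
    also have "\<dots> = (\<Sum>n\<in>{0..<int d}. \<Sum>m\<in>{0..<int d}. \<Sum>a\<in>{0..<int d}. of_int n * of_int m * ez d ((n - m) * a))"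
      by (intro sum.cong refl sum.swap)
    finally show ?thesis by (simp only: sum_distrib_left)
  qed
  also have "\<dots> = (\<Sum>n\<in>{0..<int d}. of_int n * of_int n * of_nat d)"
  proof (rule sum.cong[OF refl])
    fix n assume n: "n \<in> {0..<int d}"
    have "(int d dvd n - m) = (m = n)" if "m \<in> {0..<int d}" for m
      using n that by (auto simp: mod_eq_dvd_iff[symmetric])
    hence "(\<Sum>m\<in>{0..<int d}. of_int n * of_int m * (\<Sum>a\<in>{0..<int d}. ez d ((n - m) * a))) =
      (\<Sum>m\<in>{0..<int d}. if m = n then of_int n * of_int m * of_nat d else (0 :: complex))"
      by (intro sum.cong refl) (simp add: ez_orthogonality[OF d])
    thus "(\<Sum>m\<in>{0..<int d}. of_int n * of_int m * (\<Sum>a\<in>{0..<int d}. ez d ((n - m) * a))) = of_int n * of_int n * of_nat d"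
      using n by simp
  qed
  also have "\<dots> = of_real (real d * (\<Sum>n<d. (real n)\<^sup>2))"
    using sum_int_residues[of "\<lambda>n. of_int n * of_int n * of_nat d :: complex" d]
    by (simp add: sum_distrib_left power2_eq_square mult_ac)
  also have "(\<Sum>n<d. (real n)\<^sup>2) = real d * (real d - 1) * (2 * real d - 1) / 6"
    by (induction d) (auto simp: field_simps power2_eq_square)
  also have "(\<Sum>a\<in>{0..<int d}. W a * cnj (W a)) = of_real (\<Sum>a\<in>{0..<int d}. (norm (W a))\<^sup>2)"
    unfolding of_real_sum by (intro sum.cong refl) (simp only: complex_norm_square)
  finally have "(\<Sum>a\<in>{0..<int d}. (norm (W a))\<^sup>2) = real d * (real d * (real d - 1) * (2 * real d - 1) / 6)"
    by (simp only: of_real_eq_iff)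
  moreover have "{0..<int d} = insert 0 {1..<int d}" using d by auto
  ultimately have "(norm (W 0))\<^sup>2 + (\<Sum>a\<in>{1..<int d}. (norm (W a))\<^sup>2) = real d * (real d * (real d - 1) * (2 * real d - 1) / 6)"
    by simp
  moreover have "(norm (W 0))\<^sup>2 = (real d * (real d - 1) / 2)\<^sup>2" unfolding W0 norm_of_real by (rule power2_abs)
  moreover have "(\<Sum>a\<in>{1..<int d}. (norm (W a))\<^sup>2) = (real d)\<^sup>2 * (\<Sum>a\<in>{1..<int d}. 1 / (norm (1 - ez d a))\<^sup>2)"
    unfolding sum_distrib_left by (intro sum.cong refl W)
  ultimately have "(real d)\<^sup>2 * (\<Sum>a\<in>{1..<int d}. 1 / (norm (1 - ez d a))\<^sup>2) = 
      real d * (real d * (real d - 1) * (2 * real d - 1) / 6) - (real d * (real d - 1) / 2)\<^sup>2" by linarith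
  also have "\<dots> = (real d)\<^sup>2 * (((real d)\<^sup>2 - 1) / 12)" by (simp add: power2_eq_square field_simps)
  finally have "(\<Sum>a\<in>{1..<int d}. 1 / (norm (1 - ez d a))\<^sup>2) = ((real d)\<^sup>2 - 1) / 12" using d by simp
  thus ?thesis by simp
qed

section \<open>Real characters\<close>

text \<open>Taking the difference of two dilates makes the sequence vanish at \<open>n = 0\<close>.
  The constant \<open>-1/2\<close> of a single \<open>bose\<close> would be a boundary term
  independent of \<open>y\<close>, too large after multiplication by the factor
  \<open>sqrt d * d / 12\<close> in the bounds below.\<close>

definition hdiff :: "real \<Rightarrow> nat \<Rightarrow> real" where
  "hdiff y n = bose (real n * y) - bose (real n * (3 * y))"

lemma abs_second_difference_le:
  "\<bar>a - a' - 2 * (b - b') + (c - c')\<bar> \<le> \<bar>a - 2 * b + c\<bar> + \<bar>a' - 2 * b' + c'\<bar>" for a b c :: real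
proof -
  have "a - a' - 2 * (b - b') + (c - c') = (a - 2 * b + c) - (a' - 2 * b' + c')" by simp
  thus ?thesis by (simp only: abs_triangle_ineq4)
qed

lemma hdiff_variation:
  assumes y: "y > 0"
  shows "(\<Sum>n<N. \<bar>hdiff y (Suc (Suc n)) - 2 * hdiff y (Suc n) + hdiff y n\<bar>) \<le> y / 3"
proof -
  let ?D = "\<lambda>y n. bose (real (Suc (Suc n)) * y) - 2 * bose (real (Suc n) * y) + bose (real n * y)"
  have "(\<Sum>n<N. \<bar>hdiff y (Suc (Suc n)) - 2 * hdiff y (Suc n) + hdiff y n\<bar>) \<le> (\<Sum>n<N. \<bar>?D y n\<bar> + \<bar>?D (3 * y) n\<bar>)"
    unfolding hdiff_def by (intro sum_mono abs_second_difference_le)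
  also have "\<dots> = (\<Sum>n<N. \<bar>?D y n\<bar>) + (\<Sum>n<N. \<bar>?D (3 * y) n\<bar>)" by (rule sum.distrib)
  also have "\<dots> \<le> y / 12 + 3 * y / 12" using y by (intro add_mono bose_variation) auto
  finally show ?thesis by simp
qed

lemma norm_ez: "norm (ez d a) = 1"
proof -
  have "ez d a = exp (\<i> * of_real (2 * pi * real_of_int a / real d))"
    by (simp add: ez_def mult_ac)
  thus ?thesis by (simp only: norm_exp_i_times)
qed

text \<open>The sum over the roots of unity costs \<open>d^2 / 12\<close>, and division by the Gauss
  sum, of norm \<open>sqrt d\<close>, leaves \<open>sqrt d * d / 12\<close>. The trivial root of
  unity, where no gain is possible, belongs to \<open>a = 0\<close> and drops out because
  \<open>chi 0 = 0\<close>.\<close>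

lemma char_hdiff_partial:
  assumes chi: "dirichlet_character d chi" and pr: "prim d chi" and d: "d \<ge> 2" and y: "y > 0"
  shows "norm (\<Sum>n<N. chi (int (Suc n)) * of_real (hdiff y (Suc n))) \<le>
     sqrt (real d) * real d / 12 * (\<bar>hdiff y 1\<bar> + y / 3 + \<bar>hdiff y (Suc N) - hdiff y N\<bar> + 2 * \<bar>hdiff y N\<bar>)"
proof -
  define \<tau> where "\<tau> = gauss d chi 1"
  define R where "R = \<bar>hdiff y 1\<bar> + y / 3 + \<bar>hdiff y (Suc N) - hdiff y N\<bar> + 2 * \<bar>hdiff y N\<bar>"
  define S where "S = (\<lambda>a. \<Sum>n<N. ez d a ^ Suc n * complex_of_real (hdiff y (Suc n)))"
  let ?X = "\<Sum>n<N. chi (int (Suc n)) * complex_of_real (hdiff y (Suc n))"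
  have \<tau>: "norm \<tau> = sqrt (real d)" unfolding \<tau>_def by (rule gauss_norm[OF chi pr])
  have R0: "R \<ge> 0" using y by (simp add: R_def)
  have sep: "\<tau> * (chi m * w) = gauss d chi m * w" for m w
  proof -
    have "gauss d chi m = \<tau> * chi m" unfolding \<tau>_def by (rule gauss_separable[OF chi pr])
    thus ?thesis by (simp only: mult.assoc)
  qed
  have "\<tau> * ?X = (\<Sum>n<N. gauss d chi (int (Suc n)) * of_real (hdiff y (Suc n)))"
    unfolding sum_distrib_left by (intro sum.cong refl sep)
  also have "\<dots> = (\<Sum>n<N. \<Sum>a\<in>{0..<int d}. cnj (chi a) * (ez d a ^ Suc n * of_real (hdiff y (Suc n))))"
    unfolding gauss_def sum_distrib_right by (intro sum.cong refl) (simp only: ez_power mult.assoc)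
  also have "\<dots> = (\<Sum>a\<in>{0..<int d}. \<Sum>n<N. cnj (chi a) * (ez d a ^ Suc n * of_real (hdiff y (Suc n))))"
    by (rule sum.swap)
  also have "\<dots> = (\<Sum>a\<in>{0..<int d}. cnj (chi a) * S a)" by (simp only: S_def sum_distrib_left)
  also have "{0..<int d} = insert 0 {1..<int d}" using d by auto
  also have "(\<Sum>a\<in>insert 0 {1..<int d}. cnj (chi a) * S a) = (\<Sum>a\<in>{1..<int d}. cnj (chi a) * S a)"
  proof -
    have "chi 0 = 0" using char_nz_iff[OF chi, of 0] d by auto
    thus ?thesis by simp
  qed
  finally have eq: "\<tau> * ?X = (\<Sum>a\<in>{1..<int d}. cnj (chi a) * S a)" .
  have "norm (\<Sum>a\<in>{1..<int d}. cnj (chi a) * S a) \<le> (\<Sum>a\<in>{1..<int d}. R * (1 / (norm (1 - ez d a))\<^sup>2))"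
  proof (rule sum_norm_le)
    fix a assume a: "a \<in> {1..<int d}"
    have "\<not> int d dvd a" using a zdvd_not_zless by auto
    hence z1: "norm (1 - ez d a) > 0" using ez_eq_1_iff[of d a] d by auto
    have "norm ((1 - ez d a)\<^sup>2 * S a) \<le> norm (complex_of_real (hdiff y 1)) +
       (\<Sum>n<N. norm (complex_of_real (hdiff y (Suc (Suc n))) - 2 * of_real (hdiff y (Suc n)) + of_real (hdiff y n)))
       + norm (complex_of_real (hdiff y (Suc N)) - of_real (hdiff y N)) + 2 * norm (complex_of_real (hdiff y N))"
      unfolding S_def by (rule twice_by_parts) (simp_all add: norm_ez hdiff_def bose_def)
    also have "(\<Sum>n<N. norm (complex_of_real (hdiff y (Suc (Suc n))) - 2 * of_real (hdiff y (Suc n)) + of_real (hdiff y n))) =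
       (\<Sum>n<N. \<bar>hdiff y (Suc (Suc n)) - 2 * hdiff y (Suc n) + hdiff y n\<bar>)"
    proof (intro sum.cong refl)
      fix n
      have "complex_of_real (hdiff y (Suc (Suc n))) - 2 * of_real (hdiff y (Suc n)) + of_real (hdiff y n) =
        of_real (hdiff y (Suc (Suc n)) - 2 * hdiff y (Suc n) + hdiff y n)" by simp
      thus "norm (complex_of_real (hdiff y (Suc (Suc n))) - 2 * of_real (hdiff y (Suc n)) + of_real (hdiff y n)) =
        \<bar>hdiff y (Suc (Suc n)) - 2 * hdiff y (Suc n) + hdiff y n\<bar>" by (simp only: norm_of_real)
    qed
    also have "\<dots> \<le> y / 3" by (rule hdiff_variation[OF y])
    finally have "norm ((1 - ez d a)\<^sup>2 * S a) \<le> R"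
      unfolding R_def of_real_diff[symmetric] norm_of_real by simp
    hence "norm (S a) \<le> R * (1 / (norm (1 - ez d a))\<^sup>2)"
      using z1 by (simp add: norm_mult norm_power pos_le_divide_eq mult.commute)
    moreover have "norm (cnj (chi a) * S a) \<le> norm (S a)"
      using char_norm(2)[OF chi, of a] by (simp add: norm_mult mult_left_le_one_le)
    ultimately show "norm (cnj (chi a) * S a) \<le> R * (1 / (norm (1 - ez d a))\<^sup>2)" by linarith
  qed
  also have "\<dots> = R * (\<Sum>a\<in>{1..<int d}. 1 / (norm (1 - ez d a))\<^sup>2)" by (simp only: sum_distrib_left)
  also have "\<dots> \<le> R * ((real d)\<^sup>2 / 12)" using sum_inverse_ez[of d] d R0 by (intro mult_left_mono) auto
  finally have "sqrt (real d) * norm ?X \<le> R * ((real d)\<^sup>2 / 12)"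
    unfolding eq[symmetric] norm_mult \<tau> .
  also have "R * ((real d)\<^sup>2 / 12) = sqrt (real d) * (sqrt (real d) * real d / 12 * R)"
  proof -
    have "sqrt (real d) * sqrt (real d) = real d" by simp
    moreover have "sqrt (real d) * (sqrt (real d) * real d / 12 * R) = (sqrt (real d) * sqrt (real d)) * (real d / 12 * R)"
      by simp
    ultimately show ?thesis by (simp only: power2_eq_square) simp
  qed
  finally show ?thesis using d unfolding R_def by simp
qed

lemma hdiff_tendsto_0:
  assumes "y > 0"
  shows "hdiff y \<longlonglongrightarrow> 0"
proof -
  have "filterlim (\<lambda>n. real n * y) at_top sequentially" "filterlim (\<lambda>n. real n * (3 * y)) at_top sequentially"
    using assms by real_asymp+
  from filterlim_compose[OF bose_tendsto(1) this(1)] filterlim_compose[OF bose_tendsto(1) this(2)]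
  have "(\<lambda>n. bose (real n * y) - bose (real n * (3 * y))) \<longlonglongrightarrow> 0 - 0" by (rule tendsto_diff)
  thus ?thesis unfolding hdiff_def by simp
qed

text \<open>In the limit the boundary terms at \<open>N\<close> vanish.
  \<open>7/12 = 1/4 + 1/3\<close> collects the first value of \<open>hdiff\<close> and the sum of
  its second differences.\<close>

lemma char_hdiff_bound:
  assumes chi: "dirichlet_character d chi" and pr: "prim d chi" and d: "d \<ge> 2" and y: "y > 0"
    and S: "(\<lambda>n. chi (int (Suc n)) * of_real (hdiff y (Suc n))) sums S"
  shows "norm S \<le> sqrt (real d) * real d / 12 * (7 / 12 * y)"
proof -
  have h: "hdiff y \<longlonglongrightarrow> 0" by (rule hdiff_tendsto_0[OF y])
  have "norm S \<le> sqrt (real d) * real d / 12 * (\<bar>hdiff y 1\<bar> + y / 3 + \<bar>0 - 0\<bar> + 2 * \<bar>0\<bar>)"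
  proof (rule tendsto_le[OF sequentially_bot])
    show "(\<lambda>N. norm (\<Sum>n<N. chi (int (Suc n)) * of_real (hdiff y (Suc n)))) \<longlonglongrightarrow> norm S"
      by (intro tendsto_norm) (use S in \<open>simp only: sums_def\<close>)
    show "(\<lambda>N. sqrt (real d) * real d / 12 * (\<bar>hdiff y 1\<bar> + y / 3 + \<bar>hdiff y (Suc N) - hdiff y N\<bar> + 2 * \<bar>hdiff y N\<bar>))
       \<longlonglongrightarrow> sqrt (real d) * real d / 12 * (\<bar>hdiff y 1\<bar> + y / 3 + \<bar>0 - 0\<bar> + 2 * \<bar>0\<bar>)"
      by (intro tendsto_mult tendsto_add tendsto_const tendsto_rabs tendsto_diff h LIMSEQ_Suc[OF h])
    show "\<forall>\<^sub>F N in sequentially. norm (\<Sum>n<N. chi (int (Suc n)) * of_real (hdiff y (Suc n))) \<le>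
       sqrt (real d) * real d / 12 * (\<bar>hdiff y 1\<bar> + y / 3 + \<bar>hdiff y (Suc N) - hdiff y N\<bar> + 2 * \<bar>hdiff y N\<bar>)"
      by (rule always_eventually, rule allI, rule char_hdiff_partial[OF chi pr d y])
  qed
  also have "\<dots> \<le> sqrt (real d) * real d / 12 * (7 / 12 * y)"
  proof (intro mult_left_mono)
    have "bose y \<le> bose (3 * y)" "bose 0 \<le> bose y" using y by (auto intro!: bose_mono)
    moreover have "bose (3 * y) + 1 / 2 \<le> 3 * y / 12" using y bose_le[of "3 * y"] by simp
    moreover have "bose 0 = -1/2" by (simp add: bose_def)
    ultimately have "\<bar>bose y - bose (3 * y)\<bar> \<le> y / 4" by linarith
    thus "\<bar>hdiff y 1\<bar> + y / 3 + \<bar>0 - 0\<bar> + 2 * \<bar>0\<bar> \<le> 7 / 12 * y" by (simp add: hdiff_def)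
  qed auto
  finally show ?thesis .
qed

section \<open>Divisor sums of a real character and their Lambert series\<close>

lemma geometric_sum_sign:
  fixes v :: real
  assumes "v \<in> {-1, 0, 1}"
  shows "0 \<le> (\<Sum>i\<le>a. v ^ i)" "even a \<Longrightarrow> 1 \<le> (\<Sum>i\<le>a. v ^ i)"
proof -
  have 1: "(\<Sum>i\<le>a. (-1 :: real) ^ i) = (if even a then 1 else 0)" by (induction a) auto
  have 2: "(\<Sum>i\<le>a. (0 :: real) ^ i) = 1" by (induction a) auto
  show "0 \<le> (\<Sum>i\<le>a. v ^ i)" "even a \<Longrightarrow> 1 \<le> (\<Sum>i\<le>a. v ^ i)"
    using assms 1 2 by auto
qed

text \<open>Splitting off the full power \<open>p ^ a\<close> of one prime factors the divisor sum
  as \<open>\<Sum>i\<le>a. x p ^ i\<close> times the divisor sum of the cofactor. With values -1, 0,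
  1 the first factor is nonnegative, and at least 1 for even \<open>a\<close>. Both assertions pass
  through the same induction.\<close>

lemma divisor_sum_sign:
  fixes x :: "nat \<Rightarrow> real"
  assumes mult: "\<And>m n. x (m * n) = x m * x n" and one: "x 1 = 1" and val: "\<And>n. x n \<in> {-1, 0, 1}" and n: "n > 0"
  shows "0 \<le> (\<Sum>k | k dvd n. x k) \<and> ((\<forall>p. prime p \<longrightarrow> even (multiplicity p n)) \<longrightarrow> 1 \<le> (\<Sum>k | k dvd n. x k))"
  using n
proof (induction n rule: less_induct)
  case (less n)
  show ?case
  proof (cases "n = 1")
    case True
    thus ?thesis using one by simp
  next
    case False
    then obtain p where p: "prime p" "p dvd n" using prime_factor_nat by blast
    define a where "a = multiplicity p n"
    have "n \<noteq> 0" "\<not> is_unit p" using less.prems p(1) not_prime_unit by auto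
    from multiplicity_decompose'[OF this] obtain m where m: "n = p ^ a * m" "\<not> p dvd m"
      unfolding a_def .
    have m0: "m > 0" using m(2) by (cases m) auto
    have "a > 0" using p less.prems by (simp add: a_def prime_multiplicity_gt_zero_iff)
    hence "1 < p ^ a" using prime_gt_1_nat[OF p(1)] by (intro one_less_power)
    hence "m < n" using m(1) m0 by simp
    have xp: "x (p ^ i) = x p ^ i" for i
    proof (induction i)
      case 0 show ?case using one by simp
    next
      case (Suc i) thus ?case by (simp add: mult)
    qed
    have mp: "multiplicity p (p ^ i * e) = i" if "e dvd m" for i e
    proof -
      have "\<not> p dvd e" using that m(2) dvd_trans by blast
      moreover from this have "e \<noteq> 0" by (metis dvd_0_right)
      ultimately show ?thesis
        using p by (simp add: prime_elem_multiplicity_mult_distrib not_dvd_imp_multiplicity_0 prime_gt_0_nat)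
    qed
    have inj: "inj_on (\<lambda>(i, e). p ^ i * e) ({..a} \<times> {e. e dvd m})"
    proof (rule inj_onI, clarify)
      fix i e j e' assume e: "e dvd m" "e' dvd m" and eq: "p ^ i * e = p ^ j * e'"
      have "i = j" using mp[OF e(1), of i] mp[OF e(2), of j] eq by simp
      moreover from this have "e = e'" using eq p by (simp add: prime_gt_0_nat)
      ultimately show "i = j \<and> e = e'" by simp
    qed
    have img: "(\<lambda>(i, e). p ^ i * e) ` ({..a} \<times> {e. e dvd m}) = {k. k dvd n}"
    proof safe
      fix i e assume "i \<le> a" "e dvd m"
      thus "p ^ i * e dvd n" unfolding m(1) by (intro mult_dvd_mono le_imp_power_dvd)
    next
      fix k assume "k dvd n"
      then obtain b c where bc: "k = b * c" "b dvd p ^ a" "c dvd m" using division_decomp[of k "p ^ a" m] m(1) by auto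
      then obtain i where "i \<le> a" "b = p ^ i" using divides_primepow_nat[OF p(1)] by auto
      thus "k \<in> (\<lambda>(i, e). p ^ i * e) ` ({..a} \<times> {e. e dvd m})" using bc by auto
    qed
    have "(\<Sum>k | k dvd n. x k) = (\<Sum>(i, e)\<in>{..a} \<times> {e. e dvd m}. x (p ^ i * e))"
      unfolding img[symmetric] by (subst sum.reindex[OF inj]) (simp add: o_def case_prod_unfold)
    also have "\<dots> = (\<Sum>i\<le>a. \<Sum>e | e dvd m. x p ^ i * x e)"
      by (subst sum.cartesian_product[symmetric]) (simp add: mult xp)
    also have "\<dots> = (\<Sum>i\<le>a. x p ^ i) * (\<Sum>e | e dvd m. x e)" by (simp only: sum_product)
    finally have eq: "(\<Sum>k | k dvd n. x k) = (\<Sum>i\<le>a. x p ^ i) * (\<Sum>e | e dvd m. x e)" .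
    note IH = less.IH[OF \<open>m < n\<close> m0]
    note g = geometric_sum_sign[OF val[of p], of a]
    have "1 \<le> (\<Sum>k | k dvd n. x k)" if ev: "\<forall>p. prime p \<longrightarrow> even (multiplicity p n)"
    proof -
      have "even (multiplicity p' m)" if p': "prime p'" for p'
      proof (cases "p' = p")
        case True
        thus ?thesis using m(2) by (simp add: not_dvd_imp_multiplicity_0)
      next
        case False
        have "multiplicity p' n = multiplicity p' (p ^ a) + multiplicity p' m"
          unfolding m(1) using p' p m0 by (intro prime_elem_multiplicity_mult_distrib) auto
        also have "multiplicity p' (p ^ a) = 0" using multiplicity_distinct_prime_power[OF p' p(1)] False by auto
        finally show ?thesis using ev p' by auto
      qed
      hence "1 \<le> (\<Sum>e | e dvd m. x e)" using IH by blast
      moreover have "1 \<le> (\<Sum>i\<le>a. x p ^ i)" using g(2) ev p(1) by (simp add: a_def)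
      ultimately show ?thesis unfolding eq using mult_mono[of 1 "\<Sum>i\<le>a. x p ^ i" 1 "\<Sum>e | e dvd m. x e"] by simp
    qed
    moreover have "0 \<le> (\<Sum>k | k dvd n. x k)" unfolding eq using g(1) IH by simp
    ultimately show ?thesis by blast
  qed
qed

lemma divisor_sum_square:
  fixes x :: "nat \<Rightarrow> real"
  assumes "\<And>m n. x (m * n) = x m * x n" "x 1 = 1" "\<And>n. x n \<in> {-1, 0, 1}" "k > 0"
  shows "1 \<le> (\<Sum>j | j dvd k\<^sup>2. x j)"
proof -
  have "even (multiplicity p (k\<^sup>2))" if "prime p" for p
    using that assms(4) by (simp add: prime_elem_multiplicity_power_distrib)
  thus ?thesis using divisor_sum_sign[OF assms(1-3), of "k\<^sup>2"] assms(4) by auto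
qed

lemma geometric_exp_has_sum:
  fixes u :: real
  assumes u: "u > 0"
  shows "((\<lambda>m. exp (- (real m * u))) has_sum (1 / (exp u - 1))) {0<..}"
proof -
  have q: "norm (exp (- u)) < 1" using u by simp
  have e: "exp (- (real (Suc m) * u)) = exp (- u) * exp (- u) ^ m" for m
    by (simp add: exp_of_nat_mult[symmetric] exp_add[symmetric] algebra_simps)
  have "(\<lambda>m. exp (- u) * exp (- u) ^ m) sums (exp (- u) * (1 / (1 - exp (- u))))"
    by (intro sums_mult geometric_sums q)
  also have "exp (- u) * (1 / (1 - exp (- u))) = 1 / (exp u - 1)"
    using u by (simp add: exp_minus field_simps)
  finally have s: "(\<lambda>m. exp (- (real (Suc m) * u))) sums (1 / (exp u - 1))" unfolding e .
  have "((\<lambda>m. exp (- (real (Suc m) * u))) has_sum (1 / (exp u - 1))) UNIV"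
    by (rule norm_summable_imp_has_sum[OF _ s]) (use sums_summable[OF s] in simp)
  hence "((\<lambda>m. exp (- (real m * u))) has_sum (1 / (exp u - 1))) (range Suc)"
    by (subst has_sum_reindex) (simp_all add: o_def)
  moreover have "range Suc = {0<..}" by (auto simp: image_iff) (metis gr0_implies_Suc)
  ultimately show ?thesis by simp
qed

text \<open>A double series over \<open>(k, m)\<close>, summed over \<open>m\<close> first and then
  along \<open>n = k * m\<close>. From \<open>(k - 1) * (m - 1) \<ge> 0\<close> follows
  \<open>k * m \<ge> k + m - 1\<close>, so a product of two geometric series dominates it.\<close>

lemma lambert_divisor_sum:
  fixes x :: "nat \<Rightarrow> real"
  assumes x: "\<And>n. \<bar>x n\<bar> \<le> 1" and y: "y > 0"
  obtains A where
    "(\<lambda>n. x (Suc n) * (1 / (exp (real (Suc n) * y) - 1) - 1 / (exp (real (Suc n) * (3 * y)) - 1))) sums A"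
    "((\<lambda>n. (\<Sum>k | k dvd n. x k) * (exp (- (real n * y)) - exp (- (real n * (3 * y))))) has_sum A) {0<..}"
proof -
  define F where "F = (\<lambda>(k, m). x k * (exp (- (real (k * m) * y)) - exp (- (real (k * m) * (3 * y)))))"
  have geo: "((\<lambda>m. exp (- (real m * y))) has_sum (1 / (exp y - 1))) {0<..}" by (rule geometric_exp_has_sum[OF y])
  have "(\<lambda>(k, m). exp y * exp (- (real k * y)) * exp (- (real m * y))) summable_on ({0<..} \<times> {0<..})"
  proof (rule summable_on_SigmaI)
    show "((\<lambda>m. case (k, m) of (k, m) \<Rightarrow> exp y * exp (- (real k * y)) * exp (- (real m * y))) has_sum (exp y * exp (- (real k * y)) * (1 / (exp y - 1)))) {0<..}" for k :: nat
      using has_sum_cmult_right[OF geo, of "exp y * exp (- (real k * y))"] by simp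
    have "(\<lambda>k. exp y * exp (- (real k * y))) summable_on {0<..}"
      by (intro summable_on_cmult_right has_sum_imp_summable[OF geo])
    thus "(\<lambda>k. exp y * exp (- (real k * y)) * (1 / (exp y - 1))) summable_on {0<..}"
      by (rule summable_on_cmult_left)
  qed auto
  hence "(\<lambda>p. norm (F p)) summable_on ({0<..} \<times> {0<..})"
  proof (rule summable_on_comparison_test)
    fix p :: "nat \<times> nat" assume "p \<in> {0<..} \<times> {0<..}"
    then obtain k m where p: "p = (k, m)" "k \<ge> 1" "m \<ge> 1" by (cases p) auto
    have "(real k - 1) * (real m - 1) \<ge> 0" using p by simp
    hence "real (k * m) \<ge> real k + real m - 1" by (simp add: algebra_simps)
    hence le: "real (k * m) * y \<ge> (real k + real m - 1) * y" using y by (intro mult_right_mono) auto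
    have "exp (- (real (k * m) * (3 * y))) \<le> exp (- (real (k * m) * y))" using y by simp
    hence "\<bar>exp (- (real (k * m) * y)) - exp (- (real (k * m) * (3 * y)))\<bar> \<le> exp (- (real (k * m) * y))"
      by (simp add: abs_if)
    hence "norm (F p) \<le> 1 * exp (- (real (k * m) * y))"
      unfolding F_def p prod.case real_norm_def abs_mult using x[of k] by (intro mult_mono) auto
    also have "\<dots> \<le> exp (- ((real k + real m - 1) * y))" using le by simp
    also have "\<dots> = exp y * exp (- (real k * y)) * exp (- (real m * y))"
      unfolding exp_add[symmetric] by (simp add: algebra_simps)
    finally show "norm (F p) \<le> (case p of (k, m) \<Rightarrow> exp y * exp (- (real k * y)) * exp (- (real m * y)))" by (simp add: p)
  qed auto
  hence "F summable_on ({0<..} \<times> {0<..})" by (rule Infinite_Sum.abs_summable_summable)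
  then obtain A where A: "(F has_sum A) ({0<..} \<times> {0<..})" by (auto simp: summable_on_def)
  have "((\<lambda>n. \<Sum>k | k dvd n. F (k, n div k)) has_sum A) {0<..}" by (rule divisor_sum_has_sum[OF A])
  moreover have "(\<Sum>k | k dvd n. F (k, n div k)) = (\<Sum>k | k dvd n. x k) * (exp (- (real n * y)) - exp (- (real n * (3 * y))))" for n
    unfolding sum_distrib_right by (rule sum.cong) (auto simp: F_def simp del: of_nat_mult)
  ultimately have 2: "((\<lambda>n. (\<Sum>k | k dvd n. x k) * (exp (- (real n * y)) - exp (- (real n * (3 * y))))) has_sum A) {0<..}"
    by simp
  have "((\<lambda>k. x k * (1 / (exp (real k * y) - 1) - 1 / (exp (real k * (3 * y)) - 1))) has_sum A) {0<..}"
  proof (rule has_sum_SigmaD[OF A])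
    fix k :: nat assume "k \<in> {0<..}"
    hence k: "real k * y > 0" "real k * (3 * y) > 0" using y by auto
    have "((\<lambda>m. exp (- (real m * (real k * y))) - exp (- (real m * (real k * (3 * y))))) has_sum
       (1 / (exp (real k * y) - 1) - 1 / (exp (real k * (3 * y)) - 1))) {0<..}"
      using has_sum_add[OF geometric_exp_has_sum[OF k(1)] has_sum_cmult_right[OF geometric_exp_has_sum[OF k(2)], of "-1"]] by simp
    from has_sum_cmult_right[OF this, of "x k"]
    show "((\<lambda>m. F (k, m)) has_sum x k * (1 / (exp (real k * y) - 1) - 1 / (exp (real k * (3 * y)) - 1))) {0<..}"
      by (simp add: F_def mult_ac)
  qed
  moreover have "{0<..} = range Suc" by (auto simp: image_iff) (metis gr0_implies_Suc)
  ultimately have "((\<lambda>k. x (Suc k) * (1 / (exp (real (Suc k) * y) - 1) - 1 / (exp (real (Suc k) * (3 * y)) - 1))) has_sum A) UNIV"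
    by (simp only:) (subst (asm) has_sum_reindex, simp, simp add: o_def)
  from has_sum_imp_sums[OF this] 2 that show ?thesis by blast
qed

section \<open>Lower bound for L(1, chi) and the real case\<close>

lemma exp_diff_lower:
  fixes u :: real
  assumes "1/4 \<le> u" "u \<le> 1"
  shows "exp (- u) - exp (- (3 * u)) \<ge> 3/10"
proof -
  define v where "v = exp (- u)"
  have "v \<ge> exp (- 1)" using assms by (simp add: v_def)
  moreover have "exp (- 1) \<ge> (36/100 :: real)"
    using e_less_272 by (simp add: exp_minus field_simps)
  ultimately have v1: "v \<ge> 36/100" by linarith
  have "v \<le> exp (- (1/4))" using assms by (simp add: v_def)
  moreover have "exp (1/4 :: real) \<ge> 1 + 1/4 + (1/4)\<^sup>2 / 2" by (rule exp_lower_Taylor_quadratic) simp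
  hence "exp (- (1/4 :: real)) \<le> 785/1000"
    unfolding exp_minus by (simp add: field_simps power2_eq_square)
  ultimately have v2: "v \<le> 785/1000" by linarith
  \<comment> \<open>The product is \<open>v - v^3\<close> minus its chord over
    \<open>[36/100, 785/1000]\<close>; the third root is chosen to cancel the quadratic
    term.\<close>
  have "(v - 36/100) * ((785/1000 - v) * (v + 1145/1000)) \<ge> 0" using v1 v2 by simp
  moreover have "(v - 36/100) * ((785/1000 - v) * (v + 1145/1000)) = v - v ^ 3 + 284250/10000000 * v - 3235770/10000000"
    by (simp add: field_simps power_numeral_reduce)
  moreover have "exp (- (3 * u)) = v ^ 3" by (simp add: v_def exp_of_nat_mult[symmetric])
  ultimately show ?thesis using v2 unfolding v_def[symmetric] by linarith
qed

text \<open>Two lower bounds for the cardinality, because \<open>s / 2 - 1\<close> says nothing when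
  \<open>s\<close> is small.\<close>

lemma card_half_interval:
  fixes s :: real
  assumes s: "s \<ge> 1"
  defines "K \<equiv> {k::nat. s / 2 \<le> real k \<and> real k \<le> s}"
  shows "finite K" "card K \<ge> 1" "real (card K) \<ge> s / 2 - 1"
proof -
  have "k \<in> K \<longleftrightarrow> k \<in> {nat \<lceil>s / 2\<rceil>..nat \<lfloor>s\<rfloor>}" for k
    unfolding K_def using s by (simp add: nat_ceiling_le_eq le_nat_iff le_floor_iff)
  hence K: "K = {nat \<lceil>s / 2\<rceil>..nat \<lfloor>s\<rfloor>}" by blast
  show fin: "finite K" unfolding K by simp
  have "nat \<lfloor>s\<rfloor> \<in> K"
  proof -
    have "s < 2 \<Longrightarrow> \<lfloor>s\<rfloor> = 1" using s by (intro floor_unique) auto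
    moreover have "s \<ge> 2 \<Longrightarrow> s / 2 \<le> of_int \<lfloor>s\<rfloor>" by linarith
    ultimately have "s / 2 \<le> of_int \<lfloor>s\<rfloor>" using s by (cases "s < 2") auto
    thus ?thesis using s by (simp add: K_def)
  qed
  hence "card K > 0" using fin by (auto simp: card_gt_0_iff)
  thus "card K \<ge> 1" by simp
  have "card K = Suc (nat \<lfloor>s\<rfloor>) - nat \<lceil>s / 2\<rceil>" unfolding K by simp
  hence "real (card K) \<ge> real (Suc (nat \<lfloor>s\<rfloor>)) - real (nat \<lceil>s / 2\<rceil>)" by linarith
  moreover have "real (nat \<lfloor>s\<rfloor>) > s - 1" "real (nat \<lceil>s / 2\<rceil>) < s / 2 + 1" using s by linarith+
  ultimately show "real (card K) \<ge> s / 2 - 1" by simp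
qed

text \<open>The choice \<open>y = 1 / d\<close> puts \<open>k^2 * y\<close> into
  \<open>[1/4, 1]\<close> for the counted \<open>k\<close>, so each such square contributes at least
  \<open>3/10\<close>, and it turns the error bound into \<open>7/144 * sqrt d\<close>. About
  \<open>sqrt d / 2\<close> squares give \<open>15/100 * sqrt d\<close>, well above the
  error.\<close>

lemma real_char_L1_ge:
  assumes chi: "dirichlet_character d chi" and pr: "prim d chi" and d: "d \<ge> 2"
    and c: "coprime c (int d)" "chi c \<noteq> 1" and re: "\<And>n. cnj (chi n) = chi n"
  shows "2 / 3 * real d * norm (Lser chi 1) \<ge>
     3/10 * real (card {k::nat. sqrt (real d) / 2 \<le> real k \<and> real k \<le> sqrt (real d)}) - 7/144 * sqrt (real d)"
proof -
  define y where "y = 1 / real d"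
  define x where "x = (\<lambda>n::nat. Re (chi (int n)))"
  define K where "K = {k::nat. sqrt (real d) / 2 \<le> real k \<and> real k \<le> sqrt (real d)}"
  have y: "y > 0" using d by (simp add: y_def)
  have cx: "chi (int n) = complex_of_real (x n)" for n
    using re[of "int n"] by (simp add: x_def complex_eq_iff)
  have mult: "x (m * n) = x m * x n" for m n
  proof -
    have "complex_of_real (x (m * n)) = of_real (x m * x n)"
      unfolding of_real_mult cx[symmetric] using char_mult[OF chi] by simp
    thus ?thesis by (simp only: of_real_eq_iff)
  qed
  have one: "x 1 = 1" using char_1[OF chi] by (simp add: x_def)
  have val: "x n \<in> {-1, 0, 1}" for n
  proof (cases "chi (int n) = 0")
    case False
    hence "norm (chi (int n)) = 1" using char_norm(1)[OF chi] char_nz_iff[OF chi] by blast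
    hence "\<bar>x n\<bar> = 1" by (simp add: cx)
    thus ?thesis by (auto simp: abs_if split: if_splits)
  qed (simp add: x_def)
  have "\<bar>x n\<bar> \<le> 1" for n using val[of n] by auto
  from lambert_divisor_sum[of x, OF this y] obtain A where
    A1: "(\<lambda>n. x (Suc n) * (1 / (exp (real (Suc n) * y) - 1) - 1 / (exp (real (Suc n) * (3 * y)) - 1))) sums A" and
    A2: "((\<lambda>n. (\<Sum>k | k dvd n. x k) * (exp (- (real n * y)) - exp (- (real n * (3 * y))))) has_sum A) {0<..}"
    by blast
  have e_nn: "exp (- (real n * y)) - exp (- (real n * (3 * y))) \<ge> 0" for n using y by simp
  have s1: "sqrt (real d) \<ge> 1" using d by simp
  have finK: "finite K" unfolding K_def by (rule card_half_interval(1)[OF s1])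
  have Kpos: "k > 0" if "k \<in> K" for k
  proof -
    have "real k > 0" using that s1 unfolding K_def mem_Collect_eq by linarith
    thus ?thesis by simp
  qed
  have A_ge: "3/10 * real (card K) \<le> A"
  proof -
    have inj: "inj_on (\<lambda>k::nat. k\<^sup>2) K" by (rule inj_onI) simp
    have "3/10 * real (card K) = (\<Sum>k\<in>K. 3/10)" by simp
    also have "\<dots> \<le> (\<Sum>k\<in>K. (\<Sum>j | j dvd k\<^sup>2. x j) * (exp (- (real (k\<^sup>2) * y)) - exp (- (real (k\<^sup>2) * (3 * y)))))"
    proof (rule sum_mono)
      fix k assume k: "k \<in> K"
      have sq: "(sqrt (real d))\<^sup>2 = real d" by simp
      have "(sqrt (real d) / 2)\<^sup>2 \<le> (real k)\<^sup>2" "(real k)\<^sup>2 \<le> (sqrt (real d))\<^sup>2"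
        using k s1 unfolding K_def by (intro power_mono; simp)+
      hence "1/4 \<le> real (k\<^sup>2) * y" "real (k\<^sup>2) * y \<le> 1"
        using d unfolding y_def by (simp_all add: sq power_divide field_simps)
      from exp_diff_lower[OF this]
      have g: "3/10 \<le> exp (- (real (k\<^sup>2) * y)) - exp (- (real (k\<^sup>2) * (3 * y)))" by (simp add: mult_ac)
      have "1 \<le> (\<Sum>j | j dvd k\<^sup>2. x j)" by (rule divisor_sum_square[OF mult one val Kpos[OF k]])
      hence H: "1 * (exp (- (real (k\<^sup>2) * y)) - exp (- (real (k\<^sup>2) * (3 * y)))) \<le>
        (\<Sum>j | j dvd k\<^sup>2. x j) * (exp (- (real (k\<^sup>2) * y)) - exp (- (real (k\<^sup>2) * (3 * y))))"
        by (rule mult_right_mono[OF _ e_nn])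
      show "3/10 \<le> (\<Sum>j | j dvd k\<^sup>2. x j) * (exp (- (real (k\<^sup>2) * y)) - exp (- (real (k\<^sup>2) * (3 * y))))"
        by (rule order.trans[OF g H[unfolded mult_1]])
    qed
    also have "\<dots> = (\<Sum>n\<in>(\<lambda>k. k\<^sup>2) ` K. (\<Sum>j | j dvd n. x j) * (exp (- (real n * y)) - exp (- (real n * (3 * y)))))"
      by (simp only: sum.reindex[OF inj] o_def)
    also have "\<dots> \<le> A"
    proof (rule finite_sum_le_has_sum[OF A2])
      fix n :: nat assume "n \<in> {0<..} - (\<lambda>k. k\<^sup>2) ` K"
      hence "n > 0" by simp
      from divisor_sum_sign[OF mult one val this]
      show "0 \<le> (\<Sum>k | k dvd n. x k) * (exp (- (real n * y)) - exp (- (real n * (3 * y))))"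
        using e_nn by (intro mult_nonneg_nonneg) blast+
    qed (use finK Kpos in auto)
    finally show ?thesis .
  qed
  have L: "(\<lambda>n. chi (int (Suc n)) * of_nat (Suc n) powr (-1)) sums Lser chi 1"
    by (rule Lser_sums(1)[OF char_psum_bounded[OF chi c]]) simp
  \<comment> \<open>The polar parts of the two dilates combine to \<open>2 * d / 3\<close> times
    \<open>1 / n\<close>; subtracting that multiple of the series for \<open>Lser chi 1\<close>
    leaves exactly \<open>hdiff\<close>.\<close>
  have "(\<lambda>n. complex_of_real (x (Suc n) * (1 / (exp (real (Suc n) * y) - 1) - 1 / (exp (real (Suc n) * (3 * y)) - 1))) -
     of_real (2 / 3 * real d) * (chi (int (Suc n)) * of_nat (Suc n) powr (-1))) sums (of_real A - of_real (2 / 3 * real d) * Lser chi 1)"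
    by (intro sums_diff sums_mult sums_of_real A1 L)
  moreover have "complex_of_real (x (Suc n) * (1 / (exp (real (Suc n) * y) - 1) - 1 / (exp (real (Suc n) * (3 * y)) - 1))) -
     of_real (2 / 3 * real d) * (chi (int (Suc n)) * of_nat (Suc n) powr (-1)) = chi (int (Suc n)) * of_real (hdiff y (Suc n))" for n
  proof -
    have "(of_nat (Suc n) powr (-1) :: complex) = of_real (1 / real (Suc n))"
      by (simp add: powr_minus field_simps)
    moreover have "hdiff y (Suc n) = (1 / (exp (real (Suc n) * y) - 1) - 1 / (exp (real (Suc n) * (3 * y)) - 1)) - 2 / 3 * real d * (1 / real (Suc n))"
    proof -
      have "1 / (N * y) - 1 / (N * (3 * y)) = 2 / 3 * real d * (1 / N)" if "N > 0" for N
        using d that by (simp add: y_def field_simps)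
      from this[of "real (Suc n)"]
      have "1 / (real (Suc n) * y) - 1 / (real (Suc n) * (3 * y)) = 2 / 3 * real d * (1 / real (Suc n))" by simp
      moreover have "hdiff y (Suc n) = (1 / (exp (real (Suc n) * y) - 1) - 1 / (real (Suc n) * y)) - (1 / (exp (real (Suc n) * (3 * y)) - 1) - 1 / (real (Suc n) * (3 * y)))"
        using y by (simp only: hdiff_def bose_def) simp
      ultimately show ?thesis by linarith
    qed
    ultimately show ?thesis unfolding cx by (simp only: of_real_mult of_real_diff) (simp only: right_diff_distrib mult_ac)
  qed
  ultimately have "(\<lambda>n. chi (int (Suc n)) * of_real (hdiff y (Suc n))) sums (of_real A - of_real (2 / 3 * real d) * Lser chi 1)"
    by (simp only:)
  from char_hdiff_bound[OF chi pr d y this]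
  have "norm (of_real A - of_real (2 / 3 * real d) * Lser chi 1) \<le> 7/144 * sqrt (real d)"
    using d by (simp add: y_def field_simps)
  moreover have "A \<le> norm (complex_of_real A)" by simp
  moreover have "norm (complex_of_real (2 / 3 * real d) * Lser chi 1) = 2 / 3 * real d * norm (Lser chi 1)"
    unfolding norm_mult norm_of_real by simp
  ultimately have "A - 2 / 3 * real d * norm (Lser chi 1) \<le> 7/144 * sqrt (real d)"
    using norm_triangle_ineq2[of "complex_of_real A" "of_real (2 / 3 * real d) * Lser chi 1"] by linarith
  thus ?thesis using A_ge unfolding K_def by linarith
qed

lemma real_char_L1_lower:
  assumes chi: "dirichlet_character d chi" and pr: "prim d chi" and d: "d \<ge> 2" "real d \<le> Q"
    and c: "coprime c (int d)" "chi c \<noteq> 1" and re: "\<And>n. cnj (chi n) = chi n" and Q: "Q \<ge> 10 ^ 5"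
  shows "norm (Lser chi 1) * sqrt Q \<ge> 115/1000"
proof -
  define s where "s = sqrt (real d)"
  define l where "l = norm (Lser chi 1)"
  define N where "N = card {k::nat. s / 2 \<le> real k \<and> real k \<le> s}"
  have s: "s \<ge> 1" "s\<^sup>2 = real d" using d by (simp_all add: s_def)
  have R: "sqrt Q \<ge> 316" using Q by (intro real_le_rsqrt) simp
  have sR: "s \<le> sqrt Q" using d by (simp add: s_def)
  have l0: "l \<ge> 0" by (simp add: l_def)
  have N: "real N \<ge> 1" "real N \<ge> s / 2 - 1"
    using card_half_interval(2,3)[OF s(1)] unfolding N_def by simp_all
  have main: "3/10 * real N - 7/144 * s \<le> 2 / 3 * s\<^sup>2 * l"
    using real_char_L1_ge[OF chi pr d(1) c re] unfolding s(2) N_def l_def s_def by simp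
  show ?thesis
  \<comment> \<open>For small \<open>s\<close> the main inequality yields only a fixed constant, and
    \<open>sqrt Q \<ge> 316\<close> compensates: \<open>105/1000 * 3/800 * 316 > 115/1000\<close>.
    From 20 on the loss \<open>3/10\<close> in the count is at most \<open>15/1000 * s\<close>, and
    \<open>86/1000 * 3/2 > 115/1000\<close>.\<close>
  proof (cases "s < 20")
    case True
    have "105/1000 \<le> 3/10 * real N - 7/144 * s"
    proof (cases "s < 4")
      case True thus ?thesis using N(1) by simp
    next
      case False thus ?thesis using N(2) by simp
    qed
    also note main
    also have "2 / 3 * s\<^sup>2 * l \<le> 2 / 3 * 20\<^sup>2 * l"
      using True s(1) l0 by (intro mult_right_mono mult_left_mono power_mono) auto
    finally have "l \<ge> 105/1000 * 3/800" by simp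
    hence "(105/1000 * 3/800) * 316 \<le> l * sqrt Q" using R l0 by (intro mult_mono) auto
    thus ?thesis by (simp add: l_def)
  next
    case False
    have "86/1000 * s \<le> 3/10 * real N - 7/144 * s" using N(2) False by simp
    hence "86/1000 * s \<le> s * (2 / 3 * (s * l))" using main by (simp add: power2_eq_square)
    hence "s * (86/1000) \<le> s * (2 / 3 * (s * l))" by (simp only: mult.commute)
    hence "86/1000 \<le> 2 / 3 * (s * l)" using s(1) by simp
    moreover have "s * l \<le> sqrt Q * l" using sR l0 by (rule mult_right_mono)
    ultimately show ?thesis by (simp add: l_def mult.commute)
  qed
qed

lemma modulus_ge_3:
  assumes chi: "dirichlet_character d chi" and c: "coprime c (int d)" "chi c \<noteq> 1"
  shows "d \<ge> 3"
proof (rule ccontr)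
  assume "\<not> d \<ge> 3"
  hence d: "d = 1 \<or> d = 2" using char_pos[OF chi] by auto
  have "[c = 1] (mod int d)"
  proof (cases "d = 1")
    case False
    hence "d = 2" using d by simp
    moreover from this have "odd c" using c(1) by simp
    ultimately show ?thesis by (simp add: cong_def odd_iff_mod_2_eq_one)
  qed (simp add: cong_def)
  hence "chi c = chi 1" by (rule char_cong[OF chi])
  thus False using c char_1[OF chi] by simp
qed

text \<open>The case that fixes the final constant. \<open>ln Q \<le> 38/1000 * sqrt Q\<close> turns
  the bound \<open>ln^2 Q / 2 + ln Q + 2\<close> for the derivative into
  \<open>23/1000 * ln Q * sqrt Q\<close>, and dividing by \<open>115/1000 / sqrt Q\<close> gives
  exactly \<open>2/10 * Q * ln Q\<close>.\<close>

lemma real_logderiv_bound: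
  assumes chi: "dirichlet_character d chi" and pr: "prim d chi" and d: "real d \<le> Q"
    and c: "coprime c (int d)" "chi c \<noteq> 1" and re: "\<And>n. cnj (chi n) = chi n" and Q: "Q \<ge> 10 ^ 5"
    and D: "(Lser chi has_field_derivative D) (at 1)"
  shows "Lser chi 1 \<noteq> 0" "norm (D / Lser chi 1) \<le> 2/10 * Q * ln Q"
proof -
  note lnQ = ln_facts[OF Q]
  define R where "R = sqrt Q"
  define L where "L = ln Q"
  have R: "R \<ge> 316" unfolding R_def using Q by (intro real_le_rsqrt) simp
  have R2: "R\<^sup>2 = Q" using Q by (simp add: R_def)
  have d3: "d \<ge> 3" by (rule modulus_ge_3[OF chi c])
  have low: "norm (Lser chi 1) * R \<ge> 115/1000"
    unfolding R_def by (rule real_char_L1_lower[OF chi pr _ d c re Q]) (use d3 in simp)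
  thus nz: "Lser chi 1 \<noteq> 0" by auto
  have "norm D \<le> 1 * ((ln (real d))\<^sup>2 / 2 + 1) + real d * (ln (real (Suc d)) / real (Suc d))"
    by (rule Lser_deriv_bound[OF char_psum_bounded[OF chi c] char_psum_0[OF chi c] d3 char_norm(2)[OF chi] D])
  also have "\<dots> \<le> L\<^sup>2 / 2 + L + 2"
  proof -
    have "ln (real d) \<le> L" unfolding L_def using d d3 by (intro ln_mono) auto
    moreover have ld: "ln (real d) \<ge> 0" using d3 by simp
    ultimately have "(ln (real d))\<^sup>2 \<le> L\<^sup>2" by (intro power_mono)
    moreover have "real d * (ln (real (Suc d)) / real (Suc d)) \<le> L + 1"
    proof -
      have "real d * (ln (real (Suc d)) / real (Suc d)) = real d / real (Suc d) * ln (real (Suc d))" by simp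
      also have "\<dots> \<le> 1 * ln (real (Suc d))" by (intro mult_right_mono) auto
      also have "ln (real (Suc d)) \<le> ln (real d * 2)" using d3 by (intro ln_mono) auto
      also have "\<dots> \<le> L + 1" using d3 ln_le_minus_one[of "2::real"] \<open>ln (real d) \<le> L\<close> by (simp add: ln_mult)
      finally show ?thesis by simp
    qed
    ultimately show ?thesis by simp
  qed
  finally have nD: "norm D \<le> L\<^sup>2 / 2 + L + 2" .
  have LR: "L \<le> 38/1000 * R"
  proof (rule power2_le_imp_le)
    have "L\<^sup>2 \<le> Q * (144 / 10 ^ 5)" using lnQ(3) by (simp add: L_def)
    also have "\<dots> \<le> (38/1000 * R)\<^sup>2" unfolding power_mult_distrib R2 using Q by (simp add: power2_eq_square)
    finally show "L\<^sup>2 \<le> (38/1000 * R)\<^sup>2" .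
  qed (use R in simp)
  have L: "L \<ge> 11" using lnQ(1) by (simp add: L_def)
  have "L\<^sup>2 / 2 + L + 2 \<le> L * (L / 2 + 1 + 2 / 11)"
    using L by (simp add: power2_eq_square algebra_simps)
  also have "\<dots> \<le> L * (23/1000 * R)" using LR R L by (intro mult_left_mono) auto
  finally have "norm D \<le> L * (23/1000 * R)" using nD by linarith
  also have "\<dots> = 2/10 * (L * R) * (115/1000)" by simp
  also have "\<dots> \<le> 2/10 * (L * R) * (norm (Lser chi 1) * R)" using low L R by (intro mult_left_mono) auto
  also have "\<dots> = 2/10 * Q * L * norm (Lser chi 1)" unfolding R2[symmetric] by (simp add: power2_eq_square)
  finally show "norm (D / Lser chi 1) \<le> 2/10 * Q * ln Q"
    using nz unfolding norm_divide L_def by (simp add: pos_divide_le_eq)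
qed

text \<open>The logarithmic derivative takes \<open>200/1000\<close>; \<open>ln (wfreq d 1)\<close>
  and the Euler constant together are at most \<open>2 * ln Q\<close> and fit into the remaining
  \<open>5/1000\<close>.\<close>

lemma primitive_b_bound:
  assumes chi: "dirichlet_character d chi" and pr: "prim d chi" and d: "real d \<le> Q" and Q: "Q \<ge> 10 ^ 5"
  shows "\<exists>F c. cont_L chi F \<and> has_b F c \<and> norm c \<le> 205/1000 * Q * ln Q"
proof (cases "d = 1")
  case True
  from zeta_b[OF chi[unfolded True]] obtain F c where F: "cont_L chi F" "has_b F c" "norm c \<le> 100" by blast
  have "100 \<le> 205/1000 * Q * 1" using Q by simp
  also have "\<dots> \<le> 205/1000 * Q * ln Q" using ln_facts(1)[OF Q] Q by (intro mult_left_mono) auto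
  finally show ?thesis using F by (meson order_trans)
next
  case False
  note lnQ = ln_facts[OF Q]
  obtain p where "prime p" "p dvd d" using prime_factor_nat[OF False] by blast
  then obtain c where c: "coprime c (int d)" "chi c \<noteq> 1" using pr unfolding prim_def by blast
  define g where "g = (\<lambda>n. cnj (chi n))"
  have g: "dirichlet_character d g" unfolding g_def by (rule char_cnj[OF chi])
  have gc: "g c \<noteq> 1" using c(2) unfolding g_def by (metis complex_cnj_cnj complex_cnj_one)
  have d3: "d \<ge> 3" by (rule modulus_ge_3[OF chi c])
  define \<tau> where "\<tau> = gauss d chi 1"
  have \<tau>: "\<tau> \<noteq> 0" using gauss_norm[OF chi pr] d3 unfolding \<tau>_def by auto
  have D: "dual d chi g (chi (-1)) \<tau>" unfolding g_def \<tau>_def by (rule char_dual[OF chi pr c])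
  from Lser_has_derivative[OF char_psum_bounded[OF g c(1) gc], of 1]
  obtain D' where D': "(Lser g has_field_derivative D') (at 1)" by auto
  \<comment> \<open>Either some value of \<open>chi\<close> has a square different from 1, and the
    zero-free disc applies to \<open>g\<close>, or all nonzero values are 1 or -1, and then
    \<open>g\<close> is \<open>chi\<close> itself.\<close>
  have key: "Lser g 1 \<noteq> 0 \<and> norm (D' / Lser g 1) \<le> 2/10 * Q * ln Q"
  proof (cases "\<exists>c. coprime c (int d) \<and> chi c ^ 2 \<noteq> 1")
    case True
    then obtain c' where c': "coprime c' (int d)" "chi c' ^ 2 \<noteq> 1" by blast
    have g2: "g c' ^ 2 \<noteq> 1"
      using c'(2) unfolding g_def complex_cnj_power[symmetric] by (metis complex_cnj_cnj complex_cnj_one)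
    note cb = complex_logderiv_bound[OF g c'(1) g2 d Q]
    have "1050 * (ln Q)\<^sup>2 = 1050 * ln Q * ln Q" by (simp add: power2_eq_square)
    \<comment> \<open>By \<open>ln_facts\<close>,
      \<open>1050 * ln Q \<le> 1050 * 12 / 10^5 * Q\<close>, which is below
      \<open>2/10 * Q\<close>.\<close>
    also have "\<dots> \<le> 2/10 * Q * ln Q" using lnQ(1,2) Q by (intro mult_right_mono) auto
    finally show ?thesis using cb unfolding DERIV_imp_deriv[OF D'] by linarith
  next
    case False
    have re: "cnj (chi n) = chi n" for n
    proof (cases "coprime n (int d)")
      case True
      hence "chi n = 1 \<or> chi n = -1" using False by (auto simp: power2_eq_1_iff)
      thus ?thesis by auto
    next
      case False
      hence "chi n = 0" using char_nz_iff[OF chi] by blast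
      thus ?thesis by simp
    qed
    hence "g = chi" by (simp add: g_def)
    thus ?thesis using real_logderiv_bound[OF chi pr d c re Q] D' by blast
  qed
  let ?F = "Lent d chi g (chi (-1)) \<tau>"
  let ?c = "of_real (ln (wfreq d 1)) + euler_mascheroni - D' / Lser g 1"
  have "has_b ?F ?c"
    by (rule has_b_Lent[OF D \<tau> char_minus_1[OF chi] _ D']) (use key in blast)
  moreover have "cont_L chi ?F"
  proof -
    have an: "?F analytic_on UNIV" using Lent_holomorphic[OF D \<tau>] by (simp add: analytic_on_open)
    have "(\<lambda>n. chi (int (Suc n)) * of_nat (Suc n) powr (-s)) sums ?F s" if "Re s > 1" for s
      using Lser_sums(1)[OF char_psum_bounded[OF chi c], of s] that by (simp add: Lent_def)
    thus ?thesis unfolding cont_L_def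
      using analytic_on_imp_meromorphic_on[OF an] analytic_on_subset[OF an] by blast
  qed
  moreover have "norm ?c \<le> 205/1000 * Q * ln Q"
  proof -
    have w: "wfreq d 1 = 2 * pi / real d" by (simp add: wfreq_def)
    have "ln (wfreq d 1) = ln (2 * pi) - ln (real d)" unfolding w using d3 by (simp add: ln_div)
    moreover have "ln (real d) \<le> ln Q" "ln (real d) \<ge> 0" using d d3 by (auto intro!: ln_mono)
    moreover have "0 \<le> ln (2 * pi)" using pi_gt3 by simp
    moreover have "ln (2 * pi) \<le> 2 * pi - 1" by (intro ln_le_minus_one) simp
    hence "ln (2 * pi) \<le> 11" using pi_less_4 by linarith
    ultimately have "\<bar>ln (wfreq d 1)\<bar> \<le> ln Q" using lnQ(1) by linarith
    moreover have "norm (complex_of_real (ln (wfreq d 1))) = \<bar>ln (wfreq d 1)\<bar>" by (rule norm_of_real)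
    moreover have "norm (euler_mascheroni :: complex) \<le> 1"
    proof -
      have "norm (euler_mascheroni :: complex) = \<bar>euler_mascheroni :: real\<bar>"
        by (metis norm_of_real of_real_euler_mascheroni)
      thus ?thesis using euler_mascheroni_less_13_over_22 euler_mascheroni_pos by simp
    qed
    ultimately have "norm ?c \<le> ln Q + 1 + 2/10 * Q * ln Q"
      using key norm_triangle_ineq[of "complex_of_real (ln (wfreq d 1))" euler_mascheroni]
        norm_triangle_ineq4[of "complex_of_real (ln (wfreq d 1)) + euler_mascheroni" "D' / Lser g 1"] by linarith
    moreover have "2 * ln Q \<le> 5/1000 * Q * ln Q" using lnQ(1) Q by (intro mult_right_mono) auto
    ultimately show ?thesis using lnQ(1) by linarith
  qed
  ultimately show ?thesis by blast
qed

theorem proposition1p12: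
  fixes q :: nat and chi :: "int \<Rightarrow> complex"
  assumes "q \<ge> 10 ^ 5"
    and "dirichlet_character q chi"
  shows "norm (b_const chi) \<le> 0.2515 * real q * ln (real q)"
proof -
  have "real (10 ^ 5) \<le> real q" using assms(1) by (rule of_nat_mono)
  hence Q: "real q \<ge> 10 ^ 5" by simp
  have "\<exists>F c. cont_L chi F \<and> has_b F c \<and> norm c \<le> 205/1000 * real q * ln (real q) + real q / 2"
    by (rule b_induction[OF _ order.refl assms(2)]) (intro primitive_b_bound Q; simp)
  then obtain F c where F: "cont_L chi F" "has_b F c"
    and c: "norm c \<le> 205/1000 * real q * ln (real q) + real q / 2" by blast
  \<comment> \<open>\<open>465/10000 * 11 > 1/2\<close> absorbs the imprimitivity term, and
    \<open>205/1000 + 465/10000 = 0.2515\<close>.\<close>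
  have "real q * (465/10000 * ln (real q)) \<ge> real q * (1 / 2)"
    using ln_facts(1)[OF Q] by (intro mult_left_mono) auto
  hence "205/1000 * real q * ln (real q) + real q / 2 \<le> 0.2515 * real q * ln (real q)" by (simp add: algebra_simps)
  thus ?thesis unfolding b_const_eqI[OF F] by (rule order.trans[OF c])
qed

end
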